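(* In the setting and notation of the context, for each $n\in\mathbb N$, $$\mathbf{OP}^{(n)}=\bigoplus_{(l_1,\dots,l_i)\in M,\ l_1+\dots+l_i+i=n}\mathbf H_{(l_1,\dots,l_i)}.$$
   Context: **Underlying space.** $T$ is a locally compact, second countable Hausdorff space without isolated points; $\mathcal B_0(T)$ is the family of relatively compact Borel sets. $\sigma$ is a Radon non-atomic measure on $T$ with $\sigma(O)>0$ for every non-empty open $O$. $\mathcal D^{(n)}=C_0(T^n)$ (real continuous, compact support), $\mathcal D^{(0)}=\mathbb R$; $B_0(T^n)$ denotes real bounded measurable functions with compact support. **The process.** For each $t\in T$, $\mu(t,\cdot)$ is a probability measure on $\mathbb R$; $t\mapsto\mu(t,A)$ is measurable for each Borel $A$; and for each $\Delta\in\mathcal B_0(T)$ there is $R=R(\Delta)>0$ such that $\mu(t,\cdot)$ is supported in $[-R,R]$ for all $t\in\Delta$. Put $\tilde T=T\times\mathbb R$, $\tilde\sigma(dt,ds)=\sigma(dt)\mu(t,ds)$, $\mathcal H=L^2(\tilde T,\tilde\sigma)$ (real), $\mathcal F(\mathcal H)=\mathbb R\oplus\bigoplus_{n\ge1}\mathcal H^{\otimes n}$ the full Fock space with vacuum $\Omega=(1,0,0,\dots)$. For $f\in B_0(T)$, $X(f)=a^+(f\otimes1)+a^-(f\otimes 1)+a^0(f\otimes s)$, where $(f\otimes s^l)(t,s)=f(t)s^l$, $a^+(h)g^{(n)}=h\otimes g^{(n)}$; $a^-(h)g_1\otimes\dots\otimes g_n=(h,g_1)_{\mathcal H}\,g_2\otimes\dots\otimes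 g_n$; $a^0(h)g_1\otimes\dots\otimes g_n=(hg_1)\otimes g_2\otimes\dots\otimes g_n$; $a^-(h)\Omega=a^0(h)\Omega=0$. **Monomials.** For $f^{(n)}\in B_0(T^n)$ the monomial $\langle f^{(n)},\omega^{\otimes n}\rangle$ is the bounded operator on $\mathcal F(\mathcal H)$ defined as follows. Write $z=(t,s)\in\tilde T$, and view $f^{(n)}$ as a function on $\tilde T^n$ not depending on the $s$-variables. For a function $h(z_1,\dots,z_k;y_1,\dots,y_m)$ ($k\ge1$) put $(Ch)(z_1,\dots,z_{k-1};y_1,\dots,y_{m+1})=h(z_1,\dots,z_{k-1},y_1;y_2,\dots,y_{m+1})$, $(Ah)(z_1,\dots,z_{k-1};y_1,\dots,y_{m-1})=\int_{\tilde T}\tilde\sigma(dz)h(z_1,\dots,z_{k-1},z;z,y_1,\dots,y_{m-1})$, $(Nh)(z_1,\dots,z_{k-1};y_1,\dots,y_m)=s(y_1)h(z_1,\dots,z_{k-1},y_1;y_1,\dots,y_m)$, where $s(y_1)$ is the $\mathbb R$-coordinate of $y_1$, and $Ah=Nh=0$ if $m=0$. Then $\langle f^{(n)},\omega^{\otimes n}\rangle g^{(m)}=(C+A+N)^n(f^{(n)}\otimes g^{(m)})$, where $(f^{(n)}\otimes g^{(m)})(z;y)=f^{(n)}(z)g^{(m)}(y)$. In particular $\langle f_1\otimes\dots\otimes f_n,\omega^{\otimes n}\rangle=X(f_1)\cdots X(f_n)$. Constants are monomials of order $0$. $\mathbf{CP}$ is the set of finite sums of monomials with kernels in $\mathcal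 D^{(n)}$, $n\in\mathbb N_0$, and $\mathbf{CP}^{(n)}$ those of order $\le n$. **The space $L^2(\tau)$.** $L^2(\tau)$ is the closure of $\mathbf{CP}$ in the norm $\|P\|_{L^2(\tau)}=\|P\Omega\|_{\mathcal F(\mathcal H)}$; the map $I:P\mapsto P\Omega$ extends to a unitary operator $I:L^2(\tau)\to\mathcal F(\mathcal H)$. $\mathbf{MP}^{(n)}$ is the closure of $\mathbf{CP}^{(n)}$ in $L^2(\tau)$, $\mathbf{OP}^{(n)}=\mathbf{MP}^{(n)}\ominus\mathbf{MP}^{(n-1)}$ for $n\ge1$, $\mathbf{OP}^{(0)}=\mathbb R$. **The spaces $\mathbf H_{(l_1,\dots,l_i)}$.** For each $t$, $(p^{(n)}(t,\cdot))_{n\ge0}$ are the monic orthogonal polynomials of $\mu(t,\cdot)$ (with $p^{(n)}(t,\cdot):=0$ for $n\ge N$ if $\mu(t,\cdot)$ is supported on exactly $N$ points). Put $w_l(t)=\int_{\mathbb R}\mu(t,ds)|p^{(l)}(t,s)|^2$, $\sigma^{(l)}(dt)=w_l(t)\sigma(dt)$. $M$ is the set of all multi-indices $(l_1,\dots,l_i)\in\mathbb N_0^i$, $i\in\mathbb N$. For $(l_1,\dots,l_i)\in M$, $\mathcal H_{(l_1,\dots,l_i)}\subset\mathcal H^{\otimes i}$ is the range of the isometry $L^2(T^i,\sigma^{(l_1)}\otimes\dots\otimes\sigma^{(l_i)})\ni f\mapsto f(t_1,\dots,t_i)p^{(l_1)}(t_1,s_1)\cdots p^{(l_i)}(t_i,s_i)\in\mathcal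 H^{\otimes i}$, and $\mathbf H_{(l_1,\dots,l_i)}:=I^{-1}\mathcal H_{(l_1,\dots,l_i)}\subset L^2(\tau)$. *)

theory Defs
  imports
    "HOL-Probability.Probability"
    "HOL-Computational_Algebra.Polynomial"
    "HOL-Library.Function_Algebras"
begin

text \<open>
  The underlying space \<open>T\<close> is a type \<open>'t\<close>. A point of \<open>T\<^sup>n\<close> is an extensional function on
  \<open>{..<n}\<close>, as in \<^const>\<open>PiM\<close> and \<^const>\<open>product_topology\<close>; for \<open>n = 0\<close> there is exactly one point.
  Coordinates are numbered from \<open>0\<close>.

  Vectors of \<open>L\<^sup>2\<close>-type spaces are represented by functions that are not identified almost everywhere
  (and elements of the completion by Cauchy sequences that are not identified modulo null sequences).
  Every subspace below is saturated, i.e. closed under the respective equivalence, so that equality of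
  two subspaces is equality of the corresponding subspaces of the quotient.
\<close>


section \<open>The measures\<close>

definition radon_measure :: "'t::t2_space measure \<Rightarrow> bool" where
  "radon_measure \<sigma> \<longleftrightarrow> sets \<sigma> = sets borel \<and>
     (\<forall>K. compact K \<longrightarrow> emeasure \<sigma> K < \<infinity>) \<and>
     (\<forall>A\<in>sets borel. emeasure \<sigma> A = (SUP K\<in>{K. compact K \<and> K \<subseteq> A}. emeasure \<sigma> K))"

definition non_atomic :: "'b measure \<Rightarrow> bool" where
  "non_atomic M \<longleftrightarrow>
     (\<forall>A\<in>sets M. 0 < emeasure M A \<longrightarrow>
        (\<exists>B\<in>sets M. B \<subseteq> A \<and> 0 < emeasure M B \<and> emeasure M B < emeasure M A))"

definition relatively_compact_borel :: "'t::topological_space set set" where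
  "relatively_compact_borel = {\<Delta> \<in> sets borel. compact (closure \<Delta>)}"

definition locally_bounded_kernel :: "('t::topological_space \<Rightarrow> real measure) \<Rightarrow> bool" where
  "locally_bounded_kernel \<mu> \<longleftrightarrow>
     (\<forall>t. prob_space (\<mu> t) \<and> sets (\<mu> t) = sets borel) \<and>
     (\<forall>A\<in>sets borel. (\<lambda>t. emeasure (\<mu> t) A) \<in> borel_measurable borel) \<and>
     (\<forall>\<Delta>\<in>relatively_compact_borel. \<exists>R>0. \<forall>t\<in>\<Delta>. emeasure (\<mu> t) (- {-R..R}) = 0)"

text \<open>\<open>\<sigma>(dt) \<mu>(t,ds)\<close> on \<open>T \<times> \<real>\<close>\<close>
definition lift_measure ::
    "'t::{second_countable_topology,t2_space} measure \<Rightarrow> ('t \<Rightarrow> real measure) \<Rightarrow> ('t \<times> real) measure"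
  where "lift_measure \<sigma> \<mu> = bind \<sigma> (\<lambda>t. distr (\<mu> t) borel (Pair t))"

lemma emeasure_lift_measure:
  assumes \<sigma>: "sets \<sigma> = sets borel" and \<mu>: "locally_bounded_kernel \<mu>" and A: "A \<in> sets borel"
  shows "emeasure (lift_measure \<sigma> \<mu>) A = (\<integral>\<^sup>+t. emeasure (\<mu> t) {s. (t, s) \<in> A} \<partial>\<sigma>)"
proof -
  have s[simp]: "sets (\<mu> t) = sets borel" and p: "prob_space (\<mu> t)" for t
    using \<mu> by (auto simp: locally_bounded_kernel_def)
  have sp[simp]: "space (\<mu> t) = UNIV" for t using sets_eq_imp_space_eq[OF s] by simp
  have sps: "space \<sigma> = UNIV" using sets_eq_imp_space_eq[OF \<sigma>] by simp
  have "\<mu> \<in> measurable \<sigma> (subprob_algebra borel)"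
    using \<mu> \<sigma> p by (intro measurable_subprob_algebra)
      (auto simp: locally_bounded_kernel_def prob_space_imp_subprob_space cong: measurable_cong_sets)
  moreover have "(\<lambda>(t, s). (t, s)) \<in> measurable (\<sigma> \<Otimes>\<^sub>M borel) (borel :: ('a \<times> real) measure)"
    using \<sigma> by (simp add: borel_prod[symmetric] cong: measurable_cong_sets sets_pair_measure_cong)
  ultimately have k: "(\<lambda>t. distr (\<mu> t) borel (Pair t)) \<in> measurable \<sigma> (subprob_algebra borel)"
    by (rule measurable_distr2[rotated])
  have P: "Pair t \<in> measurable (\<mu> t) borel" for t :: 'a
    by (simp add: borel_prod[symmetric] cong: measurable_cong_sets)
  have "emeasure (lift_measure \<sigma> \<mu>) A = (\<integral>\<^sup>+t. emeasure (distr (\<mu> t) borel (Pair t)) A \<partial>\<sigma>)"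
    unfolding lift_measure_def using sps k A by (intro emeasure_bind) auto
  also have "\<dots> = (\<integral>\<^sup>+t. emeasure (\<mu> t) {s. (t, s) \<in> A} \<partial>\<sigma>)"
    using P A by (intro nn_integral_cong) (simp add: emeasure_distr vimage_def)
  finally show ?thesis .
qed


section \<open>The full Fock space\<close>

definition L2 :: "'b measure \<Rightarrow> ('b \<Rightarrow> real) set" where
  "L2 M = {f \<in> borel_measurable M. integrable M (\<lambda>x. (f x)\<^sup>2)}"

text \<open>
  \<open>\<H>\<^sup>\<otimes>\<^sup>n\<close> is \<open>L\<^sup>2\<close> of this product measure; for \<open>n = 0\<close> that is \<open>L\<^sup>2\<close> of a one-point probability space,
  i.e. \<open>\<real>\<close>.
\<close>
abbreviation lift_power ::
    "'t::{second_countable_topology,t2_space} measure \<Rightarrow> ('t \<Rightarrow> real measure) \<Rightarrow> nat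
      \<Rightarrow> (nat \<Rightarrow> 't \<times> real) measure"
  where "lift_power \<sigma> \<mu> n \<equiv> PiM {..<n} (\<lambda>_. lift_measure \<sigma> \<mu>)"

type_synonym 't fock_vector = "nat \<Rightarrow> (nat \<Rightarrow> 't \<times> real) \<Rightarrow> real"
type_synonym 't fock_operator = "'t fock_vector \<Rightarrow> 't fock_vector"

definition fock_inner ::
    "'t::{second_countable_topology,t2_space} measure \<Rightarrow> ('t \<Rightarrow> real measure)
      \<Rightarrow> 't fock_vector \<Rightarrow> 't fock_vector \<Rightarrow> real"
  where "fock_inner \<sigma> \<mu> F G = (\<Sum>n. \<integral>y. F n y * G n y \<partial>lift_power \<sigma> \<mu> n)"

definition fock_norm ::
    "'t::{second_countable_topology,t2_space} measure \<Rightarrow> ('t \<Rightarrow> real measure) \<Rightarrow> 't fock_vector \<Rightarrow> real"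
  where "fock_norm \<sigma> \<mu> F = sqrt (fock_inner \<sigma> \<mu> F F)"

definition fock_space ::
    "'t::{second_countable_topology,t2_space} measure \<Rightarrow> ('t \<Rightarrow> real measure) \<Rightarrow> 't fock_vector set"
  where "fock_space \<sigma> \<mu> =
    {F. (\<forall>n. F n \<in> L2 (lift_power \<sigma> \<mu> n)) \<and>
        summable (\<lambda>n. \<integral>y. (F n y)\<^sup>2 \<partial>lift_power \<sigma> \<mu> n)}"

definition vacuum :: "'t fock_vector" where
  "vacuum = (\<lambda>n y. if n = 0 then 1 else 0)"


section \<open>Monomials\<close>

text \<open>\<open>C\<^sub>0(T\<^sup>n)\<close>\<close>
definition test_functions :: "nat \<Rightarrow> ((nat \<Rightarrow> 't::topological_space) \<Rightarrow> real) set" where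
  "test_functions n = {f.
     continuous_map (product_topology (\<lambda>_. euclidean) {..<n}) euclideanreal f \<and>
     (\<exists>K. compactin (product_topology (\<lambda>_. euclidean) {..<n}) K \<and>
        (\<forall>x\<in>topspace (product_topology (\<lambda>_. euclidean) {..<n}) - K. f x = 0))}"

definition tuple_tail :: "nat \<Rightarrow> (nat \<Rightarrow> 'b) \<Rightarrow> (nat \<Rightarrow> 'b)" where
  "tuple_tail m y = (\<lambda>i\<in>{..<m - 1}. y (Suc i))"

definition tuple_cons :: "nat \<Rightarrow> 'b \<Rightarrow> (nat \<Rightarrow> 'b) \<Rightarrow> (nat \<Rightarrow> 'b)" where
  "tuple_cons m w y = (\<lambda>i\<in>{..<Suc m}. case i of 0 \<Rightarrow> w | Suc j \<Rightarrow> y j)"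

text \<open>
  A function \<open>h(z\<^sub>1,\<dots>,z\<^sub>k; y\<^sub>1,\<dots>,y\<^sub>m)\<close> appears as the degree-\<open>m\<close> component \<open>h m z y\<close> of a family
  indexed by \<open>m\<close>, and \<open>C\<close>, \<open>A\<close>, \<open>N\<close> act on the whole family: since they change \<open>m\<close> by \<open>+1\<close>, \<open>-1\<close>
  and \<open>0\<close>, component \<open>m\<close> of the image comes from component \<open>m - 1\<close>, \<open>m + 1\<close> and \<open>m\<close> respectively.
  The parameter \<open>k\<close> is the number of \<open>z\<close>-variables that \<^emph>\<open>remain\<close>, so the consumed variable
  is the one with index \<open>k\<close>, and \<open>z(k := w)\<close> is the tuple \<open>(z\<^sub>1,\<dots>,z\<^sub>k,w)\<close>.
\<close>
type_synonym 't fock_kernel = "nat \<Rightarrow> (nat \<Rightarrow> 't \<times> real) \<Rightarrow> (nat \<Rightarrow> 't \<times> real) \<Rightarrow> real"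

definition C_op :: "nat \<Rightarrow> 't fock_kernel \<Rightarrow> 't fock_kernel" where
  "C_op k h = (\<lambda>m z y. if m = 0 then 0 else h (m - 1) (z(k := y 0)) (tuple_tail m y))"

definition A_op ::
    "'t::{second_countable_topology,t2_space} measure \<Rightarrow> ('t \<Rightarrow> real measure) \<Rightarrow> nat
      \<Rightarrow> 't fock_kernel \<Rightarrow> 't fock_kernel"
  where "A_op \<sigma> \<mu> k h =
    (\<lambda>m z y. \<integral>w. h (m + 1) (z(k := w)) (tuple_cons m w y) \<partial>lift_measure \<sigma> \<mu>)"

definition N_op :: "nat \<Rightarrow> 't fock_kernel \<Rightarrow> 't fock_kernel" where
  "N_op k h = (\<lambda>m z y. if m = 0 then 0 else snd (y 0) * h m (z(k := y 0)) y)"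

text \<open>\<open>(C + A + N)\<^sup>k\<close> on functions with \<open>k\<close> many \<open>z\<close>-variables\<close>
primrec CAN_power ::
    "'t::{second_countable_topology,t2_space} measure \<Rightarrow> ('t \<Rightarrow> real measure) \<Rightarrow> nat
      \<Rightarrow> 't fock_kernel \<Rightarrow> 't fock_kernel"
  where
    "CAN_power \<sigma> \<mu> 0 h = h"
  | "CAN_power \<sigma> \<mu> (Suc k) h = CAN_power \<sigma> \<mu> k (C_op k h + A_op \<sigma> \<mu> k h + N_op k h)"

definition monomial ::
    "'t::{second_countable_topology,t2_space} measure \<Rightarrow> ('t \<Rightarrow> real measure) \<Rightarrow> nat
      \<Rightarrow> ((nat \<Rightarrow> 't) \<Rightarrow> real) \<Rightarrow> 't fock_operator"
  where "monomial \<sigma> \<mu> n f F =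
    (\<lambda>m y. CAN_power \<sigma> \<mu> n (\<lambda>m z y. f (\<lambda>i\<in>{..<n}. fst (z i)) * F m y) m (\<lambda>_. undefined) y)"

definition CP_le ::
    "'t::{second_countable_topology,t2_space} measure \<Rightarrow> ('t \<Rightarrow> real measure) \<Rightarrow> nat
      \<Rightarrow> 't fock_operator set"
  where "CP_le \<sigma> \<mu> n =
    {P. \<exists>ps. (\<forall>(k, f)\<in>set ps. k \<le> n \<and> f \<in> test_functions k) \<and>
             P = (\<Sum>(k, f)\<leftarrow>ps. monomial \<sigma> \<mu> k f)}"

definition CP ::
    "'t::{second_countable_topology,t2_space} measure \<Rightarrow> ('t \<Rightarrow> real measure) \<Rightarrow> 't fock_operator set"
  where "CP \<sigma> \<mu> = (\<Union>n. CP_le \<sigma> \<mu> n)"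


section \<open>The space \<open>L\<^sup>2(\<tau>)\<close>\<close>

text \<open>
  The completion of \<open>CP\<close> in the norm \<open>P \<mapsto> \<parallel>P \<Omega>\<parallel>\<close>, built from Cauchy sequences; \<open>CP\<close> sits inside as
  the constant sequences.
\<close>
definition L2_tau ::
    "'t::{second_countable_topology,t2_space} measure \<Rightarrow> ('t \<Rightarrow> real measure)
      \<Rightarrow> (nat \<Rightarrow> 't fock_operator) set"
  where "L2_tau \<sigma> \<mu> =
    {x. (\<forall>k. x k \<in> CP \<sigma> \<mu>) \<and>
        (\<forall>e>0. \<exists>K. \<forall>i\<ge>K. \<forall>j\<ge>K. fock_norm \<sigma> \<mu> ((x i - x j) vacuum) < e)}"

definition tau_inner ::
    "'t::{second_countable_topology,t2_space} measure \<Rightarrow> ('t \<Rightarrow> real measure)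
      \<Rightarrow> (nat \<Rightarrow> 't fock_operator) \<Rightarrow> (nat \<Rightarrow> 't fock_operator) \<Rightarrow> real"
  where "tau_inner \<sigma> \<mu> x y = lim (\<lambda>k. fock_inner \<sigma> \<mu> (x k vacuum) (y k vacuum))"

definition tau_norm ::
    "'t::{second_countable_topology,t2_space} measure \<Rightarrow> ('t \<Rightarrow> real measure)
      \<Rightarrow> (nat \<Rightarrow> 't fock_operator) \<Rightarrow> real"
  where "tau_norm \<sigma> \<mu> x = sqrt (tau_inner \<sigma> \<mu> x x)"

text \<open>The unitary \<open>I\<close>, the continuous extension of \<open>P \<mapsto> P \<Omega>\<close>; the limit is unique up to equality
  almost everywhere of all components.\<close>
definition tau_I ::
    "'t::{second_countable_topology,t2_space} measure \<Rightarrow> ('t \<Rightarrow> real measure)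
      \<Rightarrow> (nat \<Rightarrow> 't fock_operator) \<Rightarrow> 't fock_vector"
  where "tau_I \<sigma> \<mu> x =
    (SOME F. F \<in> fock_space \<sigma> \<mu> \<and> (\<lambda>k. fock_norm \<sigma> \<mu> (x k vacuum - F)) \<longlonglongrightarrow> 0)"

definition MP ::
    "'t::{second_countable_topology,t2_space} measure \<Rightarrow> ('t \<Rightarrow> real measure) \<Rightarrow> nat
      \<Rightarrow> (nat \<Rightarrow> 't fock_operator) set"
  where "MP \<sigma> \<mu> n =
    {x \<in> L2_tau \<sigma> \<mu>. \<forall>e>0. \<exists>P\<in>CP_le \<sigma> \<mu> n. tau_norm \<sigma> \<mu> (x - (\<lambda>_. P)) < e}"

definition OP ::
    "'t::{second_countable_topology,t2_space} measure \<Rightarrow> ('t \<Rightarrow> real measure) \<Rightarrow> nat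
      \<Rightarrow> (nat \<Rightarrow> 't fock_operator) set"
  where "OP \<sigma> \<mu> n =
    (if n = 0
     then {x \<in> L2_tau \<sigma> \<mu>. \<exists>P\<in>CP_le \<sigma> \<mu> 0. tau_norm \<sigma> \<mu> (x - (\<lambda>_. P)) = 0}
     else {x \<in> MP \<sigma> \<mu> n. \<forall>y\<in>MP \<sigma> \<mu> (n - 1). tau_inner \<sigma> \<mu> x y = 0})"


section \<open>The spaces indexed by multi-indices\<close>

definition measure_support :: "real measure \<Rightarrow> real set" where
  "measure_support \<nu> = {x. \<forall>U. open U \<and> x \<in> U \<longrightarrow> 0 < emeasure \<nu> U}"

definition monic_orthogonal_poly :: "real measure \<Rightarrow> nat \<Rightarrow> real poly" where
  "monic_orthogonal_poly \<nu> n =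
    (if finite (measure_support \<nu>) \<and> card (measure_support \<nu>) \<le> n then 0
     else (THE p. degree p = n \<and> lead_coeff p = 1 \<and>
                  (\<forall>q. degree q < n \<longrightarrow> (\<integral>s. poly p s * poly q s \<partial>\<nu>) = 0)))"

text \<open>\<open>\<sigma>\<^sup>(\<^sup>l\<^sup>)(dt) = w\<^sub>l(t) \<sigma>(dt)\<close>\<close>
definition weighted_measure ::
    "'t measure \<Rightarrow> ('t \<Rightarrow> real measure) \<Rightarrow> nat \<Rightarrow> 't measure"
  where "weighted_measure \<sigma> \<mu> l =
    density \<sigma> (\<lambda>t. ennreal (\<integral>s. \<bar>poly (monic_orthogonal_poly (\<mu> t) l) s\<bar>\<^sup>2 \<partial>\<mu> t))"

text \<open>A multi-index \<open>(l\<^sub>1,\<dots>,l\<^sub>i)\<close> is a list \<open>ls\<close> of length \<open>i \<ge> 1\<close>; \<open>\<H>\<^sup>\<otimes>\<^sup>i\<close> is embedded in the Fock space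
  as the vectors concentrated in degree \<open>i\<close>.\<close>
definition H_fock ::
    "'t::{second_countable_topology,t2_space} measure \<Rightarrow> ('t \<Rightarrow> real measure) \<Rightarrow> nat list
      \<Rightarrow> 't fock_vector set"
  where "H_fock \<sigma> \<mu> ls =
    {F \<in> fock_space \<sigma> \<mu>.
       (\<forall>m. m \<noteq> length ls \<longrightarrow> (AE y in lift_power \<sigma> \<mu> m. F m y = 0)) \<and>
       (\<exists>f \<in> L2 (PiM {..<length ls} (\<lambda>j. weighted_measure \<sigma> \<mu> (ls ! j))).
          AE y in lift_power \<sigma> \<mu> (length ls). F (length ls) y =
            f (\<lambda>j\<in>{..<length ls}. fst (y j)) *
            (\<Prod>j<length ls. poly (monic_orthogonal_poly (\<mu> (fst (y j))) (ls ! j)) (snd (y j))))}"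

definition H_tau ::
    "'t::{second_countable_topology,t2_space} measure \<Rightarrow> ('t \<Rightarrow> real measure) \<Rightarrow> nat list
      \<Rightarrow> (nat \<Rightarrow> 't fock_operator) set"
  where "H_tau \<sigma> \<mu> ls = {x \<in> L2_tau \<sigma> \<mu>. tau_I \<sigma> \<mu> x \<in> H_fock \<sigma> \<mu> ls}"

definition multi_indices :: "nat \<Rightarrow> nat list set" where
  "multi_indices n = {ls. ls \<noteq> [] \<and> sum_list ls + length ls = n}"

lemma finite_multi_indices: "finite (multi_indices n)"
proof (rule finite_subset)
  show "multi_indices n \<subseteq> {ls. set ls \<subseteq> {..n} \<and> length ls \<le> n}"
    by (fastforce simp: multi_indices_def dest: member_le_sum_list)
  show "finite {ls. set ls \<subseteq> {..n} \<and> length ls \<le> n}"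
    by (rule finite_lists_length_le) simp
qed

text \<open>
  \<open>V = \<Oplus>\<^sub>i\<^sub>\<in>\<^sub>\<Lambda> W\<^sub>i\<close> for a finite index set: the \<open>W\<^sub>i\<close> are pairwise orthogonal, and \<open>V\<close> consists of the
  elements of \<open>L\<^sup>2(\<tau>)\<close> that are equal (in \<open>L\<^sup>2(\<tau>)\<close>, not as Cauchy sequences) to a sum of elements of
  the \<open>W\<^sub>i\<close>.
\<close>
definition is_orthogonal_sum ::
    "'t::{second_countable_topology,t2_space} measure \<Rightarrow> ('t \<Rightarrow> real measure)
      \<Rightarrow> (nat \<Rightarrow> 't fock_operator) set \<Rightarrow> 'i set \<Rightarrow> ('i \<Rightarrow> (nat \<Rightarrow> 't fock_operator) set) \<Rightarrow> bool"
  where "is_orthogonal_sum \<sigma> \<mu> V \<Lambda> W \<longleftrightarrow>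
    finite \<Lambda> \<and>
    (\<forall>i\<in>\<Lambda>. \<forall>j\<in>\<Lambda>. i \<noteq> j \<longrightarrow> (\<forall>x\<in>W i. \<forall>y\<in>W j. tau_inner \<sigma> \<mu> x y = 0)) \<and>
    V = {x \<in> L2_tau \<sigma> \<mu>.
           \<exists>y. (\<forall>i\<in>\<Lambda>. y i \<in> W i) \<and> tau_norm \<sigma> \<mu> (x - (\<Sum>i\<in>\<Lambda>. y i)) = 0}"

end

theory Submission
  imports Defs
begin

text \<open>
  Under the unitary \<open>I\<close> the theorem says that the closure of \<open>CP\<^sup>(\<^sup>n\<^sup>) \<Omega>\<close> in the Fock space is the orthogonal
  sum of the constants and the spaces \<open>\<H>\<^sub>l\<close> with \<open>l\<^sub>1 + \<dots> + l\<^sub>i + i \<le> n\<close>. A monomial of order \<open>n\<close> applied to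
  \<open>\<Omega>\<close> is a finite sum of terms \<open>F(t\<^sub>1, \<dots>, t\<^sub>i) s\<^sub>1\<^bsup>a(1)\<^esup> \<cdots> s\<^sub>i\<^bsup>a(i)\<^esup>\<close> with \<open>a(1) + \<dots> + a(i) + i \<le> n\<close>, because \<open>C\<close> adds a
  variable, \<open>N\<close> adds a power of \<open>s\<close> and \<open>A\<close> adds neither; expanding the powers of \<open>s\<close> in the orthogonal
  polynomials puts it into the sum. Conversely \<open>X(f)\<close> is bounded, so it maps the closure of
  \<open>CP\<^sup>(\<^sup>n\<^sup>) \<Omega>\<close> into that of \<open>CP\<^sup>(\<^sup>n\<^sup>+\<^sup>1\<^sup>) \<Omega>\<close>, and summing \<open>X(1\<^sub>c)(1\<^sub>c u \<otimes> g)\<close> over an ever finer partition of the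
  support of \<open>u\<close> isolates \<open>s u \<otimes> g\<close>, since for non-atomic \<open>\<sigma>\<close> the terms \<open>1\<^sub>c \<otimes> 1\<^sub>c u \<otimes> g\<close> add up to something
  small. By induction on the order, every tensor of functions polynomial in \<open>s\<close> is reached, and
  indicators of boxes then give all of \<open>\<H>\<^sub>l\<close>.
\<close>

text \<open>Functions are not identified almost everywhere, so the Hilbert space theory is set up
  for semi-inner products, and X(f) is additive only up to vectors of norm zero: where a slice is
  not integrable, the annihilation integral takes the default value 0. The indicator 1_c is no test
  function, and the operator norm of X(f) involves sup |f|. For a fixed tensor with bounded factors,
  however, the image under X(f) depends continuously on f in L^2(sigma), where C_0(T) is dense. The
  creation terms of distinct cells are orthogonal, so their squared norms add up to at most the
  largest sigma(c) times a constant. The coefficients of p^(l)(t, .) may be unbounded near a point,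
  because Gram--Schmidt denominators may approach 0. Hence the boxes generating H_l are taken where
  these coefficients are bounded, and in the expansion of s^a Bessel's inequality controls
  coefficient times norm of the polynomial instead of the coefficient alone. Once the closures of
  orders n and n - 1 are known as orthogonal sums, passing to the orthogonal complement keeps
  exactly the multi-indices of weight n.\<close>

instantiation "fun" :: (type, scaleR) scaleR
begin
definition scaleR_fun_def: "c *\<^sub>R f = (\<lambda>x. c *\<^sub>R f x)"
instance ..
end

lemma scaleR_fun_apply [simp]: "(c *\<^sub>R f) x = c *\<^sub>R f x"
  by (simp add: scaleR_fun_def)

text \<open>Iterating this instance makes Fock vectors, operators and sequences of operators real
  vector spaces, so that \<open>subspace\<close> applies to all of them.\<close>

instance "fun" :: (type, real_vector) real_vector
  by standard (simp_all add: fun_eq_iff scaleR_add_right scaleR_add_left)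

section \<open>Complete semi-inner-product spaces\<close>

definition snorm :: "('v \<Rightarrow> 'v \<Rightarrow> real) \<Rightarrow> 'v \<Rightarrow> real" where
  "snorm ip x = sqrt (ip x x)"

text \<open>Closed subspaces are automatically saturated, see \<open>closed_sub_cong\<close> below.\<close>
definition closed_sub :: "'v set \<Rightarrow> ('v \<Rightarrow> 'v \<Rightarrow> real) \<Rightarrow> 'v::real_vector set \<Rightarrow> bool" where
  "closed_sub H ip V \<longleftrightarrow> subspace V \<and> V \<subseteq> H \<and>
     (\<forall>X x. (\<forall>k. X k \<in> V) \<longrightarrow> x \<in> H \<longrightarrow> (\<lambda>k::nat. snorm ip (X k - x)) \<longlonglongrightarrow> 0 \<longrightarrow> x \<in> V)"

definition sclosure :: "'v set \<Rightarrow> ('v \<Rightarrow> 'v \<Rightarrow> real) \<Rightarrow> 'v::real_vector set \<Rightarrow> 'v set" where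
  "sclosure H ip S = {x \<in> H. \<forall>e>0. \<exists>y\<in>S. snorm ip (y - x) < e}"

text \<open>Definiteness is left out because functions vanishing almost everywhere have norm 0
  without being 0. The carrier \<open>H\<close> is a subset of a function type, since square
  integrability depends on the measure.\<close>

locale semi_inner =
  fixes H :: "'v::real_vector set" and ip :: "'v \<Rightarrow> 'v \<Rightarrow> real"
  assumes subspace_H: "subspace H"
    and ip_commute: "x \<in> H \<Longrightarrow> y \<in> H \<Longrightarrow> ip x y = ip y x"
    and ip_add_left: "x \<in> H \<Longrightarrow> y \<in> H \<Longrightarrow> z \<in> H \<Longrightarrow> ip (x + y) z = ip x z + ip y z"
    and ip_scale_left: "x \<in> H \<Longrightarrow> z \<in> H \<Longrightarrow> ip (c *\<^sub>R x) z = c * ip x z"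
    and ip_nonneg: "x \<in> H \<Longrightarrow> 0 \<le> ip x x"
begin

abbreviation nrm :: "'v \<Rightarrow> real" where "nrm \<equiv> snorm ip"

lemma H_closed [simp, intro]:
  "0 \<in> H" "x \<in> H \<Longrightarrow> y \<in> H \<Longrightarrow> x + y \<in> H" "x \<in> H \<Longrightarrow> y \<in> H \<Longrightarrow> x - y \<in> H"
  "x \<in> H \<Longrightarrow> c *\<^sub>R x \<in> H" "x \<in> H \<Longrightarrow> - x \<in> H" "(\<And>i. i \<in> A \<Longrightarrow> f i \<in> H) \<Longrightarrow> sum f A \<in> H"
  using subspace_H by (auto intro: subspace_0 subspace_add subspace_diff subspace_scale subspace_neg subspace_sum)

lemma ip_minus_left: "x \<in> H \<Longrightarrow> z \<in> H \<Longrightarrow> ip (- x) z = - ip x z"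
  using ip_scale_left[of x z "-1"] by simp

lemma ip_diff_left: "x \<in> H \<Longrightarrow> y \<in> H \<Longrightarrow> z \<in> H \<Longrightarrow> ip (x - y) z = ip x z - ip y z"
  using ip_add_left[of x "- y" z] ip_minus_left[of y z] by simp

lemma ip_zero_left: "z \<in> H \<Longrightarrow> ip 0 z = 0"
  using ip_scale_left[of 0 z 0] by simp

lemma ip_add_right: "x \<in> H \<Longrightarrow> y \<in> H \<Longrightarrow> z \<in> H \<Longrightarrow> ip z (x + y) = ip z x + ip z y"
  by (metis H_closed(2) ip_add_left ip_commute)
lemma ip_diff_right: "x \<in> H \<Longrightarrow> y \<in> H \<Longrightarrow> z \<in> H \<Longrightarrow> ip z (x - y) = ip z x - ip z y"
  by (metis H_closed(3) ip_diff_left ip_commute)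
lemma ip_scale_right: "x \<in> H \<Longrightarrow> z \<in> H \<Longrightarrow> ip z (c *\<^sub>R x) = c * ip z x"
  by (metis H_closed(4) ip_scale_left ip_commute)

lemma ip_sum_left:
  "(\<And>i. i \<in> A \<Longrightarrow> f i \<in> H) \<Longrightarrow> z \<in> H \<Longrightarrow> ip (sum f A) z = (\<Sum>i\<in>A. ip (f i) z)"
  by (induction A rule: infinite_finite_induct) (auto simp: ip_zero_left ip_add_left)

lemma nrm_nonneg: "x \<in> H \<Longrightarrow> 0 \<le> nrm x"
  by (simp add: snorm_def ip_nonneg)

lemma nrm_square: "x \<in> H \<Longrightarrow> (nrm x)\<^sup>2 = ip x x"
  by (simp add: snorm_def ip_nonneg)

lemma nrm_zero [simp]: "nrm 0 = 0"
  by (simp add: snorm_def ip_zero_left)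

lemma nrm_scale: "x \<in> H \<Longrightarrow> nrm (c *\<^sub>R x) = \<bar>c\<bar> * nrm x"
  by (simp add: snorm_def ip_scale_left ip_scale_right real_sqrt_mult flip: mult.assoc power2_eq_square)

lemma nrm_minus: "x \<in> H \<Longrightarrow> nrm (- x) = nrm x"
  using nrm_scale[of x "-1"] by simp

lemma nrm_diff_commute: "x \<in> H \<Longrightarrow> y \<in> H \<Longrightarrow> nrm (x - y) = nrm (y - x)"
  using nrm_minus[of "x - y"] by simp

lemma Cauchy_Schwarz:
  assumes x: "x \<in> H" and y: "y \<in> H"
  shows "\<bar>ip x y\<bar> \<le> nrm x * nrm y"
proof -
  have q: "0 \<le> ip x x + 2 * t * ip x y + t\<^sup>2 * ip y y" for t
    using ip_nonneg[of "x + t *\<^sub>R y"] x y ip_commute[OF x y]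
    by (simp add: ip_add_left ip_add_right ip_scale_left ip_scale_right algebra_simps power2_eq_square)
  have "(ip x y)\<^sup>2 \<le> ip x x * ip y y"
  proof (cases "ip y y = 0")
    case True
    show ?thesis
    proof (cases "ip x y = 0")
      case False
      \<comment> \<open>For \<open>ip y y = 0\<close> the quadratic in \<open>q\<close> is affine in
        \<open>t\<close>, and this \<open>t\<close> gives it the value -1. The case is genuine,
        since \<open>y\<close> may be a nonzero null vector.\<close>
      then show ?thesis using q[of "- (ip x x + 1) / (2 * ip x y)"] True by (simp add: field_simps)
    qed (simp add: True)
  next
    case False
    then have "ip y y > 0" using ip_nonneg[OF y] by simp
    then show ?thesis using q[of "- ip x y / ip y y"]
      by (simp add: field_simps power2_eq_square)
  qed
  then have "sqrt ((ip x y)\<^sup>2) \<le> sqrt (ip x x * ip y y)" by (rule real_sqrt_le_mono)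
  then show ?thesis by (simp add: snorm_def real_sqrt_mult)
qed

lemma nrm_triangle:
  assumes x: "x \<in> H" and y: "y \<in> H"
  shows "nrm (x + y) \<le> nrm x + nrm y"
proof (rule power2_le_imp_le)
  have "(nrm (x + y))\<^sup>2 = (nrm x)\<^sup>2 + 2 * ip x y + (nrm y)\<^sup>2"
    using x y by (simp add: nrm_square ip_add_left ip_add_right ip_commute[OF y x])
  also have "\<dots> \<le> (nrm x + nrm y)\<^sup>2"
    using Cauchy_Schwarz[OF x y] by (simp add: power2_sum)
  finally show "(nrm (x + y))\<^sup>2 \<le> (nrm x + nrm y)\<^sup>2" .
qed (use x y in \<open>simp add: nrm_nonneg\<close>)

lemma nrm_triangle3:
  assumes "x \<in> H" "y \<in> H" "z \<in> H"
  shows "nrm (x - z) \<le> nrm (x - y) + nrm (y - z)"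
  using nrm_triangle[of "x - y" "y - z"] assms by simp

lemma nrm_pythagoras:
  assumes "x \<in> H" "y \<in> H" "ip x y = 0"
  shows "(nrm (x + y))\<^sup>2 = (nrm x)\<^sup>2 + (nrm y)\<^sup>2"
  using assms ip_commute[of x y] by (simp add: nrm_square ip_add_left ip_add_right)

lemma nrm_0_ip: "x \<in> H \<Longrightarrow> y \<in> H \<Longrightarrow> nrm x = 0 \<Longrightarrow> ip x y = 0"
  using Cauchy_Schwarz[of x y] by simp

lemma ip_cong_nrm: "x \<in> H \<Longrightarrow> x' \<in> H \<Longrightarrow> y \<in> H \<Longrightarrow> nrm (x - x') = 0 \<Longrightarrow> ip x y = ip x' y"
  using nrm_0_ip[of "x - x'" y] by (simp add: ip_diff_left)

lemma nrm_0_trans: "x \<in> H \<Longrightarrow> y \<in> H \<Longrightarrow> z \<in> H \<Longrightarrow> nrm (x - y) = 0 \<Longrightarrow> nrm (y - z) = 0 \<Longrightarrow> nrm (x - z) = 0"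
  using nrm_triangle3[of x y z] nrm_nonneg[of "x - z"] by simp

lemma nrm_tendsto:
  assumes "\<And>k. X k \<in> H" "x \<in> H" "(\<lambda>k. nrm (X k - x)) \<longlonglongrightarrow> 0"
  shows "(\<lambda>k. nrm (X k)) \<longlonglongrightarrow> nrm x"
proof -
  have "\<bar>nrm (X k) - nrm x\<bar> \<le> nrm (X k - x)" for k
    using nrm_triangle[of "X k - x" x] nrm_triangle[of "x - X k" "X k"] nrm_diff_commute[of "X k" x] assms
    by auto
  then have "(\<lambda>k. nrm (X k) - nrm x) \<longlonglongrightarrow> 0"
    by (intro Lim_null_comparison[OF _ assms(3)]) auto
  then show ?thesis by (simp add: LIM_zero_iff)
qed

lemma tends_add:
  assumes "\<And>k. X k \<in> H" "x \<in> H" "(\<lambda>k. nrm (X k - x)) \<longlonglongrightarrow> 0"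
    and "\<And>k. Y k \<in> H" "y \<in> H" "(\<lambda>k. nrm (Y k - y)) \<longlonglongrightarrow> 0"
  shows "(\<lambda>k. nrm ((X k + Y k) - (x + y))) \<longlonglongrightarrow> 0"
proof (rule Lim_null_comparison)
  have e: "X k + Y k - (x + y) = (X k - x) + (Y k - y)" for k by simp
  have "nrm (X k + Y k - (x + y)) \<le> nrm (X k - x) + nrm (Y k - y)" for k
    unfolding e by (intro nrm_triangle H_closed assms)
  then show "\<forall>\<^sub>F k in sequentially. norm (nrm (X k + Y k - (x + y))) \<le> nrm (X k - x) + nrm (Y k - y)"
    using assms by (intro always_eventually allI) (simp add: nrm_nonneg)
  show "(\<lambda>k. nrm (X k - x) + nrm (Y k - y)) \<longlonglongrightarrow> 0"
    using tendsto_add[OF assms(3,6)] by simp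
qed

lemma tends_scale:
  assumes "\<And>k. X k \<in> H" "x \<in> H" "(\<lambda>k. nrm (X k - x)) \<longlonglongrightarrow> 0"
  shows "(\<lambda>k. nrm (c *\<^sub>R X k - c *\<^sub>R x)) \<longlonglongrightarrow> 0"
proof -
  have "nrm (c *\<^sub>R X k - c *\<^sub>R x) = \<bar>c\<bar> * nrm (X k - x)" for k
    using nrm_scale[of "X k - x" c] assms by (simp add: scaleR_diff_right)
  then show ?thesis using tendsto_mult_left[OF assms(3), of "\<bar>c\<bar>"] by simp
qed

lemma ip_tendsto:
  assumes X: "\<And>k. X k \<in> H" "x \<in> H" "(\<lambda>k. nrm (X k - x)) \<longlonglongrightarrow> 0"
    and Y: "\<And>k. Y k \<in> H" "y \<in> H" "(\<lambda>k. nrm (Y k - y)) \<longlonglongrightarrow> 0"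
  shows "(\<lambda>k. ip (X k) (Y k)) \<longlonglongrightarrow> ip x y"
proof -
  \<comment> \<open>Polarization reduces the claim to convergence of norms. The difference is
    written as \<open>a + (-1) *\<^sub>R b\<close> so that \<open>tends_add\<close> and
    \<open>tends_scale\<close> apply to it.\<close>
  have pol: "ip a b = ((nrm (a + b))\<^sup>2 - (nrm (a + (-1) *\<^sub>R b))\<^sup>2) / 4" if "a \<in> H" "b \<in> H" for a b
    using that ip_commute[of a b]
    by (simp add: nrm_square ip_add_left ip_add_right ip_minus_left ip_diff_left ip_diff_right)
  have a: "(\<lambda>k. nrm (X k + Y k)) \<longlonglongrightarrow> nrm (x + y)"
    using assms by (intro nrm_tendsto tends_add) auto
  have b: "(\<lambda>k. nrm (X k + (-1) *\<^sub>R Y k)) \<longlonglongrightarrow> nrm (x + (-1) *\<^sub>R y)"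
    using X Y(1,2) tends_scale[OF Y, of "-1"] by (intro nrm_tendsto tends_add) auto
  have "(\<lambda>k. ((nrm (X k + Y k))\<^sup>2 - (nrm (X k + (-1) *\<^sub>R Y k))\<^sup>2) / 4)
      \<longlonglongrightarrow> ((nrm (x + y))\<^sup>2 - (nrm (x + (-1) *\<^sub>R y))\<^sup>2) / 4"
    by (intro tendsto_intros a b) simp
  then show ?thesis unfolding pol[OF X(1) Y(1)] pol[OF X(2) Y(2)] .
qed

lemma closed_subI:
  assumes "subspace V" "V \<subseteq> H"
    and "\<And>X x. (\<And>k. X k \<in> V) \<Longrightarrow> x \<in> H \<Longrightarrow> (\<lambda>k::nat. nrm (X k - x)) \<longlonglongrightarrow> 0 \<Longrightarrow> x \<in> V"
  shows "closed_sub H ip V"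
  using assms by (auto simp: closed_sub_def)

text \<open>The constant sequence at \<open>x\<close> converges to every point at distance 0 from
  \<open>x\<close>.\<close>

lemma closed_sub_cong:
  assumes "closed_sub H ip V" "x \<in> V" "y \<in> H" "nrm (x - y) = 0"
  shows "y \<in> V"
proof -
  have *: "(\<forall>k. X k \<in> V) \<longrightarrow> z \<in> H \<longrightarrow> (\<lambda>k::nat. nrm (X k - z)) \<longlonglongrightarrow> 0 \<longrightarrow> z \<in> V" for X z
    using assms(1) unfolding closed_sub_def by blast
  show ?thesis using *[of "\<lambda>_. x" y] assms by simp
qed

lemma closed_sub_approx:
  assumes V: "closed_sub H ip V" and x: "x \<in> H" and e: "\<And>e. e > 0 \<Longrightarrow> \<exists>y\<in>V. nrm (y - x) < e"
  shows "x \<in> V"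
proof -
  have "\<forall>k. \<exists>y\<in>V. nrm (y - x) < 1 / real (Suc k)" using e by simp
  then obtain X where X: "\<And>k. X k \<in> V" "\<And>k. nrm (X k - x) < 1 / real (Suc k)" by metis
  have "V \<subseteq> H" using V by (simp add: closed_sub_def)
  then have "X k \<in> H" for k using X by auto
  then have "(\<lambda>k. nrm (X k - x)) \<longlonglongrightarrow> 0"
    using X(2) x lim_inverse_n'
    by (intro Lim_null_comparison[OF _ LIMSEQ_Suc[OF lim_inverse_n']] always_eventually allI)
       (simp add: nrm_nonneg less_imp_le)
  then show ?thesis using V X(1) x unfolding closed_sub_def by blast
qed

text \<open>Allows orthogonality to a fixed set to be verified on a dense family only.\<close>

lemma closed_sub_orth:
  assumes S: "S \<subseteq> H"
  shows "closed_sub H ip {x \<in> H. \<forall>y\<in>S. ip x y = 0}"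
proof (rule closed_subI)
  show "subspace {x \<in> H. \<forall>y\<in>S. ip x y = 0}"
    using S by (auto simp: subspace_def ip_zero_left ip_add_left ip_scale_left subset_iff)
next
  fix X x assume X: "\<And>k. X k \<in> {x \<in> H. \<forall>y\<in>S. ip x y = 0}" and x: "x \<in> H" "(\<lambda>k::nat. nrm (X k - x)) \<longlonglongrightarrow> 0"
  have "ip x y = 0" if y: "y \<in> S" for y
  proof -
    have "(\<lambda>k. ip (X k) y) \<longlonglongrightarrow> ip x y"
      using X x S y by (intro ip_tendsto) auto
    then show ?thesis using X y by (simp add: LIMSEQ_const_iff)
  qed
  then show "x \<in> {x \<in> H. \<forall>y\<in>S. ip x y = 0}" using x by simp
qed auto

lemma sclosure_superset: "S \<subseteq> H \<Longrightarrow> S \<subseteq> sclosure H ip S"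
  by (force simp: sclosure_def)

lemma sclosure_seq:
  assumes "x \<in> sclosure H ip S" "S \<subseteq> H"
  obtains X where "\<And>k. X k \<in> S" "(\<lambda>k::nat. nrm (X k - x)) \<longlonglongrightarrow> 0"
proof -
  have x: "x \<in> H" using assms by (simp add: sclosure_def)
  have "\<forall>k. \<exists>y\<in>S. nrm (y - x) < 1 / real (Suc k)" using assms(1) by (simp add: sclosure_def)
  then obtain X where X: "\<And>k. X k \<in> S" "\<And>k. nrm (X k - x) < 1 / real (Suc k)" by metis
  have "(\<lambda>k. nrm (X k - x)) \<longlonglongrightarrow> 0"
    using X assms(2) x
    by (intro Lim_null_comparison[OF _ LIMSEQ_Suc[OF lim_inverse_n']] always_eventually allI)
       (simp add: nrm_nonneg less_imp_le subset_iff)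
  then show ?thesis using X(1) that by blast
qed

lemma closed_sub_sclosure:
  assumes S: "subspace S" "S \<subseteq> H"
  shows "closed_sub H ip (sclosure H ip S)"
proof (rule closed_subI)
  show "subspace (sclosure H ip S)"
  proof (rule subspaceI)
    show "0 \<in> sclosure H ip S" using S sclosure_superset subspace_0 by blast
  next
    fix x y assume "x \<in> sclosure H ip S" "y \<in> sclosure H ip S"
    note xyS = this
    obtain X where X: "\<And>k. X k \<in> S" "(\<lambda>k::nat. nrm (X k - x)) \<longlonglongrightarrow> 0"
      using sclosure_seq[OF xyS(1) S(2)] by blast
    obtain Y where Y: "\<And>k. Y k \<in> S" "(\<lambda>k::nat. nrm (Y k - y)) \<longlonglongrightarrow> 0"
      using sclosure_seq[OF xyS(2) S(2)] by blast
    have xy: "x \<in> H" "y \<in> H" using xyS by (auto simp: sclosure_def)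
    have l: "(\<lambda>k. nrm ((X k + Y k) - (x + y))) \<longlonglongrightarrow> 0"
      using X Y S xy by (intro tends_add) auto
    show "x + y \<in> sclosure H ip S" unfolding sclosure_def
    proof safe
      fix e :: real assume "e > 0"
      then obtain k where "nrm ((X k + Y k) - (x + y)) < e"
        using eventually_happens'[OF sequentially_bot order_tendstoD(2)[OF l, of e]] by blast
      then show "\<exists>z\<in>S. nrm (z - (x + y)) < e" using X Y S by (blast intro: subspace_add)
    qed (use xy in auto)
  next
    fix c x assume xS: "x \<in> sclosure H ip S"
    obtain X where X: "\<And>k. X k \<in> S" "(\<lambda>k::nat. nrm (X k - x)) \<longlonglongrightarrow> 0"
      using sclosure_seq[OF xS S(2)] by blast
    have x: "x \<in> H" using xS by (auto simp: sclosure_def)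
    have l: "(\<lambda>k. nrm (c *\<^sub>R X k - c *\<^sub>R x)) \<longlonglongrightarrow> 0"
      using X S x by (intro tends_scale) auto
    show "c *\<^sub>R x \<in> sclosure H ip S" unfolding sclosure_def
    proof safe
      fix e :: real assume "e > 0"
      then obtain k where "nrm (c *\<^sub>R X k - c *\<^sub>R x) < e"
        using eventually_happens'[OF sequentially_bot order_tendstoD(2)[OF l, of e]] by blast
      then show "\<exists>z\<in>S. nrm (z - c *\<^sub>R x) < e" using X S by (blast intro: subspace_scale)
    qed (use x in auto)
  qed
next
  fix X x assume X: "\<And>k. X k \<in> sclosure H ip S" and x: "x \<in> H" and l: "(\<lambda>k::nat. nrm (X k - x)) \<longlonglongrightarrow> 0"
  show "x \<in> sclosure H ip S" unfolding sclosure_def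
  proof safe
    fix e :: real assume e: "e > 0"
    then obtain k where k: "nrm (X k - x) < e / 2"
      using eventually_happens'[OF sequentially_bot order_tendstoD(2)[OF l, of "e/2"]] by auto
    obtain y where y: "y \<in> S" "nrm (y - X k) < e / 2"
      using X[of k] e by (force simp: sclosure_def dest: spec[of _ "e/2"])
    have "nrm (y - x) < e"
      using nrm_triangle3[of y "X k" x] k y X[of k] x S by (auto simp: sclosure_def)
    then show "\<exists>z\<in>S. nrm (z - x) < e" using y by blast
  qed (use x in auto)
qed (auto simp: sclosure_def)

end

locale semi_hilbert = semi_inner +
  assumes complete: "(\<And>k. X k \<in> H) \<Longrightarrow>
      (\<forall>e>0. \<exists>K. \<forall>i\<ge>K. \<forall>j\<ge>K. snorm ip (X i - X j) < e) \<Longrightarrow>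
      \<exists>x\<in>H. (\<lambda>k::nat. snorm ip (X k - x)) \<longlonglongrightarrow> 0"
begin

text \<open>By the Pythagorean theorem, the components of a Cauchy sequence in the sum are Cauchy.\<close>
lemma closed_sub_orth_plus:
  assumes A: "closed_sub H ip A" and B: "closed_sub H ip B"
    and orth: "\<And>a b. a \<in> A \<Longrightarrow> b \<in> B \<Longrightarrow> ip a b = 0"
  shows "closed_sub H ip {z \<in> H. \<exists>a\<in>A. \<exists>b\<in>B. nrm (z - (a + b)) = 0}" (is "closed_sub H ip ?S")
proof (rule closed_subI)
  have AH: "A \<subseteq> H" "subspace A" and BH: "B \<subseteq> H" "subspace B" using A B by (auto simp: closed_sub_def)
  show "subspace ?S"
  proof (rule subspaceI)
    show "0 \<in> ?S" using AH BH by (force intro: subspace_0)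
  next
    fix x y assume "x \<in> ?S" "y \<in> ?S"
    then obtain a b c d where x: "x \<in> H" "a \<in> A" "b \<in> B" "nrm (x - (a + b)) = 0"
      and y: "y \<in> H" "c \<in> A" "d \<in> B" "nrm (y - (c + d)) = 0" by blast
    have e: "x + y - ((a + c) + (b + d)) = (x - (a + b)) + (y - (c + d))" by simp
    have H: "a \<in> H" "b \<in> H" "c \<in> H" "d \<in> H" using AH BH x y by auto
    then have "nrm (x + y - ((a + c) + (b + d))) \<le> 0"
      using nrm_triangle[of "x - (a + b)" "y - (c + d)"] x y unfolding e by simp
    then have "nrm (x + y - ((a + c) + (b + d))) = 0"
      using H x y nrm_nonneg[of "x + y - ((a + c) + (b + d))"] by simp
    then show "x + y \<in> ?S" using x y AH BH by (blast intro: subspace_add)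
  next
    fix c x assume "x \<in> ?S"
    then obtain a b where x: "x \<in> H" "a \<in> A" "b \<in> B" "nrm (x - (a + b)) = 0" by blast
    have "nrm (c *\<^sub>R (x - (a + b))) = 0" using x AH BH by (subst nrm_scale) auto
    then have "nrm (c *\<^sub>R x - (c *\<^sub>R a + c *\<^sub>R b)) = 0" by (simp add: algebra_simps)
    then show "c *\<^sub>R x \<in> ?S" using x AH BH by (blast intro: subspace_scale)
  qed
next
  have AH: "A \<subseteq> H" "subspace A" and BH: "B \<subseteq> H" "subspace B" using A B by (auto simp: closed_sub_def)
  fix X x assume X: "\<And>k. X k \<in> ?S" and x: "x \<in> H" and l: "(\<lambda>k::nat. nrm (X k - x)) \<longlonglongrightarrow> 0"
  from X have "\<forall>k. \<exists>a b. a \<in> A \<and> b \<in> B \<and> nrm (X k - (a + b)) = 0" by blast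
  then obtain a b where ab: "\<And>k. a k \<in> A" "\<And>k. b k \<in> B" "\<And>k. nrm (X k - (a k + b k)) = 0" by metis
  have H[simp]: "a k \<in> H" "b k \<in> H" "X k \<in> H" for k using ab AH BH X by auto
  have l': "(\<lambda>k. nrm ((a k + b k) - x)) \<longlonglongrightarrow> 0"
  proof (rule Lim_null_comparison[OF _ l], intro always_eventually allI)
    fix k show "norm (nrm ((a k + b k) - x)) \<le> nrm (X k - x)"
      using nrm_triangle3[of "a k + b k" "X k" x] ab(3)[of k] nrm_diff_commute[of "X k" "a k + b k"] x
      by (simp add: nrm_nonneg)
  qed
  have Cau: "\<forall>e>0. \<exists>K. \<forall>i\<ge>K. \<forall>j\<ge>K. nrm ((a i + b i) - (a j + b j)) < e"
  proof safe
    fix e :: real assume "e > 0"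
    then have "\<forall>\<^sub>F k in sequentially. nrm ((a k + b k) - x) < e / 2" using order_tendstoD(2)[OF l', of "e/2"] by simp
    then obtain K where K: "\<And>k. k \<ge> K \<Longrightarrow> nrm ((a k + b k) - x) < e / 2" by (auto simp: eventually_sequentially)
    have "nrm ((a i + b i) - (a j + b j)) < e" if "i \<ge> K" "j \<ge> K" for i j
      using nrm_triangle3[of "a i + b i" x "a j + b j"] K[OF that(1)] K[OF that(2)]
        nrm_diff_commute[of x "a j + b j"] x by simp
    then show "\<exists>K. \<forall>i\<ge>K. \<forall>j\<ge>K. nrm ((a i + b i) - (a j + b j)) < e" by blast
  qed
  have pyth: "(nrm ((a i + b i) - (a j + b j)))\<^sup>2 = (nrm (a i - a j))\<^sup>2 + (nrm (b i - b j))\<^sup>2" for i j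
  proof -
    have e: "(a i + b i) - (a j + b j) = (a i - a j) + (b i - b j)" by simp
    have "ip (a i - a j) (b i - b j) = 0"
      using ab AH BH by (intro orth subspace_diff) auto
    then show ?thesis unfolding e by (intro nrm_pythagoras) auto
  qed
  have le: "nrm (a i - a j) \<le> nrm ((a i + b i) - (a j + b j))" "nrm (b i - b j) \<le> nrm ((a i + b i) - (a j + b j))" for i j
    by (rule power2_le_imp_le; use pyth[of i j] in \<open>simp add: nrm_nonneg\<close>)+
  have "\<forall>e>0. \<exists>K. \<forall>i\<ge>K. \<forall>j\<ge>K. nrm (a i - a j) < e" using Cau le(1) by (meson le_less_trans)
  then obtain a' where a': "a' \<in> H" "(\<lambda>k. nrm (a k - a')) \<longlonglongrightarrow> 0" using complete[of a] by auto
  have "\<forall>e>0. \<exists>K. \<forall>i\<ge>K. \<forall>j\<ge>K. nrm (b i - b j) < e" using Cau le(2) by (meson le_less_trans)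
  then obtain b' where b': "b' \<in> H" "(\<lambda>k. nrm (b k - b')) \<longlonglongrightarrow> 0" using complete[of b] by auto
  have "a' \<in> A" using a' A ab unfolding closed_sub_def by blast
  moreover have "b' \<in> B" using b' B ab unfolding closed_sub_def by blast
  moreover have "nrm (x - (a' + b')) = 0"
  proof -
    have 1: "(\<lambda>k. nrm ((a k + b k) - (a' + b'))) \<longlonglongrightarrow> 0" using a' b' by (intro tends_add) auto
    have "nrm (x - (a' + b')) \<le> nrm ((a k + b k) - x) + nrm ((a k + b k) - (a' + b'))" for k
      using nrm_triangle3[of x "a k + b k" "a' + b'"] nrm_diff_commute[of x "a k + b k"] x a' b' by simp
    then have "nrm (x - (a' + b')) \<le> 0"
      using tendsto_add[OF l' 1] by (intro LIMSEQ_le_const[where X = "\<lambda>k. nrm ((a k + b k) - x) + nrm ((a k + b k) - (a' + b'))"]) auto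
    then show ?thesis using x a' b' nrm_nonneg[of "x - (a' + b')"] by simp
  qed
  ultimately show "x \<in> ?S" using x by blast
qed auto

text \<open>Peeling off one summand reduces this to \<open>closed_sub_orth_plus\<close>; the sum of
  the others stays orthogonal to it because inner products ignore null vectors. Applied to the
  spaces \<open>H_fock\<close>, it allows the inclusion of \<open>MP_fock\<close> in their sum to be
  checked on monomials.\<close>

lemma closed_sub_orth_sum:
  assumes "finite \<Lambda>" "\<And>i. i \<in> \<Lambda> \<Longrightarrow> closed_sub H ip (W i)"
    and "\<And>i j a b. i \<in> \<Lambda> \<Longrightarrow> j \<in> \<Lambda> \<Longrightarrow> i \<noteq> j \<Longrightarrow> a \<in> W i \<Longrightarrow> b \<in> W j \<Longrightarrow> ip a b = 0"
  shows "closed_sub H ip {z \<in> H. \<exists>y. (\<forall>i\<in>\<Lambda>. y i \<in> W i) \<and> nrm (z - (\<Sum>i\<in>\<Lambda>. y i)) = 0}"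
  using assms
proof (induction \<Lambda> rule: finite_induct)
  \<comment> \<open>The empty sum is the set of all vectors of norm 0, not just {0}; it is closed
    because norms pass to the limit.\<close>
  case empty
  show ?case
  proof (rule closed_subI)
    show "subspace {z \<in> H. \<exists>y. (\<forall>i\<in>{}. y i \<in> W i) \<and> nrm (z - sum y {}) = 0}"
    proof (rule subspaceI)
      fix x y assume "x \<in> {z \<in> H. \<exists>y. (\<forall>i\<in>{}. y i \<in> W i) \<and> nrm (z - sum y {}) = 0}"
       "y \<in> {z \<in> H. \<exists>y. (\<forall>i\<in>{}. y i \<in> W i) \<and> nrm (z - sum y {}) = 0}"
      then show "x + y \<in> {z \<in> H. \<exists>y. (\<forall>i\<in>{}. y i \<in> W i) \<and> nrm (z - sum y {}) = 0}"
        using nrm_triangle[of x y] nrm_nonneg[of "x + y"] by auto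
    qed (auto simp: nrm_scale)
    show "x \<in> {z \<in> H. \<exists>y. (\<forall>i\<in>{}. y i \<in> W i) \<and> nrm (z - sum y {}) = 0}"
      if "\<And>k. X k \<in> {z \<in> H. \<exists>y. (\<forall>i\<in>{}. y i \<in> W i) \<and> nrm (z - sum y {}) = 0}" "x \<in> H"
         "(\<lambda>k::nat. nrm (X k - x)) \<longlonglongrightarrow> 0" for X x
      using nrm_tendsto[of X x] that by (auto simp: LIMSEQ_const_iff)
  qed auto
next
  case (insert i \<Lambda>)
  let ?S = "\<lambda>\<Lambda>. {z \<in> H. \<exists>y. (\<forall>i\<in>\<Lambda>. y i \<in> W i) \<and> nrm (z - (\<Sum>i\<in>\<Lambda>. y i)) = 0}"
  have S: "closed_sub H ip (?S \<Lambda>)"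
  proof (rule insert.IH)
    show "ip a b = 0" if "j \<in> \<Lambda>" "k \<in> \<Lambda>" "j \<noteq> k" "a \<in> W j" "b \<in> W k" for j k a b
      using insert.prems(2)[of j k a b] that by blast
  qed (use insert.prems in auto)
  have Wi: "closed_sub H ip (W i)" using insert.prems by auto
  have WH: "W j \<subseteq> H" if "j \<in> insert i \<Lambda>" for j using insert.prems that by (auto simp: closed_sub_def)
  have "closed_sub H ip {z \<in> H. \<exists>a\<in>W i. \<exists>b\<in>?S \<Lambda>. nrm (z - (a + b)) = 0}"
  proof (rule closed_sub_orth_plus[OF Wi S])
    fix a b assume a: "a \<in> W i" and "b \<in> ?S \<Lambda>"
    then obtain y where y: "b \<in> H" "\<forall>i\<in>\<Lambda>. y i \<in> W i" "nrm (b - (\<Sum>i\<in>\<Lambda>. y i)) = 0" by blast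
    have yH: "y j \<in> H" if "j \<in> \<Lambda>" for j using y that WH by blast
    have aH: "a \<in> H" using a WH by blast
    have "ip b a = ip (\<Sum>i\<in>\<Lambda>. y i) a" using y yH aH by (intro ip_cong_nrm) auto
    also have "\<dots> = (\<Sum>i\<in>\<Lambda>. ip (y i) a)" using yH aH by (rule ip_sum_left)
    also have "\<dots> = 0" using y a insert.prems(2) insert.hyps by (intro sum.neutral) blast
    finally show "ip a b = 0" using ip_commute[of a b] aH y by simp
  qed
  moreover have "{z \<in> H. \<exists>a\<in>W i. \<exists>b\<in>?S \<Lambda>. nrm (z - (a + b)) = 0} = ?S (insert i \<Lambda>)"
  proof safe
    fix z a b y assume z: "z \<in> H" "a \<in> W i" "b \<in> H" "nrm (z - (a + b)) = 0" "\<forall>i\<in>\<Lambda>. y i \<in> W i" "nrm (b - sum y \<Lambda>) = 0"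
    have yH: "y j \<in> H" if "j \<in> \<Lambda>" for j using z that WH by blast
    have aH: "a \<in> H" using z WH by blast
    have "sum (y(i := a)) \<Lambda> = sum y \<Lambda>" using insert.hyps by (intro sum.cong) auto
    then have s: "sum (y(i := a)) (insert i \<Lambda>) = a + sum y \<Lambda>" using insert.hyps by simp
    have "nrm (z - sum (y(i := a)) (insert i \<Lambda>)) = 0" unfolding s
      using nrm_0_trans[of z "a + b" "a + sum y \<Lambda>"] z aH yH by simp
    moreover have "\<forall>j\<in>insert i \<Lambda>. (y(i := a)) j \<in> W j" using z by auto
    ultimately show "\<exists>y. (\<forall>j\<in>insert i \<Lambda>. y j \<in> W j) \<and> nrm (z - sum y (insert i \<Lambda>)) = 0" by blast
  next
    fix z y assume z: "z \<in> H" "\<forall>j\<in>insert i \<Lambda>. y j \<in> W j" "nrm (z - sum y (insert i \<Lambda>)) = 0"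
    have yH: "y j \<in> H" if "j \<in> \<Lambda>" for j using z that WH by blast
    have "sum y \<Lambda> \<in> ?S \<Lambda>" using yH z by auto
    then show "\<exists>a\<in>W i. \<exists>b\<in>?S \<Lambda>. nrm (z - (a + b)) = 0" using z insert.hyps by (intro bexI[of _ "y i"] bexI[of _ "sum y \<Lambda>"]) auto
  qed
  ultimately show ?case by simp
qed

end

section \<open>Bounded linear maps and closed subspaces\<close>

text \<open>Preimages of a Cauchy sequence under an isometry form a Cauchy sequence, so completeness
  of the source supplies a preimage of the limit. Needed to see that the spaces
  \<open>H_fock\<close> are closed.\<close>

lemma closed_sub_isometry_range:
  assumes "semi_hilbert H ip" "semi_hilbert H' ip'"
    and J: "\<And>f. f \<in> H' \<Longrightarrow> J f \<in> H" "\<And>f g. f \<in> H' \<Longrightarrow> g \<in> H' \<Longrightarrow> J (f + g) = J f + J g"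
      "\<And>c f. f \<in> H' \<Longrightarrow> J (c *\<^sub>R f) = c *\<^sub>R J f" "\<And>f. f \<in> H' \<Longrightarrow> snorm ip (J f) = snorm ip' f"
  shows "closed_sub H ip {z \<in> H. \<exists>f\<in>H'. snorm ip (z - J f) = 0}" (is "closed_sub H ip ?S")
proof -
  interpret A: semi_hilbert H ip by fact
  interpret B: semi_hilbert H' ip' by fact
  have Jd: "J (f - g) = J f - J g" if "f \<in> H'" "g \<in> H'" for f g
    using J(2)[of f "(-1) *\<^sub>R g"] J(3)[of g "-1"] that by simp
  show ?thesis
  proof (rule A.closed_subI)
    show "subspace ?S"
    proof (rule subspaceI)
      have "J 0 = 0" using J(3)[of 0 0] by simp
      then show "0 \<in> ?S" by force
    next
      fix x y assume "x \<in> ?S" "y \<in> ?S"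
      then obtain f g where *: "x \<in> H" "f \<in> H'" "snorm ip (x - J f) = 0" "y \<in> H" "g \<in> H'" "snorm ip (y - J g) = 0" by blast
      have e: "x + y - J (f + g) = (x - J f) + (y - J g)" using * J by simp
      have "snorm ip (x + y - J (f + g)) = 0"
        using A.nrm_triangle[of "x - J f" "y - J g"] A.nrm_nonneg[of "x + y - J (f + g)"] * J(1) unfolding e by simp
      then show "x + y \<in> ?S" using * by blast
    next
      fix c x assume "x \<in> ?S"
      then obtain f where *: "x \<in> H" "f \<in> H'" "snorm ip (x - J f) = 0" by blast
      have "snorm ip (c *\<^sub>R x - J (c *\<^sub>R f)) = 0"
        using A.nrm_scale[of "x - J f" c] * J by (simp add: scaleR_diff_right)
      then show "c *\<^sub>R x \<in> ?S" using * by blast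
    qed
  next
    fix X x assume X: "\<And>k. X k \<in> ?S" and x: "x \<in> H" and l: "(\<lambda>k::nat. snorm ip (X k - x)) \<longlonglongrightarrow> 0"
    from X have "\<forall>k. \<exists>f. f \<in> H' \<and> snorm ip (X k - J f) = 0" by blast
    then obtain f where f: "\<And>k. f k \<in> H'" "\<And>k. snorm ip (X k - J (f k)) = 0" by metis
    have XH[simp]: "X k \<in> H" and JH[simp]: "J (f k) \<in> H" for k using X f J by auto
    have lJ: "(\<lambda>k. snorm ip (J (f k) - x)) \<longlonglongrightarrow> 0"
    proof (rule Lim_null_comparison[OF _ l], intro always_eventually allI)
      fix k show "norm (snorm ip (J (f k) - x)) \<le> snorm ip (X k - x)"
        using A.nrm_triangle3[of "J (f k)" "X k" x] f(2)[of k] A.nrm_diff_commute[of "X k" "J (f k)"] x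
        by (simp add: A.nrm_nonneg)
    qed
    have "\<forall>e>0. \<exists>K. \<forall>i\<ge>K. \<forall>j\<ge>K. snorm ip' (f i - f j) < e"
    proof safe
      fix e :: real assume "e > 0"
      then have "\<forall>\<^sub>F k in sequentially. snorm ip (J (f k) - x) < e / 2" using order_tendstoD(2)[OF lJ, of "e/2"] by simp
      then obtain K where K: "\<And>k. k \<ge> K \<Longrightarrow> snorm ip (J (f k) - x) < e / 2" by (auto simp: eventually_sequentially)
      have "snorm ip' (f i - f j) < e" if "i \<ge> K" "j \<ge> K" for i j
        using A.nrm_triangle3[of "J (f i)" x "J (f j)"] K[OF that(1)] K[OF that(2)]
          A.nrm_diff_commute[of x "J (f j)"] x J(4)[of "f i - f j"] f Jd by simp
      then show "\<exists>K. \<forall>i\<ge>K. \<forall>j\<ge>K. snorm ip' (f i - f j) < e" by blast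
    qed
    then obtain g where g: "g \<in> H'" "(\<lambda>k. snorm ip' (f k - g)) \<longlonglongrightarrow> 0" using B.complete[of f] f by auto
    then have lg: "(\<lambda>k. snorm ip (J (f k) - J g)) \<longlonglongrightarrow> 0"
      using J(4)[of "f k - g" for k] f Jd by simp
    have "snorm ip (x - J g) \<le> snorm ip (J (f k) - x) + snorm ip (J (f k) - J g)" for k
      using A.nrm_triangle3[of x "J (f k)" "J g"] A.nrm_diff_commute[of x "J (f k)"] x g J by simp
    then have "snorm ip (x - J g) \<le> 0"
      using tendsto_add[OF lJ lg] by (intro LIMSEQ_le_const[where X = "\<lambda>k. snorm ip (J (f k) - x) + snorm ip (J (f k) - J g)"]) auto
    then have "snorm ip (x - J g) = 0" using x g J A.nrm_nonneg[of "x - J g"] by simp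
    then show "x \<in> ?S" using x g by blast
  qed auto
qed

text \<open>The device behind all density arguments below: to place \<open>J f\<close> in a closed
  subspace for every \<open>f\<close>, it suffices to do so for a family of \<open>f\<close> that no
  proper closed subspace of the source contains.\<close>

lemma closed_sub_vimage:
  assumes "semi_hilbert H ip" "semi_hilbert H' ip'"
    and J: "\<And>f. f \<in> H' \<Longrightarrow> J f \<in> H" "\<And>f g. f \<in> H' \<Longrightarrow> g \<in> H' \<Longrightarrow> J (f + g) = J f + J g"
      "\<And>c f. f \<in> H' \<Longrightarrow> J (c *\<^sub>R f) = c *\<^sub>R J f" "\<And>f. f \<in> H' \<Longrightarrow> snorm ip (J f) \<le> B * snorm ip' f"
    and V: "closed_sub H ip V"
  shows "closed_sub H' ip' {f \<in> H'. J f \<in> V}"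
proof -
  interpret A: semi_hilbert H ip by fact
  interpret B: semi_hilbert H' ip' by fact
  have sV: "subspace V" using V by (simp add: closed_sub_def)
  have Jd: "J (f - g) = J f - J g" if "f \<in> H'" "g \<in> H'" for f g
    using J(2)[of f "(-1) *\<^sub>R g"] J(3)[of g "-1"] that by simp
  show ?thesis
  proof (rule B.closed_subI)
    have "J 0 = 0" using J(3)[of 0 0] by simp
    then show "subspace {f \<in> H'. J f \<in> V}"
      using sV J by (auto simp: subspace_def)
  next
    fix X x assume X: "\<And>k. X k \<in> {f \<in> H'. J f \<in> V}" and x: "x \<in> H'" and l: "(\<lambda>k::nat. snorm ip' (X k - x)) \<longlonglongrightarrow> 0"
    have lJ: "(\<lambda>k. snorm ip (J (X k) - J x)) \<longlonglongrightarrow> 0"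
    proof (rule Lim_null_comparison[where g="\<lambda>k. B * snorm ip' (X k - x)"])
      show "\<forall>\<^sub>F k in sequentially. norm (snorm ip (J (X k) - J x)) \<le> B * snorm ip' (X k - x)"
        using J(1,4)[of "X k - x" for k] J(1) X x Jd by (intro always_eventually allI) (simp add: A.nrm_nonneg)
      show "(\<lambda>k. B * snorm ip' (X k - x)) \<longlonglongrightarrow> 0" using tendsto_mult_left[OF l, of B] by simp
    qed
    have cl: "(\<forall>k. Y k \<in> V) \<longrightarrow> z \<in> H \<longrightarrow> (\<lambda>k::nat. snorm ip (Y k - z)) \<longlonglongrightarrow> 0 \<longrightarrow> z \<in> V" for Y z
      using V unfolding closed_sub_def by blast
    have "\<forall>k. J (X k) \<in> V" and "J x \<in> H" using X x J(1) by auto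
    then have "J x \<in> V" using cl[of "\<lambda>k. J (X k)" "J x"] lJ by blast
    then show "x \<in> {f \<in> H'. J f \<in> V}" using x by simp
  qed auto
qed

lemma sum_fun_apply: "(sum f A) x = (\<Sum>i\<in>A. f i x)"
  by (induction A rule: infinite_finite_induct) simp_all

section \<open>\<open>L\<^sup>2\<close> spaces and their direct sums\<close>

definition l2_inner :: "'b measure \<Rightarrow> ('b \<Rightarrow> real) \<Rightarrow> ('b \<Rightarrow> real) \<Rightarrow> real" where
  "l2_inner M f g = (\<integral>x. f x * g x \<partial>M)"

lemma L2_measurable [measurable_dest]: "f \<in> L2 M \<Longrightarrow> f \<in> borel_measurable M"
  by (simp add: L2_def)

lemma L2_integrable_square: "f \<in> L2 M \<Longrightarrow> integrable M (\<lambda>x. (f x)\<^sup>2)"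
  by (simp add: L2_def)

lemma L2_integrable_mult:
  assumes f: "f \<in> L2 M" and g: "g \<in> L2 M"
  shows "integrable M (\<lambda>x. f x * g x)"
proof (rule Bochner_Integration.integrable_bound)
  show "integrable M (\<lambda>x. (f x)\<^sup>2 + (g x)\<^sup>2)"
    using f g by (intro Bochner_Integration.integrable_add L2_integrable_square)
  show "(\<lambda>x. f x * g x) \<in> borel_measurable M" using f g by (simp add: L2_measurable)
  have "\<bar>a * b\<bar> \<le> a\<^sup>2 + b\<^sup>2" for a b :: real
  proof -
    have "2 * (\<bar>a\<bar> * \<bar>b\<bar>) \<le> a\<^sup>2 + b\<^sup>2" using sum_squares_bound[of "\<bar>a\<bar>" "\<bar>b\<bar>"] by simp
    moreover have "0 \<le> \<bar>a\<bar> * \<bar>b\<bar>" by simp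
    ultimately show ?thesis unfolding abs_mult by linarith
  qed
  then show "AE x in M. norm (f x * g x) \<le> norm ((f x)\<^sup>2 + (g x)\<^sup>2)" by simp
qed

lemma L2_iff_nn_integral:
  "f \<in> L2 M \<longleftrightarrow> f \<in> borel_measurable M \<and> (\<integral>\<^sup>+x. ennreal ((f x)\<^sup>2) \<partial>M) < \<infinity>"
  by (auto simp: L2_def integrable_iff_bounded)

lemma nn_integral_L2:
  "f \<in> L2 M \<Longrightarrow> (\<integral>\<^sup>+x. ennreal ((f x)\<^sup>2) \<partial>M) = ennreal ((snorm (l2_inner M) f)\<^sup>2)"
  by (subst nn_integral_eq_integral[OF L2_integrable_square])
     (simp_all add: snorm_def l2_inner_def power2_eq_square)

lemma indicator_in_L2: "A \<in> sets M \<Longrightarrow> emeasure M A < \<infinity> \<Longrightarrow> indicat_real A \<in> L2 M"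
  by (auto simp: L2_def power2_eq_square simp flip: indicator_inter_arith)

lemma L2_subspace: "subspace (L2 M)"
proof (rule subspaceI)
  show "0 \<in> L2 M" by (simp add: L2_def zero_fun_def)
next
  fix f g assume f: "f \<in> L2 M" and g: "g \<in> L2 M"
  have "integrable M (\<lambda>x. (f x)\<^sup>2 + 2 * (f x * g x) + (g x)\<^sup>2)"
    using f g by (intro Bochner_Integration.integrable_add integrable_mult_right L2_integrable_mult L2_integrable_square)
  then have "integrable M (\<lambda>x. (f x + g x)\<^sup>2)"
    by (simp add: power2_sum algebra_simps)
  then show "f + g \<in> L2 M" using f g by (auto simp: L2_def plus_fun_def intro: borel_measurable_add)
next
  fix c f assume "f \<in> L2 M"
  then show "c *\<^sub>R f \<in> L2 M" by (auto simp: L2_def scaleR_fun_def power_mult_distrib)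
qed

lemma L2_semi_inner: "semi_inner (L2 M) (l2_inner M)"
proof
  show "l2_inner M (x + y) z = l2_inner M x z + l2_inner M y z" if "x \<in> L2 M" "y \<in> L2 M" "z \<in> L2 M" for x y z
    using that by (simp add: l2_inner_def distrib_right L2_integrable_mult)
  show "l2_inner M (c *\<^sub>R x) z = c * l2_inner M x z" for c x z
    by (simp add: l2_inner_def mult.assoc)
qed (simp_all add: L2_subspace l2_inner_def mult.commute)

text \<open>Riesz--Fischer: a subsequence with increments below 2^-k in norm converges almost
  everywhere, and Fatou's lemma along that subsequence turns the Cauchy condition into convergence
  of the whole sequence to the pointwise limit.\<close>

lemma L2_complete:
  assumes X: "\<And>k. X k \<in> L2 M"
    and C: "\<forall>e>0. \<exists>K. \<forall>i\<ge>K. \<forall>j\<ge>K. snorm (l2_inner M) (X i - X j) < e"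
  shows "\<exists>f\<in>L2 M. (\<lambda>k::nat. snorm (l2_inner M) (X k - f)) \<longlonglongrightarrow> 0"
proof -
  interpret semi_inner "L2 M" "l2_inner M" by (rule L2_semi_inner)
  note [measurable] = L2_measurable[OF X]
  have "\<forall>k. \<exists>K. \<forall>i\<ge>K. \<forall>j\<ge>K. nrm (X i - X j) < (1/2) ^ k"
    using C by simp
  then obtain R where R: "\<And>k i j. i \<ge> R k \<Longrightarrow> j \<ge> R k \<Longrightarrow> nrm (X i - X j) < (1/2) ^ k" by metis
  \<comment> \<open>The partial sums of \<open>R\<close> make \<open>r\<close> monotone and at least
    \<open>R\<close>; the summand \<open>k\<close> makes it tend to infinity.\<close>
  define r where "r k = k + (\<Sum>i\<le>k. R i)" for k
  have rR: "r k \<ge> R k" "r (Suc k) \<ge> r k" "r k \<ge> k" for k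
    using member_le_sum[of k "{..k}" R] by (auto simp: r_def)
  define D where "D k x = (X (r (Suc k)) x - X (r k) x)\<^sup>2" for k x
  have [measurable]: "D k \<in> borel_measurable M" for k unfolding D_def by measurable
  have D: "(\<integral>\<^sup>+x. ennreal (D k x) \<partial>M) \<le> ennreal ((1/4) ^ k)" for k
  proof -
    have "r (Suc k) \<ge> R k" using rR[of k] by linarith
    then have n: "nrm (X (r (Suc k)) - X (r k)) < (1/2) ^ k" using rR by (intro R) auto
    have "(\<integral>\<^sup>+x. ennreal (D k x) \<partial>M) = ennreal ((nrm (X (r (Suc k)) - X (r k)))\<^sup>2)"
      unfolding D_def using nn_integral_L2[of "X (r (Suc k)) - X (r k)" M] X by simp
    also have "\<dots> \<le> ennreal (((1/2) ^ k)\<^sup>2)"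
      using n X by (intro ennreal_leI power_mono) (auto simp: nrm_nonneg)
    also have "((1/2::real) ^ k)\<^sup>2 = (1/4) ^ k"
      by (simp add: power2_eq_square flip: power_mult_distrib)
    finally show ?thesis .
  qed
  \<comment> \<open>The integrals of the squared increments are at most 4^-k, so the weights 2^k
    keep the series summable; conversely a finite weighted sum S bounds the k-th increment by sqrt S
    times (sqrt (1/2))^k, which is summable.\<close>
  have "(\<integral>\<^sup>+x. (\<Sum>k. ennreal (2 ^ k * D k x)) \<partial>M) = (\<Sum>k. \<integral>\<^sup>+x. ennreal (2 ^ k * D k x) \<partial>M)"
    by (rule nn_integral_suminf) simp
  also have "\<dots> \<le> (\<Sum>k. ennreal ((1/2) ^ k))"
  proof (rule suminf_le)
    fix k
    have "(\<integral>\<^sup>+x. ennreal (2 ^ k * D k x) \<partial>M) = ennreal (2 ^ k) * (\<integral>\<^sup>+x. ennreal (D k x) \<partial>M)"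
      by (subst nn_integral_cmult[symmetric]) (auto simp: ennreal_mult D_def)
    also have "\<dots> \<le> ennreal (2 ^ k) * ennreal ((1/4) ^ k)" by (intro mult_left_mono D) simp
    also have "\<dots> = ennreal ((1/2) ^ k)" by (simp add: ennreal_mult[symmetric] power_mult_distrib[symmetric])
    finally show "(\<integral>\<^sup>+x. ennreal (2 ^ k * D k x) \<partial>M) \<le> ennreal ((1/2) ^ k)" .
  qed auto
  also have "\<dots> = ennreal (\<Sum>k. (1/2) ^ k)" by (rule suminf_ennreal2) simp_all
  also have "\<dots> < \<infinity>" by simp
  finally have "(\<integral>\<^sup>+x. (\<Sum>k. ennreal (2 ^ k * D k x)) \<partial>M) \<noteq> \<infinity>" by simp
  then have "AE x in M. (\<Sum>k. ennreal (2 ^ k * D k x)) \<noteq> \<infinity>"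
    by (intro nn_integral_PInf_AE) simp_all
  then have conv: "AE x in M. convergent (\<lambda>k. X (r k) x)"
  proof (eventually_elim)
    case (elim x)
    define S where "S = enn2real (\<Sum>k. ennreal (2 ^ k * D k x))"
    have S: "(\<Sum>k. ennreal (2 ^ k * D k x)) = ennreal S" "S \<ge> 0" using elim by (auto simp: S_def less_top)
    have bd: "\<bar>X (r (Suc k)) x - X (r k) x\<bar> \<le> sqrt S * (sqrt (1/2)) ^ k" for k
    proof -
      have "ennreal (2 ^ k * D k x) \<le> (\<Sum>k. ennreal (2 ^ k * D k x))"
        using sum_le_suminf[of "\<lambda>k. ennreal (2 ^ k * D k x)" "{k}"] by simp
      then have "2 ^ k * D k x \<le> S" using S by simp
      then have "D k x \<le> S * (1/2) ^ k" by (simp add: field_simps power_one_over)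
      then have "sqrt (D k x) \<le> sqrt (S * (1/2) ^ k)" by (rule real_sqrt_le_mono)
      also have "sqrt (S * (1/2) ^ k) = sqrt S * (sqrt (1/2)) ^ k"
        by (simp only: real_sqrt_mult real_sqrt_power)
      finally show ?thesis by (simp add: D_def)
    qed
    have "summable (\<lambda>k. sqrt S * (sqrt (1/2)) ^ k)"
      by (intro summable_mult summable_geometric) (simp add: real_sqrt_divide)
    then have "summable (\<lambda>k. X (r (Suc k)) x - X (r k) x)"
      by (rule summable_comparison_test'[where N=0]) (simp add: bd)
    then have "convergent (\<lambda>n. \<Sum>k<n. X (r (Suc k)) x - X (r k) x)" by (simp add: summable_iff_convergent)
    then have "convergent (\<lambda>n. X (r n) x - X (r 0) x)"
      using sum_lessThan_telescope[of "\<lambda>k. X (r k) x"] by simp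
    then have "convergent (\<lambda>n. (X (r n) x - X (r 0) x) + X (r 0) x)" by (intro convergent_add convergent_const)
    then show ?case by simp
  qed
  define f where "f x = lim (\<lambda>k. X (r k) x)" for x
  have [measurable]: "f \<in> borel_measurable M" unfolding f_def by measurable
  have lim: "AE x in M. (\<lambda>k. X (r k) x) \<longlonglongrightarrow> f x"
    using conv by eventually_elim (simp add: f_def convergent_LIMSEQ_iff)
  have est: "(\<integral>\<^sup>+x. ennreal ((X i x - f x)\<^sup>2) \<partial>M) \<le> ennreal (e\<^sup>2)"
    if i: "i \<ge> K" and K: "\<forall>i\<ge>K. \<forall>j\<ge>K. nrm (X i - X j) < e" and e: "e > 0" for i K e
  proof -
    have "(\<integral>\<^sup>+x. ennreal ((X i x - f x)\<^sup>2) \<partial>M) = (\<integral>\<^sup>+x. liminf (\<lambda>k. ennreal ((X i x - X (r k) x)\<^sup>2)) \<partial>M)"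
    proof (rule nn_integral_cong_AE)
      show "AE x in M. ennreal ((X i x - f x)\<^sup>2) = liminf (\<lambda>k. ennreal ((X i x - X (r k) x)\<^sup>2))"
        using lim
      proof eventually_elim
        case (elim x)
        then have "(\<lambda>k. ennreal ((X i x - X (r k) x)\<^sup>2)) \<longlonglongrightarrow> ennreal ((X i x - f x)\<^sup>2)"
          by (intro tendsto_intros tendsto_ennrealI)
        then show ?case using lim_imp_Liminf[OF sequentially_bot] by metis
      qed
    qed
    also have "\<dots> \<le> liminf (\<lambda>k. \<integral>\<^sup>+x. ennreal ((X i x - X (r k) x)\<^sup>2) \<partial>M)"
      by (rule nn_integral_liminf) simp
    also have "\<dots> = liminf (\<lambda>k. ennreal ((nrm (X i - X (r k)))\<^sup>2))"
      using nn_integral_L2[of "X i - X (r k)" M for k] X by simp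
    also have "\<dots> \<le> ennreal (e\<^sup>2)"
    proof (rule Liminf_le)
      show "\<forall>\<^sub>F k in sequentially. ennreal ((nrm (X i - X (r k)))\<^sup>2) \<le> ennreal (e\<^sup>2)"
      proof (rule eventually_sequentiallyI[of K])
        fix k assume "k \<ge> K"
        then have "r k \<ge> K" using rR(3)[of k] by linarith
        then have "nrm (X i - X (r k)) < e" using K i by blast
        then show "ennreal ((nrm (X i - X (r k)))\<^sup>2) \<le> ennreal (e\<^sup>2)"
          using X by (intro ennreal_leI power_mono) (auto simp: nrm_nonneg)
      qed
    qed simp
    finally show ?thesis .
  qed
  have Xf: "X i - f \<in> L2 M \<and> nrm (X i - f) \<le> e"
    if i: "i \<ge> K" and K: "\<forall>i\<ge>K. \<forall>j\<ge>K. nrm (X i - X j) < e" and e: "e > 0" for i K e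
  proof
    have "(\<integral>\<^sup>+x. ennreal ((X i x - f x)\<^sup>2) \<partial>M) < \<infinity>" using est[OF that] by (simp add: le_less_trans)
    then show L: "X i - f \<in> L2 M" by (simp add: L2_iff_nn_integral fun_diff_def)
    have "ennreal ((nrm (X i - f))\<^sup>2) \<le> ennreal (e\<^sup>2)" using est[OF that] nn_integral_L2[OF L] by simp
    then have "(nrm (X i - f))\<^sup>2 \<le> e\<^sup>2" using e by simp
    then show "nrm (X i - f) \<le> e" by (rule power2_le_imp_le) (use e in simp)
  qed
  obtain K where "\<forall>i\<ge>K. \<forall>j\<ge>K. nrm (X i - X j) < 1" using C zero_less_one by blast
  then have "X K - f \<in> L2 M" using Xf[of K K 1] by simp
  then have "X K - (X K - f) \<in> L2 M" using X by blast
  then have f: "f \<in> L2 M" by simp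
  moreover have "(\<lambda>k. nrm (X k - f)) \<longlonglongrightarrow> 0"
  proof (rule LIMSEQ_I)
    fix e :: real assume e: "e > 0"
    then obtain K where "\<forall>i\<ge>K. \<forall>j\<ge>K. nrm (X i - X j) < e / 2" using C by (meson half_gt_zero)
    then have "nrm (X i - f) \<le> e / 2" if "i \<ge> K" for i using Xf[of K i "e/2"] e that by auto
    then have "norm (nrm (X i - f) - 0) < e" if "i \<ge> K" for i
      using that e X f nrm_nonneg[of "X i - f"] by force
    then show "\<exists>K. \<forall>i\<ge>K. norm (nrm (X i - f) - 0) < e" by blast
  qed
  ultimately show ?thesis by blast
qed

lemma L2_semi_hilbert: "semi_hilbert (L2 M) (l2_inner M)"
  using L2_semi_inner L2_complete by (auto simp: semi_hilbert_def semi_hilbert_axioms_def)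

section \<open>Hilbert sums of L^2 spaces, of which the Fock space is an instance\<close>

definition l2_sum :: "(nat \<Rightarrow> 'b measure) \<Rightarrow> (nat \<Rightarrow> 'b \<Rightarrow> real) set" where
  "l2_sum M = {F. (\<forall>n. F n \<in> L2 (M n)) \<and> summable (\<lambda>n. l2_inner (M n) (F n) (F n))}"

definition l2_sum_inner :: "(nat \<Rightarrow> 'b measure) \<Rightarrow> (nat \<Rightarrow> 'b \<Rightarrow> real) \<Rightarrow> (nat \<Rightarrow> 'b \<Rightarrow> real) \<Rightarrow> real" where
  "l2_sum_inner M F G = (\<Sum>n. l2_inner (M n) (F n) (G n))"

lemma l2_sum_summable:
  assumes F: "F \<in> l2_sum M" and G: "G \<in> l2_sum M"
  shows "summable (\<lambda>n. l2_inner (M n) (F n) (G n))"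
proof (rule summable_comparison_test')
  show "summable (\<lambda>n. l2_inner (M n) (F n) (F n) + l2_inner (M n) (G n) (G n))"
    using F G by (intro summable_add) (auto simp: l2_sum_def)
  fix n
  interpret semi_inner "L2 (M n)" "l2_inner (M n)" by (rule L2_semi_inner)
  have FG: "F n \<in> L2 (M n)" "G n \<in> L2 (M n)" using F G by (auto simp: l2_sum_def)
  have "2 * (nrm (F n) * nrm (G n)) \<le> (nrm (F n))\<^sup>2 + (nrm (G n))\<^sup>2"
    using sum_squares_bound[of "nrm (F n)" "nrm (G n)"] by simp
  moreover have "0 \<le> nrm (F n) * nrm (G n)" using FG by (simp add: nrm_nonneg)
  ultimately show "norm (l2_inner (M n) (F n) (G n)) \<le> l2_inner (M n) (F n) (F n) + l2_inner (M n) (G n) (G n)"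
    using Cauchy_Schwarz[OF FG] FG by (simp add: nrm_square)
qed

lemma l2_sum_semi_inner: "semi_inner (l2_sum M) (l2_sum_inner M)"
proof
  have c: "semi_inner (L2 (M n)) (l2_inner (M n))" for n by (rule L2_semi_inner)
  note add = semi_inner.ip_add_left[OF c] and add' = semi_inner.ip_add_right[OF c]
    and sc = semi_inner.ip_scale_left[OF c] and sc' = semi_inner.ip_scale_right[OF c]
    and Hc = semi_inner.H_closed[OF c]
  show "subspace (l2_sum M)"
  proof (rule subspaceI)
    show "0 \<in> l2_sum M" using Hc by (simp add: l2_sum_def l2_inner_def)
  next
    fix F G assume FG: "F \<in> l2_sum M" "G \<in> l2_sum M"
    then have FG': "F n \<in> L2 (M n)" "G n \<in> L2 (M n)" for n by (auto simp: l2_sum_def)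
    have "summable (\<lambda>n. l2_inner (M n) (F n) (F n) + l2_inner (M n) (F n) (G n) +
       (l2_inner (M n) (G n) (F n) + l2_inner (M n) (G n) (G n)))"
      using FG by (intro summable_add l2_sum_summable)
    then show "F + G \<in> l2_sum M" using FG' Hc by (simp add: l2_sum_def add add' algebra_simps)
  next
    fix c F assume F: "F \<in> l2_sum M"
    then have F': "F n \<in> L2 (M n)" for n by (auto simp: l2_sum_def)
    have "summable (\<lambda>n. c * (c * l2_inner (M n) (F n) (F n)))"
      using F by (intro summable_mult l2_sum_summable)
    then show "c *\<^sub>R F \<in> l2_sum M" using F' Hc by (simp add: l2_sum_def sc sc')
  qed
  fix x y z :: "nat \<Rightarrow> 'a \<Rightarrow> real" and c :: real
  assume x: "x \<in> l2_sum M"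
  then have x': "x n \<in> L2 (M n)" for n by (auto simp: l2_sum_def)
  show "0 \<le> l2_sum_inner M x x" unfolding l2_sum_inner_def
    using x by (intro suminf_nonneg l2_sum_summable) (auto simp: l2_inner_def)
  show "l2_sum_inner M x y = l2_sum_inner M y x" by (simp add: l2_sum_inner_def l2_inner_def mult.commute)
  assume z: "z \<in> l2_sum M"
  then have z': "z n \<in> L2 (M n)" for n by (auto simp: l2_sum_def)
  show "l2_sum_inner M (c *\<^sub>R x) z = c * l2_sum_inner M x z"
    using x z x' z' by (simp add: l2_sum_inner_def sc suminf_mult l2_sum_summable)
next
  have c: "semi_inner (L2 (M n)) (l2_inner (M n))" for n by (rule L2_semi_inner)
  note add = semi_inner.ip_add_left[OF c]
  fix x y z assume x: "x \<in> l2_sum M" and y: "y \<in> l2_sum M" and z: "z \<in> l2_sum M"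
  then have x': "x n \<in> L2 (M n)" "y n \<in> L2 (M n)" "z n \<in> L2 (M n)" for n by (auto simp: l2_sum_def)
  show "l2_sum_inner M (x + y) z = l2_sum_inner M x z + l2_sum_inner M y z"
    using x y z x' by (simp add: l2_sum_inner_def add suminf_add l2_sum_summable)
qed

lemma l2_sum_nrm:
  assumes "F \<in> l2_sum M"
  shows "(\<lambda>n. (snorm (l2_inner (M n)) (F n))\<^sup>2) sums (snorm (l2_sum_inner M) F)\<^sup>2"
proof -
  have c: "semi_inner (L2 (M n)) (l2_inner (M n))" for n by (rule L2_semi_inner)
  have F': "F n \<in> L2 (M n)" for n using assms by (auto simp: l2_sum_def)
  have "(snorm (l2_inner (M n)) (F n))\<^sup>2 = l2_inner (M n) (F n) (F n)" for n
    by (rule semi_inner.nrm_square[OF c F'])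
  moreover have "(snorm (l2_sum_inner M) F)\<^sup>2 = l2_sum_inner M F F"
    by (rule semi_inner.nrm_square[OF l2_sum_semi_inner assms])
  ultimately show ?thesis
    using assms by (simp add: l2_sum_inner_def l2_sum_summable summable_sums)
qed

lemma l2_sum_nrm_component:
  assumes "F \<in> l2_sum M"
  shows "snorm (l2_inner (M n)) (F n) \<le> snorm (l2_sum_inner M) F"
proof (rule power2_le_imp_le)
  show "0 \<le> snorm (l2_sum_inner M) F" by (rule semi_inner.nrm_nonneg[OF l2_sum_semi_inner assms])
  have "(\<Sum>i\<in>{n}. (snorm (l2_inner (M i)) (F i))\<^sup>2) \<le> (\<Sum>i. (snorm (l2_inner (M i)) (F i))\<^sup>2)"
    using l2_sum_nrm[OF assms] by (intro sum_le_suminf) (auto simp: sums_iff)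
  then show "(snorm (l2_inner (M n)) (F n))\<^sup>2 \<le> (snorm (l2_sum_inner M) F)\<^sup>2"
    using l2_sum_nrm[OF assms] by (simp add: sums_iff)
qed

text \<open>Estimates on finitely many components yield both membership in the Hilbert sum and the
  bound on the norm; this is how limits and operators are controlled below.\<close>

lemma l2_sum_bounded:
  assumes F: "\<And>n. F n \<in> L2 (M n)" and B: "\<And>m. (\<Sum>n<m. (snorm (l2_inner (M n)) (F n))\<^sup>2) \<le> B\<^sup>2" "0 \<le> B"
  shows "F \<in> l2_sum M \<and> snorm (l2_sum_inner M) F \<le> B"
proof
  have c: "semi_inner (L2 (M n)) (l2_inner (M n))" for n by (rule L2_semi_inner)
  have e: "(snorm (l2_inner (M n)) (F n))\<^sup>2 = l2_inner (M n) (F n) (F n)" for n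
    by (rule semi_inner.nrm_square[OF c F])
  have s: "summable (\<lambda>n. (snorm (l2_inner (M n)) (F n))\<^sup>2)"
    using B by (intro summableI_nonneg_bounded) auto
  then show FM: "F \<in> l2_sum M" using F by (simp add: l2_sum_def e)
  have "(\<Sum>n. (snorm (l2_inner (M n)) (F n))\<^sup>2) \<le> B\<^sup>2"
    using s B by (intro suminf_le_const) auto
  then have "(snorm (l2_sum_inner M) F)\<^sup>2 \<le> B\<^sup>2" using l2_sum_nrm[OF FM] by (simp add: sums_iff)
  then show "snorm (l2_sum_inner M) F \<le> B" by (rule power2_le_imp_le) (rule B)
qed

text \<open>Every component converges because its norm is dominated by the total norm. The Cauchy
  estimate survives the limit since it is tested on finitely many components at a time.\<close>

lemma l2_sum_complete:
  assumes X: "\<And>k. X k \<in> l2_sum M"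
    and C: "\<forall>e>0. \<exists>K. \<forall>i\<ge>K. \<forall>j\<ge>K. snorm (l2_sum_inner M) (X i - X j) < e"
  shows "\<exists>F\<in>l2_sum M. (\<lambda>k::nat. snorm (l2_sum_inner M) (X k - F)) \<longlonglongrightarrow> 0"
proof -
  interpret semi_inner "l2_sum M" "l2_sum_inner M" by (rule l2_sum_semi_inner)
  have c: "semi_inner (L2 (M n)) (l2_inner (M n))" for n by (rule L2_semi_inner)
  note Hc = semi_inner.H_closed[OF c]
  have Xn: "X k n \<in> L2 (M n)" for k n using X by (auto simp: l2_sum_def)
  have comp: "snorm (l2_inner (M n)) (X i n - X j n) \<le> nrm (X i - X j)" for i j n
    using l2_sum_nrm_component[of "X i - X j" M n] X by simp
  have "\<exists>f\<in>L2 (M n). (\<lambda>k. snorm (l2_inner (M n)) (X k n - f)) \<longlonglongrightarrow> 0" for n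
    using Xn C comp by (intro L2_complete) (auto, meson le_less_trans)
  then obtain F where F: "\<And>n. F n \<in> L2 (M n)" "\<And>n. (\<lambda>k. snorm (l2_inner (M n)) (X k n - F n)) \<longlonglongrightarrow> 0"
    by metis
  have XF: "X i - F \<in> l2_sum M \<and> nrm (X i - F) \<le> e"
    if i: "i \<ge> K" and K: "\<forall>i\<ge>K. \<forall>j\<ge>K. nrm (X i - X j) < e" and e: "e > 0" for i K e
  proof (rule l2_sum_bounded)
    show "(X i - F) n \<in> L2 (M n)" for n using Xn F Hc by simp
    fix m
    have l: "(\<lambda>j. snorm (l2_inner (M n)) (X i n - X j n)) \<longlonglongrightarrow> snorm (l2_inner (M n)) (X i n - F n)" for n
    proof (rule semi_inner.nrm_tendsto[OF c])
      have "(X i n - X j n) - (X i n - F n) = - (X j n - F n)" for j by simp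
      then have "snorm (l2_inner (M n)) ((X i n - X j n) - (X i n - F n)) = snorm (l2_inner (M n)) (X j n - F n)" for j
        using semi_inner.nrm_minus[OF c, of "X j n - F n"] Xn F Hc by metis
      then show "(\<lambda>j. snorm (l2_inner (M n)) ((X i n - X j n) - (X i n - F n))) \<longlonglongrightarrow> 0" using F by simp
    qed (use Xn F Hc in auto)
    have "(\<Sum>n<m. (snorm (l2_inner (M n)) (X i n - F n))\<^sup>2) \<le> e\<^sup>2"
    proof (rule LIMSEQ_le_const2)
      show "(\<lambda>j. \<Sum>n<m. (snorm (l2_inner (M n)) (X i n - X j n))\<^sup>2) \<longlonglongrightarrow> (\<Sum>n<m. (snorm (l2_inner (M n)) (X i n - F n))\<^sup>2)"
        by (intro tendsto_intros l)
      have "(\<Sum>n<m. (snorm (l2_inner (M n)) (X i n - X j n))\<^sup>2) \<le> e\<^sup>2" if j: "j \<ge> K" for j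
      proof -
        have "(\<lambda>n. (snorm (l2_inner (M n)) (X i n - X j n))\<^sup>2) sums (nrm (X i - X j))\<^sup>2"
          using l2_sum_nrm[of "X i - X j" M] H_closed(3)[OF X X] by simp
        then have "(\<Sum>n<m. (snorm (l2_inner (M n)) (X i n - X j n))\<^sup>2) \<le> (nrm (X i - X j))\<^sup>2"
          using sum_le_suminf[of "\<lambda>n. (snorm (l2_inner (M n)) (X i n - X j n))\<^sup>2" "{..<m}"] by (auto simp: sums_iff)
        also have "\<dots> \<le> e\<^sup>2" using K i j X by (intro power_mono) (auto simp: less_imp_le nrm_nonneg)
        finally show ?thesis .
      qed
      then show "\<exists>N. \<forall>j\<ge>N. (\<Sum>n<m. (snorm (l2_inner (M n)) (X i n - X j n))\<^sup>2) \<le> e\<^sup>2" by blast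
    qed
    then show "(\<Sum>n<m. (snorm (l2_inner (M n)) ((X i - F) n))\<^sup>2) \<le> e\<^sup>2" by simp
  qed (use e in simp)
  obtain K where "\<forall>i\<ge>K. \<forall>j\<ge>K. nrm (X i - X j) < 1" using C zero_less_one by blast
  then have "X K - F \<in> l2_sum M" using XF[of K K 1] by simp
  then have "X K - (X K - F) \<in> l2_sum M" using X by blast
  then have Fs: "F \<in> l2_sum M" by simp
  moreover have "(\<lambda>k. nrm (X k - F)) \<longlonglongrightarrow> 0"
  proof (rule LIMSEQ_I)
    fix e :: real assume e: "e > 0"
    then obtain K where "\<forall>i\<ge>K. \<forall>j\<ge>K. nrm (X i - X j) < e / 2" using C by (meson half_gt_zero)
    then have "nrm (X i - F) \<le> e / 2" if "i \<ge> K" for i using XF[of K i "e/2"] e that by auto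
    then have "norm (nrm (X i - F) - 0) < e" if "i \<ge> K" for i
      using that e X Fs nrm_nonneg[of "X i - F"] by force
    then show "\<exists>K. \<forall>i\<ge>K. norm (nrm (X i - F) - 0) < e" by blast
  qed
  ultimately show ?thesis by blast
qed

lemma l2_sum_semi_hilbert: "semi_hilbert (l2_sum M) (l2_sum_inner M)"
  using l2_sum_semi_inner l2_sum_complete by (auto simp: semi_hilbert_def semi_hilbert_axioms_def)

lemma l2_nrm_0_iff:
  assumes "f \<in> L2 M"
  shows "snorm (l2_inner M) f = 0 \<longleftrightarrow> (AE x in M. f x = 0)"
proof -
  have "snorm (l2_inner M) f = 0 \<longleftrightarrow> (\<integral>x. (f x)\<^sup>2 \<partial>M) = 0"
    by (simp add: snorm_def l2_inner_def power2_eq_square)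
  also have "\<dots> \<longleftrightarrow> (AE x in M. (f x)\<^sup>2 = 0)"
    by (rule integral_nonneg_eq_0_iff_AE[OF L2_integrable_square[OF assms]]) simp
  finally show ?thesis by simp
qed

lemma l2_sum_nrm_0_iff:
  assumes "F \<in> l2_sum M"
  shows "snorm (l2_sum_inner M) F = 0 \<longleftrightarrow> (\<forall>n. AE x in M n. F n x = 0)"
proof -
  have F: "F n \<in> L2 (M n)" for n using assms by (auto simp: l2_sum_def)
  have "snorm (l2_sum_inner M) F = 0 \<longleftrightarrow> (\<forall>n. (snorm (l2_inner (M n)) (F n))\<^sup>2 = 0)"
    using l2_sum_nrm[OF assms] suminf_eq_zero_iff[of "\<lambda>n. (snorm (l2_inner (M n)) (F n))\<^sup>2"]
    by (auto simp: sums_iff)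
  then show ?thesis using l2_nrm_0_iff[OF F] by simp
qed

definition l2_embed :: "nat \<Rightarrow> ('b \<Rightarrow> real) \<Rightarrow> nat \<Rightarrow> 'b \<Rightarrow> real" where
  "l2_embed m f = (\<lambda>n. if n = m then f else 0)"

lemma l2_embed_inner: "l2_sum_inner M (l2_embed m f) G = l2_inner (M m) f (G m)"
proof -
  have "(\<lambda>n. l2_inner (M n) (l2_embed m f n) (G n)) = (\<lambda>n. if n = m then l2_inner (M m) f (G m) else 0)"
    by (auto simp: l2_embed_def l2_inner_def)
  then show ?thesis
    using sums_unique[OF sums_single[of m "\<lambda>_. l2_inner (M m) f (G m)"]] by (simp add: l2_sum_inner_def)
qed

lemma l2_embed_in: "f \<in> L2 (M m) \<Longrightarrow> l2_embed m f \<in> l2_sum M"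
proof -
  assume f: "f \<in> L2 (M m)"
  have "(\<lambda>n. l2_inner (M n) (l2_embed m f n) (l2_embed m f n)) = (\<lambda>n. if n = m then l2_inner (M m) f f else 0)"
    by (auto simp: l2_embed_def l2_inner_def)
  then show ?thesis using f subspace_0[OF L2_subspace] by (auto simp: l2_sum_def l2_embed_def)
qed

lemma l2_embed_nrm: "snorm (l2_sum_inner M) (l2_embed m f) = snorm (l2_inner (M m)) f"
  by (simp add: snorm_def l2_embed_inner) (simp add: l2_embed_def)

text \<open>Translates distance 0 into the almost-everywhere conditions in terms of which
  \<open>H_fock\<close> is defined.\<close>

lemma l2_sum_eq_embed:
  assumes F: "F \<in> l2_sum M" and f: "f \<in> L2 (M m)"
  shows "snorm (l2_sum_inner M) (F - l2_embed m f) = 0 \<longleftrightarrow>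
    (\<forall>n. n \<noteq> m \<longrightarrow> (AE x in M n. F n x = 0)) \<and> (AE x in M m. F m x = f x)"
proof -
  have "F - l2_embed m f \<in> l2_sum M"
    using F l2_embed_in[where M=M and m=m, OF f] subspace_diff[OF semi_inner.subspace_H[OF l2_sum_semi_inner]] by blast
  then show ?thesis by (subst l2_sum_nrm_0_iff) (auto simp: l2_embed_def)
qed

section \<open>A density criterion\<close>

text \<open>A Dynkin argument carries the indicators from the generator \<open>E\<close> to all
  measurable sets, cut to the finite pieces \<Omega> k; monotone approximation then reaches all
  nonnegative functions, and positive and negative parts the rest. The cutting keeps every
  intermediate function square integrable.\<close>

lemma L2_dense:
  assumes W: "closed_sub (L2 M) (l2_inner M) W"
    and E: "Int_stable E" "E \<subseteq> Pow (space M)" "sets M = sigma_sets (space M) E" "space M \<in> E"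
    and \<Omega>: "\<And>k. \<Omega> k \<in> sets M" "\<And>k. emeasure M (\<Omega> k) < \<infinity>" "incseq \<Omega>" "(\<Union>k::nat. \<Omega> k) = space M"
    and ind: "\<And>A k. A \<in> E \<Longrightarrow> indicat_real (A \<inter> \<Omega> k) \<in> W"
  shows "W = L2 M"
proof -
  interpret semi_hilbert "L2 M" "l2_inner M" by (rule L2_semi_hilbert)
  have sW: "subspace W" "W \<subseteq> L2 M" using W by (auto simp: closed_sub_def)
  have fin: "emeasure M (A \<inter> \<Omega> k) < \<infinity>" if "A \<in> sets M" for A k
    using \<Omega>(1,2)[of k] that by (meson emeasure_mono inf_le2 le_less_trans)
  \<comment> \<open>Dominated convergence is the only way in which closedness of \<open>W\<close> is
    used.\<close>
  have dom: "f \<in> W" if X: "\<And>j. X j \<in> W" and f: "f \<in> L2 M" and g: "g \<in> L2 M"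
    and le: "\<And>j x. x \<in> space M \<Longrightarrow> \<bar>X j x - f x\<bar> \<le> \<bar>g x\<bar>"
    and lim: "\<And>x. x \<in> space M \<Longrightarrow> (\<lambda>j. X j x) \<longlonglongrightarrow> f x" for X :: "nat \<Rightarrow> 'a \<Rightarrow> real" and f g
  proof -
    have XL: "X j \<in> L2 M" for j using X sW by auto
    note [measurable] = L2_measurable[OF XL] L2_measurable[OF f]
    have "(\<lambda>j. \<integral>x. (X j x - f x)\<^sup>2 \<partial>M) \<longlonglongrightarrow> (\<integral>x. 0 \<partial>M)"
    proof (rule integral_dominated_convergence[where w="\<lambda>x. (g x)\<^sup>2"])
      show "AE x in M. (\<lambda>j. (X j x - f x)\<^sup>2) \<longlonglongrightarrow> 0"
      proof (rule AE_I2)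
        fix x assume "x \<in> space M"
        then have "(\<lambda>j. (X j x - f x)\<^sup>2) \<longlonglongrightarrow> (f x - f x)\<^sup>2" by (intro tendsto_intros lim)
        then show "(\<lambda>j. (X j x - f x)\<^sup>2) \<longlonglongrightarrow> 0" by simp
      qed
      show "AE x in M. norm ((X j x - f x)\<^sup>2) \<le> (g x)\<^sup>2" for j
      proof (rule AE_I2)
        fix x assume "x \<in> space M"
        then have "\<bar>X j x - f x\<bar>\<^sup>2 \<le> \<bar>g x\<bar>\<^sup>2" by (intro power_mono le) auto
        then show "norm ((X j x - f x)\<^sup>2) \<le> (g x)\<^sup>2" by simp
      qed
    qed (use g in \<open>auto simp: L2_integrable_square\<close>)
    then have "(\<lambda>j. sqrt (\<integral>x. (X j x - f x)\<^sup>2 \<partial>M)) \<longlonglongrightarrow> sqrt 0" by (intro tendsto_real_sqrt) simp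
    then have l: "(\<lambda>j. nrm (X j - f)) \<longlonglongrightarrow> 0"
      by (simp add: snorm_def l2_inner_def power2_eq_square)
    show ?thesis using W X f l unfolding closed_sub_def by blast
  qed
  have \<Omega>W: "indicat_real (\<Omega> k) \<in> W" for k
    using ind[OF E(4), of k] sets.sets_into_space[OF \<Omega>(1)[of k]] by (simp add: Int_absorb1)
  have sets: "indicat_real (A \<inter> \<Omega> k) \<in> W" if "A \<in> sigma_sets (space M) E" for A k
    using E(1,2) that
  proof (induction rule: sigma_sets_induct_disjoint)
    case (basic A)
    then show ?case by (rule ind)
  next
    case empty
    have "indicat_real ({} \<inter> \<Omega> k) = 0" by auto
    then show ?case using sW subspace_0 by metis
  next
    case (compl A)
    \<comment> \<open>Complements are formed inside \<Omega> k, whose indicator lies in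
      \<open>W\<close> because the whole space belongs to \<open>E\<close>.\<close>
    have "indicat_real ((space M - A) \<inter> \<Omega> k) = indicat_real (\<Omega> k) - indicat_real (A \<inter> \<Omega> k)"
      using sets.sets_into_space[OF \<Omega>(1)[of k]] by (auto simp: fun_eq_iff indicator_def)
    then show ?case using subspace_diff[OF sW(1) \<Omega>W compl.IH] by (simp only:)
  next
    case (union A)
    have Am: "A i \<in> sets M" for i using union E(3) by blast
    have dj: "disjoint_family (\<lambda>i. A i \<inter> \<Omega> k)" using union(1) by (auto simp: disjoint_family_on_def)
    show ?case
    proof (rule dom)
      show "(\<Sum>i<j. indicat_real (A i \<inter> \<Omega> k)) \<in> W" for j using union sW by (intro subspace_sum) auto
      show "indicat_real ((\<Union>i. A i) \<inter> \<Omega> k) \<in> L2 M" using Am \<Omega> fin by (intro indicator_in_L2 fin) auto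
      show "indicat_real (\<Omega> k) \<in> L2 M" using \<Omega>W sW by auto
      have s: "(\<Sum>i<j. indicat_real (A i \<inter> \<Omega> k)) x = indicat_real (\<Union>i<j. A i \<inter> \<Omega> k) x" for j x
        using dj by (subst indicator_UN_disjoint) (auto simp: sum_fun_apply disjoint_family_on_def)
      show "\<bar>(\<Sum>i<j. indicat_real (A i \<inter> \<Omega> k)) x - indicat_real ((\<Union>i. A i) \<inter> \<Omega> k) x\<bar> \<le> \<bar>indicat_real (\<Omega> k) x\<bar>" for j x
        unfolding s by (auto simp: indicator_def)
      have "(\<lambda>j. indicat_real (\<Union>i<j. A i \<inter> \<Omega> k) x) \<longlonglongrightarrow> indicat_real (\<Union>i. A i \<inter> \<Omega> k) x" for x
        by (rule LIMSEQ_indicator_UN)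
      then show "(\<lambda>j. (\<Sum>i<j. indicat_real (A i \<inter> \<Omega> k)) x) \<longlonglongrightarrow> indicat_real ((\<Union>i. A i) \<inter> \<Omega> k) x" for x
        unfolding s Int_UN_distrib2[symmetric] UN_simps(4)[symmetric] .
    qed
  qed
  \<comment> \<open>Square integrability stays a premise within the induction, because the functions
    from which \<open>f\<close> is built have to inherit it from \<open>f\<close> before the
    induction hypothesis applies to them.\<close>
  have pos: "f \<in> L2 M \<longrightarrow> f \<in> W" if "f \<in> borel_measurable M" "\<And>x. 0 \<le> f x" for f
    using that
  proof (induction rule: borel_measurable_induct_real)
    case (set A)
    show ?case
    proof
      assume A: "indicat_real A \<in> L2 M"
      show "indicat_real A \<in> W"
      proof (rule dom)
        show "indicat_real (A \<inter> \<Omega> k) \<in> W" for k using sets set E by auto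
        show "(\<lambda>k. indicat_real (A \<inter> \<Omega> k) x) \<longlonglongrightarrow> indicat_real A x" if "x \<in> space M" for x
        proof -
          have "x \<in> (\<Union>k. \<Omega> k)" using \<Omega>(4) that by simp
          then obtain k where "x \<in> \<Omega> k" by (rule UN_E)
          then have "indicat_real (A \<inter> \<Omega> j) x = indicat_real A x" if "j \<ge> k" for j
            using \<Omega>(3) that by (auto simp: incseq_def indicator_def)
          then show ?thesis by (intro tendsto_eventually eventually_sequentiallyI)
        qed
      qed (use A in \<open>auto simp: indicator_def\<close>)
    qed
  next
    case (mult u c)
    show ?case
    proof (cases "c = 0")
      case True
      then show ?thesis using subspace_0[OF sW(1)] by (simp add: zero_fun_def)
    next
      case False
      show ?thesis
      proof
        assume "(\<lambda>x. c * u x) \<in> L2 M"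
        then have "(1/c) *\<^sub>R (\<lambda>x. c * u x) \<in> L2 M" by blast
        moreover have "(1/c) *\<^sub>R (\<lambda>x. c * u x) = u" using False by auto
        ultimately have "c *\<^sub>R u \<in> W" using mult.IH sW by (auto intro: subspace_scale)
        then show "(\<lambda>x. c * u x) \<in> W" by (simp add: scaleR_fun_def)
      qed
    qed
  next
    case (add u v)
    show ?case
    proof
      assume uv: "(\<lambda>x. v x + u x) \<in> L2 M"
      have *: "w \<in> L2 M" if "w \<in> borel_measurable M" "\<And>x. 0 \<le> w x" "\<And>x. w x \<le> v x + u x" for w
        unfolding L2_iff_nn_integral
      proof
        have "(\<integral>\<^sup>+x. ennreal ((w x)\<^sup>2) \<partial>M) \<le> (\<integral>\<^sup>+x. ennreal ((v x + u x)\<^sup>2) \<partial>M)"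
          using that by (intro nn_integral_mono ennreal_leI power_mono) auto
        also have "\<dots> < \<infinity>" using uv by (simp add: L2_iff_nn_integral)
        finally show "(\<integral>\<^sup>+x. ennreal ((w x)\<^sup>2) \<partial>M) < \<infinity>" .
      qed fact
      have "u \<in> W" "v \<in> W" using *[of u] *[of v] add by (auto simp: add_increasing add_increasing2)
      then have "v + u \<in> W" using sW by (blast intro: subspace_add)
      then show "(\<lambda>x. v x + u x) \<in> W" by (simp add: plus_fun_def)
    qed
  next
    case (seq U)
    show ?case
    proof
      assume f: "f \<in> L2 M"
      have le: "U i x \<le> f x" if "x \<in> space M" for i x
        using seq.hyps(3,4) that by (intro incseq_le[of "\<lambda>i. U i x"]) (auto simp: incseq_def le_fun_def)
      have UL: "U i \<in> L2 M" for i unfolding L2_iff_nn_integral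
      proof
        have "(\<integral>\<^sup>+x. ennreal ((U i x)\<^sup>2) \<partial>M) \<le> (\<integral>\<^sup>+x. ennreal ((f x)\<^sup>2) \<partial>M)"
          using le seq.hyps(2) by (intro nn_integral_mono ennreal_leI power_mono) auto
        also have "\<dots> < \<infinity>" using f by (simp add: L2_iff_nn_integral)
        finally show "(\<integral>\<^sup>+x. ennreal ((U i x)\<^sup>2) \<partial>M) < \<infinity>" .
      qed (use seq in auto)
      show "f \<in> W"
      proof (rule dom[of U f f])
        show "\<bar>U j x - f x\<bar> \<le> \<bar>f x\<bar>" if "x \<in> space M" for j x using le[OF that, of j] seq.hyps(2)[of j x] by auto
      qed (use seq UL f in auto)
    qed
  qed
  show ?thesis
  proof
    show "L2 M \<subseteq> W"
    proof
      fix f assume f: "f \<in> L2 M"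
      note [measurable] = L2_measurable[OF f]
      have *: "w \<in> L2 M" if "w \<in> borel_measurable M" "\<And>x. \<bar>w x\<bar> \<le> \<bar>f x\<bar>" for w
        unfolding L2_iff_nn_integral
      proof
        have "(w x)\<^sup>2 \<le> (f x)\<^sup>2" for x using that(2)[of x] by (simp add: abs_le_square_iff)
        then have "(\<integral>\<^sup>+x. ennreal ((w x)\<^sup>2) \<partial>M) \<le> (\<integral>\<^sup>+x. ennreal ((f x)\<^sup>2) \<partial>M)"
          by (intro nn_integral_mono ennreal_leI)
        also have "\<dots> < \<infinity>" using f by (simp add: L2_iff_nn_integral)
        finally show "(\<integral>\<^sup>+x. ennreal ((w x)\<^sup>2) \<partial>M) < \<infinity>" .
      qed fact
      have "(\<lambda>x. max 0 (f x)) \<in> W" "(\<lambda>x. max 0 (- f x)) \<in> W"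
        using pos *[of "\<lambda>x. max 0 (f x)"] *[of "\<lambda>x. max 0 (- f x)"] by auto
      then have "(\<lambda>x. max 0 (f x)) - (\<lambda>x. max 0 (- f x)) \<in> W" using sW by (blast intro: subspace_diff)
      moreover have "(\<lambda>x. max 0 (f x)) - (\<lambda>x. max 0 (- f x)) = f" by (auto simp: fun_eq_iff)
      ultimately show "f \<in> W" by simp
    qed
  qed (rule sW)
qed

section \<open>The measures on \<open>T\<close> and \<open>T \<times> \<real>\<close>\<close>

text \<open>C_0(T) with arguments in T itself rather than in the one-tuples of
  \<open>test_functions 1\<close>.\<close>

definition compactly_supported_continuous :: "('t::topological_space \<Rightarrow> real) set" where
  "compactly_supported_continuous =
    {f. continuous_on UNIV f \<and> (\<exists>K. compact K \<and> (\<forall>x. x \<notin> K \<longrightarrow> f x = 0))}"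

locale jacobi_setting =
  fixes \<sigma> :: "'t::{second_countable_topology,t2_space} measure" and \<mu> :: "'t \<Rightarrow> real measure"
  assumes lc: "locally_compact_space (euclidean :: 't topology)"
    and radon: "radon_measure \<sigma>" and nonatomic: "non_atomic \<sigma>" and kernel: "locally_bounded_kernel \<mu>"
begin

abbreviation lm :: "('t \<times> real) measure" where "lm \<equiv> lift_measure \<sigma> \<mu>"

lemma sets_sigma [simp, measurable_cong]: "sets \<sigma> = sets borel"
  using radon by (simp add: radon_measure_def)

lemma space_sigma [simp]: "space \<sigma> = UNIV"
  using sets_eq_imp_space_eq[OF sets_sigma] by simp

lemma sets_mu [simp, measurable_cong]: "sets (\<mu> t) = sets borel"
  using kernel by (simp add: locally_bounded_kernel_def)

lemma space_mu [simp]: "space (\<mu> t) = UNIV"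
  using sets_eq_imp_space_eq[OF sets_mu] by simp

lemma prob_mu: "prob_space (\<mu> t)"
  using kernel by (simp add: locally_bounded_kernel_def)

lemma mu_measurable: "\<mu> \<in> measurable \<sigma> (subprob_algebra borel)"
  using kernel prob_mu by (intro measurable_subprob_algebra)
    (auto simp: locally_bounded_kernel_def prob_space_imp_subprob_space cong: measurable_cong_sets)

lemma kernel_distr_measurable:
  "(\<lambda>t. distr (\<mu> t) borel (Pair t)) \<in> measurable \<sigma> (subprob_algebra (borel :: ('t \<times> real) measure))"
proof (rule measurable_distr2[OF _ mu_measurable])
  show "(\<lambda>(t, s). (t, s)) \<in> measurable (\<sigma> \<Otimes>\<^sub>M borel) (borel :: ('t \<times> real) measure)"
    by (simp add: borel_prod[symmetric] cong: measurable_cong_sets sets_pair_measure_cong)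
qed

lemma sets_lm [simp, measurable_cong]: "sets lm = sets borel"
  unfolding lift_measure_def by (rule sets_bind[where N=borel]) auto

lemma space_lm [simp]: "space lm = UNIV"
  using sets_eq_imp_space_eq[OF sets_lm] by simp

lemma fst_borel [measurable]: "fst \<in> measurable (borel :: ('t \<times> real) measure) borel"
  and snd_borel [measurable]: "snd \<in> measurable (borel :: ('t \<times> real) measure) borel"
  by (simp_all add: borel_prod[symmetric])

lemma nn_integral_lm:
  assumes [measurable]: "f \<in> borel_measurable (borel :: ('t \<times> real) measure)"
  shows "(\<integral>\<^sup>+z. f z \<partial>lm) = (\<integral>\<^sup>+t. \<integral>\<^sup>+s. f (t, s) \<partial>\<mu> t \<partial>\<sigma>)"
  unfolding lift_measure_def
  by (subst nn_integral_bind[OF assms kernel_distr_measurable]) (simp add: nn_integral_distr)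

lemma borel_measurable_nn_mu [measurable]:
  assumes "f \<in> borel_measurable (borel :: ('t \<times> real) measure)"
  shows "(\<lambda>t. \<integral>\<^sup>+s. f (t, s) \<partial>\<mu> t) \<in> borel_measurable borel"
proof -
  have "(\<lambda>t. integral\<^sup>N (distr (\<mu> t) borel (Pair t)) f) \<in> borel_measurable \<sigma>"
    using measurable_compose[OF kernel_distr_measurable nn_integral_measurable_subprob_algebra[OF assms]] .
  then show ?thesis using assms by (simp add: nn_integral_distr cong: measurable_cong_sets)
qed

lemma borel_measurable_integral_mu [measurable]:
  assumes "f \<in> borel_measurable (borel :: ('t \<times> real) measure)"
  shows "(\<lambda>t. \<integral>s. f (t, s) \<partial>\<mu> t :: real) \<in> borel_measurable borel"
proof -
  have "(\<lambda>t. integral\<^sup>L (distr (\<mu> t) borel (Pair t)) f) \<in> borel_measurable \<sigma>"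
    using measurable_compose[OF kernel_distr_measurable integral_measurable_subprob_algebra[OF assms]] .
  then show ?thesis using assms by (simp add: integral_distr cong: measurable_cong_sets)
qed

lemma AE_lm:
  assumes "Measurable.pred borel P"
  shows "(AE z in lm. P z) \<longleftrightarrow> (AE t in \<sigma>. AE s in \<mu> t. P (t, s))"
  unfolding lift_measure_def
  using assms by (subst AE_bind[OF kernel_distr_measurable]) (simp_all add: AE_distr_iff)

text \<open>Positive and negative part have equal integrals on every fibre, hence over the whole
  space. When \<open>f\<close> is not integrable over \<open>lm\<close>, its integral is 0 by
  convention, so integrability need be known on the fibres only.\<close>

lemma integral_lm_eq_0:
  assumes [measurable]: "f \<in> borel_measurable (borel :: ('t \<times> real) measure)"
    and int: "\<And>t. integrable (\<mu> t) (\<lambda>s. f (t, s))" and 0: "\<And>t. (\<integral>s. f (t, s) \<partial>\<mu> t) = (0::real)"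
  shows "(\<integral>z. f z \<partial>lm) = 0"
proof (cases "integrable lm f")
  case True
  have "(\<integral>\<^sup>+s. ennreal (f (t, s)) \<partial>\<mu> t) = (\<integral>\<^sup>+s. ennreal (- f (t, s)) \<partial>\<mu> t)" for t
  proof -
    have fin: "(\<integral>\<^sup>+s. ennreal (f (t, s)) \<partial>\<mu> t) < \<infinity>" "(\<integral>\<^sup>+s. ennreal (- f (t, s)) \<partial>\<mu> t) < \<infinity>"
      using int[of t] by (auto simp: real_integrable_def less_top)
    have "enn2real (\<integral>\<^sup>+s. ennreal (f (t, s)) \<partial>\<mu> t) = enn2real (\<integral>\<^sup>+s. ennreal (- f (t, s)) \<partial>\<mu> t)"
      using real_lebesgue_integral_def[OF int[of t]] 0[of t] by simp
    then show ?thesis using fin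
      by (metis ennreal_enn2real_if infinity_ennreal_def less_irrefl)
  qed
  then show ?thesis using real_lebesgue_integral_def[OF True] by (simp add: nn_integral_lm)
qed (simp add: not_integrable_integral_eq)

section \<open>Exhaustion, fine partitions and cut-off functions on T\<close>

text \<open>By Lindelof countably many open sets contained in compact sets cover T; their finite
  unions increase to T.\<close>

lemma exhaustion: "\<exists>U::nat \<Rightarrow> 't set. (\<forall>k. open (U k) \<and> compact (closure (U k))) \<and> incseq U \<and> (\<Union>k. U k) = UNIV"
proof -
  have "\<forall>x::'t. \<exists>V K. open V \<and> compact K \<and> x \<in> V \<and> V \<subseteq> K"
    using lc by (simp add: locally_compact_space_def)
  then obtain V K where VK: "\<And>x::'t. open (V x)" "\<And>x. compact (K x)" "\<And>x. x \<in> V x" "\<And>x. V x \<subseteq> K x"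
    by metis
  obtain F where F: "F \<subseteq> range V" "countable F" "\<Union>F = (\<Union>(range V))"
    using Lindelof[of "range V"] VK(1) by blast
  have "F \<noteq> {}" using F(3) VK(3) by auto
  then have FF: "range (from_nat_into F) = F" using F(2) by (rule range_from_nat_into)
  define U where "U k = (\<Union>i\<le>k. from_nat_into F i)" for k
  have "open (U k) \<and> compact (closure (U k))" for k
  proof
    have *: "\<exists>x. from_nat_into F i = V x" for i using FF F(1) by blast
    show "open (U k)" unfolding U_def using * VK(1) by (metis (no_types, lifting) open_UN)
    have "\<exists>K. compact K \<and> from_nat_into F i \<subseteq> K" for i using * VK(2,4) by metis
    then obtain L where L: "\<And>i. compact (L i)" "\<And>i. from_nat_into F i \<subseteq> L i" by metis
    have "compact (\<Union>i\<le>k. L i)" using L by (intro compact_UN) auto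
    moreover have "U k \<subseteq> (\<Union>i\<le>k. L i)" unfolding U_def using L by blast
    ultimately have "closure (U k) = (\<Union>i\<le>k. L i) \<inter> closure (U k)"
      using closure_minimal[of "U k" "\<Union>i\<le>k. L i"] compact_imp_closed by blast
    then show "compact (closure (U k))"
      using \<open>compact (\<Union>i\<le>k. L i)\<close> compact_Int_closed closed_closure by metis
  qed
  moreover have "incseq U" unfolding incseq_def U_def by (intro allI impI UN_mono) auto
  moreover have "(\<Union>k. U k) = UNIV"
  proof -
    have "(\<Union>k. U k) = (\<Union>i. from_nat_into F i)" by (auto simp: U_def)
    also have "\<dots> = \<Union>F" using FF by metis
    also have "\<dots> = UNIV" using F(3) VK(3) by auto
    finally show ?thesis .
  qed
  ultimately show ?thesis by blast
qed

text \<open>One exhaustion is fixed for good, since \<open>coeff_bounded\<close> refers to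
  it.\<close>

definition exh :: "nat \<Rightarrow> 't set" where
  "exh = (SOME U. (\<forall>k. open (U k) \<and> compact (closure (U k))) \<and> incseq U \<and> (\<Union>k. U k) = UNIV)"

lemma exh: "open (exh k)" "compact (closure (exh k))" "incseq exh" "(\<Union>k. exh k) = UNIV"
  using someI_ex[OF exhaustion] unfolding exh_def[symmetric] by auto

lemma exh_measurable [measurable, simp]: "exh k \<in> sets borel"
  using exh(1) by simp

lemma emeasure_compact: "compact K \<Longrightarrow> emeasure \<sigma> K < \<infinity>"
  using radon by (simp add: radon_measure_def)

lemma emeasure_in_compact: "compact K \<Longrightarrow> A \<subseteq> K \<Longrightarrow> emeasure \<sigma> A < \<infinity>"
  using emeasure_compact emeasure_mono[of A K \<sigma>] borel_compact[of K] by (metis le_less_trans sets_sigma)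

lemma emeasure_exh: "emeasure \<sigma> (exh k) < \<infinity>"
  using emeasure_in_compact[OF exh(2) closure_subset] .

lemma sigma_finite_sigma: "sigma_finite_measure \<sigma>"
proof
  show "\<exists>A. countable A \<and> A \<subseteq> sets \<sigma> \<and> \<Union>A = space \<sigma> \<and> (\<forall>a\<in>A. emeasure \<sigma> a \<noteq> \<infinity>)"
    using exh emeasure_exh by (intro exI[of _ "range exh"]) (auto simp: less_top)
qed

lemma strip_measurable [measurable]:
  "A \<in> sets borel \<Longrightarrow> A \<times> (UNIV :: real set) \<in> sets (borel :: ('t \<times> real) measure)"
  unfolding borel_prod[symmetric] by (rule pair_measureI) auto

lemma emeasure_lm_strip:
  assumes [measurable]: "A \<in> sets borel"
  shows "emeasure lm (A \<times> UNIV) = emeasure \<sigma> A"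
proof -
  have "emeasure lm (A \<times> UNIV) = (\<integral>\<^sup>+t. emeasure (\<mu> t) {s. (t, s) \<in> A \<times> UNIV} \<partial>\<sigma>)"
    by (intro emeasure_lift_measure kernel) auto
  also have "\<dots> = (\<integral>\<^sup>+t. indicator A t \<partial>\<sigma>)"
    using prob_space.emeasure_space_1[OF prob_mu] by (intro nn_integral_cong) (auto simp: indicator_def)
  finally show ?thesis by simp
qed

lemma sigma_finite_lm: "sigma_finite_measure lm"
proof
  show "\<exists>A. countable A \<and> A \<subseteq> sets lm \<and> \<Union>A = space lm \<and> (\<forall>a\<in>A. emeasure lm a \<noteq> \<infinity>)"
  proof (intro exI[of _ "range (\<lambda>k. exh k \<times> UNIV)"] conjI)
    show "\<Union>(range (\<lambda>k. exh k \<times> UNIV)) = space lm" using exh(4) by auto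
    show "\<forall>a\<in>range (\<lambda>k. exh k \<times> UNIV). emeasure lm a \<noteq> \<infinity>"
      using emeasure_exh by (auto simp: emeasure_lm_strip less_top)
  qed auto
qed

sublocale lm: product_sigma_finite "\<lambda>_::nat. lm"
  using sigma_finite_lm by (simp add: product_sigma_finite_def)

lemma kernel_bound:
  assumes "compact L"
  obtains R where "R > 0" "\<And>t. t \<in> L \<Longrightarrow> AE s in \<mu> t. \<bar>s\<bar> \<le> R" "AE z in lm. fst z \<in> L \<longrightarrow> \<bar>snd z\<bar> \<le> R"
proof -
  have "L \<in> relatively_compact_borel"
    using assms by (simp add: relatively_compact_borel_def borel_compact closure_closed compact_imp_closed)
  then obtain R where R: "R > 0" "\<forall>t\<in>L. emeasure (\<mu> t) (- {-R..R}) = 0"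
    using kernel by (auto simp: locally_bounded_kernel_def)
  have 1: "AE s in \<mu> t. \<bar>s\<bar> \<le> R" if "t \<in> L" for t
    by (rule AE_I[of _ _ "- {-R..R}"]) (use R that in auto)
  have [measurable]: "L \<in> sets borel" using assms by (rule borel_compact)
  have "AE z in lm. fst z \<in> L \<longrightarrow> \<bar>snd z\<bar> \<le> R"
    by (subst AE_lm) (use 1 in auto)
  then show ?thesis using that R 1 by blast
qed

lemma emeasure_point: "emeasure \<sigma> {x} = 0"
proof (rule ccontr)
  assume "emeasure \<sigma> {x} \<noteq> 0"
  then have "0 < emeasure \<sigma> {x}" by (simp add: zero_less_iff_neq_zero)
  then obtain B where B: "B \<subseteq> {x}" "0 < emeasure \<sigma> B" "emeasure \<sigma> B < emeasure \<sigma> {x}"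
    using nonatomic unfolding non_atomic_def by (metis borel_singleton sets_sigma sets.empty_sets)
  then have "B = {} \<or> B = {x}" by blast
  then show False using B by auto
qed

text \<open>Finite intersections of a countable neighbourhood base at \<open>x\<close> shrink to
  {x}, a null set because \<sigma> is non-atomic. Intersecting with some \<open>exh k\<close> makes
  the measures finite, as continuity from above demands.\<close>

lemma small_neighbourhood:
  assumes "e > 0" obtains U where "open U" "x \<in> U" "emeasure \<sigma> U < e"
proof -
  obtain k where k: "x \<in> exh k" using exh(4) by blast
  obtain A :: "nat \<Rightarrow> 't set" where A: "\<And>i. open (A i)" "\<And>i. x \<in> A i" "\<And>S. open S \<Longrightarrow> x \<in> S \<Longrightarrow> \<exists>i. A i \<subseteq> S"
    using first_countable_basis[of x] by blast
  define B where "B i = exh k \<inter> (\<Inter>j\<le>i. A j)" for i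
  have Bo: "open (B i)" and Bx: "x \<in> B i" for i using A exh k by (auto simp: B_def intro!: open_INT open_Int)
  have "(\<Inter>i. B i) = {x}"
  proof (intro equalityI subsetI)
    fix y assume y: "y \<in> (\<Inter>i. B i)"
    show "y \<in> {x}"
    proof (rule ccontr)
      assume "y \<notin> {x}"
      then obtain i where "A i \<subseteq> - {y}" using A(3)[of "- {y}"] by auto
      then show False using y by (auto simp: B_def)
    qed
  qed (use Bx in auto)
  moreover have "(\<lambda>i. emeasure \<sigma> (B i)) \<longlonglongrightarrow> emeasure \<sigma> (\<Inter>i. B i)"
  proof (rule Lim_emeasure_decseq)
    show "decseq B" by (auto simp: decseq_def B_def)
    have "emeasure \<sigma> (B i) \<le> emeasure \<sigma> (exh k)" for i by (intro emeasure_mono) (auto simp: B_def)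
    then show "emeasure \<sigma> (B i) \<noteq> \<infinity>" for i using emeasure_exh[of k] by (metis infinity_ennreal_def leD)
  qed (use Bo in auto)
  ultimately have "(\<lambda>i. emeasure \<sigma> (B i)) \<longlonglongrightarrow> 0" by (simp add: emeasure_point)
  then have "\<forall>\<^sub>F i in sequentially. emeasure \<sigma> (B i) < e" using assms by (rule order_tendstoD)
  then obtain i where "emeasure \<sigma> (B i) < e" using eventually_happens'[OF sequentially_bot] by blast
  then show ?thesis using that Bo Bx by blast
qed

text \<open>Finitely many neighbourhoods of small measure cover \<open>L\<close>; making them
  disjoint gives the cells. Indices beyond the list give empty cells, so the bound on the measure
  holds for every index.\<close>

lemma fine_partition:
  assumes L: "compact L" and e: "e > 0"
  obtains n :: nat and c where "\<And>i. c i \<in> sets borel" "disjoint_family_on c {..<n}" "(\<Union>i<n. c i) = L"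
    "\<And>i. emeasure \<sigma> (c i) < e"
proof -
  have "\<forall>x. \<exists>U. open U \<and> x \<in> U \<and> emeasure \<sigma> U < e" using small_neighbourhood[OF e] by metis
  then obtain U where U: "\<And>x. open (U x)" "\<And>x. x \<in> U x" "\<And>x. emeasure \<sigma> (U x) < e" by metis
  obtain D where D: "finite D" "L \<subseteq> (\<Union>x\<in>D. U x)"
    by (rule compactE_image[OF L, of UNIV U]) (use U(1,2) in blast)+
  obtain xs where xs: "set xs = D" using finite_list[OF D(1)] by blast
  define V where "V i = (if i < length xs then U (xs ! i) else {})" for i
  define c where "c i = L \<inter> disjointed V i" for i
  have Vm: "range V \<subseteq> sets \<sigma>" using U by (auto simp: V_def)
  have dm: "disjointed V i \<in> sets \<sigma>" for i using sets.range_disjointed_sets[OF Vm] by blast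
  show ?thesis
  proof (rule that[of c "length xs"])
    show "c i \<in> sets borel" for i using dm borel_compact[OF L] by (auto simp: c_def)
    show "disjoint_family_on c {..<length xs}"
      using disjoint_family_disjointed[of V] by (auto simp: c_def disjoint_family_on_def)
    have "(\<Union>i<length xs. disjointed V i) = (\<Union>i<length xs. V i)"
      using UN_disjointed_eq[of V] by (simp add: finite_UN_disjointed_eq atLeast0LessThan[symmetric])
    also have "\<dots> = (\<Union>x\<in>D. U x)" unfolding xs[symmetric] set_conv_nth by (auto simp: V_def)
    finally show "(\<Union>i<length xs. c i) = L" using D(2) by (auto simp: c_def)
    show "emeasure \<sigma> (c i) < e" for i
    proof -
      have "emeasure \<sigma> (c i) \<le> emeasure \<sigma> (V i)" using Vm disjointed_subset[of V i]
        by (intro emeasure_mono) (auto simp: c_def)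
      also have "\<dots> < e" using U e by (auto simp: V_def)
      finally show ?thesis .
    qed
  qed
qed

text \<open>Normality of T follows from regularity, which locally compact Hausdorff spaces have,
  together with the Lindelof property.\<close>

lemma Urysohn_compact:
  assumes K: "compact K" and V: "open V" "K \<subseteq> V"
  shows "\<exists>f :: 't \<Rightarrow> real. continuous_on UNIV f \<and> (\<forall>x. 0 \<le> f x \<and> f x \<le> 1) \<and>
    (\<forall>x\<in>K. f x = 1) \<and> (\<forall>x. x \<notin> V \<longrightarrow> f x = 0)"
proof -
  have "Hausdorff_space (euclidean :: 't topology)"
    unfolding Hausdorff_space_def using hausdorff by (auto simp: disjnt_def)
  then have "regular_space (euclidean :: 't topology)"
    using lc by (intro locally_compact_Hausdorff_imp_regular_space) auto
  moreover have "Lindelof_space (euclidean :: 't topology)"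
    unfolding Lindelof_space_def
  proof safe
    fix F :: "'t set set" assume F: "\<forall>U\<in>F. openin euclidean U" "\<Union>F = topspace euclidean"
    obtain F' where "F' \<subseteq> F" "countable F'" "\<Union>F' = \<Union>F" using Lindelof[of F] F by auto
    then show "\<exists>\<V>. countable \<V> \<and> \<V> \<subseteq> F \<and> \<Union>\<V> = topspace euclidean" using F by metis
  qed
  ultimately have n: "normal_space (euclidean :: 't topology)"
    by (intro regular_Lindelof_imp_normal_space)
  obtain f where f: "continuous_map (euclidean :: 't topology) (top_of_set {0..1::real}) f"
    "f ` (- V) \<subseteq> {0}" "f ` K \<subseteq> {1}"
    using Urysohn_lemma[OF n, of "- V" K 0 1] V compact_imp_closed[OF K] by (auto simp: disjnt_def)
  have "continuous_on UNIV f" using f(1) by (simp add: continuous_map_in_subtopology)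
  moreover have "f x \<in> {0..1}" for x using f(1) by (auto simp: continuous_map_in_subtopology)
  ultimately show ?thesis using f by (intro exI[of _ f]) (auto simp: image_subset_iff)
qed

text \<open>Open sets form the generator in \<open>L2_dense\<close>. For an open set G of finite
  measure, a Urysohn function between a compact K and G differs from the indicator of G only on G -
  K, and inner regularity makes that set small.\<close>

lemma Cc_dense:
  assumes W: "closed_sub (L2 \<sigma>) (l2_inner \<sigma>) W" and Cc: "compactly_supported_continuous \<subseteq> W"
  shows "W = L2 \<sigma>"
proof (rule L2_dense[OF W, where E="{S. open S}" and \<Omega>=exh])
  show "Int_stable {S :: 't set. open S}" by (auto simp: Int_stable_def)
  show "sets \<sigma> = sigma_sets (space \<sigma>) {S. open S}" by (simp add: borel_def)
  show "emeasure \<sigma> (exh k) < \<infinity>" for k by (rule emeasure_exh)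
  fix A k assume A: "A \<in> {S :: 't set. open S}"
  interpret semi_hilbert "L2 \<sigma>" "l2_inner \<sigma>" by (rule L2_semi_hilbert)
  define G where "G = A \<inter> exh k"
  have G: "open G" "G \<in> sets borel" using A exh by (auto simp: G_def)
  have Gf: "emeasure \<sigma> G < \<infinity>" using emeasure_in_compact[OF exh(2), of G k] closure_subset by (auto simp: G_def)
  have GL: "indicat_real G \<in> L2 \<sigma>"
    using G Gf by (intro indicator_in_L2) auto
  show "indicat_real (A \<inter> exh k) \<in> W" unfolding G_def[symmetric]
  proof (rule closed_sub_approx[OF W GL])
    fix e :: real assume e: "e > 0"
    have mG: "emeasure \<sigma> G = ennreal (measure \<sigma> G)" using Gf by (intro emeasure_eq_ennreal_measure) auto
    have mK: "emeasure \<sigma> K = ennreal (measure \<sigma> K)" if "compact K" for K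
      using emeasure_compact[OF that] by (intro emeasure_eq_ennreal_measure) auto
    obtain K where K: "compact K" "K \<subseteq> G" "measure \<sigma> G < measure \<sigma> K + e\<^sup>2"
    proof -
      have s: "emeasure \<sigma> G = (SUP K\<in>{K. compact K \<and> K \<subseteq> G}. emeasure \<sigma> K)"
        using radon G by (simp add: radon_measure_def)
      show ?thesis
      \<comment> \<open>If the measure of G is below e^2 the empty set serves as K. Otherwise the
        lower bound sought for K is nonnegative, so it can be compared inside
        \<open>ennreal\<close>.\<close>
      proof (cases "measure \<sigma> G < e\<^sup>2")
        case True
        then show ?thesis using that[of "{}"] by simp
      next
        case False
        have "ennreal (measure \<sigma> G - e\<^sup>2) < emeasure \<sigma> G"
          using False e unfolding mG by (simp add: ennreal_less_iff)
        then obtain K where K: "compact K" "K \<subseteq> G" "ennreal (measure \<sigma> G - e\<^sup>2) < emeasure \<sigma> K"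
          using s by (metis (mono_tags, lifting) less_SUP_iff mem_Collect_eq)
        then show ?thesis using that[of K] False by (simp add: mK ennreal_less_iff)
      qed
    qed
    obtain f :: "'t \<Rightarrow> real" where f: "continuous_on UNIV f" "\<And>x. 0 \<le> f x" "\<And>x. f x \<le> 1" "\<And>x. x \<in> K \<Longrightarrow> f x = 1" "\<And>x. x \<notin> G \<Longrightarrow> f x = 0"
      using Urysohn_compact[OF K(1) G(1) K(2)] by metis
    have "f x = 0" if "x \<notin> closure (exh k)" for x
    proof -
      have "x \<notin> G" using that closure_subset[of "exh k"] by (auto simp: G_def)
      then show ?thesis by (rule f)
    qed
    then have fW: "f \<in> W" using Cc f(1) exh(2)[of k] by (auto simp: compactly_supported_continuous_def)
    then have fL: "f \<in> L2 \<sigma>" using W by (auto simp: closed_sub_def)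
    have Km: "K \<in> sets borel" using K(1) by (rule borel_compact)
    have "ennreal ((nrm (f - indicat_real G))\<^sup>2) = (\<integral>\<^sup>+x. ennreal ((f x - indicat_real G x)\<^sup>2) \<partial>\<sigma>)"
      using nn_integral_L2[of "f - indicat_real G" \<sigma>] fL GL by simp
    also have "\<dots> \<le> (\<integral>\<^sup>+x. indicator (G - K) x \<partial>\<sigma>)"
    proof (rule nn_integral_mono)
      fix x
      have "(f x - 1)\<^sup>2 \<le> 1" using f(2,3)[of x] by (simp add: abs_square_le_1 abs_le_iff)
      then show "ennreal ((f x - indicat_real G x)\<^sup>2) \<le> indicator (G - K) x"
        using f(4,5)[of x] K(2) by (auto simp: indicator_def)
    qed
    also have "\<dots> = emeasure \<sigma> (G - K)" using G Km by simp
    also have "\<dots> = emeasure \<sigma> G - emeasure \<sigma> K"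
      using G Km K emeasure_compact[OF K(1)] by (intro emeasure_Diff) auto
    also have "\<dots> = ennreal (measure \<sigma> G - measure \<sigma> K)"
      unfolding mG mK[OF K(1)] by (simp add: ennreal_minus)
    also have "\<dots> < ennreal (e\<^sup>2)" using K(3) e by (intro ennreal_lessI) auto
    finally have "(nrm (f - indicat_real G))\<^sup>2 < e\<^sup>2" by (simp add: ennreal_less_iff)
    then have "nrm (f - indicat_real G) < e" by (rule power2_less_imp_less) (use e in simp)
    then show "\<exists>y\<in>W. nrm (y - indicat_real G) < e" using fW by blast
  qed
qed (auto simp: exh)

end

section \<open>The operators \<open>X(f)\<close>\<close>

text \<open>The z-variables are consumed from the last one downwards, so \<open>z 0\<close> is
  untouched until the final step. A factor depending on \<open>z 0\<close> alone therefore passes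
  through the first \<open>k\<close> steps, which act on the remaining variables as they would on
  \<open>h\<close>.\<close>

lemma CAN_power_shift:
  "CAN_power \<sigma> \<mu> (Suc k) (\<lambda>m z y. f (fst (z 0)) * h m (\<lambda>i. z (Suc i)) y) =
    (let H = (\<lambda>m z y. f (fst (z 0)) * CAN_power \<sigma> \<mu> k h m (\<lambda>i. z (Suc i)) y)
     in C_op 0 H + A_op \<sigma> \<mu> 0 H + N_op 0 H)"
proof (induction k arbitrary: h)
  case 0
  show ?case by (simp add: Let_def)
next
  case (Suc k)
  let ?h = "\<lambda>m z y. f (fst (z 0)) * h m (\<lambda>i. z (Suc i)) y"
  have eq: "C_op (Suc k) ?h + A_op \<sigma> \<mu> (Suc k) ?h + N_op (Suc k) ?h =
    (\<lambda>m z y. f (fst (z 0)) * (C_op k h + A_op \<sigma> \<mu> k h + N_op k h) m (\<lambda>i. z (Suc i)) y)"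
    by (auto simp: fun_eq_iff C_op_def A_op_def N_op_def fun_upd_def algebra_simps)
  show ?case
    by (subst CAN_power.simps(2), subst eq, subst Suc.IH) (simp only: CAN_power.simps(2))
qed

text \<open>The three summands are the creation operator of f (x) 1, the annihilation operator of f
  (x) 1 and the neutral operator of f (x) s.\<close>

definition X_op :: "'t::{second_countable_topology,t2_space} measure \<Rightarrow> ('t \<Rightarrow> real measure) \<Rightarrow> ('t \<Rightarrow> real) \<Rightarrow> 't fock_operator"
  where "X_op \<sigma> \<mu> f G = (\<lambda>m y.
    (if m = 0 then 0 else f (fst (y 0)) * G (m - 1) (tuple_tail m y)) +
    (\<integral>w. f (fst w) * G (m + 1) (tuple_cons m w y) \<partial>lift_measure \<sigma> \<mu>) +
    (if m = 0 then 0 else snd (y 0) * (f (fst (y 0)) * G m y)))"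

definition tensor_test :: "nat \<Rightarrow> ('t \<Rightarrow> real) \<Rightarrow> ((nat \<Rightarrow> 't) \<Rightarrow> real) \<Rightarrow> (nat \<Rightarrow> 't) \<Rightarrow> real" where
  "tensor_test n f g = (\<lambda>x. f (x 0) * g (\<lambda>i\<in>{..<n}. x (Suc i)))"

lemma monomial_tensor:
  "monomial \<sigma> \<mu> (Suc n) (tensor_test n f g) F = X_op \<sigma> \<mu> f (monomial \<sigma> \<mu> n g F)"
proof -
  have r: "tensor_test n f g (\<lambda>i\<in>{..<Suc n}. fst (z i)) = f (fst (z 0)) * g (\<lambda>i\<in>{..<n}. fst (z (Suc i)))"
    for z :: "nat \<Rightarrow> 'a \<times> real"
  proof -
    have "(\<lambda>i\<in>{..<n}. (\<lambda>i\<in>{..<Suc n}. fst (z i)) (Suc i)) = (\<lambda>i\<in>{..<n}. fst (z (Suc i)))"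
      by (auto simp: fun_eq_iff restrict_def)
    then show ?thesis by (simp add: tensor_test_def)
  qed
  \<comment> \<open>In the final step only \<open>z 0\<close> has been filled in; dropping it leaves
    the constant tuple \<open>undefined\<close> at which \<open>monomial\<close> evaluates the
    lower-order kernel.\<close>
  have u: "(\<lambda>i. ((\<lambda>_. undefined)(0 := w)) (Suc i)) = (\<lambda>_. undefined)" for w :: "'a \<times> real" by auto
  show ?thesis
    unfolding monomial_def r mult.assoc
    by (subst CAN_power_shift[where h="\<lambda>m z y. g (\<lambda>i\<in>{..<n}. fst (z i)) * F m y"])
       (simp add: Let_def fun_eq_iff C_op_def A_op_def N_op_def X_op_def)
qed

lemma tensor_test_functions:
  assumes f: "f \<in> compactly_supported_continuous" and g: "g \<in> test_functions n"
  shows "tensor_test n f g \<in> test_functions (Suc n)"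
proof -
  let ?P = "\<lambda>n. product_topology (\<lambda>_. euclidean :: 'a topology) {..<n}"
  obtain K where K: "compact K" "\<And>x. x \<notin> K \<Longrightarrow> f x = 0" and fc: "continuous_on UNIV f"
    using f by (auto simp: compactly_supported_continuous_def)
  obtain L where L: "compactin (?P n) L" "\<And>x. x \<in> topspace (?P n) - L \<Longrightarrow> g x = 0"
    and gc: "continuous_map (?P n) euclideanreal g"
    using g by (auto simp: test_functions_def)
  have p0: "continuous_map (?P (Suc n)) euclidean (\<lambda>x. x 0)"
    by (rule continuous_map_product_projection) simp
  have shift: "continuous_map (?P (Suc n)) (?P n) (\<lambda>x. \<lambda>i\<in>{..<n}. x (Suc i))"
    by (auto simp: continuous_map_componentwise intro!: continuous_map_product_projection)
  have "continuous_map (?P (Suc n)) euclideanreal (\<lambda>x. f (x 0))"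
    using continuous_map_compose[OF p0, of euclideanreal f] fc by (simp add: o_def)
  moreover have "continuous_map (?P (Suc n)) euclideanreal (\<lambda>x. g (\<lambda>i\<in>{..<n}. x (Suc i)))"
    using continuous_map_compose[OF shift gc] by (simp add: o_def)
  ultimately have c: "continuous_map (?P (Suc n)) euclideanreal (tensor_test n f g)"
    unfolding tensor_test_def by (intro continuous_map_real_mult)
  \<comment> \<open>The support of the tensor product lies in the box with first side K, whose other
    sides are the coordinate projections of L; a finite box with compact sides is compact.\<close>
  define S where "S i = (case i of 0 \<Rightarrow> K | Suc j \<Rightarrow> (\<lambda>x. x j) ` L)" for i
  have "compactin euclidean (S i)" if "i < Suc n" for i
  proof (cases i)
    case (Suc j)
    have "continuous_map (?P n) euclidean (\<lambda>x. x j)"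
      using that Suc by (intro continuous_map_product_projection) simp
    then show ?thesis using image_compactin[OF L(1), of euclidean "\<lambda>x. x j"] Suc by (simp add: S_def)
  qed (simp add: S_def K)
  then have comp: "compactin (?P (Suc n)) (PiE {..<Suc n} S)"
    by (subst compactin_PiE) auto
  have "tensor_test n f g x = 0" if x: "x \<in> topspace (?P (Suc n)) - PiE {..<Suc n} S" for x
  proof (rule ccontr)
    assume "tensor_test n f g x \<noteq> 0"
    then have "x 0 \<in> K" "(\<lambda>i\<in>{..<n}. x (Suc i)) \<in> L"
      using K(2) L(2)[of "\<lambda>i\<in>{..<n}. x (Suc i)"] by (auto simp: tensor_test_def)
    note xKL = this
    have "x i \<in> S i" if "i < Suc n" for i
    proof (cases i)
      case (Suc j)
      then have "x i = (\<lambda>x. x j) (\<lambda>i\<in>{..<n}. x (Suc i))" using that by simp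
      then show ?thesis unfolding Suc S_def nat.case using xKL(2) by (rule image_eqI)
    qed (use xKL in \<open>simp add: S_def\<close>)
    then show False using x by (auto simp: PiE_iff)
  qed
  then show ?thesis using c comp by (auto simp: test_functions_def)
qed

lemma const_test_functions: "(\<lambda>_. c) \<in> test_functions 0"
  by (auto simp: test_functions_def intro!: exI[of _ "{\<lambda>_. undefined}"])

section \<open>Splitting off the first variable\<close>

context jacobi_setting
begin

abbreviation fock :: "'t fock_vector set" where "fock \<equiv> fock_space \<sigma> \<mu>"

lemma fock_l2_sum: "fock = l2_sum (\<lambda>n. lift_power \<sigma> \<mu> n)" "fock_inner \<sigma> \<mu> = l2_sum_inner (\<lambda>n. lift_power \<sigma> \<mu> n)"
  by (auto simp: fock_space_def l2_sum_def l2_inner_def power2_eq_square fock_inner_def l2_sum_inner_def fun_eq_iff)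

lemma fock_norm_snorm: "fock_norm \<sigma> \<mu> = snorm (fock_inner \<sigma> \<mu>)"
  by (auto simp: fock_norm_def snorm_def fun_eq_iff)

sublocale fock: semi_hilbert fock "fock_inner \<sigma> \<mu>"
  unfolding fock_l2_sum by (rule l2_sum_semi_hilbert)

lemma tuple_cons_measurable [measurable]:
  "(\<lambda>(w, y). tuple_cons m w y) \<in> measurable (lm \<Otimes>\<^sub>M lift_power \<sigma> \<mu> m) (lift_power \<sigma> \<mu> (Suc m))"
  unfolding tuple_cons_def split_beta
proof (rule measurable_restrict)
  fix i assume "i \<in> {..<Suc m}"
  then show "(\<lambda>x. case i of 0 \<Rightarrow> fst x | Suc j \<Rightarrow> snd x j) \<in> measurable (lm \<Otimes>\<^sub>M lift_power \<sigma> \<mu> m) lm"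
    by (cases i) auto
qed

lemma tuple_tail_measurable [measurable]:
  "tuple_tail (Suc m) \<in> measurable (lift_power \<sigma> \<mu> (Suc m)) (lift_power \<sigma> \<mu> m)"
  unfolding tuple_tail_def diff_Suc_1 by (rule measurable_restrict) auto

lemma tuple_cons_0 [simp]: "tuple_cons m w y 0 = w"
  by (simp add: tuple_cons_def)

lemma tuple_tail_cons: "y \<in> space (lift_power \<sigma> \<mu> m) \<Longrightarrow> tuple_tail (Suc m) (tuple_cons m w y) = y"
  by (auto simp: tuple_tail_def tuple_cons_def space_PiM PiE_iff extensional_def fun_eq_iff)

lemma sigma_finite_power: "sigma_finite_measure (lift_power \<sigma> \<mu> m)"
  by (rule lm.sigma_finite) simp

text \<open>The identification of H (x) H^(x)m with H^(x)(m+1) at the level of measures: both sides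
  agree on boxes, which determine a sigma-finite product.\<close>

lemma distr_tuple_cons:
  "distr (lm \<Otimes>\<^sub>M lift_power \<sigma> \<mu> m) (lift_power \<sigma> \<mu> (Suc m)) (\<lambda>(w, y). tuple_cons m w y) = lift_power \<sigma> \<mu> (Suc m)"
proof (rule lm.PiM_eqI)
  interpret P: sigma_finite_measure "lift_power \<sigma> \<mu> m" by (rule sigma_finite_power)
  fix A assume A: "\<And>i. i \<in> {..<Suc m} \<Longrightarrow> A i \<in> sets lm"
  have AP: "PiE {..<Suc m} A \<in> sets (lift_power \<sigma> \<mu> (Suc m))" using A by (intro sets_PiM_I_finite) auto
  have AP': "PiE {..<m} (\<lambda>i. A (Suc i)) \<in> sets (lift_power \<sigma> \<mu> m)" using A by (intro sets_PiM_I_finite) auto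
  have "tuple_cons m w y \<in> PiE {..<Suc m} A \<longleftrightarrow> w \<in> A 0 \<and> y \<in> PiE {..<m} (\<lambda>i. A (Suc i))"
    if "y \<in> space (lift_power \<sigma> \<mu> m)" for w y
  proof -
    have "(\<forall>i<Suc m. tuple_cons m w y i \<in> A i) \<longleftrightarrow> w \<in> A 0 \<and> (\<forall>i<m. y i \<in> A (Suc i))"
      by (subst All_less_Suc2) (auto simp: tuple_cons_def)
    moreover have "tuple_cons m w y \<in> extensional {..<Suc m}" by (simp add: tuple_cons_def)
    moreover have "y \<in> extensional {..<m}" using that by (auto simp: space_PiM PiE_iff)
    ultimately show ?thesis by (auto simp: PiE_iff)
  qed
  then have v: "(\<lambda>(w, y). tuple_cons m w y) -` PiE {..<Suc m} A \<inter> space (lm \<Otimes>\<^sub>M lift_power \<sigma> \<mu> m)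
      = A 0 \<times> PiE {..<m} (\<lambda>i. A (Suc i))"
    using sets.sets_into_space[OF AP'] by (auto simp: space_pair_measure)
  have "emeasure (distr (lm \<Otimes>\<^sub>M lift_power \<sigma> \<mu> m) (lift_power \<sigma> \<mu> (Suc m)) (\<lambda>(w, y). tuple_cons m w y)) (PiE {..<Suc m} A)
      = emeasure (lm \<Otimes>\<^sub>M lift_power \<sigma> \<mu> m) (A 0 \<times> PiE {..<m} (\<lambda>i. A (Suc i)))"
    using AP by (subst emeasure_distr) (simp_all add: v)
  also have "\<dots> = emeasure lm (A 0) * (\<Prod>i<m. emeasure lm (A (Suc i)))"
    using A AP' lm.emeasure_PiM[of "{..<m}" "\<lambda>i. A (Suc i)"]
    by (subst P.emeasure_pair_measure_Times) auto
  also have "\<dots> = (\<Prod>i<Suc m. emeasure lm (A i))" by (simp only: prod.lessThan_Suc_shift)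
  finally show "emeasure (distr (lm \<Otimes>\<^sub>M lift_power \<sigma> \<mu> m) (lift_power \<sigma> \<mu> (Suc m)) (\<lambda>(w, y). tuple_cons m w y)) (PiE {..<Suc m} A)
    = (\<Prod>i<Suc m. emeasure lm (A i))" .
qed auto

lemma nn_integral_tuple_cons:
  assumes [measurable]: "f \<in> borel_measurable (lift_power \<sigma> \<mu> (Suc m))"
  shows "(\<integral>\<^sup>+y. f y \<partial>lift_power \<sigma> \<mu> (Suc m)) = (\<integral>\<^sup>+w. \<integral>\<^sup>+y. f (tuple_cons m w y) \<partial>lift_power \<sigma> \<mu> m \<partial>lm)"
    and "(\<integral>\<^sup>+y. f y \<partial>lift_power \<sigma> \<mu> (Suc m)) = (\<integral>\<^sup>+y. \<integral>\<^sup>+w. f (tuple_cons m w y) \<partial>lm \<partial>lift_power \<sigma> \<mu> m)"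
proof -
  interpret P: sigma_finite_measure "lift_power \<sigma> \<mu> m" by (rule sigma_finite_power)
  interpret Q: sigma_finite_measure lm by (rule sigma_finite_lm)
  interpret PQ: pair_sigma_finite lm "lift_power \<sigma> \<mu> m" ..
  have m [measurable]: "(\<lambda>(w, y). f (tuple_cons m w y)) \<in> borel_measurable (lm \<Otimes>\<^sub>M lift_power \<sigma> \<mu> m)"
    using measurable_compose[OF tuple_cons_measurable assms] by (simp add: split_beta)
  have "(\<integral>\<^sup>+y. f y \<partial>lift_power \<sigma> \<mu> (Suc m)) = (\<integral>\<^sup>+y. f y \<partial>distr (lm \<Otimes>\<^sub>M lift_power \<sigma> \<mu> m) (lift_power \<sigma> \<mu> (Suc m)) (\<lambda>(w, y). tuple_cons m w y))"
    by (simp only: distr_tuple_cons)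
  also have "\<dots> = (\<integral>\<^sup>+x. (\<lambda>(w, y). f (tuple_cons m w y)) x \<partial>(lm \<Otimes>\<^sub>M lift_power \<sigma> \<mu> m))"
    by (subst nn_integral_distr) (auto simp: case_prod_unfold)
  finally have e: "(\<integral>\<^sup>+y. f y \<partial>lift_power \<sigma> \<mu> (Suc m)) = (\<integral>\<^sup>+x. (\<lambda>(w, y). f (tuple_cons m w y)) x \<partial>(lm \<Otimes>\<^sub>M lift_power \<sigma> \<mu> m))" .
  show "(\<integral>\<^sup>+y. f y \<partial>lift_power \<sigma> \<mu> (Suc m)) = (\<integral>\<^sup>+w. \<integral>\<^sup>+y. f (tuple_cons m w y) \<partial>lift_power \<sigma> \<mu> m \<partial>lm)"
    unfolding e by (subst P.nn_integral_fst[symmetric]) auto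
  show "(\<integral>\<^sup>+y. f y \<partial>lift_power \<sigma> \<mu> (Suc m)) = (\<integral>\<^sup>+y. \<integral>\<^sup>+w. f (tuple_cons m w y) \<partial>lm \<partial>lift_power \<sigma> \<mu> m)"
    unfolding e by (subst PQ.nn_integral_snd[symmetric]) auto
qed

lemma tuple_cons_measurable' [measurable]:
  assumes "y \<in> space (lift_power \<sigma> \<mu> m)"
  shows "(\<lambda>w. tuple_cons m w y) \<in> measurable lm (lift_power \<sigma> \<mu> (Suc m))"
  using measurable_compose[OF measurable_Pair2'[OF assms] tuple_cons_measurable] by simp

section \<open>Boundedness of \<open>X(f)\<close>\<close>

text \<open>This is the space B_0(T).\<close>

definition nice :: "('t \<Rightarrow> real) set" where
  "nice = {f \<in> borel_measurable borel. (\<exists>B. \<forall>t. \<bar>f t\<bar> \<le> B) \<and> (\<exists>L. compact L \<and> (\<forall>t. t \<notin> L \<longrightarrow> f t = 0))}"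

lemma niceD:
  assumes "f \<in> nice"
  shows "\<exists>B L. B > 0 \<and> (\<forall>t. \<bar>f t\<bar> \<le> B) \<and> compact L \<and> (\<forall>t. t \<notin> L \<longrightarrow> f t = 0)"
proof -
  obtain B L where *: "f \<in> borel_measurable borel" "\<And>t. \<bar>f t\<bar> \<le> B" "compact L" "\<And>t. t \<notin> L \<Longrightarrow> f t = 0"
    using assms by (auto simp: nice_def)
  then have "\<bar>f t\<bar> \<le> max 1 B" for t by (meson max.coboundedI2)
  then show ?thesis using * by (intro exI[of _ "max 1 B"] exI[of _ L]) auto
qed

lemma Cc_nice: "compactly_supported_continuous \<subseteq> nice"
proof
  fix f :: "'t \<Rightarrow> real" assume "f \<in> compactly_supported_continuous"
  then obtain K where K: "continuous_on UNIV f" "compact K" "\<And>x. x \<notin> K \<Longrightarrow> f x = 0"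
    by (auto simp: compactly_supported_continuous_def)
  have "compact (f ` K)" using K by (intro compact_continuous_image) (auto intro: continuous_on_subset)
  then obtain B where B: "\<And>y. y \<in> f ` K \<Longrightarrow> norm y \<le> B" by (metis compact_imp_bounded bounded_iff)
  have "\<bar>f t\<bar> \<le> max 0 B" for t using B[of "f t"] K(3)[of t] by (cases "t \<in> K") auto
  then show "f \<in> nice" using K borel_measurable_continuous_onI[of f] by (auto simp: nice_def)
qed

lemma nice_times_bounded_L2:
  assumes f: "f \<in> nice" and u: "u \<in> borel_measurable borel"
    and b: "\<And>L. compact L \<Longrightarrow> \<exists>B. AE z in lm. fst z \<in> L \<longrightarrow> \<bar>u z\<bar> \<le> B"
  shows "(\<lambda>z. f (fst z) * u z) \<in> L2 lm"
proof -
  note [measurable] = u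
  have "f \<in> borel_measurable borel" using f by (simp add: nice_def)
  with niceD[OF f] obtain B L where L: "f \<in> borel_measurable borel" "B > 0" "\<And>t. \<bar>f t\<bar> \<le> B" "compact L" "\<And>t. t \<notin> L \<Longrightarrow> f t = 0"
    by metis
  note [measurable] = L(1) borel_compact[OF L(4)]
  obtain C where C: "AE z in lm. fst z \<in> L \<longrightarrow> \<bar>u z\<bar> \<le> C" using b[OF L(4)] by blast
  have "AE z in lm. ennreal ((f (fst z) * u z)\<^sup>2) \<le> ennreal ((B * C)\<^sup>2) * indicator (L \<times> UNIV) z"
    using C
  proof eventually_elim
    case (elim z)
    show ?case
    proof (cases "fst z \<in> L")
      case True
      then have "\<bar>f (fst z) * u z\<bar> \<le> B * C"
        using L(3)[of "fst z"] elim by (auto simp: abs_mult intro!: mult_mono)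
      then have "\<bar>f (fst z) * u z\<bar>\<^sup>2 \<le> (B * C)\<^sup>2" by (intro power_mono) auto
      then show ?thesis using True by (cases z) (auto simp: indicator_def)
    qed (use L(5) in \<open>cases z, auto\<close>)
  qed
  then have "(\<integral>\<^sup>+z. ennreal ((f (fst z) * u z)\<^sup>2) \<partial>lm) \<le> (\<integral>\<^sup>+z. ennreal ((B * C)\<^sup>2) * indicator (L \<times> UNIV) z \<partial>lm)"
    by (rule nn_integral_mono_AE)
  also have "\<dots> = ennreal ((B * C)\<^sup>2) * emeasure \<sigma> L"
    by (subst nn_integral_cmult_indicator) (simp_all add: emeasure_lm_strip)
  also have "\<dots> < \<infinity>" using emeasure_compact[OF L(4)] by (simp add: ennreal_mult_less_top)
  finally show ?thesis by (simp add: L2_iff_nn_integral)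
qed

lemma nice_L2: "f \<in> nice \<Longrightarrow> (\<lambda>z. f (fst z)) \<in> L2 lm"
  using nice_times_bounded_L2[of f "\<lambda>_. 1"] by (auto intro: exI[of _ 1])

lemma creation_L2:
  assumes f: "f \<in> L2 lm" and g: "g \<in> L2 (lift_power \<sigma> \<mu> m)"
  shows "(\<lambda>y. f (y 0) * g (tuple_tail (Suc m) y)) \<in> L2 (lift_power \<sigma> \<mu> (Suc m))" (is "?h \<in> _")
    and "snorm (l2_inner (lift_power \<sigma> \<mu> (Suc m))) (\<lambda>y. f (y 0) * g (tuple_tail (Suc m) y))
      = snorm (l2_inner lm) f * snorm (l2_inner (lift_power \<sigma> \<mu> m)) g"
proof -
  note [measurable] = L2_measurable[OF f] L2_measurable[OF g]
  have hm [measurable]: "?h \<in> borel_measurable (lift_power \<sigma> \<mu> (Suc m))" by measurable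
  have "(\<integral>\<^sup>+y. ennreal ((?h y)\<^sup>2) \<partial>lift_power \<sigma> \<mu> (Suc m)) =
    (\<integral>\<^sup>+w. \<integral>\<^sup>+y. ennreal ((f w)\<^sup>2) * ennreal ((g y)\<^sup>2) \<partial>lift_power \<sigma> \<mu> m \<partial>lm)"
    by (subst nn_integral_tuple_cons(1), measurable, intro nn_integral_cong)
       (simp add: tuple_tail_cons power_mult_distrib ennreal_mult)
  also have "\<dots> = (\<integral>\<^sup>+w. ennreal ((f w)\<^sup>2) \<partial>lm) * (\<integral>\<^sup>+y. ennreal ((g y)\<^sup>2) \<partial>lift_power \<sigma> \<mu> m)"
    by (simp add: nn_integral_cmult nn_integral_multc)
  also have "\<dots> = ennreal ((snorm (l2_inner lm) f * snorm (l2_inner (lift_power \<sigma> \<mu> m)) g)\<^sup>2)"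
    by (simp add: nn_integral_L2[OF f] nn_integral_L2[OF g] power_mult_distrib ennreal_mult)
  finally have e: "(\<integral>\<^sup>+y. ennreal ((?h y)\<^sup>2) \<partial>lift_power \<sigma> \<mu> (Suc m)) =
    ennreal ((snorm (l2_inner lm) f * snorm (l2_inner (lift_power \<sigma> \<mu> m)) g)\<^sup>2)" .
  show h: "?h \<in> L2 (lift_power \<sigma> \<mu> (Suc m))" unfolding L2_iff_nn_integral e by simp
  have "(snorm (l2_inner (lift_power \<sigma> \<mu> (Suc m))) ?h)\<^sup>2 = (snorm (l2_inner lm) f * snorm (l2_inner (lift_power \<sigma> \<mu> m)) g)\<^sup>2"
    using e nn_integral_L2[OF h] by simp
  then show "snorm (l2_inner (lift_power \<sigma> \<mu> (Suc m))) ?h = snorm (l2_inner lm) f * snorm (l2_inner (lift_power \<sigma> \<mu> m)) g"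
    using f g h by (subst (asm) power2_eq_iff_nonneg) (auto intro!: mult_nonneg_nonneg semi_inner.nrm_nonneg[OF L2_semi_inner])
qed

text \<open>Cauchy--Schwarz in the contracted variable, then Tonelli. The slices of \<open>g\<close>
  are square integrable for almost every \<open>y\<close> only, which is why linearity of
  annihilation holds merely up to null sets.\<close>

lemma annihilation_L2:
  assumes f: "f \<in> L2 lm" and g: "g \<in> L2 (lift_power \<sigma> \<mu> (Suc m))"
  shows "AE y in lift_power \<sigma> \<mu> m. (\<lambda>w. g (tuple_cons m w y)) \<in> L2 lm"
    and "(\<lambda>y. \<integral>w. f w * g (tuple_cons m w y) \<partial>lm) \<in> L2 (lift_power \<sigma> \<mu> m)" (is "?h \<in> _")
    and "snorm (l2_inner (lift_power \<sigma> \<mu> m)) (\<lambda>y. \<integral>w. f w * g (tuple_cons m w y) \<partial>lm)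
      \<le> snorm (l2_inner lm) f * snorm (l2_inner (lift_power \<sigma> \<mu> (Suc m))) g"
proof -
  interpret Q: sigma_finite_measure lm by (rule sigma_finite_lm)
  interpret P: sigma_finite_measure "lift_power \<sigma> \<mu> m" by (rule sigma_finite_power)
  interpret PQ: pair_sigma_finite "lift_power \<sigma> \<mu> m" lm ..
  note [measurable] = L2_measurable[OF f] L2_measurable[OF g]
  have gm [measurable]: "(\<lambda>(y, w). g (tuple_cons m w y)) \<in> borel_measurable (lift_power \<sigma> \<mu> m \<Otimes>\<^sub>M lm)"
    using measurable_compose[OF measurable_pair_swap' measurable_compose[OF tuple_cons_measurable L2_measurable[OF g]]]
    by (simp add: split_beta)
  have hm [measurable]: "?h \<in> borel_measurable (lift_power \<sigma> \<mu> m)" by measurable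
  have G: "(\<integral>\<^sup>+y. \<integral>\<^sup>+w. ennreal ((g (tuple_cons m w y))\<^sup>2) \<partial>lm \<partial>lift_power \<sigma> \<mu> m) =
      ennreal ((snorm (l2_inner (lift_power \<sigma> \<mu> (Suc m))) g)\<^sup>2)"
    unfolding nn_integral_L2[OF g, symmetric] by (rule nn_integral_tuple_cons(2)[symmetric]) measurable
  then have "AE y in lift_power \<sigma> \<mu> m. (\<integral>\<^sup>+w. ennreal ((g (tuple_cons m w y))\<^sup>2) \<partial>lm) \<noteq> \<infinity>"
    by (intro nn_integral_PInf_AE) auto
  then show ae: "AE y in lift_power \<sigma> \<mu> m. (\<lambda>w. g (tuple_cons m w y)) \<in> L2 lm"
    by (rule AE_mp) (auto intro!: AE_I2 simp: L2_iff_nn_integral less_top measurable_compose[OF tuple_cons_measurable' L2_measurable[OF g]])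
  have "AE y in lift_power \<sigma> \<mu> m. ennreal ((?h y)\<^sup>2) \<le>
      ennreal ((snorm (l2_inner lm) f)\<^sup>2) * (\<integral>\<^sup>+w. ennreal ((g (tuple_cons m w y))\<^sup>2) \<partial>lm)"
    using ae
  proof eventually_elim
    case (elim y)
    have "\<bar>?h y\<bar> \<le> snorm (l2_inner lm) f * snorm (l2_inner lm) (\<lambda>w. g (tuple_cons m w y))"
      using semi_inner.Cauchy_Schwarz[OF L2_semi_inner f elim] by (simp add: l2_inner_def)
    then have "\<bar>?h y\<bar>\<^sup>2 \<le> (snorm (l2_inner lm) f * snorm (l2_inner lm) (\<lambda>w. g (tuple_cons m w y)))\<^sup>2"
      by (intro power_mono) auto
    then show ?case by (simp add: nn_integral_L2[OF elim] power_mult_distrib flip: ennreal_mult)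
  qed
  then have "(\<integral>\<^sup>+y. ennreal ((?h y)\<^sup>2) \<partial>lift_power \<sigma> \<mu> m) \<le>
     (\<integral>\<^sup>+y. ennreal ((snorm (l2_inner lm) f)\<^sup>2) * (\<integral>\<^sup>+w. ennreal ((g (tuple_cons m w y))\<^sup>2) \<partial>lm) \<partial>lift_power \<sigma> \<mu> m)"
    by (rule nn_integral_mono_AE)
  also have "\<dots> = ennreal ((snorm (l2_inner lm) f)\<^sup>2) * ennreal ((snorm (l2_inner (lift_power \<sigma> \<mu> (Suc m))) g)\<^sup>2)"
    by (subst nn_integral_cmult) (auto simp: G)
  also have "\<dots> = ennreal ((snorm (l2_inner lm) f * snorm (l2_inner (lift_power \<sigma> \<mu> (Suc m))) g)\<^sup>2)"
    by (simp add: power_mult_distrib ennreal_mult)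
  finally have e: "(\<integral>\<^sup>+y. ennreal ((?h y)\<^sup>2) \<partial>lift_power \<sigma> \<mu> m) \<le>
    ennreal ((snorm (l2_inner lm) f * snorm (l2_inner (lift_power \<sigma> \<mu> (Suc m))) g)\<^sup>2)" .
  then show h: "?h \<in> L2 (lift_power \<sigma> \<mu> m)" unfolding L2_iff_nn_integral by (auto simp: le_less_trans)
  have "(snorm (l2_inner (lift_power \<sigma> \<mu> m)) ?h)\<^sup>2 \<le> (snorm (l2_inner lm) f * snorm (l2_inner (lift_power \<sigma> \<mu> (Suc m))) g)\<^sup>2"
    using e nn_integral_L2[OF h] by simp
  then show "snorm (l2_inner (lift_power \<sigma> \<mu> m)) ?h \<le> snorm (l2_inner lm) f * snorm (l2_inner (lift_power \<sigma> \<mu> (Suc m))) g"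
    by (rule power2_le_imp_le) (use f g in \<open>auto intro!: mult_nonneg_nonneg semi_inner.nrm_nonneg[OF L2_semi_inner]\<close>)
qed

lemma neutral_L2:
  assumes u: "u \<in> borel_measurable lm" "AE w in lm. \<bar>u w\<bar> \<le> B" "B \<ge> 0" and g: "g \<in> L2 (lift_power \<sigma> \<mu> (Suc m))"
  shows "(\<lambda>y. u (y 0) * g y) \<in> L2 (lift_power \<sigma> \<mu> (Suc m))" (is "?h \<in> _")
    and "snorm (l2_inner (lift_power \<sigma> \<mu> (Suc m))) (\<lambda>y. u (y 0) * g y)
      \<le> B * snorm (l2_inner (lift_power \<sigma> \<mu> (Suc m))) g"
proof -
  note [measurable] = L2_measurable[OF g] u(1)
  have hm [measurable]: "?h \<in> borel_measurable (lift_power \<sigma> \<mu> (Suc m))" by measurable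
  have gm [measurable]: "(\<lambda>y. g (tuple_cons m w y)) \<in> borel_measurable (lift_power \<sigma> \<mu> m)" for w
    using measurable_compose[OF measurable_compose[OF measurable_Pair1' tuple_cons_measurable] L2_measurable[OF g]] by simp
  have "(\<integral>\<^sup>+y. ennreal ((?h y)\<^sup>2) \<partial>lift_power \<sigma> \<mu> (Suc m)) =
    (\<integral>\<^sup>+w. \<integral>\<^sup>+y. ennreal ((u w * g (tuple_cons m w y))\<^sup>2) \<partial>lift_power \<sigma> \<mu> m \<partial>lm)"
    by (subst nn_integral_tuple_cons(1)) simp_all
  also have "\<dots> \<le> (\<integral>\<^sup>+w. \<integral>\<^sup>+y. ennreal ((B * g (tuple_cons m w y))\<^sup>2) \<partial>lift_power \<sigma> \<mu> m \<partial>lm)"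
  proof (rule nn_integral_mono_AE)
    show "AE w in lm. (\<integral>\<^sup>+y. ennreal ((u w * g (tuple_cons m w y))\<^sup>2) \<partial>lift_power \<sigma> \<mu> m) \<le> (\<integral>\<^sup>+y. ennreal ((B * g (tuple_cons m w y))\<^sup>2) \<partial>lift_power \<sigma> \<mu> m)"
      using u(2)
    proof eventually_elim
      case (elim w)
      have "(u w)\<^sup>2 \<le> B\<^sup>2" using elim u(3) by (simp add: abs_le_square_iff[symmetric])
      then show ?case by (intro nn_integral_mono ennreal_leI) (simp add: power_mult_distrib mult_right_mono)
    qed
  qed
  also have "\<dots> = (\<integral>\<^sup>+y. ennreal ((B * g y)\<^sup>2) \<partial>lift_power \<sigma> \<mu> (Suc m))"
    by (subst nn_integral_tuple_cons(1)) simp_all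
  also have "\<dots> = ennreal (B\<^sup>2) * ennreal ((snorm (l2_inner (lift_power \<sigma> \<mu> (Suc m))) g)\<^sup>2)"
    by (simp add: power_mult_distrib ennreal_mult nn_integral_cmult nn_integral_L2[OF g])
  also have "\<dots> = ennreal ((B * snorm (l2_inner (lift_power \<sigma> \<mu> (Suc m))) g)\<^sup>2)"
    by (simp add: power_mult_distrib ennreal_mult)
  finally have e: "(\<integral>\<^sup>+y. ennreal ((?h y)\<^sup>2) \<partial>lift_power \<sigma> \<mu> (Suc m)) \<le> ennreal ((B * snorm (l2_inner (lift_power \<sigma> \<mu> (Suc m))) g)\<^sup>2)" .
  then show h: "?h \<in> L2 (lift_power \<sigma> \<mu> (Suc m))" unfolding L2_iff_nn_integral by (auto simp: le_less_trans)
  have "(snorm (l2_inner (lift_power \<sigma> \<mu> (Suc m))) ?h)\<^sup>2 \<le> (B * snorm (l2_inner (lift_power \<sigma> \<mu> (Suc m))) g)\<^sup>2"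
    using e nn_integral_L2[OF h] by simp
  then show "snorm (l2_inner (lift_power \<sigma> \<mu> (Suc m))) ?h \<le> B * snorm (l2_inner (lift_power \<sigma> \<mu> (Suc m))) g"
    by (rule power2_le_imp_le) (use u(3) g in \<open>auto intro!: mult_nonneg_nonneg semi_inner.nrm_nonneg[OF L2_semi_inner]\<close>)
qed

lemma fock_component: "G \<in> fock \<Longrightarrow> G n \<in> L2 (lift_power \<sigma> \<mu> n)"
  by (simp add: fock_space_def)

lemma fock_partial_sums:
  assumes "G \<in> fock" "finite A"
  shows "(\<Sum>n\<in>A. (snorm (l2_inner (lift_power \<sigma> \<mu> n)) (G n))\<^sup>2) \<le> (fock.nrm G)\<^sup>2"
proof -
  have "(\<lambda>n. (snorm (l2_inner (lift_power \<sigma> \<mu> n)) (G n))\<^sup>2) sums (fock.nrm G)\<^sup>2"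
    using l2_sum_nrm[of G "\<lambda>n. lift_power \<sigma> \<mu> n"] assms by (simp add: fock_l2_sum)
  then show ?thesis using sum_le_suminf[of "\<lambda>n. (snorm (l2_inner (lift_power \<sigma> \<mu> n)) (G n))\<^sup>2" A] assms(2)
    by (auto simp: sums_iff)
qed

lemma fock_bounded:
  assumes "\<And>n. F n \<in> L2 (lift_power \<sigma> \<mu> n)"
    and "\<And>m. (\<Sum>n<m. (snorm (l2_inner (lift_power \<sigma> \<mu> n)) (F n))\<^sup>2) \<le> B\<^sup>2" "0 \<le> B"
  shows "F \<in> fock" "fock.nrm F \<le> B"
  using l2_sum_bounded[of F "\<lambda>n. lift_power \<sigma> \<mu> n" B] assms by (auto simp: fock_l2_sum)

lemma fock_nrm_0_iff:
  "F \<in> fock \<Longrightarrow> fock.nrm F = 0 \<longleftrightarrow> (\<forall>n. AE y in lift_power \<sigma> \<mu> n. F n y = 0)"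
  using l2_sum_nrm_0_iff[of F "\<lambda>n. lift_power \<sigma> \<mu> n"] by (simp add: fock_l2_sum)

text \<open>Over a compact set carrying \<open>f\<close> the fibre coordinate s is bounded by some
  R, which bounds the neutral part by R sup |f|; creation and annihilation are bounded by the L^2
  norm of \<open>f\<close>. Creation shifts the components up and annihilation shifts them down, so
  the partial sums of squares are controlled by those of \<open>G\<close>.\<close>

lemma X_op_bounded:
  assumes f: "f \<in> nice"
  shows "\<exists>c\<ge>0. \<forall>G\<in>fock. X_op \<sigma> \<mu> f G \<in> fock \<and> fock.nrm (X_op \<sigma> \<mu> f G) \<le> c * fock.nrm G"
proof -
  let ?n = "\<lambda>n. snorm (l2_inner (lift_power \<sigma> \<mu> n))"
  note ss = semi_inner.subspace_H[OF L2_semi_inner]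
  define a where "a = snorm (l2_inner lm) (\<lambda>z. f (fst z))"
  have fL: "(\<lambda>z. f (fst z)) \<in> L2 lm" by (rule nice_L2[OF f])
  have a0: "a \<ge> 0" unfolding a_def by (rule semi_inner.nrm_nonneg[OF L2_semi_inner fL])
  have fm [measurable]: "f \<in> borel_measurable borel" using f by (simp add: nice_def)
  obtain B L where L: "B > 0" "\<And>t. \<bar>f t\<bar> \<le> B" "compact L" "\<And>t. t \<notin> L \<Longrightarrow> f t = 0"
    using niceD[OF f] by metis
  obtain R where R: "R > 0" "AE z in lm. fst z \<in> L \<longrightarrow> \<bar>snd z\<bar> \<le> R" using kernel_bound[OF L(3)] by metis
  define b where "b = R * B"
  have b0: "b \<ge> 0" using R L by (simp add: b_def)
  have sf: "AE z in lm. \<bar>snd z * f (fst z)\<bar> \<le> b" using R(2)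
  proof eventually_elim
    case (elim z)
    show ?case
    proof (cases "fst z \<in> L")
      case True
      then show ?thesis using elim L(2)[of "fst z"] R(1) L(1) by (auto simp: b_def abs_mult intro!: mult_mono)
    qed (use L(4) b0 in auto)
  qed
  show ?thesis
  proof (intro exI[of _ "a + a + b"] conjI ballI)
    show "0 \<le> a + a + b" using a0 b0 by simp
    fix G assume G: "G \<in> fock"
    have Gn: "G n \<in> L2 (lift_power \<sigma> \<mu> n)" for n using fock_component[OF G] .
    have nG: "0 \<le> fock.nrm G" by (rule fock.nrm_nonneg[OF G])
    define C where "C = (\<lambda>m y. if m = 0 then 0 else f (fst (y 0)) * G (m - 1) (tuple_tail m y))"
    define A where "A = (\<lambda>m y. \<integral>w. f (fst w) * G (m + 1) (tuple_cons m w y) \<partial>lm)"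
    define N where "N = (\<lambda>m y. if m = 0 then 0 else snd (y 0) * (f (fst (y 0)) * G m y))"
    have C0: "C 0 = 0" by (simp add: C_def fun_eq_iff)
    have CS: "C (Suc n) = (\<lambda>y. f (fst (y 0)) * G n (tuple_tail (Suc n) y))" for n by (simp add: C_def)
    have N0: "N 0 = 0" by (simp add: N_def fun_eq_iff)
    have NS: "N (Suc n) = (\<lambda>y. snd (y 0) * f (fst (y 0)) * G (Suc n) y)" for n by (simp add: N_def mult.assoc)
    have AS: "A n = (\<lambda>y. \<integral>w. f (fst w) * G (Suc n) (tuple_cons n w y) \<partial>lm)" for n by (simp add: A_def)
    have z2: "?n 0 0 = 0" by (rule semi_inner.nrm_zero[OF L2_semi_inner])
    have Cb: "C \<in> fock" "fock.nrm C \<le> a * fock.nrm G"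
    proof (rule_tac [!] fock_bounded)
      show "C n \<in> L2 (lift_power \<sigma> \<mu> n)" for n
        by (cases n) (simp_all add: C0 CS subspace_0[OF ss] creation_L2(1)[OF fL Gn])
      then show "C n \<in> L2 (lift_power \<sigma> \<mu> n)" for n .
      show "(\<Sum>n<m. (?n n (C n))\<^sup>2) \<le> (a * fock.nrm G)\<^sup>2" for m
      proof (cases m)
        case (Suc k)
        have "(\<Sum>n<Suc k. (?n n (C n))\<^sup>2) = (\<Sum>n<k. (a * ?n n (G n))\<^sup>2)"
          unfolding sum.lessThan_Suc_shift C0 CS creation_L2(2)[OF fL Gn] a_def[symmetric] z2 by simp
        also have "\<dots> = a\<^sup>2 * (\<Sum>n<k. (?n n (G n))\<^sup>2)" by (simp add: power_mult_distrib sum_distrib_left)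
        also have "\<dots> \<le> a\<^sup>2 * (fock.nrm G)\<^sup>2" by (intro mult_left_mono fock_partial_sums[OF G]) auto
        finally show ?thesis by (simp add: Suc power_mult_distrib)
      qed simp
      then show "(\<Sum>n<m. (?n n (C n))\<^sup>2) \<le> (a * fock.nrm G)\<^sup>2" for m .
    qed (use a0 nG in auto)
    have Ab: "A \<in> fock" "fock.nrm A \<le> a * fock.nrm G"
    proof (rule_tac [!] fock_bounded)
      show "A n \<in> L2 (lift_power \<sigma> \<mu> n)" for n unfolding AS by (rule annihilation_L2(2)[OF fL Gn])
      then show "A n \<in> L2 (lift_power \<sigma> \<mu> n)" for n .
      show "(\<Sum>n<m. (?n n (A n))\<^sup>2) \<le> (a * fock.nrm G)\<^sup>2" for m
      proof -
        have "?n n (A n) \<le> a * ?n (Suc n) (G (Suc n))" for n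
          unfolding AS a_def by (rule annihilation_L2(3)[OF fL Gn])
        then have "(\<Sum>n<m. (?n n (A n))\<^sup>2) \<le> (\<Sum>n<m. (a * ?n (Suc n) (G (Suc n)))\<^sup>2)"
          using \<open>\<And>n. A n \<in> L2 (lift_power \<sigma> \<mu> n)\<close>
          by (intro sum_mono power_mono) (auto intro: semi_inner.nrm_nonneg[OF L2_semi_inner])
        also have "\<dots> = a\<^sup>2 * (\<Sum>n<m. (?n (Suc n) (G (Suc n)))\<^sup>2)" by (simp add: power_mult_distrib sum_distrib_left)
        also have "(\<Sum>n<m. (?n (Suc n) (G (Suc n)))\<^sup>2) \<le> (\<Sum>n<Suc m. (?n n (G n))\<^sup>2)"
          unfolding sum.lessThan_Suc_shift by simp
        also have "\<dots> \<le> (fock.nrm G)\<^sup>2" by (intro fock_partial_sums[OF G]) simp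
        finally show ?thesis by (simp add: power_mult_distrib mult_left_mono)
      qed
      then show "(\<Sum>n<m. (?n n (A n))\<^sup>2) \<le> (a * fock.nrm G)\<^sup>2" for m .
    qed (use a0 nG in auto)
    have Nb: "N \<in> fock" "fock.nrm N \<le> b * fock.nrm G"
    proof (rule_tac [!] fock_bounded)
      have sfm: "(\<lambda>z. snd z * f (fst z)) \<in> borel_measurable lm" by simp
      show NL: "N n \<in> L2 (lift_power \<sigma> \<mu> n)" for n
        by (cases n) (simp_all add: N0 NS subspace_0[OF ss] neutral_L2(1)[OF sfm sf b0 Gn])
      then show "N n \<in> L2 (lift_power \<sigma> \<mu> n)" for n .
      have le: "?n n (N n) \<le> b * ?n n (G n)" for n
      proof (cases n)
        case 0
        then show ?thesis using semi_inner.nrm_nonneg[OF L2_semi_inner Gn[of 0]] b0 by (simp only: N0 z2) simp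
      next
        case (Suc k)
        show ?thesis unfolding Suc NS by (rule neutral_L2(2)[OF sfm sf b0 Gn])
      qed
      show "(\<Sum>n<m. (?n n (N n))\<^sup>2) \<le> (b * fock.nrm G)\<^sup>2" for m
      proof -
        have "(\<Sum>n<m. (?n n (N n))\<^sup>2) \<le> (\<Sum>n<m. (b * ?n n (G n))\<^sup>2)"
          by (intro sum_mono power_mono le semi_inner.nrm_nonneg[OF L2_semi_inner NL])
        also have "\<dots> = b\<^sup>2 * (\<Sum>n<m. (?n n (G n))\<^sup>2)" by (simp add: power_mult_distrib sum_distrib_left)
        also have "\<dots> \<le> b\<^sup>2 * (fock.nrm G)\<^sup>2" by (intro mult_left_mono fock_partial_sums[OF G]) auto
        finally show ?thesis by (simp add: power_mult_distrib)
      qed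
      then show "(\<Sum>n<m. (?n n (N n))\<^sup>2) \<le> (b * fock.nrm G)\<^sup>2" for m .
    qed (use b0 nG in auto)
    have X: "X_op \<sigma> \<mu> f G = C + A + N"
      by (auto simp: X_op_def C_def A_def N_def fun_eq_iff)
    show "X_op \<sigma> \<mu> f G \<in> fock" unfolding X using Ab Cb Nb by blast
    have "fock.nrm (C + A + N) \<le> fock.nrm (C + A) + fock.nrm N" using Ab Cb Nb by (intro fock.nrm_triangle) auto
    also have "\<dots> \<le> fock.nrm C + fock.nrm A + fock.nrm N" using Ab Cb by (intro add_right_mono fock.nrm_triangle)
    also have "\<dots> \<le> (a + a + b) * fock.nrm G" using Ab Cb Nb by (simp add: algebra_simps)
    finally show "fock.nrm (X_op \<sigma> \<mu> f G) \<le> (a + a + b) * fock.nrm G" unfolding X .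
  qed
qed

lemma X_op_in_fock: "f \<in> nice \<Longrightarrow> G \<in> fock \<Longrightarrow> X_op \<sigma> \<mu> f G \<in> fock"
  using X_op_bounded by blast

text \<open>Equality of functions would be too much: on a null set of \<open>y\<close> the slices of
  \<open>G\<close> and \<open>H\<close> may fail to be integrable against \<open>f\<close>, and
  there the Bochner integral is not additive.\<close>

lemma X_op_diff:
  assumes f: "f \<in> nice" and G: "G \<in> fock" and H: "H \<in> fock"
  shows "fock.nrm (X_op \<sigma> \<mu> f (G - H) - (X_op \<sigma> \<mu> f G - X_op \<sigma> \<mu> f H)) = 0"
proof -
  have "X_op \<sigma> \<mu> f (G - H) - (X_op \<sigma> \<mu> f G - X_op \<sigma> \<mu> f H) \<in> fock"
    using X_op_in_fock[OF f] G H by blast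
  moreover have "AE y in lift_power \<sigma> \<mu> n. (X_op \<sigma> \<mu> f (G - H) - (X_op \<sigma> \<mu> f G - X_op \<sigma> \<mu> f H)) n y = 0" for n
    using annihilation_L2(1)[OF nice_L2[OF f] fock_component[OF G, of "Suc n"]]
      annihilation_L2(1)[OF nice_L2[OF f] fock_component[OF H, of "Suc n"]]
  proof eventually_elim
    case (elim y)
    have "integrable lm (\<lambda>w. f (fst w) * G (Suc n) (tuple_cons n w y))" "integrable lm (\<lambda>w. f (fst w) * H (Suc n) (tuple_cons n w y))"
      using L2_integrable_mult[OF nice_L2[OF f] elim(1)] L2_integrable_mult[OF nice_L2[OF f] elim(2)] by simp_all
    then show ?case by (simp add: X_op_def algebra_simps)
  qed
  ultimately show ?thesis using fock_nrm_0_iff by blast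
qed

lemma X_op_add:
  assumes f: "f \<in> nice" and G: "G \<in> fock" and H: "H \<in> fock"
  shows "fock.nrm (X_op \<sigma> \<mu> f (G + H) - (X_op \<sigma> \<mu> f G + X_op \<sigma> \<mu> f H)) = 0"
proof -
  have GH: "G + H \<in> fock" using G H by blast
  note XF = X_op_in_fock[OF f G] X_op_in_fock[OF f H] X_op_in_fock[OF f GH]
  have "G + H - H = G" by simp
  then have 0: "fock.nrm (X_op \<sigma> \<mu> f G - (X_op \<sigma> \<mu> f (G + H) - X_op \<sigma> \<mu> f H)) = 0"
    using X_op_diff[OF f GH H] by metis
  have "X_op \<sigma> \<mu> f (G + H) - (X_op \<sigma> \<mu> f G + X_op \<sigma> \<mu> f H) = - (X_op \<sigma> \<mu> f G - (X_op \<sigma> \<mu> f (G + H) - X_op \<sigma> \<mu> f H))"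
    by (simp add: algebra_simps)
  then show ?thesis using 0 fock.nrm_minus XF fock.H_closed by metis
qed

lemma X_op_sclosure:
  assumes f: "f \<in> nice" and S: "S \<subseteq> fock" "S' \<subseteq> fock"
    and SS: "\<And>P. P \<in> S \<Longrightarrow> \<exists>Q\<in>S'. fock.nrm (X_op \<sigma> \<mu> f P - Q) = 0"
    and G: "G \<in> sclosure fock (fock_inner \<sigma> \<mu>) S"
  shows "X_op \<sigma> \<mu> f G \<in> sclosure fock (fock_inner \<sigma> \<mu>) S'"
proof -
  have GF: "G \<in> fock" using G by (simp add: sclosure_def)
  obtain c where c: "c \<ge> 0" "\<And>G. G \<in> fock \<Longrightarrow> fock.nrm (X_op \<sigma> \<mu> f G) \<le> c * fock.nrm G"
    using X_op_bounded[OF f] by blast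
  show ?thesis unfolding sclosure_def
  proof safe
    show "X_op \<sigma> \<mu> f G \<in> fock" by (rule X_op_in_fock[OF f GF])
    fix e :: real assume e: "e > 0"
    \<comment> \<open>The summand 1 avoids a division by zero when \<open>c = 0\<close>.\<close>
    then have "e / (c + 1) > 0" using c by simp
    then obtain P where P: "P \<in> S" "fock.nrm (P - G) < e / (c + 1)" using G by (auto simp: sclosure_def)
    then obtain Q where Q: "Q \<in> S'" "fock.nrm (X_op \<sigma> \<mu> f P - Q) = 0" using SS by blast
    have PF: "P \<in> fock" "Q \<in> fock" "P - G \<in> fock" using P Q S GF by auto
    note XF = X_op_in_fock[OF f PF(1)] X_op_in_fock[OF f GF] X_op_in_fock[OF f PF(3)]
    have "fock.nrm (Q - X_op \<sigma> \<mu> f G) \<le> fock.nrm (Q - X_op \<sigma> \<mu> f P) + fock.nrm (X_op \<sigma> \<mu> f P - X_op \<sigma> \<mu> f G)"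
      using XF PF by (intro fock.nrm_triangle3) auto
    also have "fock.nrm (Q - X_op \<sigma> \<mu> f P) = 0" using Q fock.nrm_diff_commute XF PF by metis
    also have "0 + fock.nrm (X_op \<sigma> \<mu> f P - X_op \<sigma> \<mu> f G) \<le>
        fock.nrm (X_op \<sigma> \<mu> f P - X_op \<sigma> \<mu> f G - X_op \<sigma> \<mu> f (P - G)) + fock.nrm (X_op \<sigma> \<mu> f (P - G))"
      using fock.nrm_triangle[of "X_op \<sigma> \<mu> f P - X_op \<sigma> \<mu> f G - X_op \<sigma> \<mu> f (P - G)" "X_op \<sigma> \<mu> f (P - G)"] XF by simp
    also have "fock.nrm (X_op \<sigma> \<mu> f P - X_op \<sigma> \<mu> f G - X_op \<sigma> \<mu> f (P - G)) = 0"
      using X_op_diff[OF f PF(1) GF] fock.nrm_diff_commute XF fock.H_closed(3) by metis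
    also have "0 + fock.nrm (X_op \<sigma> \<mu> f (P - G)) \<le> c * fock.nrm (P - G)" using c(2)[OF PF(3)] by simp
    also have "\<dots> \<le> c * (e / (c + 1))" using P c by (intro mult_left_mono) auto
    also have "\<dots> < e" using c e by (simp add: field_simps)
    finally show "\<exists>Q\<in>S'. fock.nrm (Q - X_op \<sigma> \<mu> f G) < e" using Q by blast
  qed
qed

section \<open>Monomials applied to the vacuum\<close>

text \<open>Kernels take full sequences as arguments, so that measurability refers to one fixed
  space for all \<open>k\<close> and \<open>m\<close>. Only the first \<open>k\<close> coordinates
  of \<open>x\<close> (the z-variables still to be consumed) and the first \<open>m\<close>
  coordinates of \<open>y\<close> have to stay in a compact set.\<close>

definition nice_kernel :: "nat \<Rightarrow> nat \<Rightarrow> ((nat \<Rightarrow> 't) \<Rightarrow> (nat \<Rightarrow> 't) \<Rightarrow> real) set" where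
  "nice_kernel k m = {F. (\<lambda>p. F (fst p) (snd p)) \<in> borel_measurable borel \<and> (\<exists>B. \<forall>x y. \<bar>F x y\<bar> \<le> B) \<and>
     (\<exists>L. compact L \<and> (\<forall>x y. F x y \<noteq> 0 \<longrightarrow> (\<forall>i<k. x i \<in> L) \<and> (\<forall>j<m. y j \<in> L)))}"

lemma nice_kernelD:
  assumes "F \<in> nice_kernel k m"
  shows "(\<lambda>p. F (fst p) (snd p)) \<in> borel_measurable borel" "\<exists>B. \<forall>x y. \<bar>F x y\<bar> \<le> B"
    "\<exists>L. compact L \<and> (\<forall>x y. F x y \<noteq> 0 \<longrightarrow> (\<forall>i<k. x i \<in> L) \<and> (\<forall>j<m. y j \<in> L))"
  using assms by (simp_all add: nice_kernel_def)

text \<open>No fibre coordinate of a z-variable occurs, since test functions depend on the points of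
  T only; powers of s appear only in the y-variables, through \<open>N_op\<close>.\<close>

definition term_kernel :: "nat \<Rightarrow> ((nat \<Rightarrow> 't) \<Rightarrow> (nat \<Rightarrow> 't) \<Rightarrow> real) \<Rightarrow> (nat \<Rightarrow> nat) \<Rightarrow> 't fock_kernel" where
  "term_kernel m0 F a = (\<lambda>m z y. if m = m0
     then F (\<lambda>i. fst (z i)) (\<lambda>i. fst (y i)) * (\<Prod>j<m0. snd (y j) ^ a j) else 0)"

text \<open>\<open>d\<close> bounds the weight \<open>m + \<Sum> a j\<close>, which \<open>C\<close>, \<open>N\<close> raise by one and \<open>A\<close> does not raise.\<close>
inductive poly_kernel :: "nat \<Rightarrow> nat \<Rightarrow> 't fock_kernel \<Rightarrow> bool" for k d where
  zero: "poly_kernel k d 0"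
| add: "poly_kernel k d h \<Longrightarrow> poly_kernel k d h' \<Longrightarrow> poly_kernel k d (h + h')"
| monom: "F \<in> nice_kernel k m \<Longrightarrow> m + (\<Sum>j<m. a j) \<le> d \<Longrightarrow> poly_kernel k d (term_kernel m F a)"

lemma coordinate_measurable [measurable]: "(\<lambda>x::nat \<Rightarrow> 't. x i) \<in> borel_measurable borel"
  by (intro borel_measurable_continuous_onI continuous_on_product_coordinates)

lemma fst_measurable_pp [measurable]: "fst \<in> measurable (borel :: ((nat \<Rightarrow> 't) \<times> (nat \<Rightarrow> 't)) measure) borel"
  and snd_measurable_pp [measurable]: "snd \<in> measurable (borel :: ((nat \<Rightarrow> 't) \<times> (nat \<Rightarrow> 't)) measure) borel"
  by (simp_all add: borel_prod[symmetric])

lemma kernel_compose: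
  fixes a b :: "'x \<Rightarrow> nat \<Rightarrow> 't"
  assumes F: "(\<lambda>p. F (fst p) (snd p)) \<in> borel_measurable borel"
    and a: "\<And>i. (\<lambda>p. a p i) \<in> borel_measurable M" and b: "\<And>i. (\<lambda>p. b p i) \<in> borel_measurable M"
  shows "(\<lambda>p. F (a p) (b p) :: real) \<in> borel_measurable M"
proof -
  have "a \<in> borel_measurable M" "b \<in> borel_measurable M"
    using a b by (auto intro: measurable_coordinatewise_then_product)
  then have "(\<lambda>p. (a p, b p)) \<in> borel_measurable M" by (simp add: borel_prod[symmetric])
  from measurable_compose[OF this F] show ?thesis by simp
qed

lemma power_bounded:
  assumes "compact L" shows "\<exists>B. AE z in lm. fst z \<in> L \<longrightarrow> \<bar>snd z ^ n\<bar> \<le> B"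
proof -
  obtain R where R: "R > 0" "AE z in lm. fst z \<in> L \<longrightarrow> \<bar>snd z\<bar> \<le> R" using kernel_bound[OF assms] by metis
  have "AE z in lm. fst z \<in> L \<longrightarrow> \<bar>snd z ^ n\<bar> \<le> R ^ n" using R(2)
    by eventually_elim (auto simp: power_abs intro: power_mono)
  then show ?thesis by blast
qed

lemma nice_indicator: "compact L \<Longrightarrow> A \<in> sets borel \<Longrightarrow> A \<subseteq> L \<Longrightarrow> indicat_real A \<in> nice"
  by (auto simp: nice_def indicator_def intro!: exI[of _ 1])

lemma nice_power_L2: "f \<in> nice \<Longrightarrow> (\<lambda>z. f (fst z) * snd z ^ n) \<in> L2 lm"
  by (rule nice_times_bounded_L2) (auto intro: power_bounded)

lemma indicator_power_integrable:
  assumes "compact L" shows "integrable lm (\<lambda>z. indicat_real L (fst z) * \<bar>snd z\<bar> ^ n)"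
proof -
  have i: "indicat_real L \<in> nice" using nice_indicator[OF assms borel_compact[OF assms]] by simp
  have "integrable lm (\<lambda>z. indicat_real L (fst z) * (indicat_real L (fst z) * snd z ^ n))"
    by (rule L2_integrable_mult[OF nice_L2[OF i] nice_power_L2[OF i]])
  then have "integrable lm (\<lambda>z. \<bar>indicat_real L (fst z) * (indicat_real L (fst z) * snd z ^ n)\<bar>)" by simp
  then show ?thesis by (rule Bochner_Integration.integrable_cong[THEN iffD1, rotated -1]) (auto simp: abs_mult power_abs indicator_def)
qed

text \<open>The integrand is dominated, uniformly in \<open>x\<close> and \<open>y\<close>, by a
  constant times 1_L(t) |s|^n, which is integrable because s is bounded over the compact set L. The
  value at \<open>undefined\<close> is what a restricted tuple returns outside its index
  range.\<close>

lemma annihilation_kernel: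
  fixes n :: nat
  assumes F: "F \<in> nice_kernel (Suc k) (Suc m)"
  defines "G \<equiv> \<lambda>x y w. F (x(k := fst w)) (\<lambda>i. case i of 0 \<Rightarrow> fst w | Suc j \<Rightarrow> if j < m then y j else fst (undefined :: 't \<times> real)) * snd w ^ n"
  shows "integrable lm (G x y)" and "(\<lambda>x y. \<integral>w. G x y w \<partial>lm) \<in> nice_kernel k m"
proof -
  interpret Q: sigma_finite_measure lm by (rule sigma_finite_lm)
  obtain B where B: "\<And>x y. \<bar>F x y\<bar> \<le> B" using nice_kernelD(2)[OF F] by blast
  obtain L where L: "compact L" "\<And>x y. F x y \<noteq> 0 \<Longrightarrow> (\<forall>i<Suc k. x i \<in> L) \<and> (\<forall>j<Suc m. y j \<in> L)"
    using nice_kernelD(3)[OF F] by metis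
  note Fm = nice_kernelD(1)[OF F]
  have B0: "B \<ge> 0" using B abs_ge_zero order_trans by blast
  have Gm: "(\<lambda>(p, w). G (fst p) (snd p) w) \<in> borel_measurable ((borel :: ((nat \<Rightarrow> 't) \<times> (nat \<Rightarrow> 't)) measure) \<Otimes>\<^sub>M lm)"
    unfolding G_def split_beta
  proof (intro borel_measurable_times kernel_compose[OF Fm])
    show "(\<lambda>p. ((fst (fst p))(k := fst (snd p))) i) \<in> borel_measurable ((borel :: ((nat \<Rightarrow> 't) \<times> (nat \<Rightarrow> 't)) measure) \<Otimes>\<^sub>M lm)" for i
      by (cases "i = k") auto
    show "(\<lambda>p. case i of 0 \<Rightarrow> fst (snd p) | Suc j \<Rightarrow> if j < m then snd (fst p) j else fst (undefined :: 't \<times> real))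
        \<in> borel_measurable ((borel :: ((nat \<Rightarrow> 't) \<times> (nat \<Rightarrow> 't)) measure) \<Otimes>\<^sub>M lm)" for i
      by (cases i) auto
  qed auto
  have Gb: "\<bar>G x y w\<bar> \<le> B * (indicat_real L (fst w) * \<bar>snd w\<bar> ^ n)" for x y w
  proof (cases "G x y w = 0")
    case False
    then have "fst w \<in> L" using L(2) unfolding G_def by force
    then show ?thesis using B by (auto simp: G_def abs_mult power_abs intro!: mult_right_mono)
  qed (use B0 in auto)
  have ii: "integrable lm (\<lambda>w. B * (indicat_real L (fst w) * \<bar>snd w\<bar> ^ n))"
    using indicator_power_integrable[OF L(1)] by simp
  have Gm1: "G x y \<in> borel_measurable lm" for x y
    using measurable_compose[OF measurable_Pair1'[of "(x, y)"] Gm] by simp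
  show int: "integrable lm (G x y)" for x y
    by (rule Bochner_Integration.integrable_bound[OF ii Gm1]) (use Gb in \<open>simp add: order_trans[OF _ abs_ge_self]\<close>)
  have "(\<lambda>p. \<integral>w. G (fst p) (snd p) w \<partial>lm) \<in> borel_measurable (borel :: ((nat \<Rightarrow> 't) \<times> (nat \<Rightarrow> 't)) measure)"
    using Gm by measurable
  moreover have "\<bar>\<integral>w. G x y w \<partial>lm\<bar> \<le> (\<integral>w. B * (indicat_real L (fst w) * \<bar>snd w\<bar> ^ n) \<partial>lm)" for x y
  proof -
    have "\<bar>\<integral>w. G x y w \<partial>lm\<bar> \<le> (\<integral>w. \<bar>G x y w\<bar> \<partial>lm)" by (rule integral_abs_bound)
    also have "\<dots> \<le> (\<integral>w. B * (indicat_real L (fst w) * \<bar>snd w\<bar> ^ n) \<partial>lm)"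
      using int by (intro integral_mono ii Gb) auto
    finally show ?thesis .
  qed
  moreover have "(\<forall>i<k. x i \<in> L) \<and> (\<forall>j<m. y j \<in> L)" if "(\<integral>w. G x y w \<partial>lm) \<noteq> 0" for x y
  proof -
    have "\<exists>w. G x y w \<noteq> 0"
    proof (rule ccontr)
      assume "\<nexists>w. G x y w \<noteq> 0"
      then have "G x y = (\<lambda>_. 0)" by auto
      then show False using that by simp
    qed
    then obtain w where "G x y w \<noteq> 0" by blast
    then have "F (x(k := fst w)) (\<lambda>i. case i of 0 \<Rightarrow> fst w | Suc j \<Rightarrow> if j < m then y j else fst (undefined :: 't \<times> real)) \<noteq> 0"
      unfolding G_def by (metis mult_zero_left)
    from L(2)[OF this] have *: "(\<forall>i<Suc k. (x(k := fst w)) i \<in> L) \<and>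
      (\<forall>j<Suc m. (case j of 0 \<Rightarrow> fst w | Suc j \<Rightarrow> if j < m then y j else fst (undefined :: 't \<times> real)) \<in> L)"
      by blast
    have "x i \<in> L" if "i < k" for i using *[THEN conjunct1, rule_format, of i] that by simp
    moreover have "y j \<in> L" if "j < m" for j using *[THEN conjunct2, rule_format, of "Suc j"] that by simp
    ultimately show ?thesis by blast
  qed
  ultimately show "(\<lambda>x y. \<integral>w. G x y w \<partial>lm) \<in> nice_kernel k m"
    using L(1) unfolding nice_kernel_def by blast
qed

text \<open>Integrability of the slices is proved along with the shape of the kernel, because
  \<open>A_op\<close> is additive only on kernels with integrable slices.\<close>

lemma poly_kernel_step:
  assumes "poly_kernel (Suc k) d h"
  shows "poly_kernel k (Suc d) (C_op k h + A_op \<sigma> \<mu> k h + N_op k h) \<and>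
    (\<forall>m z y. integrable lm (\<lambda>w. h (m + 1) (z(k := w)) (tuple_cons m w y)))"
  using assms
proof induction
  case zero
  have "C_op k 0 + A_op \<sigma> \<mu> k 0 + N_op k 0 = (0 :: 't fock_kernel)"
    by (auto simp: fun_eq_iff C_op_def A_op_def N_op_def)
  then show ?case by (metis (no_types, lifting) poly_kernel.zero integrable_zero zero_fun_apply Bochner_Integration.integrable_cong)
next
  case (add h h')
  have eq: "C_op k (h + h') + A_op \<sigma> \<mu> k (h + h') + N_op k (h + h') =
      (C_op k h + A_op \<sigma> \<mu> k h + N_op k h) + (C_op k h' + A_op \<sigma> \<mu> k h' + N_op k h')"
  proof (intro ext)
    fix m z y
    have "integrable lm (\<lambda>w. h (m + 1) (z(k := w)) (tuple_cons m w y))" "integrable lm (\<lambda>w. h' (m + 1) (z(k := w)) (tuple_cons m w y))"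
      using add.IH by blast+
    from Bochner_Integration.integral_add[OF this]
    show "(C_op k (h + h') + A_op \<sigma> \<mu> k (h + h') + N_op k (h + h')) m z y =
      ((C_op k h + A_op \<sigma> \<mu> k h + N_op k h) + (C_op k h' + A_op \<sigma> \<mu> k h' + N_op k h')) m z y"
      by (simp add: C_op_def A_op_def N_op_def algebra_simps)
  qed
  show ?case unfolding eq
  proof (intro conjI allI)
    show "integrable lm (\<lambda>w. (h + h') (m + 1) (z(k := w)) (tuple_cons m w y))" for m z y
      unfolding plus_fun_apply
      by (intro Bochner_Integration.integrable_add) (use add.IH in blast)+
  qed (use add.IH in \<open>blast intro: poly_kernel.add\<close>)
next
  case (monom F m a)
  obtain B where B: "\<And>x y. \<bar>F x y\<bar> \<le> B" using nice_kernelD(2)[OF monom(1)] by blast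
  obtain L where L: "compact L" "\<And>x y. F x y \<noteq> 0 \<Longrightarrow> (\<forall>i<Suc k. x i \<in> L) \<and> (\<forall>j<m. y j \<in> L)"
    using nice_kernelD(3)[OF monom(1)] by metis
  note Fm = nice_kernelD(1)[OF monom(1)]
  have upd: "(\<lambda>i. fst ((z(k := w)) i)) = (\<lambda>i. fst (z i))(k := fst w)" for z :: "nat \<Rightarrow> 't \<times> real" and w by auto
  have upd': "(\<lambda>i. fst (if i = k then w else z i)) = (\<lambda>i. fst (z i))(k := fst w)" for z :: "nat \<Rightarrow> 't \<times> real" and w by auto
  define F1 where "F1 = (\<lambda>x y. F (x(k := y 0)) (\<lambda>i. if i < m then y (Suc i) else fst (undefined :: 't \<times> real)))"
  have F1: "F1 \<in> nice_kernel k (Suc m)"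
  proof -
    have "(\<lambda>p. F1 (fst p) (snd p)) \<in> borel_measurable borel" unfolding F1_def
    proof (rule kernel_compose[OF Fm])
      show "(\<lambda>p. ((fst p)(k := snd p 0)) i) \<in> borel_measurable (borel :: ((nat \<Rightarrow> 't) \<times> (nat \<Rightarrow> 't)) measure)" for i
        by (cases "i = k") auto
      show "(\<lambda>p. if i < m then snd p (Suc i) else fst (undefined :: 't \<times> real)) \<in> borel_measurable (borel :: ((nat \<Rightarrow> 't) \<times> (nat \<Rightarrow> 't)) measure)" for i
        by auto
    qed
    moreover have "(\<forall>i<k. x i \<in> L) \<and> (\<forall>j<Suc m. y j \<in> L)" if "F1 x y \<noteq> 0" for x y
    proof -
      have *: "(\<forall>i<Suc k. (x(k := y 0)) i \<in> L) \<and> (\<forall>j<m. (if j < m then y (Suc j) else fst (undefined :: 't \<times> real)) \<in> L)"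
        using that unfolding F1_def by (rule L(2))
      have "x i \<in> L" if "i < k" for i using *[THEN conjunct1, rule_format, of i] that by simp
      moreover have "y j \<in> L" if "j < Suc m" for j
        using *[THEN conjunct1, rule_format, of k] *[THEN conjunct2, rule_format, of "j - 1"] that by (cases j) auto
      ultimately show ?thesis by blast
    qed
    ultimately show ?thesis using B L(1) unfolding nice_kernel_def F1_def by blast
  qed
  \<comment> \<open>The variable just created carries the power 0 of s, and the old exponents move
    up by one place.\<close>
  have C: "C_op k (term_kernel m F a) = term_kernel (Suc m) F1 (\<lambda>j. case j of 0 \<Rightarrow> 0 | Suc i \<Rightarrow> a i)"
  proof (intro ext)
    fix m' and z y :: "nat \<Rightarrow> 't \<times> real"
    have t: "(\<lambda>i. fst (tuple_tail (Suc m) y i)) = (\<lambda>i. if i < m then fst (y (Suc i)) else fst (undefined :: 't \<times> real))"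
      by (auto simp: tuple_tail_def fun_eq_iff)
    have p: "(\<Prod>j<m. snd (tuple_tail (Suc m) y j) ^ a j) = (\<Prod>j<m. snd (y (Suc j)) ^ a j)"
      by (intro prod.cong) (auto simp: tuple_tail_def)
    show "C_op k (term_kernel m F a) m' z y = term_kernel (Suc m) F1 (\<lambda>j. case j of 0 \<Rightarrow> 0 | Suc i \<Rightarrow> a i) m' z y"
      by (cases m') (auto simp: C_op_def term_kernel_def upd t p F1_def prod.lessThan_Suc_shift simp del: prod.lessThan_Suc fun_upd_apply)
  qed
  have Cg: "poly_kernel k (Suc d) (C_op k (term_kernel m F a))" unfolding C
    using F1 monom(2) by (intro poly_kernel.monom) (simp_all add: sum.lessThan_Suc_shift del: sum.lessThan_Suc)
  have Ng: "poly_kernel k (Suc d) (N_op k (term_kernel m F a))"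
  proof (cases m)
    case 0
    then have "N_op k (term_kernel m F a) = 0" by (auto simp: fun_eq_iff N_op_def term_kernel_def)
    then show ?thesis by (simp only: poly_kernel.zero)
  next
    case (Suc m1)
    define F2 where "F2 = (\<lambda>x y. F (x(k := y 0)) y)"
    have F2: "F2 \<in> nice_kernel k m"
    proof -
      have "(\<lambda>p. F2 (fst p) (snd p)) \<in> borel_measurable borel" unfolding F2_def
      proof (rule kernel_compose[OF Fm])
        show "(\<lambda>p. ((fst p)(k := snd p 0)) i) \<in> borel_measurable (borel :: ((nat \<Rightarrow> 't) \<times> (nat \<Rightarrow> 't)) measure)" for i
          by (cases "i = k") auto
      qed auto
      moreover have "(\<forall>i<k. x i \<in> L) \<and> (\<forall>j<m. y j \<in> L)" if "F2 x y \<noteq> 0" for x y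
      proof -
        have *: "(\<forall>i<Suc k. (x(k := y 0)) i \<in> L) \<and> (\<forall>j<m. y j \<in> L)"
          using that unfolding F2_def by (rule L(2))
        have "x i \<in> L" if "i < k" for i using *[THEN conjunct1, rule_format, of i] that by simp
        then show ?thesis using * by blast
      qed
      ultimately show ?thesis using B L(1) unfolding nice_kernel_def F2_def by blast
    qed
    have N: "N_op k (term_kernel m F a) = term_kernel m F2 (a(0 := Suc (a 0)))"
      unfolding Suc by (auto simp: fun_eq_iff N_op_def term_kernel_def upd' F2_def prod.lessThan_Suc_shift simp del: prod.lessThan_Suc)
    show ?thesis unfolding N using F2 monom(2)
      by (intro poly_kernel.monom) (auto simp: Suc sum.lessThan_Suc_shift simp del: sum.lessThan_Suc)
  qed
  \<comment> \<open>Contraction integrates out the first y-variable together with its power of s, so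
    the weight drops by \<open>1 + a 0\<close>; the bound \<open>Suc d\<close> is generous
    here.\<close>
  have Ag: "poly_kernel k (Suc d) (A_op \<sigma> \<mu> k (term_kernel m F a)) \<and>
     (\<forall>m' z y. integrable lm (\<lambda>w. term_kernel m F a (m' + 1) (z(k := w)) (tuple_cons m' w y)))"
  proof (cases m)
    case 0
    then have "A_op \<sigma> \<mu> k (term_kernel m F a) = 0" by (auto simp: fun_eq_iff A_op_def term_kernel_def)
    then have "poly_kernel k (Suc d) (A_op \<sigma> \<mu> k (term_kernel m F a))" by (simp only: poly_kernel.zero)
    then show ?thesis using 0 by (auto simp: term_kernel_def)
  next
    case (Suc m1)
    define G where "G = (\<lambda>x y w. F (x(k := fst w)) (\<lambda>i. case i of 0 \<Rightarrow> fst w | Suc j \<Rightarrow> if j < m1 then y j else fst (undefined :: 't \<times> real)) * snd w ^ a 0)"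
    have G: "integrable lm (G x y)" "(\<lambda>x y. \<integral>w. G x y w \<partial>lm) \<in> nice_kernel k m1" for x y
      using annihilation_kernel[where F=F and k=k and m=m1 and n="a 0"] monom(1) unfolding Suc G_def by auto
    have t: "(\<lambda>i. fst (tuple_cons m1 w y i)) = (\<lambda>i. case i of 0 \<Rightarrow> fst w | Suc j \<Rightarrow> if j < m1 then fst (y j) else fst (undefined :: 't \<times> real))"
      for w and y :: "nat \<Rightarrow> 't \<times> real"
      by (auto simp: tuple_cons_def fun_eq_iff split: nat.splits)
    have p: "(\<Prod>j<m1. snd (tuple_cons m1 w y (Suc j)) ^ a (Suc j)) = (\<Prod>j<m1. snd (y j) ^ a (Suc j))"
      for w and y :: "nat \<Rightarrow> 't \<times> real"
      by (intro prod.cong) (auto simp: tuple_cons_def)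
    have e: "term_kernel m F a (m' + 1) (z(k := w)) (tuple_cons m' w y) =
        (if m' = m1 then G (\<lambda>i. fst (z i)) (\<lambda>i. fst (y i)) w * (\<Prod>j<m1. snd (y j) ^ a (Suc j)) else 0)" for m' z y w
      by (auto simp: term_kernel_def Suc upd' t p G_def prod.lessThan_Suc_shift simp del: prod.lessThan_Suc)
    have "A_op \<sigma> \<mu> k (term_kernel m F a) = term_kernel m1 (\<lambda>x y. \<integral>w. G x y w \<partial>lm) (\<lambda>j. a (Suc j))"
      unfolding A_op_def e by (auto simp: fun_eq_iff term_kernel_def)
    moreover have "poly_kernel k (Suc d) (term_kernel m1 (\<lambda>x y. \<integral>w. G x y w \<partial>lm) (\<lambda>j. a (Suc j)))"
      using G(2) monom(2) by (intro poly_kernel.monom) (auto simp: Suc sum.lessThan_Suc_shift simp del: sum.lessThan_Suc)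
    moreover have "integrable lm (\<lambda>w. if m' = m1 then G (\<lambda>i. fst (z i)) (\<lambda>i. fst (y i)) w * (\<Prod>j<m1. snd (y j) ^ a (Suc j)) else 0)"
      for m' and z y :: "nat \<Rightarrow> 't \<times> real"
      using G(1) by (cases "m' = m1") auto
    ultimately show ?thesis unfolding e by auto
  qed
  show ?case using Cg Ng Ag by (blast intro: poly_kernel.add)
qed

lemma poly_kernel_CAN_power:
  "poly_kernel k d h \<Longrightarrow> poly_kernel 0 (d + k) (CAN_power \<sigma> \<mu> k h)"
proof (induction k arbitrary: d h)
  case (Suc k)
  have "poly_kernel 0 (Suc d + k) (CAN_power \<sigma> \<mu> k (C_op k h + A_op \<sigma> \<mu> k h + N_op k h))"
    by (rule Suc.IH[OF poly_kernel_step[OF Suc.prems, THEN conjunct1]])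
  then show ?case by simp
qed simp

lemma test_function_kernel:
  assumes f: "f \<in> test_functions n"
  shows "(\<lambda>x y. f (\<lambda>i\<in>{..<n}. x i)) \<in> nice_kernel n 0"
proof -
  let ?P = "product_topology (\<lambda>_. euclidean :: 't topology) {..<n}"
  obtain L where L: "compactin ?P L" "\<And>x. x \<in> topspace ?P - L \<Longrightarrow> f x = 0"
    and fc: "continuous_map ?P euclideanreal f"
    using f by (auto simp: test_functions_def)
  have "continuous_map (product_topology (\<lambda>_. euclidean) UNIV) ?P (\<lambda>x. \<lambda>i\<in>{..<n}. x i)"
    by (auto simp: continuous_map_componentwise intro!: continuous_map_product_projection)
  from continuous_map_compose[OF this fc]
  have "continuous_on UNIV (\<lambda>x. f (\<lambda>i\<in>{..<n}. x i))"
    by (simp add: o_def euclidean_product_topology)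
  then have m: "(\<lambda>x. f (\<lambda>i\<in>{..<n}. x i)) \<in> borel_measurable borel" by (rule borel_measurable_continuous_onI)
  have m': "(\<lambda>p. f (\<lambda>i\<in>{..<n}. fst p i)) \<in> borel_measurable (borel :: ((nat \<Rightarrow> 't) \<times> (nat \<Rightarrow> 't)) measure)"
    using measurable_compose[OF fst_measurable_pp m] by simp
  have "compactin euclideanreal (f ` L)" by (rule image_compactin[OF L(1) fc])
  then obtain B where B: "\<And>x. x \<in> L \<Longrightarrow> \<bar>f x\<bar> \<le> B"
    by (metis compact_imp_bounded bounded_iff compactin_euclidean_iff image_eqI real_norm_def)
  have B': "\<bar>f (\<lambda>i\<in>{..<n}. x i)\<bar> \<le> max 0 B" for x
    using B[of "\<lambda>i\<in>{..<n}. x i"] L(2)[of "\<lambda>i\<in>{..<n}. x i"] by fastforce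
  define K where "K = (\<Union>i<n. (\<lambda>x. x i) ` L)"
  have "compact ((\<lambda>x. x i) ` L)" if "i < n" for i
  proof -
    have "continuous_map ?P euclidean (\<lambda>x. x i)"
      using that by (intro continuous_map_product_projection) simp
    then show ?thesis using image_compactin[OF L(1), of euclidean "\<lambda>x. x i"] by simp
  qed
  then have "compact K" unfolding K_def by (intro compact_UN) auto
  moreover have "\<forall>i<n. x i \<in> K" if "f (\<lambda>i\<in>{..<n}. x i) \<noteq> 0" for x
  proof safe
    fix i assume i: "i < n"
    have "(\<lambda>i\<in>{..<n}. x i) \<in> L" using that L(2)[of "\<lambda>i\<in>{..<n}. x i"] by auto
    moreover have "x i = (\<lambda>i\<in>{..<n}. x i) i" using i by simp
    ultimately show "x i \<in> K" unfolding K_def using i by blast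
  qed
  ultimately show ?thesis using m' B' unfolding nice_kernel_def by blast
qed

text \<open>The vacuum sits in degree 0, so the initial kernel has weight 0, and each of the n steps
  adds at most one.\<close>

lemma monomial_vacuum:
  assumes f: "f \<in> test_functions n"
  obtains h where "poly_kernel 0 n h" "monomial \<sigma> \<mu> n f vacuum = (\<lambda>m y. h m (\<lambda>_. undefined) y)"
proof -
  have "(\<lambda>m z y. f (\<lambda>i\<in>{..<n}. fst (z i)) * vacuum m y) = term_kernel 0 (\<lambda>x y. f (\<lambda>i\<in>{..<n}. x i)) (\<lambda>_. 0)"
    by (auto simp: fun_eq_iff term_kernel_def vacuum_def)
  moreover have "poly_kernel n 0 (term_kernel 0 (\<lambda>x y. f (\<lambda>i\<in>{..<n}. x i)) (\<lambda>_. 0))"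
    using test_function_kernel[OF f] by (rule poly_kernel.monom) simp
  ultimately have "poly_kernel 0 n (CAN_power \<sigma> \<mu> n (\<lambda>m z y. f (\<lambda>i\<in>{..<n}. fst (z i)) * vacuum m y))"
    using poly_kernel_CAN_power[of n 0] by simp
  then show ?thesis by (rule that) (simp add: monomial_def)
qed

end

text \<open>As rewrite rules, these equations would also eta-expand unapplied sums of functions.\<close>
lemmas fun_apply = plus_fun_apply zero_fun_apply minus_apply scaleR_fun_apply
declare fun_apply [simp del]

lemma (in semi_inner) nrm_orth_sum:
  assumes "finite A" "\<And>i. i \<in> A \<Longrightarrow> x i \<in> H" "\<And>i j. i \<in> A \<Longrightarrow> j \<in> A \<Longrightarrow> i \<noteq> j \<Longrightarrow> ip (x i) (x j) = 0"
  shows "(nrm (sum x A))\<^sup>2 = (\<Sum>i\<in>A. (nrm (x i))\<^sup>2)"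
  using assms
proof (induction A rule: finite_induct)
  case (insert i A)
  have xi: "x i \<in> H" and xA: "sum x A \<in> H" using insert.prems by auto
  have "ip (sum x A) (x i) = (\<Sum>j\<in>A. ip (x j) (x i))" using insert.prems by (intro ip_sum_left) auto
  also have "\<dots> = 0"
  proof (rule sum.neutral, rule ballI)
    fix j assume "j \<in> A"
    then show "ip (x j) (x i) = 0" using insert.hyps insert.prems(2)[of j i] by auto
  qed
  finally have "ip (x i) (sum x A) = 0" using ip_commute[OF xi xA] by simp
  then have "(nrm (x i + sum x A))\<^sup>2 = (nrm (x i))\<^sup>2 + (nrm (sum x A))\<^sup>2"
    by (rule nrm_pythagoras[OF xi xA])
  moreover have "(nrm (sum x A))\<^sup>2 = (\<Sum>j\<in>A. (nrm (x j))\<^sup>2)"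
    using insert.prems by (intro insert.IH) auto
  ultimately show ?case using insert.hyps by simp
qed simp

section \<open>Elementary tensors\<close>

definition tens :: "('b \<Rightarrow> real) list \<Rightarrow> nat \<Rightarrow> (nat \<Rightarrow> 'b) \<Rightarrow> real" where
  "tens us = l2_embed (length us) (\<lambda>y. \<Prod>j<length us. (us ! j) (y j))"

lemma prod_lessThan_append:
  "(\<Prod>j<length us + n. f ((us @ vs) ! j) j) = (\<Prod>j<length us. f (us ! j) j) * (\<Prod>j<n. f (vs ! j) (length us + j))"
  for f :: "'a \<Rightarrow> nat \<Rightarrow> 'b::comm_monoid_mult"
proof (induction n)
  case 0
  show ?case by (auto intro!: prod.cong simp: nth_append)
next
  case (Suc n)
  then show ?case by (simp add: mult.assoc)
qed

lemma tens_append: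
  "tens (us @ vs) = l2_embed (length us + length vs)
    (\<lambda>y. (\<Prod>j<length us. (us ! j) (y j)) * (\<Prod>j<length vs. (vs ! j) (y (length us + j))))"
  unfolding tens_def by (simp add: prod_lessThan_append[where f="\<lambda>u j. u (_ j)"])

lemma tens_Cons:
  "tens (u # us) = l2_embed (Suc (length us)) (\<lambda>y. u (y 0) * (\<Prod>j<length us. (us ! j) (y (Suc j))))"
  unfolding tens_def by (simp add: prod.lessThan_Suc_shift del: prod.lessThan_Suc)

text \<open>With one factor isolated, multilinearity in that slot can be read off.\<close>

lemma tens_slot:
  "tens (us @ u # vs) = l2_embed (length us + Suc (length vs)) (\<lambda>y. u (y (length us)) *
    ((\<Prod>j<length us. (us ! j) (y j)) * (\<Prod>j<length vs. (vs ! j) (y (length us + Suc j)))))"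
  unfolding tens_append
  by (simp add: prod.lessThan_Suc_shift mult_ac del: prod.lessThan_Suc)

lemma tens_slot_add: "tens (us @ (u + v) # vs) = tens (us @ u # vs) + tens (us @ v # vs)"
  unfolding tens_slot by (auto simp: l2_embed_def fun_eq_iff fun_apply distrib_right)

lemma tens_slot_scale: "tens (us @ (c *\<^sub>R u) # vs) = c *\<^sub>R tens (us @ u # vs)"
  unfolding tens_slot by (auto simp: l2_embed_def fun_eq_iff fun_apply)

lemma tens_slot_zero: "tens (us @ 0 # vs) = 0"
  unfolding tens_slot by (auto simp: l2_embed_def fun_eq_iff fun_apply)

lemma tens_slot_sum: "finite A \<Longrightarrow> tens (us @ (sum u A) # vs) = (\<Sum>i\<in>A. tens (us @ u i # vs))"
  by (induction A rule: finite_induct) (simp_all add: tens_slot_zero tens_slot_add)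

lemma tens_slot_diff: "tens (us @ (u - v) # vs) = tens (us @ u # vs) - tens (us @ v # vs)"
  unfolding tens_slot by (auto simp: l2_embed_def fun_eq_iff fun_apply left_diff_distrib)

lemmas tens_Cons_add = tens_slot_add[of "[]", simplified append_Nil]
  and tens_Cons_scale = tens_slot_scale[of "[]", simplified append_Nil]
  and tens_Cons_sum = tens_slot_sum[where us="[]", simplified append_Nil]

lemma vacuum_tens: "vacuum = tens []"
  by (auto simp: vacuum_def tens_def l2_embed_def fun_eq_iff fun_apply)

context jacobi_setting
begin

lemma tens_L2:
  assumes "set us \<subseteq> L2 lm"
  shows "(\<lambda>y. \<Prod>j<length us. (us ! j) (y j)) \<in> L2 (lift_power \<sigma> \<mu> (length us))"
proof -
  have uL: "us ! j \<in> L2 lm" if "j < length us" for j using assms that by auto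
  have "integrable (lift_power \<sigma> \<mu> (length us)) (\<lambda>y. \<Prod>j<length us. ((us ! j) (y j))\<^sup>2)"
    using uL by (intro lm.product_integrable_prod) (auto simp: L2_integrable_square)
  moreover have "(\<lambda>y. \<Prod>j<length us. (us ! j) (y j)) \<in> borel_measurable (lift_power \<sigma> \<mu> (length us))"
    by (intro borel_measurable_prod measurable_compose[OF measurable_component_singleton[where M="\<lambda>_. lm"] L2_measurable[OF uL]]) auto
  ultimately show ?thesis by (simp add: L2_def prod_power_distrib)
qed

lemma tens_fock: "set us \<subseteq> L2 lm \<Longrightarrow> tens us \<in> fock"
  unfolding tens_def fock_l2_sum by (intro l2_embed_in tens_L2)

lemma tens_inner:
  assumes "set us \<subseteq> L2 lm" "set vs \<subseteq> L2 lm"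
  shows "fock_inner \<sigma> \<mu> (tens us) (tens vs) =
    (if length us = length vs then \<Prod>j<length us. l2_inner lm (us ! j) (vs ! j) else 0)"
proof (cases "length us = length vs")
  case True
  have "fock_inner \<sigma> \<mu> (tens us) (tens vs) = (\<integral>y. (\<Prod>j<length us. (us ! j) (y j) * (vs ! j) (y j)) \<partial>lift_power \<sigma> \<mu> (length us))"
    unfolding fock_l2_sum tens_def l2_embed_inner using True by (simp add: l2_embed_def l2_inner_def prod.distrib)
  also have "\<dots> = (\<Prod>j<length us. l2_inner lm (us ! j) (vs ! j))"
    unfolding l2_inner_def using assms True
    by (intro lm.product_integral_prod L2_integrable_mult) auto
  finally show ?thesis using True by simp
next
  case False
  then show ?thesis unfolding fock_l2_sum tens_def l2_embed_inner by (simp add: l2_embed_def l2_inner_def zero_fun_apply)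
qed

lemma tens_nrm:
  assumes "set us \<subseteq> L2 lm"
  shows "fock.nrm (tens us) = (\<Prod>j<length us. snorm (l2_inner lm) (us ! j))"
  unfolding snorm_def tens_inner[OF assms assms]
proof -
  have "sqrt (\<Prod>j<n. l2_inner lm (us ! j) (us ! j)) = (\<Prod>j<n. sqrt (l2_inner lm (us ! j) (us ! j)))" for n
    by (induction n) (simp_all add: real_sqrt_mult)
  then show "sqrt (if length us = length us then \<Prod>j<length us. l2_inner lm (us ! j) (us ! j) else 0) =
    (\<Prod>j<length us. sqrt (l2_inner lm (us ! j) (us ! j)))" by simp
qed

lemma tens_nrm_Cons:
  assumes "u \<in> L2 lm" "set us \<subseteq> L2 lm"
  shows "fock.nrm (tens (u # us)) = snorm (l2_inner lm) u * fock.nrm (tens us)"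
  using assms by (simp add: tens_nrm prod.lessThan_Suc_shift del: prod.lessThan_Suc)

lemma tens_nrm_slot:
  assumes "set us \<subseteq> L2 lm" "u \<in> L2 lm" "set vs \<subseteq> L2 lm" "snorm (l2_inner lm) u = 0"
  shows "fock.nrm (tens (us @ u # vs)) = 0"
proof -
  have "(\<Prod>j<length (us @ u # vs). snorm (l2_inner lm) ((us @ u # vs) ! j)) = 0"
    by (rule prod_zero) (auto intro!: bexI[of _ "length us"] simp: assms nth_append)
  then show ?thesis using assms by (subst tens_nrm) auto
qed

lemma X_op_tens_Nil: "X_op \<sigma> \<mu> f (tens []) = tens [\<lambda>z. f (fst z)]"
proof (intro ext)
  fix m and y :: "nat \<Rightarrow> 't \<times> real"
  show "X_op \<sigma> \<mu> f (tens []) m y = tens [\<lambda>z. f (fst z)] m y"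
    by (auto simp: X_op_def tens_def l2_embed_def zero_fun_apply)
qed

text \<open>An identity of functions, not merely up to null sets: the annihilation integral pulls a
  constant out of the integral, which raises no question of integrability.\<close>

lemma X_op_tens_Cons:
  "X_op \<sigma> \<mu> f (tens (u # us)) = tens ((\<lambda>z. f (fst z)) # u # us) +
    l2_inner lm (\<lambda>z. f (fst z)) u *\<^sub>R tens us + tens ((\<lambda>z. snd z * f (fst z) * u z) # us)"
proof (intro ext)
  fix m and y :: "nat \<Rightarrow> 't \<times> real"
  have t: "(\<Prod>j<k. (us ! j) (tuple_tail (Suc (Suc k)) y (Suc j))) = (\<Prod>j<k. (us ! j) (y (Suc (Suc j))))" for k
    by (intro prod.cong) (auto simp: tuple_tail_def)
  have t0: "tuple_tail (Suc (Suc k)) y 0 = y (Suc 0)" for k by (simp add: tuple_tail_def)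
  have c: "(\<Prod>j<k. (us ! j) (tuple_cons k w y (Suc j))) = (\<Prod>j<k. (us ! j) (y j))" for k w
    by (intro prod.cong) (auto simp: tuple_cons_def)
  have T2: "tens ((\<lambda>z. f (fst z)) # u # us) m y = (if m = Suc (Suc (length us)) then f (fst (y 0)) * (u (y (Suc 0)) * (\<Prod>j<length us. (us ! j) (y (Suc (Suc j))))) else 0)"
    by (simp add: tens_Cons l2_embed_def prod.lessThan_Suc_shift zero_fun_apply del: prod.lessThan_Suc)
  have T0: "tens us m y = (if m = length us then (\<Prod>j<length us. (us ! j) (y j)) else 0)"
    by (simp add: tens_def l2_embed_def zero_fun_apply)
  have I: "(\<integral>w. f (fst w) * tens (u # us) (m + 1) (tuple_cons m w y) \<partial>lm) = l2_inner lm (\<lambda>z. f (fst z)) u * tens us m y"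
    by (auto simp: tens_Cons l2_embed_def zero_fun_apply T0 c l2_inner_def mult.assoc[symmetric])
  have C: "(if m = 0 then 0 else f (fst (y 0)) * tens (u # us) (m - 1) (tuple_tail m y)) = tens ((\<lambda>z. f (fst z)) # u # us) m y"
    unfolding T2 by (cases m) (auto simp: tens_Cons l2_embed_def t t0 zero_fun_apply)
  have N: "(if m = 0 then 0 else snd (y 0) * (f (fst (y 0)) * tens (u # us) m y)) = tens ((\<lambda>z. snd z * f (fst z) * u z) # us) m y"
    by (auto simp: tens_Cons l2_embed_def mult.assoc zero_fun_apply)
  show "X_op \<sigma> \<mu> f (tens (u # us)) m y = (tens ((\<lambda>z. f (fst z)) # u # us) +
    l2_inner lm (\<lambda>z. f (fst z)) u *\<^sub>R tens us + tens ((\<lambda>z. snd z * f (fst z) * u z) # us)) m y"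
    unfolding X_op_def I C N by (simp add: fun_apply)
qed

section \<open>The closure of \<open>CP\<^sup>(\<^sup>n\<^sup>) \<Omega>\<close>\<close>

lemma fst_tuple_measurable:
  "(\<lambda>y. fst (y i)) \<in> borel_measurable (lift_power \<sigma> \<mu> m)"
proof (cases "i < m")
  case True
  have "(\<lambda>y. y i) \<in> measurable (lift_power \<sigma> \<mu> m) lm"
    by (rule measurable_component_singleton) (use True in simp)
  moreover have "fst \<in> measurable lm borel" by simp
  ultimately show ?thesis by (rule measurable_compose)
next
  case False
  then have "fst (y i) = fst (undefined :: 't \<times> real)" if "y \<in> space (lift_power \<sigma> \<mu> m)" for y
    using that by (auto simp: space_PiM PiE_iff extensional_def)
  then show ?thesis by (subst measurable_cong[where g="\<lambda>_. fst (undefined :: 't \<times> real)"]) auto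
qed

text \<open>The term is dominated by a multiple of the elementary tensor with factors 1_L(t) s^(a
  j), where the compact set L contains all coordinates at which \<open>F\<close> is nonzero.\<close>

lemma term_kernel_L2:
  assumes F: "F \<in> nice_kernel 0 m"
  shows "(\<lambda>y. F x (\<lambda>i. fst (y i)) * (\<Prod>j<m. snd (y j) ^ a j)) \<in> L2 (lift_power \<sigma> \<mu> m)" (is "?h \<in> _")
proof -
  obtain B where B: "\<And>x y. \<bar>F x y\<bar> \<le> B" using nice_kernelD(2)[OF F] by blast
  obtain L where L: "compact L" "\<And>x y. F x y \<noteq> 0 \<Longrightarrow> (\<forall>i<0::nat. x i \<in> L) \<and> (\<forall>j<m. y j \<in> L)"
    using nice_kernelD(3)[OF F] by metis
  have "(\<lambda>y. F x (\<lambda>i. fst (y i))) \<in> borel_measurable (lift_power \<sigma> \<mu> m)"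
    by (rule kernel_compose[OF nice_kernelD(1)[OF F]]) (auto intro: fst_tuple_measurable)
  moreover have "(\<lambda>y. \<Prod>j<m. snd (y j) ^ a j) \<in> borel_measurable (lift_power \<sigma> \<mu> m)"
    by (intro borel_measurable_prod borel_measurable_power measurable_compose[OF measurable_component_singleton]) auto
  ultimately have hm: "?h \<in> borel_measurable (lift_power \<sigma> \<mu> m)" by (rule borel_measurable_times)
  have iL: "indicat_real L \<in> nice" using nice_indicator[OF L(1) borel_compact[OF L(1)]] by simp
  define us where "us = map (\<lambda>j z. indicat_real L (fst z) * snd z ^ a j) [0..<m]"
  have us: "set us \<subseteq> L2 lm" using nice_power_L2[OF iL] by (auto simp: us_def)
  have e: "(\<Prod>j<length us. (us ! j) (y j)) = (\<Prod>j<m. indicat_real L (fst (y j)) * snd (y j) ^ a j)" for y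
    by (auto simp: us_def intro!: prod.cong)
  have "integrable (lift_power \<sigma> \<mu> m) (\<lambda>y. B\<^sup>2 * (\<Prod>j<m. indicat_real L (fst (y j)) * snd (y j) ^ a j)\<^sup>2)"
    using L2_integrable_square[OF tens_L2[OF us]] unfolding e by (simp add: us_def)
  then have "integrable (lift_power \<sigma> \<mu> m) (\<lambda>y. (?h y)\<^sup>2)"
  proof (rule Bochner_Integration.integrable_bound)
    show "(\<lambda>y. (?h y)\<^sup>2) \<in> borel_measurable (lift_power \<sigma> \<mu> m)" using hm by simp
    have "\<bar>?h y\<bar> \<le> B * \<bar>\<Prod>j<m. indicat_real L (fst (y j)) * snd (y j) ^ a j\<bar>" for y
    proof (cases "F x (\<lambda>i. fst (y i)) = 0")
      case True
      have "0 \<le> B" using B[of x "\<lambda>_. undefined"] by linarith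
      then show ?thesis by (simp only: True mult_zero_left abs_zero) simp
    next
      case False
      then have "(\<Prod>j<m. indicat_real L (fst (y j)) * snd (y j) ^ a j) = (\<Prod>j<m. snd (y j) ^ a j)"
        using L(2)[OF False] by (intro prod.cong) (auto simp: indicator_def)
      then show ?thesis using B by (simp add: abs_mult mult_right_mono)
    qed
    then have "\<bar>?h y\<bar>\<^sup>2 \<le> (B * \<bar>\<Prod>j<m. indicat_real L (fst (y j)) * snd (y j) ^ a j\<bar>)\<^sup>2" for y
      by (intro power_mono) auto
    then show "AE y in lift_power \<sigma> \<mu> m. norm ((?h y)\<^sup>2) \<le> norm (B\<^sup>2 * (\<Prod>j<m. indicat_real L (fst (y j)) * snd (y j) ^ a j)\<^sup>2)"
      by (simp add: power_mult_distrib)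
  qed
  then show ?thesis using hm by (simp add: L2_def)
qed

lemma poly_kernel_fock:
  assumes "poly_kernel 0 d h" shows "(\<lambda>m y. h m x y) \<in> fock"
  using assms
proof induction
  case zero
  show ?case using fock.H_closed(1) by (simp add: zero_fun_def)
next
  case (add h h')
  have "(\<lambda>m y. (h + h') m x y) = (\<lambda>m y. h m x y) + (\<lambda>m y. h' m x y)" by (auto simp: fun_eq_iff fun_apply)
  then show ?case using add.IH by auto
next
  case (monom F m a)
  have "(\<lambda>n y. term_kernel m F a n x y) = l2_embed m (\<lambda>y. F (\<lambda>i. fst (x i)) (\<lambda>i. fst (y i)) * (\<Prod>j<m. snd (y j) ^ a j))"
    by (auto simp: fun_eq_iff fun_apply term_kernel_def l2_embed_def)
  then show ?case unfolding fock_l2_sum using term_kernel_L2[OF monom(1)] by (simp add: l2_embed_in)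
qed

lemma monomial_vacuum_fock: "f \<in> test_functions n \<Longrightarrow> monomial \<sigma> \<mu> n f vacuum \<in> fock"
  using monomial_vacuum[of f n] poly_kernel_fock by metis

definition CP_image :: "nat \<Rightarrow> 't fock_vector set" where
  "CP_image n = (\<lambda>P. P vacuum) ` CP_le \<sigma> \<mu> n"

text \<open>The counterpart of \<open>MP\<close> on the Fock side of the unitary I, see
  \<open>MP_iff\<close>; all approximation takes place here.\<close>

definition MP_fock :: "nat \<Rightarrow> 't fock_vector set" where
  "MP_fock n = sclosure fock (fock_inner \<sigma> \<mu>) (CP_image n)"

lemma op_vacuum: "(0 :: 't fock_operator) vacuum = 0" "(P + Q :: 't fock_operator) vacuum = P vacuum + Q vacuum"
  "(P - Q :: 't fock_operator) vacuum = P vacuum - Q vacuum" "(c *\<^sub>R P :: 't fock_operator) vacuum = c *\<^sub>R P vacuum"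
  by (rule fun_apply)+

lemma CAN_power_scale:
  "CAN_power \<sigma> \<mu> k (\<lambda>m z y. c * h m z y) = (\<lambda>m z y. c * CAN_power \<sigma> \<mu> k h m z y)"
proof (induction k arbitrary: h)
  case (Suc k)
  have "C_op k (\<lambda>m z y. c * h m z y) + A_op \<sigma> \<mu> k (\<lambda>m z y. c * h m z y) + N_op k (\<lambda>m z y. c * h m z y)
    = (\<lambda>m z y. c * (C_op k h + A_op \<sigma> \<mu> k h + N_op k h) m z y)"
    by (auto simp: fun_eq_iff fun_apply C_op_def A_op_def N_op_def algebra_simps)
  then show ?case using Suc.IH by simp
qed simp

lemma monomial_scale: "monomial \<sigma> \<mu> n (\<lambda>x. c * f x) = c *\<^sub>R monomial \<sigma> \<mu> n f"
  unfolding monomial_def using CAN_power_scale[of n c] by (auto simp: fun_eq_iff fun_apply mult.assoc)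

lemma test_functions_scale: "f \<in> test_functions n \<Longrightarrow> (\<lambda>x. c * f x) \<in> test_functions n"
  by (auto simp: test_functions_def intro: continuous_map_real_mult)

text \<open>\<open>CP_le\<close> consists of sums of monomials without coefficients; a scalar is
  absorbed into the kernels.\<close>

lemma CP_le_subspace: "subspace (CP_le \<sigma> \<mu> n)"
proof (rule subspaceI)
  show "0 \<in> CP_le \<sigma> \<mu> n" by (auto simp: CP_le_def intro!: exI[of _ "[]"])
next
  fix P Q assume "P \<in> CP_le \<sigma> \<mu> n" "Q \<in> CP_le \<sigma> \<mu> n"
  then obtain ps qs where "\<forall>(k, f)\<in>set ps. k \<le> n \<and> f \<in> test_functions k" "P = (\<Sum>(k, f)\<leftarrow>ps. monomial \<sigma> \<mu> k f)"
    "\<forall>(k, f)\<in>set qs. k \<le> n \<and> f \<in> test_functions k" "Q = (\<Sum>(k, f)\<leftarrow>qs. monomial \<sigma> \<mu> k f)"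
    by (auto simp: CP_le_def)
  then show "P + Q \<in> CP_le \<sigma> \<mu> n" by (auto simp: CP_le_def intro!: exI[of _ "ps @ qs"])
next
  fix c P assume "P \<in> CP_le \<sigma> \<mu> n"
  then obtain ps where ps: "\<forall>(k, f)\<in>set ps. k \<le> n \<and> f \<in> test_functions k" "P = (\<Sum>(k, f)\<leftarrow>ps. monomial \<sigma> \<mu> k f)"
    by (auto simp: CP_le_def)
  have "c *\<^sub>R (\<Sum>(k, f)\<leftarrow>ps. monomial \<sigma> \<mu> k f) = (\<Sum>(k, f)\<leftarrow>map (\<lambda>(k, f). (k, \<lambda>x. c * f x)) ps. monomial \<sigma> \<mu> k f)"
    by (induction ps) (auto simp: scaleR_add_right monomial_scale)
  then show "c *\<^sub>R P \<in> CP_le \<sigma> \<mu> n" using ps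
    by (force simp: CP_le_def test_functions_scale intro!: exI[of _ "map (\<lambda>(k, f). (k, \<lambda>x. c * f x)) ps"])
qed

lemma CP_image_subspace: "subspace (CP_image n)"
proof -
  note s = CP_le_subspace[of n]
  show ?thesis unfolding CP_image_def
  proof (rule subspaceI)
    show "0 \<in> (\<lambda>P. P vacuum) ` CP_le \<sigma> \<mu> n" using subspace_0[OF s] by (intro image_eqI[of _ _ 0]) (simp_all add: fun_apply)
    show "x + y \<in> (\<lambda>P. P vacuum) ` CP_le \<sigma> \<mu> n" if "x \<in> (\<lambda>P. P vacuum) ` CP_le \<sigma> \<mu> n" "y \<in> (\<lambda>P. P vacuum) ` CP_le \<sigma> \<mu> n" for x y
      using that subspace_add[OF s] by (force simp flip: op_vacuum)
    show "c *\<^sub>R x \<in> (\<lambda>P. P vacuum) ` CP_le \<sigma> \<mu> n" if "x \<in> (\<lambda>P. P vacuum) ` CP_le \<sigma> \<mu> n" for c x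
      using that subspace_scale[OF s] by (force simp flip: op_vacuum)
  qed
qed

lemma CP_le_induct [consumes 1, case_names zero add]:
  assumes "P \<in> CP_le \<sigma> \<mu> n" and "Q 0"
    and "\<And>k f P. k \<le> n \<Longrightarrow> f \<in> test_functions k \<Longrightarrow> P \<in> CP_le \<sigma> \<mu> n \<Longrightarrow> Q P \<Longrightarrow> Q (monomial \<sigma> \<mu> k f + P)"
  shows "Q P"
proof -
  obtain ps where ps: "\<forall>(k, f)\<in>set ps. k \<le> n \<and> f \<in> test_functions k" "P = (\<Sum>(k, f)\<leftarrow>ps. monomial \<sigma> \<mu> k f)"
    using assms(1) by (auto simp: CP_le_def)
  have "Q (\<Sum>(k, f)\<leftarrow>ps. monomial \<sigma> \<mu> k f)" using ps(1)
  proof (induction ps)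
    case (Cons p ps)
    obtain k f where p: "p = (k, f)" by (cases p)
    have "(\<Sum>(k, f)\<leftarrow>ps. monomial \<sigma> \<mu> k f) \<in> CP_le \<sigma> \<mu> n" using Cons.prems by (auto simp: CP_le_def)
    then have "Q (monomial \<sigma> \<mu> k f + (\<Sum>(k, f)\<leftarrow>ps. monomial \<sigma> \<mu> k f))"
      using Cons p by (intro assms(3)) auto
    then show ?case by (simp add: p)
  qed (use assms(2) in simp)
  then show ?thesis using ps(2) by simp
qed

lemma monomial_CP_le: "k \<le> n \<Longrightarrow> f \<in> test_functions k \<Longrightarrow> monomial \<sigma> \<mu> k f \<in> CP_le \<sigma> \<mu> n"
  by (auto simp: CP_le_def intro!: exI[of _ "[(k, f)]"])

lemma CP_le_vacuum_fock: "P \<in> CP_le \<sigma> \<mu> n \<Longrightarrow> P vacuum \<in> fock"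
  by (induction rule: CP_le_induct) (auto simp: monomial_vacuum_fock op_vacuum)

lemma CP_image_fock: "CP_image n \<subseteq> fock"
  using CP_le_vacuum_fock by (auto simp: CP_image_def)

lemma CP_le_mono: "n \<le> m \<Longrightarrow> CP_le \<sigma> \<mu> n \<subseteq> CP_le \<sigma> \<mu> m"
  unfolding CP_le_def by fastforce

lemma MP_fock_closed: "closed_sub fock (fock_inner \<sigma> \<mu>) (MP_fock n)"
  unfolding MP_fock_def by (rule fock.closed_sub_sclosure[OF CP_image_subspace CP_image_fock])

lemma MP_fock_subspace: "subspace (MP_fock n)" and MP_fock_fock: "MP_fock n \<subseteq> fock"
  using MP_fock_closed by (auto simp: closed_sub_def)

lemma MP_fock_mono: "n \<le> m \<Longrightarrow> MP_fock n \<subseteq> MP_fock m"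
  using CP_le_mono[of n m] unfolding MP_fock_def CP_image_def sclosure_def by blast

lemma CP_image_MP_fock: "CP_image n \<subseteq> MP_fock n"
  unfolding MP_fock_def by (rule fock.sclosure_superset[OF CP_image_fock])

lemma vacuum_MP_fock: "tens [] \<in> MP_fock n"
proof -
  have "monomial \<sigma> \<mu> 0 (\<lambda>_. 1) vacuum = vacuum" by (simp add: monomial_def)
  moreover have "monomial \<sigma> \<mu> 0 (\<lambda>_. 1) \<in> CP_le \<sigma> \<mu> n" by (rule monomial_CP_le) (simp_all add: const_test_functions)
  ultimately have "vacuum \<in> CP_image n" unfolding CP_image_def by (intro image_eqI[where x="monomial \<sigma> \<mu> 0 (\<lambda>_. 1)"]) simp_all
  then show ?thesis using CP_image_MP_fock unfolding vacuum_tens by blast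
qed

text \<open>On monomials X(f) replaces the kernel g by f (x) g, so sums of monomials are mapped, up
  to norm zero, to sums of order one higher. Boundedness of X(f) extends this to the
  closure.\<close>

lemma X_op_MP_fock_Cc:
  assumes f: "f \<in> compactly_supported_continuous" and G: "G \<in> MP_fock n"
  shows "X_op \<sigma> \<mu> f G \<in> MP_fock (Suc n)"
  unfolding MP_fock_def
proof (rule X_op_sclosure[OF _ CP_image_fock CP_image_fock])
  show fn: "f \<in> nice" using f Cc_nice by blast
  show "G \<in> sclosure fock (fock_inner \<sigma> \<mu>) (CP_image n)" using G by (simp add: MP_fock_def)
  fix Q assume "Q \<in> CP_image n"
  then obtain P where P: "P \<in> CP_le \<sigma> \<mu> n" "Q = P vacuum" by (auto simp: CP_image_def)
  have "\<exists>R\<in>CP_image (Suc n). fock.nrm (X_op \<sigma> \<mu> f (P vacuum) - R) = 0" using P(1)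
  proof (induction rule: CP_le_induct)
    case zero
    have "X_op \<sigma> \<mu> f 0 = 0" by (auto simp: X_op_def fun_eq_iff fun_apply)
    then show ?case using subspace_0[OF CP_image_subspace] unfolding op_vacuum by (intro bexI[of _ 0]) auto
  next
    case (add k g P)
    then obtain R where R: "R \<in> CP_image (Suc n)" "fock.nrm (X_op \<sigma> \<mu> f (P vacuum) - R) = 0" by blast
    define M where "M = monomial \<sigma> \<mu> (Suc k) (tensor_test k f g) vacuum"
    have M: "M \<in> CP_image (Suc n)" unfolding M_def CP_image_def
      using add(1) tensor_test_functions[OF f add(2)] by (intro imageI monomial_CP_le) auto
    have MX: "M = X_op \<sigma> \<mu> f (monomial \<sigma> \<mu> k g vacuum)" by (simp add: M_def monomial_tensor)
    have F: "monomial \<sigma> \<mu> k g vacuum \<in> fock" "P vacuum \<in> fock" "R \<in> fock"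
      by (rule monomial_vacuum_fock[OF add(2)] CP_le_vacuum_fock[OF add(3)] subsetD[OF CP_image_fock R(1)])+
    note XF = X_op_in_fock[OF fn F(1)] X_op_in_fock[OF fn F(2)] X_op_in_fock[OF fn fock.H_closed(2)[OF F(1,2)]]
    have "fock.nrm (X_op \<sigma> \<mu> f (monomial \<sigma> \<mu> k g vacuum + P vacuum) - (M + X_op \<sigma> \<mu> f (P vacuum))) = 0"
      unfolding MX by (rule X_op_add[OF fn F(1,2)])
    moreover have "fock.nrm ((M + X_op \<sigma> \<mu> f (P vacuum)) - (M + R)) = 0" using R(2) by simp
    ultimately have "fock.nrm (X_op \<sigma> \<mu> f (monomial \<sigma> \<mu> k g vacuum + P vacuum) - (M + R)) = 0"
    proof (rule fock.nrm_0_trans[rotated 3])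
      show "M + X_op \<sigma> \<mu> f (P vacuum) \<in> fock" "M + R \<in> fock"
        unfolding MX by (rule fock.H_closed(2) XF F)+
    qed (rule XF)
    moreover have "M + R \<in> CP_image (Suc n)" using M R CP_image_subspace by (intro subspace_add)
    ultimately show ?case unfolding op_vacuum by blast
  qed
  then show "\<exists>R\<in>CP_image (Suc n). fock.nrm (X_op \<sigma> \<mu> f Q - R) = 0" using P by simp
qed

section \<open>Norm estimates for a single tensor factor\<close>

lemma L2_sigma_fst:
  assumes f: "f \<in> L2 \<sigma>"
  shows "(\<lambda>z. f (fst z)) \<in> L2 lm" and "snorm (l2_inner lm) (\<lambda>z. f (fst z)) = snorm (l2_inner \<sigma>) f"
proof -
  have [measurable]: "f \<in> borel_measurable borel" using L2_measurable[OF f] by simp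
  have "(\<integral>\<^sup>+z. ennreal ((f (fst z))\<^sup>2) \<partial>lm) = (\<integral>\<^sup>+t. \<integral>\<^sup>+s. ennreal ((f t)\<^sup>2) \<partial>\<mu> t \<partial>\<sigma>)"
    by (subst nn_integral_lm) simp_all
  also have "\<dots> = (\<integral>\<^sup>+t. ennreal ((f t)\<^sup>2) \<partial>\<sigma>)"
    using prob_space.emeasure_space_1[OF prob_mu] by (intro nn_integral_cong) simp
  finally have e: "(\<integral>\<^sup>+z. ennreal ((f (fst z))\<^sup>2) \<partial>lm) = ennreal ((snorm (l2_inner \<sigma>) f)\<^sup>2)"
    by (simp add: nn_integral_L2[OF f])
  then show h: "(\<lambda>z. f (fst z)) \<in> L2 lm" by (simp add: L2_iff_nn_integral)
  have "(snorm (l2_inner lm) (\<lambda>z. f (fst z)))\<^sup>2 = (snorm (l2_inner \<sigma>) f)\<^sup>2"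
    using e nn_integral_L2[OF h] by simp
  then show "snorm (l2_inner lm) (\<lambda>z. f (fst z)) = snorm (l2_inner \<sigma>) f"
    by (subst (asm) power2_eq_iff_nonneg) (auto intro!: semi_inner.nrm_nonneg[OF L2_semi_inner] f h)
qed

lemma L2_bounded_mult:
  assumes f: "f \<in> L2 M" and u: "u \<in> borel_measurable M" "AE z in M. \<bar>u z\<bar> \<le> B" "B \<ge> 0"
  shows "(\<lambda>z. u z * f z) \<in> L2 M" and "snorm (l2_inner M) (\<lambda>z. u z * f z) \<le> B * snorm (l2_inner M) f"
proof -
  note [measurable] = L2_measurable[OF f] u(1)
  have "(\<integral>\<^sup>+z. ennreal ((u z * f z)\<^sup>2) \<partial>M) \<le> (\<integral>\<^sup>+z. ennreal (B\<^sup>2) * ennreal ((f z)\<^sup>2) \<partial>M)"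
  proof (rule nn_integral_mono_AE)
    show "AE z in M. ennreal ((u z * f z)\<^sup>2) \<le> ennreal (B\<^sup>2) * ennreal ((f z)\<^sup>2)"
      using u(2)
    proof eventually_elim
      case (elim z)
      then have "(u z)\<^sup>2 \<le> B\<^sup>2" using u(3) by (simp add: abs_le_square_iff[symmetric])
      then show ?case by (simp add: power_mult_distrib mult_right_mono flip: ennreal_mult)
    qed
  qed
  also have "\<dots> = ennreal ((B * snorm (l2_inner M) f)\<^sup>2)"
    by (simp add: nn_integral_cmult nn_integral_L2[OF f] power_mult_distrib ennreal_mult)
  finally have e: "(\<integral>\<^sup>+z. ennreal ((u z * f z)\<^sup>2) \<partial>M) \<le> ennreal ((B * snorm (l2_inner M) f)\<^sup>2)" .
  then show h: "(\<lambda>z. u z * f z) \<in> L2 M" unfolding L2_iff_nn_integral by (auto simp: le_less_trans)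
  have "(snorm (l2_inner M) (\<lambda>z. u z * f z))\<^sup>2 \<le> (B * snorm (l2_inner M) f)\<^sup>2"
    using e nn_integral_L2[OF h] by simp
  then show "snorm (l2_inner M) (\<lambda>z. u z * f z) \<le> B * snorm (l2_inner M) f"
    by (rule power2_le_imp_le) (use u(3) f in \<open>auto intro!: mult_nonneg_nonneg semi_inner.nrm_nonneg[OF L2_semi_inner]\<close>)
qed

lemma nice_L2_sigma: "f \<in> nice \<Longrightarrow> f \<in> L2 \<sigma>"
proof -
  assume f: "f \<in> nice"
  have m [measurable]: "f \<in> borel_measurable borel" using f by (simp add: nice_def)
  have "(\<integral>\<^sup>+z. ennreal ((f (fst z))\<^sup>2) \<partial>lm) = (\<integral>\<^sup>+t. \<integral>\<^sup>+s. ennreal ((f t)\<^sup>2) \<partial>\<mu> t \<partial>\<sigma>)"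
    by (subst nn_integral_lm) simp_all
  also have "\<dots> = (\<integral>\<^sup>+t. ennreal ((f t)\<^sup>2) \<partial>\<sigma>)"
    using prob_space.emeasure_space_1[OF prob_mu] by (intro nn_integral_cong) simp
  finally have "(\<integral>\<^sup>+t. ennreal ((f t)\<^sup>2) \<partial>\<sigma>) < \<infinity>" using nice_L2[OF f] by (simp add: L2_iff_nn_integral)
  moreover have "f \<in> borel_measurable \<sigma>" by (subst measurable_cong_sets[OF sets_sigma refl]) (rule m)
  ultimately show ?thesis by (simp add: L2_iff_nn_integral)
qed

section \<open>Functions that are polynomial in \<open>s\<close>\<close>

text \<open>Polynomials in s of degree at most l with coefficients in B_0(T), in Horner form: the
  recursion peels off one factor s at a time, as the induction in \<open>tens_MP_fock\<close>
  does.\<close>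

primrec poly_fun :: "nat \<Rightarrow> ('t \<times> real \<Rightarrow> real) set" where
  "poly_fun 0 = {\<lambda>z. b (fst z) | b. b \<in> nice}"
| "poly_fun (Suc l) = {\<lambda>z. b (fst z) + snd z * u z | b u. b \<in> nice \<and> u \<in> poly_fun l}"

lemma nice_zero: "(\<lambda>_. 0) \<in> nice"
  by (auto simp: nice_def intro!: exI[of _ "{}"])

lemma nice_mult:
  assumes "g \<in> borel_measurable borel" "\<And>t. \<bar>g t\<bar> \<le> C" "b \<in> nice"
  shows "(\<lambda>t. g t * b t) \<in> nice"
proof -
  obtain B L where B: "B > 0" "\<And>t. \<bar>b t\<bar> \<le> B" "compact L" "\<And>t. t \<notin> L \<Longrightarrow> b t = 0"
    using niceD[OF assms(3)] by metis
  have "\<bar>g t * b t\<bar> \<le> C * B" for t unfolding abs_mult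
    using assms(2)[of t] B(2)[of t] by (intro mult_mono) auto
  then show ?thesis using assms B by (auto simp: nice_def)
qed

lemma poly_fun_mult:
  assumes "g \<in> borel_measurable borel" "\<And>t. \<bar>g t\<bar> \<le> C"
  shows "u \<in> poly_fun l \<Longrightarrow> (\<lambda>z. g (fst z) * u z) \<in> poly_fun l"
proof (induction l arbitrary: u)
  case 0
  then obtain b where b: "u = (\<lambda>z. b (fst z))" "b \<in> nice" by auto
  show ?case using nice_mult[OF assms b(2)] b(1) by auto
next
  case (Suc l)
  then obtain b v where b: "u = (\<lambda>z. b (fst z) + snd z * v z)" "b \<in> nice" "v \<in> poly_fun l" by auto
  have e: "(\<lambda>z. g (fst z) * u z) = (\<lambda>z. g (fst z) * b (fst z) + snd z * (g (fst z) * v z))"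
    unfolding b by (auto simp: algebra_simps)
  show ?case unfolding e using nice_mult[OF assms b(2)] Suc.IH[OF b(3)] by force
qed

lemma poly_fun_s: "u \<in> poly_fun l \<Longrightarrow> (\<lambda>z. snd z * u z) \<in> poly_fun (Suc l)"
  using nice_zero by force

text \<open>A compact set over which \<open>u\<close> lives is carried through the induction,
  because s is bounded only over compact sets.\<close>

lemma poly_fun_bounded:
  "u \<in> poly_fun l \<Longrightarrow> u \<in> borel_measurable borel \<and> (\<exists>L. compact L \<and> (\<forall>z. fst z \<notin> L \<longrightarrow> u z = 0)) \<and>
    (\<exists>B\<ge>0. AE z in lm. \<bar>u z\<bar> \<le> B)"
proof (induction l arbitrary: u)
  case 0
  then obtain b where b: "u = (\<lambda>z. b (fst z))" "b \<in> nice" by auto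
  obtain B L where B: "B > 0" "\<And>t. \<bar>b t\<bar> \<le> B" "compact L" "\<And>t. t \<notin> L \<Longrightarrow> b t = 0"
    using niceD[OF b(2)] by metis
  have "b \<in> borel_measurable borel" using b by (simp add: nice_def)
  then have "u \<in> borel_measurable borel" unfolding b(1) by simp
  moreover have "\<exists>B\<ge>0. AE z in lm. \<bar>u z\<bar> \<le> B" unfolding b(1) using B by (intro exI[of _ B]) simp
  moreover have "\<exists>L. compact L \<and> (\<forall>z. fst z \<notin> L \<longrightarrow> u z = 0)" unfolding b(1) using B by blast
  ultimately show ?case by blast
next
  case (Suc l)
  then obtain b v where b: "u = (\<lambda>z. b (fst z) + snd z * v z)" "b \<in> nice" "v \<in> poly_fun l" by auto
  obtain B L where B: "B > 0" "\<And>t. \<bar>b t\<bar> \<le> B" "compact L" "\<And>t. t \<notin> L \<Longrightarrow> b t = 0"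
    using niceD[OF b(2)] by metis
  obtain B' L' where B': "v \<in> borel_measurable borel" "compact L'" "\<And>z. fst z \<notin> L' \<Longrightarrow> v z = 0" "B' \<ge> 0" "AE z in lm. \<bar>v z\<bar> \<le> B'"
    using Suc.IH[OF b(3)] by metis
  obtain R where R: "R > 0" "AE z in lm. fst z \<in> L' \<longrightarrow> \<bar>snd z\<bar> \<le> R" using kernel_bound[OF B'(2)] by metis
  have [measurable]: "b \<in> borel_measurable borel" "v \<in> borel_measurable borel" using b B' by (simp_all add: nice_def)
  have "AE z in lm. \<bar>u z\<bar> \<le> B + R * B'" using R(2) B'(5)
  proof eventually_elim
    case (elim z)
    have "\<bar>snd z * v z\<bar> \<le> R * B'"
    proof (cases "fst z \<in> L'")
      case True
      then show ?thesis using elim R(1) by (auto simp: abs_mult intro!: mult_mono)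
    next
      case False
      then show ?thesis using B'(3,4) R(1) by simp
    qed
    then show ?case unfolding b(1) using B(2)[of "fst z"] by linarith
  qed
  moreover have "compact (L \<union> L')" "\<forall>z. fst z \<notin> L \<union> L' \<longrightarrow> u z = 0" using B B' unfolding b(1) by auto
  moreover have "u \<in> borel_measurable borel" unfolding b(1) by simp
  moreover have "B + R * B' \<ge> 0" using B B' R by simp
  ultimately show ?case by blast
qed

lemma poly_fun_L2: assumes u: "u \<in> poly_fun l" shows "u \<in> L2 lm"
proof -
  obtain B L where B: "u \<in> borel_measurable borel" "compact L" "\<And>z. fst z \<notin> L \<Longrightarrow> u z = 0" "B \<ge> 0" "AE z in lm. \<bar>u z\<bar> \<le> B"
    using poly_fun_bounded[OF u] by metis
  have i: "indicat_real L \<in> nice" using nice_indicator[OF B(2) borel_compact[OF B(2)]] by simp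
  have "(\<lambda>z. u z * indicat_real L (fst z)) \<in> L2 lm"
    by (rule L2_bounded_mult(1)[OF nice_L2[OF i] _ B(5,4)]) (use B(1) in simp)
  moreover have "(\<lambda>z. u z * indicat_real L (fst z)) = u" using B(3) by (auto simp: fun_eq_iff indicator_def)
  ultimately show ?thesis by simp
qed

lemma poly_fun_list_L2: "list_all2 (\<lambda>u l. u \<in> poly_fun l) us ls \<Longrightarrow> set us \<subseteq> L2 lm"
  by (induction rule: list_all2_induct) (auto intro: poly_fun_L2)

text \<open>For a tensor with bounded factors, \<open>f \<mapsto> X(f) tens us\<close> is continuous in \<open>L\<^sup>2(\<sigma>)\<close>.\<close>
lemma X_op_tens_MP_fock:
  assumes us: "list_all2 (\<lambda>u l. u \<in> poly_fun l) us ls" and T: "tens us \<in> MP_fock n" and b: "b \<in> nice"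
  shows "X_op \<sigma> \<mu> b (tens us) \<in> MP_fock (Suc n)"
proof -
  have sL: "semi_hilbert (L2 \<sigma>) (l2_inner \<sigma>)" by (rule L2_semi_hilbert)
  have fsh: "semi_hilbert fock (fock_inner \<sigma> \<mu>)" by (rule fock.semi_hilbert_axioms)
  have usL: "set us \<subseteq> L2 lm"
    using us by (rule poly_fun_list_L2)
  \<comment> \<open>The admissible \<open>f\<close> form a closed subspace of L^2(sigma) containing
    C_0(T); by density it also contains the indicators of cells needed later.\<close>
  have "{f \<in> L2 \<sigma>. X_op \<sigma> \<mu> f (tens us) \<in> MP_fock (Suc n)} = L2 \<sigma>"
  proof (rule Cc_dense)
    show "compactly_supported_continuous \<subseteq> {f \<in> L2 \<sigma>. X_op \<sigma> \<mu> f (tens us) \<in> MP_fock (Suc n)}"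
      using X_op_MP_fock_Cc[OF _ T] Cc_nice nice_L2_sigma by blast
    show "closed_sub (L2 \<sigma>) (l2_inner \<sigma>) {f \<in> L2 \<sigma>. X_op \<sigma> \<mu> f (tens us) \<in> MP_fock (Suc n)}"
    proof (cases us)
      case Nil
      have fs: "(\<lambda>z. (f + g) (fst z)) = (\<lambda>z. f (fst z)) + (\<lambda>z. g (fst z))" "(\<lambda>z. (c *\<^sub>R f) (fst z)) = c *\<^sub>R (\<lambda>z. f (fst z))"
        for f g :: "'t \<Rightarrow> real" and c by (auto simp: fun_eq_iff fun_apply)
      show ?thesis unfolding Nil
        by (rule closed_sub_vimage[OF fsh sL _ _ _ _ MP_fock_closed, where B=1])
           (simp_all add: X_op_tens_Nil fs tens_Cons_add tens_Cons_scale tens_fock tens_nrm L2_sigma_fst)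
    next
      case (Cons u vs)
      then obtain l where u: "u \<in> poly_fun l" using us by (auto simp: list_all2_Cons1)
      have uL: "u \<in> L2 lm" and vL: "set vs \<subseteq> L2 lm" using usL Cons by auto
      obtain B where B: "B \<ge> 0" "AE z in lm. \<bar>snd z * u z\<bar> \<le> B" "(\<lambda>z. snd z * u z) \<in> borel_measurable lm"
        using poly_fun_bounded[OF poly_fun_s[OF u]] by auto
      have m: "(\<lambda>z. snd z * f (fst z) * u z) = (\<lambda>z. (snd z * u z) * f (fst z))" for f :: "'t \<Rightarrow> real" by auto
      have mL: "(\<lambda>z. (snd z * u z) * f (fst z)) \<in> L2 lm"
        "snorm (l2_inner lm) (\<lambda>z. (snd z * u z) * f (fst z)) \<le> B * snorm (l2_inner \<sigma>) f" if "f \<in> L2 \<sigma>" for f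
        using L2_bounded_mult[OF L2_sigma_fst(1)[OF that] B(3,2,1)] L2_sigma_fst(2)[OF that] by auto
      have fs: "(\<lambda>z. (f + g) (fst z)) = (\<lambda>z. f (fst z)) + (\<lambda>z. g (fst z))" "(\<lambda>z. (c *\<^sub>R f) (fst z)) = c *\<^sub>R (\<lambda>z. f (fst z))"
        "(\<lambda>z. (snd z * u z) * (f + g) (fst z)) = (\<lambda>z. (snd z * u z) * f (fst z)) + (\<lambda>z. (snd z * u z) * g (fst z))"
        "(\<lambda>z. (snd z * u z) * (c *\<^sub>R f) (fst z)) = c *\<^sub>R (\<lambda>z. (snd z * u z) * f (fst z))"
        for f g :: "'t \<Rightarrow> real" and c by (auto simp: fun_eq_iff fun_apply algebra_simps)
      note ipadd = semi_inner.ip_add_left[OF L2_semi_inner] and ipsc = semi_inner.ip_scale_left[OF L2_semi_inner]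
      note CS = semi_inner.Cauchy_Schwarz[OF L2_semi_inner]
      \<comment> \<open>The sum of the bounds for the creation, annihilation and neutral terms;
        \<open>B\<close> is an essential bound of s u.\<close>
      define K where "K = snorm (l2_inner lm) u * fock.nrm (tens vs) + snorm (l2_inner lm) u * fock.nrm (tens vs) + B * fock.nrm (tens vs)"
      show ?thesis unfolding Cons
      proof (rule closed_sub_vimage[OF fsh sL _ _ _ _ MP_fock_closed, where B=K])
        fix f assume f: "f \<in> L2 \<sigma>"
        note fL = L2_sigma_fst[OF f]
        have T1: "tens ((\<lambda>z. f (fst z)) # u # vs) \<in> fock" "tens vs \<in> fock" "tens ((\<lambda>z. (snd z * u z) * f (fst z)) # vs) \<in> fock"
          using fL(1) uL vL mL(1)[OF f] by (auto intro!: tens_fock)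
        then show Xf: "X_op \<sigma> \<mu> f (tens (u # vs)) \<in> fock"
          unfolding X_op_tens_Cons m by (intro fock.H_closed)
        have "fock.nrm (X_op \<sigma> \<mu> f (tens (u # vs))) \<le> fock.nrm (tens ((\<lambda>z. f (fst z)) # u # vs) + l2_inner lm (\<lambda>z. f (fst z)) u *\<^sub>R tens vs)
          + fock.nrm (tens ((\<lambda>z. (snd z * u z) * f (fst z)) # vs))"
          unfolding X_op_tens_Cons m using T1 by (intro fock.nrm_triangle fock.H_closed)
        also have "fock.nrm (tens ((\<lambda>z. f (fst z)) # u # vs) + l2_inner lm (\<lambda>z. f (fst z)) u *\<^sub>R tens vs) \<le>
          fock.nrm (tens ((\<lambda>z. f (fst z)) # u # vs)) + fock.nrm (l2_inner lm (\<lambda>z. f (fst z)) u *\<^sub>R tens vs)"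
          using T1 by (intro fock.nrm_triangle fock.H_closed)
        also have "fock.nrm (tens ((\<lambda>z. f (fst z)) # u # vs)) = snorm (l2_inner \<sigma>) f * (snorm (l2_inner lm) u * fock.nrm (tens vs))"
          using fL uL vL by (simp add: tens_nrm_Cons)
        also have "fock.nrm (l2_inner lm (\<lambda>z. f (fst z)) u *\<^sub>R tens vs) \<le> (snorm (l2_inner \<sigma>) f * snorm (l2_inner lm) u) * fock.nrm (tens vs)"
          unfolding fock.nrm_scale[OF T1(2)] using CS[OF fL(1) uL] fL(2) T1(2) by (intro mult_right_mono) (auto simp: fock.nrm_nonneg)
        also have "fock.nrm (tens ((\<lambda>z. (snd z * u z) * f (fst z)) # vs)) \<le> (B * snorm (l2_inner \<sigma>) f) * fock.nrm (tens vs)"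
          unfolding tens_nrm_Cons[OF mL(1)[OF f] vL] using mL(2)[OF f] T1(2) by (intro mult_right_mono) (auto simp: fock.nrm_nonneg)
        finally show "fock.nrm (X_op \<sigma> \<mu> f (tens (u # vs))) \<le> K * snorm (l2_inner \<sigma>) f"
          by (simp add: K_def algebra_simps)
        fix c
        show "X_op \<sigma> \<mu> (c *\<^sub>R f) (tens (u # vs)) = c *\<^sub>R X_op \<sigma> \<mu> f (tens (u # vs))"
          unfolding X_op_tens_Cons m fs tens_Cons_scale ipsc[OF fL(1) uL] by (simp add: scaleR_add_right)
        fix g assume g: "g \<in> L2 \<sigma>"
        show "X_op \<sigma> \<mu> (f + g) (tens (u # vs)) = X_op \<sigma> \<mu> f (tens (u # vs)) + X_op \<sigma> \<mu> g (tens (u # vs))"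
          unfolding X_op_tens_Cons m fs tens_Cons_add ipadd[OF fL(1) L2_sigma_fst(1)[OF g] uL]
          by (simp add: scaleR_add_left add_ac)
      qed
    qed
  qed
  then show ?thesis using nice_L2_sigma[OF b] by blast
qed

text \<open>Summing \<open>X(1\<^sub>c)(1\<^sub>c u \<otimes> \<dots>)\<close> over a fine partition isolates \<open>s u \<otimes> \<dots>\<close>: non-atomicity makes the
  creation terms \<open>1\<^sub>c \<otimes> 1\<^sub>c u \<otimes> \<dots>\<close> disappear in the limit.\<close>
lemma tens_s_MP_fock:
  assumes u: "u \<in> poly_fun l" and vs: "list_all2 (\<lambda>u l. u \<in> poly_fun l) vs ls"
    and IH: "\<And>u'. u' \<in> poly_fun l \<Longrightarrow> tens (u' # vs) \<in> MP_fock n" and IH': "tens vs \<in> MP_fock n"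
  shows "tens ((\<lambda>z. snd z * u z) # vs) \<in> MP_fock (Suc n)"
proof (rule fock.closed_sub_approx[OF MP_fock_closed])
  have vL: "set vs \<subseteq> L2 lm"
    using vs by (rule poly_fun_list_L2)
  have uL: "u \<in> L2 lm" by (rule poly_fun_L2[OF u])
  have suL: "(\<lambda>z. snd z * u z) \<in> L2 lm" by (rule poly_fun_L2[OF poly_fun_s[OF u]])
  show "tens ((\<lambda>z. snd z * u z) # vs) \<in> fock" using suL vL by (intro tens_fock) auto
  have vF: "tens vs \<in> fock" using vL by (rule tens_fock)
  fix e :: real assume e: "e > 0"
  obtain L where L: "compact L" "\<And>z. fst z \<notin> L \<Longrightarrow> u z = 0"
    using poly_fun_bounded[OF u] by metis
  define D where "D = (snorm (l2_inner lm) u * fock.nrm (tens vs))\<^sup>2"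
  have D0: "D \<ge> 0" by (simp add: D_def)
  \<comment> \<open>Chosen to achieve \<open>d * D\<close> below e^2, where \<open>d * D\<close>
    will bound the squared norm of the sum of the creation terms; the summand 1 covers
    \<open>D = 0\<close>.\<close>
  define d where "d = e\<^sup>2 / (D + 1)"
  have d: "d > 0" using e D0 by (simp add: d_def)
  obtain N :: nat and c where c: "\<And>i. c i \<in> sets borel" "disjoint_family_on c {..<N}" "(\<Union>i<N. c i) = L"
    "\<And>i. emeasure \<sigma> (c i) < ennreal d"
    by (rule fine_partition[OF L(1), of "ennreal d"]) (use d in simp, rule that)
  define ch where "ch i = (\<lambda>z::'t \<times> real. indicat_real (c i) (fst z))" for i
  have chn: "indicat_real (c i) \<in> nice" if "i < N" for i
    using c that by (intro nice_indicator[OF L(1)]) auto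
  have chL: "ch i \<in> L2 lm" if "i < N" for i using nice_L2[OF chn[OF that]] by (simp add: ch_def)
  have chu: "(\<lambda>z. ch i z * u z) \<in> poly_fun l" for i
    unfolding ch_def using c(1) by (intro poly_fun_mult[OF _ _ u, where C=1]) auto
  have chuL: "(\<lambda>z. ch i z * u z) \<in> L2 lm" for i by (rule poly_fun_L2[OF chu])
  define T where "T i = tens (ch i # (\<lambda>z. ch i z * u z) # vs)" for i
  have TF: "T i \<in> fock" if "i < N" for i unfolding T_def using chL[OF that] chuL vL by (intro tens_fock) auto
  define S where "S i = tens ((\<lambda>z. snd z * (ch i z * u z)) # vs)" for i
  \<comment> \<open>In X(1_c)(1_c u (x) vs) the neutral term simplifies by 1_c 1_c = 1_c, and the
    annihilation term is a multiple of \<open>tens vs\<close>, which is already available and can be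
    subtracted.\<close>
  have XV: "T i + S i \<in> MP_fock (Suc n)" if i: "i < N" for i
  proof -
    have "X_op \<sigma> \<mu> (indicat_real (c i)) (tens ((\<lambda>z. ch i z * u z) # vs)) \<in> MP_fock (Suc n)"
      using chu vs IH[OF chu] chn[OF i] by (intro X_op_tens_MP_fock[where ls="l # ls"]) auto
    moreover have "(\<lambda>z. snd z * indicat_real (c i) (fst z) * (ch i z * u z)) = (\<lambda>z. snd z * (ch i z * u z))"
      by (auto simp: ch_def indicator_def fun_eq_iff)
    ultimately have "T i + l2_inner lm (ch i) (\<lambda>z. ch i z * u z) *\<^sub>R tens vs + S i \<in> MP_fock (Suc n)"
      unfolding X_op_tens_Cons T_def S_def ch_def[symmetric] by simp
    moreover have "l2_inner lm (ch i) (\<lambda>z. ch i z * u z) *\<^sub>R tens vs \<in> MP_fock (Suc n)"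
      using IH' MP_fock_mono[of n "Suc n"] by (intro subspace_scale[OF MP_fock_subspace]) auto
    ultimately have "(T i + l2_inner lm (ch i) (\<lambda>z. ch i z * u z) *\<^sub>R tens vs + S i) - l2_inner lm (ch i) (\<lambda>z. ch i z * u z) *\<^sub>R tens vs \<in> MP_fock (Suc n)"
      by (rule subspace_diff[OF MP_fock_subspace])
    then show ?thesis by (simp add: algebra_simps)
  qed
  have ch1: "(\<Sum>i<N. ch i z) = 1" if "fst z \<in> L" for z
  proof -
    have "fst z \<in> (\<Union>i<N. c i)" using that c(3) by simp
    then obtain i where i: "i < N" "fst z \<in> c i" by blast
    have "ch j z = (if j = i then 1 else 0)" if j: "j < N" for j
    proof (cases "j = i")
      case False
      then have "c j \<inter> c i = {}" using c(2) i(1) j by (auto simp: disjoint_family_on_def)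
      then have "fst z \<notin> c j" using i(2) by blast
      then show ?thesis using False by (simp add: ch_def)
    qed (use i(2) in \<open>simp add: ch_def\<close>)
    then have "(\<Sum>j<N. ch j z) = (\<Sum>j<N. if j = i then 1 else 0)" by (intro sum.cong) auto
    then show ?thesis using i(1) by simp
  qed
  have SS: "(\<Sum>i<N. S i) = tens ((\<lambda>z. snd z * u z) # vs)"
  proof -
    have "(\<Sum>i<N. S i) = tens ((\<Sum>i<N. (\<lambda>z. snd z * (ch i z * u z))) # vs)"
      unfolding S_def by (simp add: tens_Cons_sum)
    also have "(\<Sum>i<N. (\<lambda>z. snd z * (ch i z * u z))) = (\<lambda>z. snd z * u z)"
    proof
      fix z
      have "(\<Sum>i<N. (\<lambda>z. snd z * (ch i z * u z))) z = snd z * ((\<Sum>i<N. ch i z) * u z)"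
        by (simp add: sum_fun_apply sum_distrib_left sum_distrib_right)
      also have "\<dots> = snd z * u z" using ch1[of z] L(2)[of z] by (cases "fst z \<in> L") auto
      finally show "(\<Sum>i<N. (\<lambda>z. snd z * (ch i z * u z))) z = snd z * u z" .
    qed
    finally show ?thesis .
  qed
  have orth0: "l2_inner lm (\<lambda>z. ch i z * u z) (\<lambda>z. ch j z * u z) = 0" "l2_inner lm (ch i) (ch j) = 0"
    if "i < N" "j < N" "i \<noteq> j" for i j
  proof -
    have p: "ch i z * ch j z = 0" for z using c(2) that by (auto simp: ch_def indicator_def disjoint_family_on_def)
    have "ch i z * u z * (ch j z * u z) = (ch i z * ch j z) * (u z * u z)" for z by (simp add: mult_ac)
    then have "ch i z * u z * (ch j z * u z) = 0" for z by (simp only: p mult_zero_left)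
    note this p
    then show "l2_inner lm (\<lambda>z. ch i z * u z) (\<lambda>z. ch j z * u z) = 0" "l2_inner lm (ch i) (ch j) = 0"
      unfolding l2_inner_def by (simp_all only: Bochner_Integration.integral_zero)
  qed
  \<comment> \<open>Distinct cells are disjoint, so creation terms of different cells are orthogonal
    and there are no cross terms in the norm of their sum.\<close>
  have Torth: "fock_inner \<sigma> \<mu> (T i) (T j) = 0" if "i < N" "j < N" "i \<noteq> j" for i j
    unfolding T_def using orth0[OF that] chL[OF that(1)] chL[OF that(2)] chuL vL
    by (subst tens_inner) (auto simp: prod.lessThan_Suc_shift simp del: prod.lessThan_Suc)
  have chnrm: "(snorm (l2_inner lm) (ch i))\<^sup>2 \<le> d" if "i < N" for i
  proof -
    have "ennreal ((snorm (l2_inner lm) (ch i))\<^sup>2) = (\<integral>\<^sup>+z. ennreal ((ch i z)\<^sup>2) \<partial>lm)" using nn_integral_L2[OF chL[OF that]] by simp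
    also have "\<dots> = (\<integral>\<^sup>+z. indicator (c i \<times> UNIV) z \<partial>lm)"
      by (intro nn_integral_cong) (auto simp: ch_def indicator_def)
    also have "\<dots> = emeasure \<sigma> (c i)" using c(1) by (simp add: emeasure_lm_strip)
    also have "\<dots> < ennreal d" by (rule c)
    finally show ?thesis using d by (simp add: ennreal_less_iff)
  qed
  have usum: "(\<Sum>i<N. (snorm (l2_inner lm) (\<lambda>z. ch i z * u z))\<^sup>2) = (snorm (l2_inner lm) u)\<^sup>2"
  proof -
    have "(\<Sum>i<N. (\<lambda>z. ch i z * u z)) = u"
    proof
      fix z
      have "(\<Sum>i<N. (\<lambda>z. ch i z * u z)) z = (\<Sum>i<N. ch i z) * u z" by (simp add: sum_fun_apply sum_distrib_right)
      also have "\<dots> = u z" using ch1[of z] L(2)[of z] by (cases "fst z \<in> L") auto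
      finally show "(\<Sum>i<N. (\<lambda>z. ch i z * u z)) z = u z" .
    qed
    moreover have "(snorm (l2_inner lm) (\<Sum>i<N. (\<lambda>z. ch i z * u z)))\<^sup>2 = (\<Sum>i<N. (snorm (l2_inner lm) (\<lambda>z. ch i z * u z))\<^sup>2)"
      by (rule semi_inner.nrm_orth_sum[OF L2_semi_inner]) (use chuL orth0 in auto)
    ultimately show ?thesis by simp
  qed
  have "(fock.nrm (\<Sum>i<N. T i))\<^sup>2 = (\<Sum>i<N. (fock.nrm (T i))\<^sup>2)"
    using TF Torth by (intro fock.nrm_orth_sum) auto
  \<comment> \<open>Each cell gains the factor \<open>d\<close> from its indicator, while the
    squared norms of the pieces 1_c u sum to that of \<open>u\<close>; the total does not depend on
    the number of cells.\<close>
  also have "\<dots> \<le> (\<Sum>i<N. d * ((snorm (l2_inner lm) (\<lambda>z. ch i z * u z))\<^sup>2 * (fock.nrm (tens vs))\<^sup>2))"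
  proof (rule sum_mono)
    fix i assume "i \<in> {..<N}"
    then have i: "i < N" by simp
    have "fock.nrm (T i) = snorm (l2_inner lm) (ch i) * (snorm (l2_inner lm) (\<lambda>z. ch i z * u z) * fock.nrm (tens vs))"
      unfolding T_def using chL[OF i] chuL vL by (simp add: tens_nrm_Cons)
    then show "(fock.nrm (T i))\<^sup>2 \<le> d * ((snorm (l2_inner lm) (\<lambda>z. ch i z * u z))\<^sup>2 * (fock.nrm (tens vs))\<^sup>2)"
      using chnrm[OF i] by (simp add: power_mult_distrib mult_right_mono)
  qed
  also have "\<dots> = d * D"
    unfolding D_def power_mult_distrib usum[symmetric] by (simp add: sum_distrib_left sum_distrib_right)
  also have "\<dots> < e\<^sup>2" using e D0 by (simp add: d_def field_simps)
  finally have "fock.nrm (\<Sum>i<N. T i) < e" by (rule power2_less_imp_less) (use e in simp)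
  moreover have diff: "(\<Sum>i<N. T i + S i) - tens ((\<lambda>z. snd z * u z) # vs) = (\<Sum>i<N. T i)"
    unfolding sum.distrib SS by simp
  ultimately have "fock.nrm ((\<Sum>i<N. T i + S i) - tens ((\<lambda>z. snd z * u z) # vs)) < e" by (simp only:)
  moreover have "(\<Sum>i<N. T i + S i) \<in> MP_fock (Suc n)" using XV by (intro subspace_sum[OF MP_fock_subspace]) auto
  ultimately show "\<exists>y\<in>MP_fock (Suc n). fock.nrm (y - tens ((\<lambda>z. snd z * u z) # vs)) < e" by blast
qed

text \<open>A factor of degree l costs l + 1: one order to create the variable and one for each
  power of s. In the induction on the order, \<open>S\<close> multiplies the first factor by s, and
  \<open>B\<close> puts a new factor without s in front.\<close>

lemma tens_MP_fock:
  "list_all2 (\<lambda>u l. u \<in> poly_fun l) us ls \<Longrightarrow> sum_list (map Suc ls) \<le> n \<Longrightarrow> tens us \<in> MP_fock n"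
proof (induction n arbitrary: us ls)
  case 0
  then have "us = []" by (cases ls) auto
  then show ?case using vacuum_MP_fock by simp
next
  case (Suc n)
  have S: "tens ((\<lambda>z. snd z * u z) # vs) \<in> MP_fock (Suc n)"
    if u: "u \<in> poly_fun l" and vs: "list_all2 (\<lambda>u l. u \<in> poly_fun l) vs ms" and n: "Suc l + sum_list (map Suc ms) \<le> n" for u l vs ms
  proof (rule tens_s_MP_fock[OF u vs])
    show "tens (u' # vs) \<in> MP_fock n" if "u' \<in> poly_fun l" for u'
      using Suc.IH[of "u' # vs" "l # ms"] that vs n by simp
    show "tens vs \<in> MP_fock n" using Suc.IH[of vs ms] vs n by simp
  qed
  \<comment> \<open>X(b) applied to \<open>tens vs\<close> produces the wanted tensor plus an
    annihilation term of lower weight and a neutral term. The latter has s b v as its first factor;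
    its weight is one more than that of \<open>vs\<close>, so \<open>S\<close> covers it.\<close>
  have B: "tens ((\<lambda>z. b (fst z)) # vs) \<in> MP_fock (Suc n)"
    if b: "b \<in> nice" and vs: "list_all2 (\<lambda>u l. u \<in> poly_fun l) vs ms" and n: "sum_list (map Suc ms) \<le> n" for b vs ms
  proof -
    have X: "X_op \<sigma> \<mu> b (tens vs) \<in> MP_fock (Suc n)"
      by (rule X_op_tens_MP_fock[OF vs Suc.IH[OF vs n] b])
    show ?thesis
    proof (cases vs)
      case Nil
      then show ?thesis using X by (simp add: X_op_tens_Nil)
    next
      case (Cons v ws)
      then obtain l ks where ms: "ms = l # ks" "v \<in> poly_fun l" "list_all2 (\<lambda>u l. u \<in> poly_fun l) ws ks"
        using vs by (auto simp: list_all2_Cons1)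
      obtain C where C: "\<And>t. \<bar>b t\<bar> \<le> C" using niceD[OF b] by metis
      have bm: "b \<in> borel_measurable borel" using b by (simp add: nice_def)
      have "tens ((\<lambda>z. snd z * (b (fst z) * v z)) # ws) \<in> MP_fock (Suc n)"
        using n ms by (intro S[OF poly_fun_mult[OF bm C ms(2)] ms(3)]) simp
      moreover have "l2_inner lm (\<lambda>z. b (fst z)) v *\<^sub>R tens ws \<in> MP_fock (Suc n)"
        using Suc.IH[OF ms(3)] n ms(1) MP_fock_mono[of n "Suc n"] by (intro subspace_scale[OF MP_fock_subspace]) auto
      ultimately have "X_op \<sigma> \<mu> b (tens vs) - (l2_inner lm (\<lambda>z. b (fst z)) v *\<^sub>R tens ws + tens ((\<lambda>z. snd z * (b (fst z) * v z)) # ws)) \<in> MP_fock (Suc n)"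
        using X by (intro subspace_diff[OF MP_fock_subspace] subspace_add[OF MP_fock_subspace])
      then show ?thesis unfolding Cons X_op_tens_Cons by (simp add: mult.assoc)
    qed
  qed
  show ?case
  proof (cases us)
    case Nil
    then show ?thesis using vacuum_MP_fock by simp
  next
    case (Cons u vs)
    then obtain l ms where ls: "ls = l # ms" "u \<in> poly_fun l" "list_all2 (\<lambda>u l. u \<in> poly_fun l) vs ms"
      using Suc.prems by (auto simp: list_all2_Cons1)
    show ?thesis
    proof (cases l)
      case 0
      then obtain b where "b \<in> nice" "u = (\<lambda>z. b (fst z))" using ls by auto
      then show ?thesis using B[OF _ ls(3)] Suc.prems(2) ls 0 Cons by simp
    next
      case (Suc l')
      then obtain b w where u: "b \<in> nice" "w \<in> poly_fun l'" "u = (\<lambda>z. b (fst z) + snd z * w z)" using ls by auto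
      have e: "u = (\<lambda>z. b (fst z)) + (\<lambda>z. snd z * w z)" by (auto simp: u fun_eq_iff fun_apply)
      have "tens ((\<lambda>z. b (fst z)) # vs) \<in> MP_fock (Suc n)" "tens ((\<lambda>z. snd z * w z) # vs) \<in> MP_fock (Suc n)"
        using B[OF u(1) ls(3)] S[OF u(2) ls(3)] Suc.prems(2) ls Suc by auto
      then show ?thesis unfolding Cons e tens_Cons_add by (intro subspace_add[OF MP_fock_subspace])
    qed
  qed
qed

end

section \<open>Orthogonal polynomials\<close>

text \<open>Gram--Schmidt; where the denominator vanishes, \<open>x / 0 = 0\<close> drops a summand that is zero almost
  everywhere anyway.\<close>
declare sum.cong [fundef_cong]

function gram_schmidt :: "real measure \<Rightarrow> nat \<Rightarrow> real poly" where
  "gram_schmidt \<nu> n = monom 1 n - (\<Sum>j<n. smult ((\<integral>s. s ^ n * poly (gram_schmidt \<nu> j) s \<partial>\<nu>) /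
     (\<integral>s. (poly (gram_schmidt \<nu> j) s)\<^sup>2 \<partial>\<nu>)) (gram_schmidt \<nu> j))"
  by pat_completeness auto
termination by (relation "inv_image less_than snd") auto

declare gram_schmidt.simps [simp del]

text \<open>The value 1 at \<open>j = n\<close> turns the Gram--Schmidt step into an expansion of
  s^n in the polynomials of index at most n.\<close>

definition gs_coeff :: "real measure \<Rightarrow> nat \<Rightarrow> nat \<Rightarrow> real" where
  "gs_coeff \<nu> n j = (if j = n then 1 else (\<integral>s. s ^ n * poly (gram_schmidt \<nu> j) s \<partial>\<nu>) /
     (\<integral>s. (poly (gram_schmidt \<nu> j) s)\<^sup>2 \<partial>\<nu>))"

lemma gram_schmidt_eq: "gram_schmidt \<nu> n = monom 1 n - (\<Sum>j<n. smult (gs_coeff \<nu> n j) (gram_schmidt \<nu> j))"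
  by (subst gram_schmidt.simps) (simp add: gs_coeff_def)

lemma monom_gram_schmidt: "monom 1 n = (\<Sum>j\<le>n. smult (gs_coeff \<nu> n j) (gram_schmidt \<nu> j))"
proof -
  have "(\<Sum>j\<le>n. smult (gs_coeff \<nu> n j) (gram_schmidt \<nu> j)) = (\<Sum>j<n. smult (gs_coeff \<nu> n j) (gram_schmidt \<nu> j)) + gram_schmidt \<nu> n"
    by (simp add: lessThan_Suc_atMost[symmetric] gs_coeff_def)
  then show ?thesis by (simp add: gram_schmidt_eq[of \<nu> n])
qed

lemma power_gram_schmidt: "s ^ n = (\<Sum>j\<le>n. gs_coeff \<nu> n j * poly (gram_schmidt \<nu> j) s)"
  using arg_cong[OF monom_gram_schmidt[of n \<nu>], of "\<lambda>p. poly p s"] by (simp add: poly_monom poly_sum)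

lemma gram_schmidt_degree: "degree (gram_schmidt \<nu> n) = n \<and> lead_coeff (gram_schmidt \<nu> n) = 1"
proof (induction n rule: less_induct)
  case (less n)
  let ?S = "\<Sum>j<n. smult (gs_coeff \<nu> n j) (gram_schmidt \<nu> j)"
  have c: "coeff ?S i = 0" if "i \<ge> n" for i
    unfolding coeff_sum
  proof (rule sum.neutral, rule ballI)
    fix j assume "j \<in> {..<n}"
    then have "degree (gram_schmidt \<nu> j) < i" using less[of j] that by simp
    then show "coeff (smult (gs_coeff \<nu> n j) (gram_schmidt \<nu> j)) i = 0" by (simp add: coeff_eq_0)
  qed
  have e: "coeff (gram_schmidt \<nu> n) i = (if i = n then 1 else 0)" if "i \<ge> n" for i
    unfolding gram_schmidt_eq[of \<nu> n] using c[OF that] by simp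
  have "degree (gram_schmidt \<nu> n) = n"
  proof (rule antisym)
    show "degree (gram_schmidt \<nu> n) \<le> n" using e by (intro degree_le) auto
    show "n \<le> degree (gram_schmidt \<nu> n)" using e[of n] by (intro le_degree) simp
  qed
  then show ?case using e[of n] by simp
qed

lemma gram_schmidt_lead [simp]: "degree (gram_schmidt \<nu> n) = n" "coeff (gram_schmidt \<nu> n) n = 1"
  using gram_schmidt_degree[of \<nu> n] by auto

locale bounded_prob = prob_space \<nu> for \<nu> :: "real measure" +
  fixes R :: real
  assumes sets_nu [simp, measurable_cong]: "sets \<nu> = sets borel" and bounded: "AE s in \<nu>. \<bar>s\<bar> \<le> R"
begin

lemma space_nu [simp]: "space \<nu> = UNIV"
  using sets_eq_imp_space_eq[OF sets_nu] by simp

lemma continuous_integrable: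
  assumes f: "continuous_on UNIV f" shows "integrable \<nu> (f :: real \<Rightarrow> real)"
proof -
  have "compact (f ` {-R..R})" by (intro compact_continuous_image continuous_on_subset[OF f]) auto
  then obtain B where B: "\<And>y. y \<in> f ` {-R..R} \<Longrightarrow> norm y \<le> B" by (metis compact_imp_bounded bounded_iff)
  have m: "f \<in> borel_measurable \<nu>" using borel_measurable_continuous_onI[OF f] by simp
  have "AE s in \<nu>. norm (f s) \<le> B" using bounded
  proof eventually_elim
    case (elim s)
    then show ?case by (intro B imageI) auto
  qed
  then show ?thesis using m by (rule integrable_const_bound)
qed

lemma poly_integrable [simp]: "integrable \<nu> (\<lambda>s. poly p s)"
  by (intro continuous_integrable continuous_intros)

lemma poly_mult_integrable [simp]: "integrable \<nu> (\<lambda>s. poly p s * poly q s)"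
  using poly_integrable[of "p * q"] by simp

lemma poly_square_integrable [simp]: "integrable \<nu> (\<lambda>s. (poly p s)\<^sup>2)"
  using poly_mult_integrable[of p p] by (simp add: power2_eq_square)

lemma poly_square_0: "(\<integral>s. (poly p s)\<^sup>2 \<partial>\<nu>) = 0 \<longleftrightarrow> (AE s in \<nu>. poly p s = 0)"
  by (subst integral_nonneg_eq_0_iff_AE) auto

lemma poly_borel: "poly p \<in> borel_measurable (borel :: real measure)"
  by (intro borel_measurable_continuous_onI continuous_intros)

abbreviation gs :: "nat \<Rightarrow> real poly" where "gs \<equiv> gram_schmidt \<nu>"
abbreviation w :: "nat \<Rightarrow> real" where "w n \<equiv> (\<integral>s. (poly (gs n) s)\<^sup>2 \<partial>\<nu>)"

lemma integral_AE_0: "AE s in \<nu>. f s = 0 \<Longrightarrow> f \<in> borel_measurable borel \<Longrightarrow> (\<integral>s. f s * g s \<partial>\<nu>) = (0::real)"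
  by (rule integral_eq_zero_AE) (auto elim: eventually_mono)

lemma gs_orth_less: "i < n \<Longrightarrow> (\<integral>s. poly (gs n) s * poly (gs i) s \<partial>\<nu>) = 0"
proof (induction n arbitrary: i rule: less_induct)
  case (less n)
  have orth: "(\<integral>s. poly (gs j) s * poly (gs i) s \<partial>\<nu>) = 0" if "j < n" "j \<noteq> i" for j
  proof (cases "i < j")
    case True
    then show ?thesis using less.IH[of j i] that by simp
  next
    case False
    then have "(\<integral>s. poly (gs i) s * poly (gs j) s \<partial>\<nu>) = 0" using less.IH[of i j] that less.prems by simp
    then show ?thesis by (simp add: mult.commute)
  qed
  have e: "poly (gs n) s * poly (gs i) s = s ^ n * poly (gs i) s - (\<Sum>j<n. gs_coeff \<nu> n j * (poly (gs j) s * poly (gs i) s))" for s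
    unfolding gram_schmidt_eq[of \<nu> n] by (simp add: poly_monom poly_sum left_diff_distrib sum_distrib_right mult.assoc)
  have i1: "integrable \<nu> (\<lambda>s. s ^ n * poly (gs i) s)" by (intro continuous_integrable continuous_intros)
  have "(\<integral>s. poly (gs n) s * poly (gs i) s \<partial>\<nu>) =
      (\<integral>s. s ^ n * poly (gs i) s \<partial>\<nu>) - (\<Sum>j<n. gs_coeff \<nu> n j * (\<integral>s. poly (gs j) s * poly (gs i) s \<partial>\<nu>))"
    unfolding e using i1 by (subst Bochner_Integration.integral_diff) (auto simp: Bochner_Integration.integral_sum)
  also have "(\<Sum>j<n. gs_coeff \<nu> n j * (\<integral>s. poly (gs j) s * poly (gs i) s \<partial>\<nu>)) =
      (\<Sum>j<n. if j = i then gs_coeff \<nu> n i * w i else 0)"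
    using orth by (intro sum.cong) (auto simp: power2_eq_square)
  also have "\<dots> = gs_coeff \<nu> n i * w i" using less.prems by simp
  also have "\<dots> = (\<integral>s. s ^ n * poly (gs i) s \<partial>\<nu>)"
  proof (cases "w i = 0")
    case True
    then have "AE s in \<nu>. poly (gs i) s = 0" using poly_square_0 by blast
    then have "(\<integral>s. poly (gs i) s * s ^ n \<partial>\<nu>) = 0" by (rule integral_AE_0[OF _ poly_borel])
    then show ?thesis using True by (simp add: mult.commute)
  next
    case False
    then show ?thesis using less.prems by (simp add: gs_coeff_def)
  qed
  finally show ?case by simp
qed

lemma gs_orth: "i \<noteq> j \<Longrightarrow> (\<integral>s. poly (gs i) s * poly (gs j) s \<partial>\<nu>) = 0"
  using gs_orth_less[of i j] gs_orth_less[of j i] by (cases "i < j") (auto simp: mult.commute)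

lemma monom_orth: "i < n \<Longrightarrow> (\<integral>s. poly (gs n) s * s ^ i \<partial>\<nu>) = 0"
proof -
  assume i: "i < n"
  have "(\<integral>s. poly (gs n) s * s ^ i \<partial>\<nu>) = (\<integral>s. (\<Sum>j\<le>i. gs_coeff \<nu> i j * (poly (gs n) s * poly (gs j) s)) \<partial>\<nu>)"
    by (subst power_gram_schmidt[of _ i \<nu>]) (simp add: sum_distrib_left mult_ac)
  also have "\<dots> = (\<Sum>j\<le>i. gs_coeff \<nu> i j * (\<integral>s. poly (gs n) s * poly (gs j) s \<partial>\<nu>))"
    by (subst Bochner_Integration.integral_sum) auto
  also have "\<dots> = 0" using i by (intro sum.neutral) (auto simp: gs_orth)
  finally show ?thesis .
qed

text \<open>The alternative \<open>q = 0\<close> covers \<open>n = 0\<close>, where no polynomial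
  satisfies \<open>degree q < n\<close>; it arises for differences of monic polynomials of degree
  n.\<close>

lemma gs_orth_poly: "degree q < n \<or> q = 0 \<Longrightarrow> (\<integral>s. poly (gs n) s * poly q s \<partial>\<nu>) = 0"
proof (cases "q = 0")
  case False
  assume "degree q < n \<or> q = 0"
  then have d: "degree q < n" using False by simp
  have int: "integrable \<nu> (\<lambda>s. poly (gs n) s * s ^ i)" for i by (intro continuous_integrable continuous_intros)
  have "(\<integral>s. poly (gs n) s * poly q s \<partial>\<nu>) = (\<integral>s. (\<Sum>i\<le>degree q. coeff q i * (poly (gs n) s * s ^ i)) \<partial>\<nu>)"
    by (simp add: poly_altdef[of q] sum_distrib_left mult_ac)
  also have "\<dots> = (\<Sum>i\<le>degree q. coeff q i * (\<integral>s. poly (gs n) s * s ^ i \<partial>\<nu>))"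
    using int by (subst Bochner_Integration.integral_sum) auto
  also have "\<dots> = 0" using d by (intro sum.neutral) (auto simp: monom_orth)
  finally show ?thesis .
qed simp

text \<open>The complement of the support is a union of open null sets, and by Lindelof countably
  many of them suffice.\<close>

lemma AE_support: "AE s in \<nu>. s \<in> measure_support \<nu>"
proof -
  define F where "F = {U :: real set. open U \<and> emeasure \<nu> U = 0}"
  have N: "- measure_support \<nu> = \<Union>F"
    by (auto simp: measure_support_def F_def zero_less_iff_neq_zero)
  obtain G where G: "G \<subseteq> F" "countable G" "\<Union>G = \<Union>F"
    using Lindelof[of F] by (auto simp: F_def)
  have "(\<Union>U\<in>G. U) \<in> null_sets \<nu>"
    using G(1,2) by (intro null_sets_UN') (auto simp: F_def null_sets_def)
  then have "- measure_support \<nu> \<in> null_sets \<nu>" using N G(3) by simp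
  then show ?thesis using AE_not_in by force
qed

lemma support_roots:
  assumes "AE s in \<nu>. poly p s = 0" shows "measure_support \<nu> \<subseteq> {s. poly p s = 0}"
proof
  fix x assume x: "x \<in> measure_support \<nu>"
  show "x \<in> {s. poly p s = 0}"
  proof (rule ccontr)
    assume "x \<notin> {s. poly p s = 0}"
    moreover have o: "open {s. poly p s \<noteq> 0}" by (intro open_Collect_neq continuous_intros)
    ultimately have "0 < emeasure \<nu> {s. poly p s \<noteq> 0}" using x by (auto simp: measure_support_def)
    moreover have "emeasure \<nu> {s. poly p s \<noteq> 0} = 0"
      using assms o AE_iff_measurable[of "{s. poly p s \<noteq> 0}" \<nu> "\<lambda>s. poly p s = 0"] by simp
    ultimately show False by simp
  qed
qed

lemma AE_poly_0_support:
  assumes "AE s in \<nu>. poly p s = 0" "p \<noteq> 0"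
  shows "finite (measure_support \<nu>)" "card (measure_support \<nu>) \<le> degree p"
proof -
  have s: "measure_support \<nu> \<subseteq> {s. poly p s = 0}" by (rule support_roots[OF assms(1)])
  have f: "finite {s. poly p s = 0}" using assms(2) by (rule poly_roots_finite)
  show "finite (measure_support \<nu>)" using s f by (rule finite_subset)
  show "card (measure_support \<nu>) \<le> degree p" using card_mono[OF f s] card_poly_roots_bound[OF assms(2)] by linarith
qed

text \<open>Turns the condition on the support in \<open>monic_orthogonal_poly\<close> into one on
  an integral. If the support has at most n points, some monic polynomial r of degree n vanishes on
  it; \<open>gs n\<close> is orthogonal to \<open>gs n - r\<close>, which has lower degree or is 0,
  and r is 0 almost everywhere, so \<open>w n = 0\<close>. Conversely \<open>w n = 0\<close> puts
  the support among the roots of \<open>gs n\<close>.\<close>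

lemma support_iff_w: "finite (measure_support \<nu>) \<and> card (measure_support \<nu>) \<le> n \<longleftrightarrow> w n = 0"
proof
  assume fin: "finite (measure_support \<nu>) \<and> card (measure_support \<nu>) \<le> n"
  define p where "p = (\<Prod>x\<in>measure_support \<nu>. [:- x, 1:])"
  \<comment> \<open>The power of s raises the degree from the number of support points to exactly
    n.\<close>
  define r where "r = monom 1 (n - card (measure_support \<nu>)) * p"
  have p: "degree p = card (measure_support \<nu>)" "lead_coeff p = 1"
  proof -
    show "degree p = card (measure_support \<nu>)" using fin unfolding p_def by (simp add: degree_prod_eq_sum_degree)
    have "lead_coeff p = (\<Prod>x\<in>measure_support \<nu>. lead_coeff [:- x, 1:])" unfolding p_def by (rule lead_coeff_prod)
    then show "lead_coeff p = 1" by simp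
  qed
  then have "p \<noteq> 0" by auto
  have "lead_coeff r = lead_coeff (monom (1::real) (n - card (measure_support \<nu>))) * lead_coeff p"
    unfolding r_def by (rule lead_coeff_mult)
  then have r: "degree r = n" "lead_coeff r = 1" using p fin \<open>p \<noteq> 0\<close>
    by (simp_all add: r_def degree_mult_eq degree_monom_eq monom_eq_0_iff)
  have p0: "poly r s = 0" if "s \<in> measure_support \<nu>" for s
    using that fin by (auto simp: r_def p_def poly_prod)
  have r0: "AE s in \<nu>. poly r s = 0" using AE_support by eventually_elim (rule p0)
  have "degree (gs n - r) < n \<or> gs n - r = 0"
  proof (cases "gs n = r")
    case False
    have g: "degree (gs n) = n" "lead_coeff (gs n) = 1" by simp_all
    have "coeff (gs n - r) n = 0" using g r by auto
    moreover have "degree (gs n - r) \<le> n" using degree_diff_le_max[of "gs n" r] g r by simp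
    ultimately have "degree (gs n - r) < n" using False
      by (metis leading_coeff_0_iff le_neq_implies_less right_minus_eq)
    then show ?thesis by simp
  qed simp
  then have "(\<integral>s. poly (gs n) s * poly (gs n - r) s \<partial>\<nu>) = 0" by (rule gs_orth_poly)
  moreover have "(\<integral>s. poly (gs n) s * poly (gs n - r) s \<partial>\<nu>) = w n - (\<integral>s. poly r s * poly (gs n) s \<partial>\<nu>)"
    by (subst Bochner_Integration.integral_diff[symmetric]) (auto simp: algebra_simps power2_eq_square)
  moreover have "(\<integral>s. poly r s * poly (gs n) s \<partial>\<nu>) = 0" by (rule integral_AE_0[OF r0 poly_borel])
  ultimately show "w n = 0" by simp
next
  assume "w n = 0"
  then have "AE s in \<nu>. poly (gs n) s = 0" using poly_square_0 by blast
  moreover have "gs n \<noteq> 0" using gram_schmidt_lead(2)[of \<nu> n] by (metis coeff_0 zero_neq_one)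
  ultimately show "finite (measure_support \<nu>) \<and> card (measure_support \<nu>) \<le> n"
    using AE_poly_0_support[of "gs n"] gram_schmidt_degree[of \<nu> n] by auto
qed

text \<open>Uniqueness in the definite description: the difference of two candidates has degree
  below n, hence is orthogonal to both and so to itself. If it were not the zero polynomial, the
  support would have fewer than n points, contradicting \<open>w n \<noteq> 0\<close>.\<close>

lemma monic_orthogonal_poly_eq: "monic_orthogonal_poly \<nu> n = (if w n = 0 then 0 else gs n)"
proof (cases "w n = 0")
  case True
  then show ?thesis using support_iff_w[of n] by (simp add: monic_orthogonal_poly_def)
next
  case False
  have g: "degree (gs n) = n" "lead_coeff (gs n) = 1" by simp_all
  have "(THE p. degree p = n \<and> lead_coeff p = 1 \<and>
                  (\<forall>q. degree q < n \<longrightarrow> (\<integral>s. poly p s * poly q s \<partial>\<nu>) = 0)) = gs n"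
  proof (rule the_equality)
    show "degree (gs n) = n \<and> lead_coeff (gs n) = 1 \<and> (\<forall>q. degree q < n \<longrightarrow> (\<integral>s. poly (gs n) s * poly q s \<partial>\<nu>) = 0)"
      using g gs_orth_poly by auto
    fix p assume p: "degree p = n \<and> lead_coeff p = 1 \<and> (\<forall>q. degree q < n \<longrightarrow> (\<integral>s. poly p s * poly q s \<partial>\<nu>) = 0)"
    show "p = gs n"
    proof (rule ccontr)
      assume ne: "p \<noteq> gs n"
      define r where "r = p - gs n"
      have r0: "r \<noteq> 0" using ne by (simp add: r_def)
      have "coeff r n = 0" using g p by (auto simp: r_def)
      moreover have "degree r \<le> n" using degree_diff_le_max[of p "gs n"] g p by (simp add: r_def)
      ultimately have d: "degree r < n" using r0 by (metis leading_coeff_0_iff le_neq_implies_less)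
      have "(\<integral>s. (poly r s)\<^sup>2 \<partial>\<nu>) = (\<integral>s. poly p s * poly r s \<partial>\<nu>) - (\<integral>s. poly (gs n) s * poly r s \<partial>\<nu>)"
        by (subst Bochner_Integration.integral_diff[symmetric]) (auto simp: r_def algebra_simps power2_eq_square)
      also have "\<dots> = 0" using p d gs_orth_poly[of r n] by simp
      finally have "AE s in \<nu>. poly r s = 0" using poly_square_0 by blast
      then have "finite (measure_support \<nu>) \<and> card (measure_support \<nu>) \<le> n"
        using AE_poly_0_support[of r] r0 d by auto
      then show False using support_iff_w[of n] False by blast
    qed
  qed
  moreover have "\<not> (finite (measure_support \<nu>) \<and> card (measure_support \<nu>) \<le> n)" using support_iff_w[of n] False by blast
  ultimately show ?thesis using False unfolding monic_orthogonal_poly_def by (simp only: if_False)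
qed

lemma monic_orthogonal_poly_AE: "AE s in \<nu>. poly (monic_orthogonal_poly \<nu> n) s = poly (gs n) s"
  using poly_square_0[of "gs n"] by (auto simp: monic_orthogonal_poly_eq)

lemma monic_orthogonal_orth:
  "i \<noteq> j \<Longrightarrow> (\<integral>s. poly (monic_orthogonal_poly \<nu> i) s * poly (monic_orthogonal_poly \<nu> j) s \<partial>\<nu>) = 0"
  by (simp add: monic_orthogonal_poly_eq gs_orth)

text \<open>Bessel's inequality for the projection of s^n onto \<open>gs j\<close>, with R^(2n)
  bounding the squared norm of s^n. For small \<open>w j\<close> the coefficient by itself may be
  large; the product with \<open>w j\<close> is what the later L^2 estimate needs.\<close>

lemma gs_coeff_bound:
  assumes "j \<le> n" "R \<ge> 0" shows "(gs_coeff \<nu> n j)\<^sup>2 * w j \<le> R ^ (2 * n)"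
proof -
  have int: "integrable \<nu> (\<lambda>s. s ^ n * poly (gs j) s)" "integrable \<nu> (\<lambda>s. (s ^ n)\<^sup>2)"
    by (intro continuous_integrable continuous_intros)+
  have m: "(\<integral>s. (s ^ n)\<^sup>2 \<partial>\<nu>) \<le> R ^ (2 * n)"
  proof (rule integral_le_const[OF int(2)])
    show "AE s in \<nu>. (s ^ n)\<^sup>2 \<le> R ^ (2 * n)" using bounded
    proof eventually_elim
      case (elim s)
      then have "\<bar>s\<bar> ^ (2 * n) \<le> R ^ (2 * n)" by (intro power_mono) auto
      then show ?case by (simp add: power_mult[symmetric] power_even_abs mult.commute)
    qed
  qed
  \<comment> \<open>The defining relation of the coefficient without a division: for
    \<open>w j = 0\<close> both sides vanish, and for \<open>j = n\<close> orthogonality reduces the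
    left side to \<open>w n\<close>.\<close>
  have sp: "(\<integral>s. s ^ n * poly (gs j) s \<partial>\<nu>) = gs_coeff \<nu> n j * w j"
  proof (cases "j = n")
    case True
    have "s ^ n * poly (gs n) s = (poly (gs n) s)\<^sup>2 + (\<Sum>i<n. gs_coeff \<nu> n i * (poly (gs n) s * poly (gs i) s))" for s
      by (subst power_gram_schmidt[of _ n \<nu>])
         (simp add: lessThan_Suc_atMost[symmetric] gs_coeff_def sum_distrib_left sum_distrib_right power2_eq_square algebra_simps)
    then have "(\<integral>s. s ^ n * poly (gs n) s \<partial>\<nu>) = w n + (\<Sum>i<n. gs_coeff \<nu> n i * (\<integral>s. poly (gs n) s * poly (gs i) s \<partial>\<nu>))"
      by (simp add: Bochner_Integration.integral_sum)
    also have "\<dots> = w n" by (simp add: gs_orth)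
    finally show ?thesis using True by (simp add: gs_coeff_def)
  next
    case False
    show ?thesis
    proof (cases "w j = 0")
      case True
      then have "AE s in \<nu>. poly (gs j) s = 0" using poly_square_0 by blast
      then have "(\<integral>s. poly (gs j) s * s ^ n \<partial>\<nu>) = 0" by (rule integral_AE_0[OF _ poly_borel])
      then show ?thesis using True by (simp add: mult.commute)
    qed (simp add: gs_coeff_def False)
  qed
  have "0 \<le> (\<integral>s. (s ^ n - gs_coeff \<nu> n j * poly (gs j) s)\<^sup>2 \<partial>\<nu>)" by simp
  also have "(\<integral>s. (s ^ n - gs_coeff \<nu> n j * poly (gs j) s)\<^sup>2 \<partial>\<nu>) =
    (\<integral>s. (s ^ n)\<^sup>2 - 2 * gs_coeff \<nu> n j * (s ^ n * poly (gs j) s) + (gs_coeff \<nu> n j)\<^sup>2 * (poly (gs j) s)\<^sup>2 \<partial>\<nu>)"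
    by (intro Bochner_Integration.integral_cong refl) (simp add: power2_diff power_mult_distrib)
  also have "\<dots> = (\<integral>s. (s ^ n)\<^sup>2 \<partial>\<nu>) - 2 * gs_coeff \<nu> n j * (\<integral>s. s ^ n * poly (gs j) s \<partial>\<nu>) + (gs_coeff \<nu> n j)\<^sup>2 * w j"
    using int by simp
  also have "\<dots> = (\<integral>s. (s ^ n)\<^sup>2 \<partial>\<nu>) - (gs_coeff \<nu> n j)\<^sup>2 * w j"
    unfolding sp by (simp add: power2_eq_square)
  finally show ?thesis using m by simp
qed

end

context jacobi_setting
begin

section \<open>Measurable dependence of the orthogonal polynomials on the point t\<close>

lemma bounded_prob_mu:
  assumes "compact L" obtains R where "R > 0" "\<And>t. t \<in> L \<Longrightarrow> bounded_prob (\<mu> t) R"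
proof -
  obtain R where R: "R > 0" "\<And>t. t \<in> L \<Longrightarrow> AE s in \<mu> t. \<bar>s\<bar> \<le> R" using kernel_bound[OF assms] by metis
  then have "bounded_prob (\<mu> t) R" if "t \<in> L" for t
    using prob_mu[of t] that by (simp add: bounded_prob_def bounded_prob_axioms_def)
  then show ?thesis using that R(1) by blast
qed

lemma bounded_prob_mu': "\<exists>R. bounded_prob (\<mu> t) R"
  using bounded_prob_mu[of "{t}"] by auto

text \<open>Proved simultaneously: the coefficients at stage n are quotients of fibre integrals of
  the polynomials at earlier stages, and they in turn determine the values and coefficients of the
  polynomial at stage n.\<close>

lemma gs_measurable:
  "(\<lambda>z. poly (gram_schmidt (\<mu> (fst z)) n) (snd z)) \<in> borel_measurable borel \<and>
   (\<forall>j\<le>n. (\<lambda>t. gs_coeff (\<mu> t) n j) \<in> borel_measurable borel) \<and>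
   (\<forall>i. (\<lambda>t. coeff (gram_schmidt (\<mu> t) n) i) \<in> borel_measurable borel)"
proof (induction n rule: less_induct)
  case (less n)
  have [measurable]: "(\<lambda>z. poly (gram_schmidt (\<mu> (fst z)) j) (snd z)) \<in> borel_measurable borel" if "j < n" for j
    using less that by blast
  have c: "(\<lambda>t. gs_coeff (\<mu> t) n j) \<in> borel_measurable borel" if "j \<le> n" for j
  proof (cases "j = n")
    case False
    then have [measurable]: "(\<lambda>z. poly (gram_schmidt (\<mu> (fst z)) j) (snd z)) \<in> borel_measurable borel"
      using less that by simp
    have "(\<lambda>t. \<integral>s. snd (t, s) ^ n * poly (gram_schmidt (\<mu> (fst (t, s))) j) (snd (t, s)) \<partial>\<mu> t) \<in> borel_measurable borel"
      "(\<lambda>t. \<integral>s. (poly (gram_schmidt (\<mu> (fst (t, s))) j) (snd (t, s)))\<^sup>2 \<partial>\<mu> t) \<in> borel_measurable borel"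
      by (rule borel_measurable_integral_mu, measurable)+
    then show ?thesis using False by (simp add: gs_coeff_def)
  qed (simp add: gs_coeff_def)
  have "(\<lambda>z. snd z ^ n - (\<Sum>j<n. gs_coeff (\<mu> (fst z)) n j * poly (gram_schmidt (\<mu> (fst z)) j) (snd z))) \<in> borel_measurable borel"
    using c less by (intro borel_measurable_diff borel_measurable_sum borel_measurable_times borel_measurable_power
        measurable_compose[OF fst_borel]) auto
  moreover have "(\<lambda>t. coeff (monom 1 n) i - (\<Sum>j<n. gs_coeff (\<mu> t) n j * coeff (gram_schmidt (\<mu> t) j) i)) \<in> borel_measurable borel" for i
    using c less by (intro borel_measurable_diff borel_measurable_sum borel_measurable_times) auto
  moreover have "(\<lambda>z. poly (gram_schmidt (\<mu> (fst z)) n) (snd z)) =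
      (\<lambda>z. snd z ^ n - (\<Sum>j<n. gs_coeff (\<mu> (fst z)) n j * poly (gram_schmidt (\<mu> (fst z)) j) (snd z)))"
    by (rule ext, subst gram_schmidt_eq) (simp add: poly_monom poly_sum)
  moreover have "(\<lambda>t. coeff (gram_schmidt (\<mu> t) n) i) =
      (\<lambda>t. coeff (monom 1 n) i - (\<Sum>j<n. gs_coeff (\<mu> t) n j * coeff (gram_schmidt (\<mu> t) j) i))" for i
    by (rule ext, subst gram_schmidt_eq) (simp add: coeff_sum)
  ultimately show ?case using c by (simp only: refl simp_thms) blast
qed

definition ortho :: "nat \<Rightarrow> 't \<times> real \<Rightarrow> real" where
  "ortho l z = poly (monic_orthogonal_poly (\<mu> (fst z)) l) (snd z)"

text \<open>The case distinction now depends on a fibre integral, which is measurable in t, rather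
  than on the support of the fibre measure.\<close>

lemma monic_orthogonal_poly_mu:
  "monic_orthogonal_poly (\<mu> t) l = (if (\<integral>s. (poly (gram_schmidt (\<mu> t) l) s)\<^sup>2 \<partial>\<mu> t) = 0 then 0 else gram_schmidt (\<mu> t) l)"
  using bounded_prob_mu'[of t] bounded_prob.monic_orthogonal_poly_eq by blast

lemma gs_norm_measurable: "(\<lambda>t. \<integral>s. (poly (gram_schmidt (\<mu> t) l) s)\<^sup>2 \<partial>\<mu> t) \<in> borel_measurable borel"
proof -
  have [measurable]: "(\<lambda>z. poly (gram_schmidt (\<mu> (fst z)) l) (snd z)) \<in> borel_measurable borel" using gs_measurable by blast
  have "(\<lambda>t. \<integral>s. (poly (gram_schmidt (\<mu> (fst (t, s))) l) (snd (t, s)))\<^sup>2 \<partial>\<mu> t) \<in> borel_measurable borel"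
    by (rule borel_measurable_integral_mu) measurable
  then show ?thesis by simp
qed

lemma ortho_measurable [measurable]: "ortho l \<in> borel_measurable borel"
proof -
  note [measurable] = gs_norm_measurable gs_measurable[THEN conjunct1]
  have "(\<lambda>z. if (\<integral>s. (poly (gram_schmidt (\<mu> (fst z)) l) s)\<^sup>2 \<partial>\<mu> (fst z)) = 0 then 0
      else poly (gram_schmidt (\<mu> (fst z)) l) (snd z)) \<in> borel_measurable borel"
    by (intro measurable_If) measurable
  then show ?thesis unfolding ortho_def monic_orthogonal_poly_mu by (simp add: if_distrib[of "\<lambda>p. poly p _"] cong: if_cong)
qed

lemma ortho_coeff_measurable: "(\<lambda>t. coeff (monic_orthogonal_poly (\<mu> t) l) i) \<in> borel_measurable borel"
proof -
  note [measurable] = gs_norm_measurable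
  have [measurable]: "(\<lambda>t. coeff (gram_schmidt (\<mu> t) l) i) \<in> borel_measurable borel" using gs_measurable by blast
  have "(\<lambda>t. if (\<integral>s. (poly (gram_schmidt (\<mu> t) l) s)\<^sup>2 \<partial>\<mu> t) = 0 then 0
      else coeff (gram_schmidt (\<mu> t) l) i) \<in> borel_measurable borel"
    by (intro measurable_If) measurable
  then show ?thesis unfolding monic_orthogonal_poly_mu by (simp add: if_distrib[of "\<lambda>p. coeff p _"] cong: if_cong)
qed

lemma ortho_degree: "degree (monic_orthogonal_poly (\<mu> t) l) \<le> l"
  using gram_schmidt_degree[of "\<mu> t" l] by (simp add: monic_orthogonal_poly_mu)

end

section \<open>The isometries \<open>f \<mapsto> f(t\<^sub>1, \<dots>, t\<^sub>i) \<phi>\<^sub>1(t\<^sub>1, s\<^sub>1) \<cdots> \<phi>\<^sub>i(t\<^sub>i, s\<^sub>i)\<close>\<close>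

context jacobi_setting
begin

text \<open>General enough for two families: \<phi> j = p^(l_j), which gives the spaces
  \<open>H_fock\<close>, and \<phi> j = s^(a j), which gives the terms of a monomial applied to the
  vacuum. Finite fibre integrals make the weights finite everywhere.\<close>

definition slots :: "(nat \<Rightarrow> 't \<times> real \<Rightarrow> real) \<Rightarrow> bool" where
  "slots \<phi> \<longleftrightarrow> (\<forall>j. \<phi> j \<in> borel_measurable borel \<and> (\<forall>t. (\<integral>\<^sup>+s. ennreal ((\<phi> j (t, s))\<^sup>2) \<partial>\<mu> t) < \<infinity>))"

text \<open>For u = p^(l) this is the measure \<sigma>^(l), see
  \<open>weighted_measure_slot\<close>.\<close>

definition slot_measure :: "('t \<times> real \<Rightarrow> real) \<Rightarrow> 't measure" where
  "slot_measure u = density \<sigma> (\<lambda>t. \<integral>\<^sup>+s. ennreal ((u (t, s))\<^sup>2) \<partial>\<mu> t)"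

abbreviation slot_power :: "nat \<Rightarrow> (nat \<Rightarrow> 't \<times> real \<Rightarrow> real) \<Rightarrow> (nat \<Rightarrow> 't) measure" where
  "slot_power i \<phi> \<equiv> PiM {..<i} (\<lambda>j. slot_measure (\<phi> j))"

abbreviation fst_tuple :: "nat \<Rightarrow> (nat \<Rightarrow> 't \<times> real) \<Rightarrow> nat \<Rightarrow> 't" where
  "fst_tuple i y \<equiv> (\<lambda>j\<in>{..<i}. fst (y j))"

definition slot_map :: "nat \<Rightarrow> (nat \<Rightarrow> 't \<times> real \<Rightarrow> real) \<Rightarrow> ((nat \<Rightarrow> 't) \<Rightarrow> real) \<Rightarrow> 't fock_vector" where
  "slot_map i \<phi> f = l2_embed i (\<lambda>y. f (fst_tuple i y) * (\<Prod>j<i. \<phi> j (y j)))"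

lemma sets_slot_measure [simp, measurable_cong]: "sets (slot_measure u) = sets borel"
  by (simp add: slot_measure_def)

lemma space_slot_measure [simp]: "space (slot_measure u) = UNIV"
  by (simp add: slot_measure_def)

lemma emeasure_slot_measure:
  assumes [measurable]: "u \<in> borel_measurable borel" "A \<in> sets borel"
  shows "emeasure (slot_measure u) A = (\<integral>\<^sup>+z. ennreal ((u z)\<^sup>2) * indicator A (fst z) \<partial>lm)"
proof -
  have m: "(\<lambda>t. \<integral>\<^sup>+s. ennreal ((u (t, s))\<^sup>2) \<partial>\<mu> t) \<in> borel_measurable borel" by measurable
  have "emeasure (slot_measure u) A = (\<integral>\<^sup>+t. (\<integral>\<^sup>+s. ennreal ((u (t, s))\<^sup>2) \<partial>\<mu> t) * indicator A t \<partial>\<sigma>)"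
    unfolding slot_measure_def using m by (intro emeasure_density) (simp_all cong: measurable_cong_sets)
  also have "\<dots> = (\<integral>\<^sup>+t. \<integral>\<^sup>+s. ennreal ((u (t, s))\<^sup>2) * indicator A (fst (t, s)) \<partial>\<mu> t \<partial>\<sigma>)"
    by (intro nn_integral_cong) (simp add: nn_integral_multc)
  also have "\<dots> = (\<integral>\<^sup>+z. ennreal ((u z)\<^sup>2) * indicator A (fst z) \<partial>lm)"
    by (rule nn_integral_lm[symmetric]) measurable
  finally show ?thesis .
qed

lemma slots_sigma_finite: "slots \<phi> \<Longrightarrow> product_sigma_finite (\<lambda>j. slot_measure (\<phi> j))"
proof
  fix j assume "slots \<phi>"
  then have [measurable]: "\<phi> j \<in> borel_measurable borel" and fin: "(\<integral>\<^sup>+s. ennreal ((\<phi> j (t, s))\<^sup>2) \<partial>\<mu> t) < \<infinity>" for t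
    by (auto simp: slots_def)
  have m: "(\<lambda>t. \<integral>\<^sup>+s. ennreal ((\<phi> j (t, s))\<^sup>2) \<partial>\<mu> t) \<in> borel_measurable borel" by measurable
  have "sigma_finite_measure (slot_measure (\<phi> j))" unfolding slot_measure_def
    using fin m by (subst sigma_finite_measure.sigma_finite_iff_density_finite[OF sigma_finite_sigma])
      (simp_all add: less_top cong: measurable_cong_sets)
  then interpret sigma_finite_measure "slot_measure (\<phi> j)" .
  show "\<exists>A. countable A \<and> A \<subseteq> sets (slot_measure (\<phi> j)) \<and> \<Union>A = space (slot_measure (\<phi> j)) \<and> (\<forall>a\<in>A. emeasure (slot_measure (\<phi> j)) a \<noteq> \<infinity>)"
    by (rule sigma_finite_countable)
qed

lemma fst_tuple_slot_measurable:
  "fst_tuple i \<in> measurable (lift_power \<sigma> \<mu> i) (slot_power i \<phi>)"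
proof (rule measurable_restrict)
  fix j assume j: "j \<in> {..<i}"
  have "(\<lambda>y. y j) \<in> measurable (lift_power \<sigma> \<mu> i) lm" by (rule measurable_component_singleton[OF j])
  moreover have "fst \<in> measurable lm (slot_measure (\<phi> j))" by (simp cong: measurable_cong_sets)
  ultimately show "(\<lambda>y. fst (y j)) \<in> measurable (lift_power \<sigma> \<mu> i) (slot_measure (\<phi> j))" by (rule measurable_compose)
qed

lemma slots_prod_measurable:
  assumes "slots \<phi>" shows "(\<lambda>y. \<Prod>j<i. \<phi> j (y j)) \<in> borel_measurable (lift_power \<sigma> \<mu> i)"
proof (rule borel_measurable_prod)
  fix j assume j: "j \<in> {..<i}"
  have "(\<lambda>y. y j) \<in> measurable (lift_power \<sigma> \<mu> i) lm" by (rule measurable_component_singleton[OF j])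
  moreover have "\<phi> j \<in> measurable lm borel" using assms by (simp add: slots_def cong: measurable_cong_sets)
  ultimately show "(\<lambda>y. \<phi> j (y j)) \<in> borel_measurable (lift_power \<sigma> \<mu> i)" by (rule measurable_compose)
qed

text \<open>The isometry property in terms of measures: weighting the product measure by the squared
  factors and forgetting the fibre coordinates gives the product of the slot measures. On boxes both
  sides factorize.\<close>

lemma distr_slot_power:
  assumes s: "slots \<phi>"
  shows "distr (density (lift_power \<sigma> \<mu> i) (\<lambda>y. ennreal ((\<Prod>j<i. \<phi> j (y j))\<^sup>2))) (slot_power i \<phi>) (fst_tuple i) = slot_power i \<phi>"
proof (rule product_sigma_finite.PiM_eqI[OF slots_sigma_finite[OF s]])
  have \<phi>m [measurable]: "\<phi> j \<in> borel_measurable borel" for j using s by (simp add: slots_def)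
  note pm [measurable] = slots_prod_measurable[OF s, of i]
  note tm [measurable] = fst_tuple_slot_measurable[of i \<phi>]
  fix A assume A: "\<And>j. j \<in> {..<i} \<Longrightarrow> A j \<in> sets (slot_measure (\<phi> j))"
  have AP: "PiE {..<i} A \<in> sets (slot_power i \<phi>)" using A by (intro sets_PiM_I_finite) auto
  have "emeasure (distr (density (lift_power \<sigma> \<mu> i) (\<lambda>y. ennreal ((\<Prod>j<i. \<phi> j (y j))\<^sup>2))) (slot_power i \<phi>) (fst_tuple i)) (PiE {..<i} A)
    = emeasure (density (lift_power \<sigma> \<mu> i) (\<lambda>y. ennreal ((\<Prod>j<i. \<phi> j (y j))\<^sup>2))) (fst_tuple i -` PiE {..<i} A \<inter> space (lift_power \<sigma> \<mu> i))"
    using AP tm by (subst emeasure_distr) (simp_all cong: measurable_cong_sets)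
  also have "\<dots> = (\<integral>\<^sup>+y. ennreal ((\<Prod>j<i. \<phi> j (y j))\<^sup>2) * indicator (fst_tuple i -` PiE {..<i} A \<inter> space (lift_power \<sigma> \<mu> i)) y \<partial>lift_power \<sigma> \<mu> i)"
    using measurable_sets[OF tm AP] pm by (intro emeasure_density) auto
  also have "\<dots> = (\<integral>\<^sup>+y. (\<Prod>j<i. (ennreal ((\<phi> j (y j))\<^sup>2) * indicator (A j) (fst (y j)))) \<partial>lift_power \<sigma> \<mu> i)"
  proof (rule nn_integral_cong)
    fix y assume y: "y \<in> space (lift_power \<sigma> \<mu> i)"
    have "indicator (fst_tuple i -` PiE {..<i} A \<inter> space (lift_power \<sigma> \<mu> i)) y = (\<Prod>j<i. indicator (A j) (fst (y j)) :: ennreal)"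
    proof (cases "\<forall>j<i. fst (y j) \<in> A j")
      case True
      then show ?thesis using y by (auto simp: indicator_def)
    next
      case False
      then obtain j where "j < i" "fst (y j) \<notin> A j" by blast
      then have "(\<Prod>j<i. indicator (A j) (fst (y j)) :: ennreal) = 0" by (intro prod_zero bexI[of _ j]) auto
      then show ?thesis using False by (auto simp: indicator_def)
    qed
    moreover have "ennreal ((\<Prod>j<i. \<phi> j (y j))\<^sup>2) = (\<Prod>j<i. ennreal ((\<phi> j (y j))\<^sup>2))"
      by (simp add: prod_ennreal prod_power_distrib)
    ultimately show "ennreal ((\<Prod>j<i. \<phi> j (y j))\<^sup>2) * indicator (fst_tuple i -` PiE {..<i} A \<inter> space (lift_power \<sigma> \<mu> i)) y
      = (\<Prod>j<i. (ennreal ((\<phi> j (y j))\<^sup>2) * indicator (A j) (fst (y j))))" by (simp add: prod.distrib)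
  qed
  also have "\<dots> = (\<Prod>j<i. \<integral>\<^sup>+z. ennreal ((\<phi> j z)\<^sup>2) * indicator (A j) (fst z) \<partial>lm)"
  proof (rule lm.product_nn_integral_prod[where f="\<lambda>j z. ennreal ((\<phi> j z)\<^sup>2) * indicator (A j) (fst z)"])
    fix j assume "j \<in> {..<i}"
    then have [measurable]: "A j \<in> sets borel" using A by simp
    have "(\<lambda>z. ennreal ((\<phi> j z)\<^sup>2) * indicator (A j) (fst z)) \<in> borel_measurable borel" by measurable
    then show "(\<lambda>z. ennreal ((\<phi> j z)\<^sup>2) * indicator (A j) (fst z)) \<in> borel_measurable lm" by (simp cong: measurable_cong_sets)
  qed simp
  also have "\<dots> = (\<Prod>j<i. emeasure (slot_measure (\<phi> j)) (A j))"
    using A by (intro prod.cong refl emeasure_slot_measure[symmetric] \<phi>m) simp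
  finally show "emeasure (distr (density (lift_power \<sigma> \<mu> i) (\<lambda>y. ennreal ((\<Prod>j<i. \<phi> j (y j))\<^sup>2))) (slot_power i \<phi>) (fst_tuple i)) (PiE {..<i} A)
    = (\<Prod>j<i. emeasure (slot_measure (\<phi> j)) (A j))" .
qed auto

lemma nn_integral_slot_power:
  assumes s: "slots \<phi>" and f: "f \<in> borel_measurable (slot_power i \<phi>)"
  shows "(\<integral>\<^sup>+x. ennreal ((f x)\<^sup>2) \<partial>slot_power i \<phi>) = (\<integral>\<^sup>+y. ennreal ((f (fst_tuple i y) * (\<Prod>j<i. \<phi> j (y j)))\<^sup>2) \<partial>lift_power \<sigma> \<mu> i)"
proof -
  note pm [measurable] = slots_prod_measurable[OF s, of i]
  note tm [measurable] = fst_tuple_slot_measurable[of i \<phi>]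
  have fm [measurable]: "(\<lambda>y. f (fst_tuple i y)) \<in> borel_measurable (lift_power \<sigma> \<mu> i)" by (rule measurable_compose[OF tm f])
  have "(\<integral>\<^sup>+x. ennreal ((f x)\<^sup>2) \<partial>slot_power i \<phi>) =
    (\<integral>\<^sup>+x. ennreal ((f x)\<^sup>2) \<partial>distr (density (lift_power \<sigma> \<mu> i) (\<lambda>y. ennreal ((\<Prod>j<i. \<phi> j (y j))\<^sup>2))) (slot_power i \<phi>) (fst_tuple i))"
    by (simp only: distr_slot_power[OF s])
  also have "\<dots> = (\<integral>\<^sup>+y. ennreal ((f (fst_tuple i y))\<^sup>2) \<partial>density (lift_power \<sigma> \<mu> i) (\<lambda>y. ennreal ((\<Prod>j<i. \<phi> j (y j))\<^sup>2)))"
    using tm f by (intro nn_integral_distr) (simp_all cong: measurable_cong_sets)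
  also have "\<dots> = (\<integral>\<^sup>+y. ennreal ((\<Prod>j<i. \<phi> j (y j))\<^sup>2) * ennreal ((f (fst_tuple i y))\<^sup>2) \<partial>lift_power \<sigma> \<mu> i)"
    by (rule nn_integral_density) measurable
  also have "\<dots> = (\<integral>\<^sup>+y. ennreal ((f (fst_tuple i y) * (\<Prod>j<i. \<phi> j (y j)))\<^sup>2) \<partial>lift_power \<sigma> \<mu> i)"
    by (intro nn_integral_cong) (simp add: power_mult_distrib mult.commute flip: ennreal_mult)
  finally show ?thesis .
qed

lemma slot_map_component:
  assumes s: "slots \<phi>" and f: "f \<in> borel_measurable (slot_power i \<phi>)"
  shows "(\<lambda>y. f (fst_tuple i y) * (\<Prod>j<i. \<phi> j (y j))) \<in> L2 (lift_power \<sigma> \<mu> i) \<longleftrightarrow> f \<in> L2 (slot_power i \<phi>)"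
proof -
  have "(\<lambda>y. f (fst_tuple i y) * (\<Prod>j<i. \<phi> j (y j))) \<in> borel_measurable (lift_power \<sigma> \<mu> i)"
    by (intro borel_measurable_times slots_prod_measurable[OF s] measurable_compose[OF fst_tuple_slot_measurable f])
  then show ?thesis using f by (simp add: L2_iff_nn_integral nn_integral_slot_power[OF s f])
qed

lemma slot_map_fock: "slots \<phi> \<Longrightarrow> f \<in> L2 (slot_power i \<phi>) \<Longrightarrow> slot_map i \<phi> f \<in> fock"
  unfolding slot_map_def fock_l2_sum using slot_map_component[OF _ L2_measurable] by (intro l2_embed_in) blast

lemma slot_map_nrm:
  assumes s: "slots \<phi>" and f: "f \<in> L2 (slot_power i \<phi>)"
  shows "fock.nrm (slot_map i \<phi> f) = snorm (l2_inner (slot_power i \<phi>)) f"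
proof -
  have c: "(\<lambda>y. f (fst_tuple i y) * (\<Prod>j<i. \<phi> j (y j))) \<in> L2 (lift_power \<sigma> \<mu> i)"
    using slot_map_component[OF s L2_measurable[OF f]] f by blast
  have n: "fock.nrm (slot_map i \<phi> f) = snorm (l2_inner (lift_power \<sigma> \<mu> i)) (\<lambda>y. f (fst_tuple i y) * (\<Prod>j<i. \<phi> j (y j)))"
    unfolding slot_map_def fock_l2_sum by (rule l2_embed_nrm)
  have "ennreal ((fock.nrm (slot_map i \<phi> f))\<^sup>2) = ennreal ((snorm (l2_inner (slot_power i \<phi>)) f)\<^sup>2)"
    unfolding n nn_integral_L2[OF c, symmetric] nn_integral_L2[OF f, symmetric]
    by (rule nn_integral_slot_power[OF s L2_measurable[OF f], symmetric])
  then have "(fock.nrm (slot_map i \<phi> f))\<^sup>2 = (snorm (l2_inner (slot_power i \<phi>)) f)\<^sup>2" by simp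
  then show ?thesis
    by (subst (asm) power2_eq_iff_nonneg) (auto intro!: semi_inner.nrm_nonneg[OF L2_semi_inner] f fock.nrm_nonneg slot_map_fock s)
qed

lemma slot_map_linear: "slot_map i \<phi> (f + g) = slot_map i \<phi> f + slot_map i \<phi> g" "slot_map i \<phi> (c *\<^sub>R f) = c *\<^sub>R slot_map i \<phi> f"
  by (auto simp: slot_map_def l2_embed_def fun_eq_iff fun_apply distrib_right)

text \<open>By isometry the admissible \<open>f\<close> form a closed subspace, so
  \<open>L2_dense\<close> applies with boxes as generator; the image of the indicator of a box is an
  elementary tensor. The exhaustion \<Omega> may be adapted to the slots, so that only tensors with
  well-behaved factors have to be treated.\<close>

lemma slot_map_dense:
  assumes s: "slots \<phi>" and V: "closed_sub fock (fock_inner \<sigma> \<mu>) W"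
    and \<Omega>: "\<And>k j. \<Omega> k j \<in> sets borel" "\<And>j. incseq (\<lambda>k. \<Omega> k j)" "\<And>j. (\<Union>k. \<Omega> k j) = UNIV"
      "\<And>k j. j < i \<Longrightarrow> emeasure (slot_measure (\<phi> j)) (\<Omega> k j) < \<infinity>"
    and T: "\<And>k A. (\<And>j. j < i \<Longrightarrow> A j \<in> sets borel \<and> A j \<subseteq> \<Omega> k j) \<Longrightarrow>
      tens (map (\<lambda>j z. indicat_real (A j) (fst z) * \<phi> j z) [0..<i]) \<in> W"
    and f: "f \<in> L2 (slot_power i \<phi>)"
  shows "slot_map i \<phi> f \<in> W"
proof -
  interpret P: product_sigma_finite "\<lambda>j. slot_measure (\<phi> j)" by (rule slots_sigma_finite[OF s])
  let ?M = "slot_power i \<phi>"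
  let ?E = "prod_algebra {..<i} (\<lambda>j. slot_measure (\<phi> j))"
  have Ex: "?E = {PiE {..<i} X | X. X \<in> (\<Pi> j\<in>{..<i}. sets (slot_measure (\<phi> j)))}"
    by (rule prod_algebra_eq_finite) simp
  have "{f \<in> L2 ?M. slot_map i \<phi> f \<in> W} = L2 ?M"
  proof (rule L2_dense[where E="?E" and \<Omega>="\<lambda>k. PiE {..<i} (\<Omega> k)"])
    show "closed_sub (L2 ?M) (l2_inner ?M) {f \<in> L2 ?M. slot_map i \<phi> f \<in> W}"
      by (rule closed_sub_vimage[OF fock.semi_hilbert_axioms L2_semi_hilbert _ _ _ _ V, where B=1])
         (simp_all add: slot_map_fock[OF s] slot_map_linear slot_map_nrm[OF s])
    show "Int_stable ?E" by (rule Int_stable_prod_algebra)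
    show "?E \<subseteq> Pow (space ?M)" using prod_algebra_sets_into_space[of "{..<i}" "\<lambda>j. slot_measure (\<phi> j)"] by (simp add: space_PiM)
    show "sets ?M = sigma_sets (space ?M) ?E" by (simp add: sets_PiM space_PiM)
    show "space ?M \<in> ?E" unfolding Ex space_PiM by blast
    show "PiE {..<i} (\<Omega> k) \<in> sets ?M" for k using \<Omega>(1) by (intro sets_PiM_I_finite) auto
    show "emeasure ?M (PiE {..<i} (\<Omega> k)) < \<infinity>" for k
      using \<Omega>(1,4) by (subst P.emeasure_PiM) (auto simp: less_top[symmetric] ennreal_prod_eq_top)
    show "incseq (\<lambda>k. PiE {..<i} (\<Omega> k))" using \<Omega>(2) by (auto simp: incseq_def PiE_iff) blast
    show "(\<Union>k. PiE {..<i} (\<Omega> k)) = space ?M"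
    proof (intro equalityI subsetI)
      fix x assume x: "x \<in> space ?M"
      have "\<forall>j. \<exists>k. x j \<in> \<Omega> k j" using \<Omega>(3) by (metis UNIV_I UN_E)
      then obtain k where k: "\<And>j. x j \<in> \<Omega> (k j) j" by metis
      \<comment> \<open>Finitely many coordinates allow a common index; the inserted 0 covers
        \<open>i = 0\<close>.\<close>
      define K where "K = Max (insert 0 (k ` {..<i}))"
      have "x j \<in> \<Omega> K j" if "j < i" for j
      proof -
        have "k j \<le> K" using that by (simp add: K_def)
        then show ?thesis using \<Omega>(2)[of j] k[of j] by (auto simp: incseq_def)
      qed
      then have "x \<in> PiE {..<i} (\<Omega> K)" using x by (auto simp: space_PiM PiE_iff)
      then show "x \<in> (\<Union>k. PiE {..<i} (\<Omega> k))" by blast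
    qed (auto simp: space_PiM PiE_iff)
    fix B k assume "B \<in> ?E"
    then obtain X where X: "B = PiE {..<i} X" "\<And>j. j < i \<Longrightarrow> X j \<in> sets borel" unfolding Ex by auto
    define A where "A j = X j \<inter> \<Omega> k j" for j
    have BA: "B \<inter> PiE {..<i} (\<Omega> k) = PiE {..<i} A" unfolding X(1) A_def by (rule PiE_Int)
    have Am: "A j \<in> sets borel \<and> A j \<subseteq> \<Omega> k j" if "j < i" for j using X(2)[OF that] \<Omega>(1)[of k j] by (auto simp: A_def)
    have "indicat_real (PiE {..<i} A) \<in> L2 ?M"
    proof (rule indicator_in_L2)
      show "PiE {..<i} A \<in> sets ?M" using Am by (intro sets_PiM_I_finite) auto
      have "emeasure (slot_measure (\<phi> j)) (A j) < \<infinity>" if "j < i" for j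
      proof -
        have "emeasure (slot_measure (\<phi> j)) (A j) \<le> emeasure (slot_measure (\<phi> j)) (\<Omega> k j)"
          using Am[OF that] \<Omega>(1) by (intro emeasure_mono) auto
        then show ?thesis using \<Omega>(4)[OF that, of k] by (rule le_less_trans)
      qed
      then show "emeasure ?M (PiE {..<i} A) < \<infinity>"
        using Am by (subst P.emeasure_PiM) (auto simp: less_top[symmetric] ennreal_prod_eq_top)
    qed
    moreover have "slot_map i \<phi> (indicat_real (PiE {..<i} A)) = tens (map (\<lambda>j z. indicat_real (A j) (fst z) * \<phi> j z) [0..<i])"
    proof -
      have "indicat_real (PiE {..<i} A) (fst_tuple i y) = (\<Prod>j<i. indicat_real (A j) (fst (y j)))" for y
      proof (cases "\<forall>j<i. fst (y j) \<in> A j")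
        case False
        then obtain j where "j < i" "fst (y j) \<notin> A j" by blast
        then have "(\<Prod>j<i. indicat_real (A j) (fst (y j))) = 0" by (intro prod_zero bexI[of _ j]) auto
        then show ?thesis using False by (auto simp: indicator_def)
      qed (auto simp: indicator_def)
      then show ?thesis unfolding slot_map_def tens_def by (auto simp: prod.distrib intro!: arg_cong[where f="l2_embed i"])
    qed
    ultimately show "indicat_real (B \<inter> PiE {..<i} (\<Omega> k)) \<in> {f \<in> L2 ?M. slot_map i \<phi> f \<in> W}"
      unfolding BA using T[of A k] Am by simp
  qed
  then show ?thesis using f by blast
qed

lemma slot_map_inner_length:
  assumes "slots \<phi>" "slots \<psi>" "i \<noteq> k"
  shows "fock_inner \<sigma> \<mu> (slot_map i \<phi> f) (slot_map k \<psi> g) = 0"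
  using assms unfolding slot_map_def fock_l2_sum l2_embed_inner by (simp add: l2_embed_def l2_inner_def zero_fun_apply)

section \<open>The spaces \<open>H_fock\<close>\<close>

abbreviation ortho_slots :: "nat list \<Rightarrow> nat \<Rightarrow> 't \<times> real \<Rightarrow> real" where
  "ortho_slots ls \<equiv> \<lambda>j. ortho (ls ! j)"

lemma ortho_square_integrable: "integrable (\<mu> t) (\<lambda>s. (ortho l (t, s))\<^sup>2)"
proof -
  obtain R where "bounded_prob (\<mu> t) R" using bounded_prob_mu' by blast
  then show ?thesis by (simp add: ortho_def bounded_prob.poly_square_integrable)
qed

lemma slots_ortho: "slots (ortho_slots ls)"
  using ortho_square_integrable by (auto simp: slots_def integrable_iff_bounded)

lemma weighted_measure_slot: "weighted_measure \<sigma> \<mu> l = slot_measure (ortho l)"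
proof -
  have "ennreal (\<integral>s. \<bar>poly (monic_orthogonal_poly (\<mu> t) l) s\<bar>\<^sup>2 \<partial>\<mu> t) = (\<integral>\<^sup>+s. ennreal ((ortho l (t, s))\<^sup>2) \<partial>\<mu> t)" for t
    using ortho_square_integrable[of t l] by (subst nn_integral_eq_integral) (auto simp: ortho_def)
  then show ?thesis by (simp add: weighted_measure_def slot_measure_def)
qed

abbreviation ortho_map :: "nat list \<Rightarrow> ((nat \<Rightarrow> 't) \<Rightarrow> real) \<Rightarrow> 't fock_vector" where
  "ortho_map ls \<equiv> slot_map (length ls) (ortho_slots ls)"

abbreviation L2o :: "nat list \<Rightarrow> ((nat \<Rightarrow> 't) \<Rightarrow> real) set" where
  "L2o ls \<equiv> L2 (slot_power (length ls) (ortho_slots ls))"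

text \<open>Puts the almost-everywhere description of \<open>H_fock\<close> into the form of an
  isometric range saturated by null vectors, to which \<open>closed_sub_isometry_range\<close>
  applies.\<close>

lemma H_fock_iff:
  "F \<in> H_fock \<sigma> \<mu> ls \<longleftrightarrow> F \<in> fock \<and> (\<exists>f\<in>L2o ls. fock.nrm (F - ortho_map ls f) = 0)"
proof -
  have *: "fock.nrm (F - ortho_map ls f) = 0 \<longleftrightarrow> (\<forall>m. m \<noteq> length ls \<longrightarrow> (AE y in lift_power \<sigma> \<mu> m. F m y = 0)) \<and>
     (AE y in lift_power \<sigma> \<mu> (length ls). F (length ls) y = f (fst_tuple (length ls) y) * (\<Prod>j<length ls. ortho (ls ! j) (y j)))"
    if "F \<in> fock" "f \<in> L2o ls" for f
    using l2_sum_eq_embed[of F "\<lambda>n. lift_power \<sigma> \<mu> n" "\<lambda>y. f (fst_tuple (length ls) y) * (\<Prod>j<length ls. ortho (ls ! j) (y j))" "length ls"]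
      that slot_map_component[OF slots_ortho L2_measurable[OF that(2)]]
    unfolding fock_l2_sum slot_map_def by blast
  have "F \<in> H_fock \<sigma> \<mu> ls \<longleftrightarrow> F \<in> fock \<and> (\<forall>m. m \<noteq> length ls \<longrightarrow> (AE y in lift_power \<sigma> \<mu> m. F m y = 0)) \<and>
     (\<exists>f\<in>L2o ls. AE y in lift_power \<sigma> \<mu> (length ls). F (length ls) y = f (fst_tuple (length ls) y) * (\<Prod>j<length ls. ortho (ls ! j) (y j)))"
    unfolding H_fock_def weighted_measure_slot ortho_def by simp
  then show ?thesis using * by blast
qed

lemma H_fock_closed: "closed_sub fock (fock_inner \<sigma> \<mu>) (H_fock \<sigma> \<mu> ls)"
proof -
  have "H_fock \<sigma> \<mu> ls = {F \<in> fock. \<exists>f\<in>L2o ls. fock.nrm (F - ortho_map ls f) = 0}"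
    using H_fock_iff by blast
  moreover have "closed_sub fock (fock_inner \<sigma> \<mu>) {F \<in> fock. \<exists>f\<in>L2o ls. fock.nrm (F - ortho_map ls f) = 0}"
    by (rule closed_sub_isometry_range[OF fock.semi_hilbert_axioms L2_semi_hilbert])
       (simp_all add: slot_map_fock[OF slots_ortho] slot_map_linear slot_map_nrm[OF slots_ortho])
  ultimately show ?thesis by (simp only:)
qed

lemma H_fock_subset: "H_fock \<sigma> \<mu> ls \<subseteq> fock"
  using H_fock_closed by (simp add: closed_sub_def)

text \<open>Where the coefficients of \<open>p\<^sup>(\<^sup>l\<^sup>)(t, \<cdot>)\<close> are bounded; they need not be locally bounded on \<open>T\<close>.\<close>
definition coeff_bounded :: "nat \<Rightarrow> nat \<Rightarrow> 't set" where
  "coeff_bounded l k = {t \<in> exh k. \<forall>i\<le>l. \<bar>coeff (monic_orthogonal_poly (\<mu> t) l) i\<bar> \<le> real k}"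

lemma coeff_bounded_measurable: "coeff_bounded l k \<in> sets borel"
proof -
  have [measurable]: "(\<lambda>t. coeff (monic_orthogonal_poly (\<mu> t) l) i) \<in> borel_measurable borel" for i
    by (rule ortho_coeff_measurable)
  have "coeff_bounded l k = exh k \<inter> (\<Inter>i\<le>l. {t. \<bar>coeff (monic_orthogonal_poly (\<mu> t) l) i\<bar> \<le> real k})"
    by (auto simp: coeff_bounded_def)
  also have "\<dots> \<in> sets borel"
    by (intro sets.Int exh_measurable sets.finite_INT) (auto intro!: borel_measurable_le)
  finally show ?thesis .
qed

lemma coeff_bounded_incseq: "incseq (coeff_bounded l)"
proof -
  have "coeff_bounded l k \<subseteq> coeff_bounded l m" if "k \<le> m" for k m
  proof
    fix t assume t: "t \<in> coeff_bounded l k"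
    have "exh k \<subseteq> exh m" using exh(3) that by (auto simp: incseq_def)
    moreover have "real k \<le> real m" using that by simp
    ultimately show "t \<in> coeff_bounded l m" using t unfolding coeff_bounded_def by force
  qed
  then show ?thesis by (simp add: incseq_def)
qed

lemma coeff_bounded_UN: "(\<Union>k. coeff_bounded l k) = UNIV"
proof (intro equalityI subsetI UNIV_I)
  fix t
  obtain k where k: "t \<in> exh k" using exh(4) by blast
  define S where "S = (\<Sum>i\<le>l. \<bar>coeff (monic_orthogonal_poly (\<mu> t) l) i\<bar>)"
  obtain m where m: "S \<le> real m" using real_arch_simple by blast
  have "\<bar>coeff (monic_orthogonal_poly (\<mu> t) l) i\<bar> \<le> S" if "i \<le> l" for i
    unfolding S_def using that by (intro member_le_sum) auto
  then have "\<bar>coeff (monic_orthogonal_poly (\<mu> t) l) i\<bar> \<le> real (max k m)" if "i \<le> l" for i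
    using m that by (meson le_max_iff_disj of_nat_le_iff order_trans order_refl)
  moreover have "t \<in> exh (max k m)" using incseqD[OF exh(3), of k "max k m"] k by auto
  ultimately have "t \<in> coeff_bounded l (max k m)" by (simp add: coeff_bounded_def)
  then show "t \<in> (\<Union>k. coeff_bounded l k)" by blast
qed

lemma poly_fun_sum:
  "(\<And>i. i \<le> l \<Longrightarrow> c i \<in> nice) \<Longrightarrow> (\<lambda>z. \<Sum>i\<le>l. c i (fst z) * snd z ^ i) \<in> poly_fun l"
proof (induction l arbitrary: c)
  case 0
  then show ?case by auto
next
  case (Suc l)
  have "(\<lambda>z. \<Sum>i\<le>l. c (Suc i) (fst z) * snd z ^ i) \<in> poly_fun l" using Suc.prems by (intro Suc.IH) auto
  moreover have "(\<lambda>z. \<Sum>i\<le>Suc l. c i (fst z) * snd z ^ i) = (\<lambda>z. c 0 (fst z) + snd z * (\<Sum>i\<le>l. c (Suc i) (fst z) * snd z ^ i))"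
    by (auto simp: fun_eq_iff sum.atMost_Suc_shift sum_distrib_left mult_ac simp del: sum.atMost_Suc)
  moreover have "c 0 \<in> nice" using Suc.prems by simp
  ultimately show ?case by auto
qed

lemma ortho_poly_fun:
  assumes A: "A \<in> sets borel" "A \<subseteq> coeff_bounded l k"
  shows "(\<lambda>z. indicat_real A (fst z) * ortho l z) \<in> poly_fun l"
proof -
  define c where "c i = (\<lambda>t. indicat_real A t * coeff (monic_orthogonal_poly (\<mu> t) l) i)" for i
  have "c i \<in> nice" if "i \<le> l" for i
  proof -
    have "c i \<in> borel_measurable borel" unfolding c_def using A ortho_coeff_measurable by simp
    moreover have "\<bar>c i t\<bar> \<le> real k" for t
      using A(2) that by (auto simp: c_def indicator_def coeff_bounded_def)
    moreover have "c i t = 0" if "t \<notin> closure (exh k)" for t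
      using A(2) that closure_subset[of "exh k"] by (auto simp: c_def indicator_def coeff_bounded_def)
    ultimately show ?thesis using exh(2)[of k] unfolding nice_def by blast
  qed
  then have "(\<lambda>z. \<Sum>i\<le>l. c i (fst z) * snd z ^ i) \<in> poly_fun l" by (rule poly_fun_sum)
  moreover have "(\<Sum>i\<le>l. c i (fst z) * snd z ^ i) = indicat_real A (fst z) * ortho l z" for z
  proof -
    \<comment> \<open>Summation up to \<open>l\<close> is correct even where the polynomial is 0
      because the fibre measure has at most \<open>l\<close> support points.\<close>
    have "poly (monic_orthogonal_poly (\<mu> (fst z)) l) (snd z) = (\<Sum>i\<le>l. coeff (monic_orthogonal_poly (\<mu> (fst z)) l) i * snd z ^ i)"
      unfolding poly_altdef by (rule sum.mono_neutral_left) (use ortho_degree[of "fst z" l] in \<open>auto simp: coeff_eq_0\<close>)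
    then show ?thesis by (simp add: c_def ortho_def sum_distrib_left mult.assoc)
  qed
  ultimately show ?thesis by simp
qed

lemma emeasure_slot_ortho: "emeasure (slot_measure (ortho l)) (coeff_bounded l k) < \<infinity>"
proof -
  have "(\<lambda>z. indicat_real (coeff_bounded l k) (fst z) * ortho l z) \<in> L2 lm"
    by (rule poly_fun_L2[OF ortho_poly_fun[OF coeff_bounded_measurable order_refl]])
  then have "(\<integral>\<^sup>+z. ennreal ((indicat_real (coeff_bounded l k) (fst z) * ortho l z)\<^sup>2) \<partial>lm) < \<infinity>"
    by (simp add: L2_iff_nn_integral)
  moreover have "ennreal ((indicat_real (coeff_bounded l k) (fst z) * ortho l z)\<^sup>2) = ennreal ((ortho l z)\<^sup>2) * indicator (coeff_bounded l k) (fst z)" for z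
    by (auto simp: indicator_def)
  ultimately show ?thesis by (simp add: emeasure_slot_measure[OF ortho_measurable coeff_bounded_measurable])
qed

text \<open>The tensors offered to \<open>T\<close> serve two purposes: their factors are in
  \<open>poly_fun\<close>, as \<open>tens_MP_fock\<close> requires, and they have the exact form
  1_A(t) p^(l)(t, s), as orthogonality requires.\<close>

lemma ortho_map_dense:
  assumes V: "closed_sub fock (fock_inner \<sigma> \<mu>) W"
    and T: "\<And>us. list_all2 (\<lambda>u l. u \<in> poly_fun l) us ls \<Longrightarrow>
      (\<And>j. j < length ls \<Longrightarrow> \<exists>A\<in>sets borel. us ! j = (\<lambda>z. indicat_real A (fst z) * ortho (ls ! j) z)) \<Longrightarrow> tens us \<in> W"
    and f: "f \<in> L2o ls"
  shows "ortho_map ls f \<in> W"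
proof (rule slot_map_dense[OF slots_ortho V, where \<Omega>="\<lambda>k j. coeff_bounded (ls ! j) k"])
  fix k A assume A: "\<And>j. j < length ls \<Longrightarrow> A j \<in> sets borel \<and> A j \<subseteq> coeff_bounded (ls ! j) k"
  show "tens (map (\<lambda>j z. indicat_real (A j) (fst z) * ortho (ls ! j) z) [0..<length ls]) \<in> W"
  proof (rule T)
    show "list_all2 (\<lambda>u l. u \<in> poly_fun l) (map (\<lambda>j z. indicat_real (A j) (fst z) * ortho (ls ! j) z) [0..<length ls]) ls"
      using A by (auto simp: list_all2_conv_all_nth intro: ortho_poly_fun)
  qed (use A in auto)
qed (use coeff_bounded_measurable coeff_bounded_incseq coeff_bounded_UN emeasure_slot_ortho f in auto)

text \<open>Since a factor of degree l costs l + 1, the length of the multi-index enters the weight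
  next to the sum of its entries.\<close>

lemma H_fock_MP_fock:
  assumes "sum_list ls + length ls \<le> n" shows "H_fock \<sigma> \<mu> ls \<subseteq> MP_fock n"
proof
  fix F assume "F \<in> H_fock \<sigma> \<mu> ls"
  then obtain f where f: "F \<in> fock" "f \<in> L2o ls" "fock.nrm (F - ortho_map ls f) = 0" using H_fock_iff by blast
  have w: "sum_list (map Suc ls) \<le> n"
  proof -
    have "sum_list (map Suc ls) = sum_list ls + length ls" by (induction ls) auto
    then show ?thesis using assms by simp
  qed
  have "ortho_map ls f \<in> MP_fock n" by (rule ortho_map_dense[OF MP_fock_closed tens_MP_fock[OF _ w] f(2)])
  moreover have "fock.nrm (ortho_map ls f - F) = 0"
    using f(3) fock.nrm_diff_commute[OF f(1) slot_map_fock[OF slots_ortho f(2)]] by simp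
  ultimately show "F \<in> MP_fock n" using fock.closed_sub_cong[OF MP_fock_closed _ f(1)] by blast
qed

section \<open>Orthogonality of the spaces belonging to different multi-indices\<close>

text \<open>Both indicators are constant on a fibre, where p^(l) and p^(l') are orthogonal.\<close>

lemma ortho_inner_0:
  assumes "l \<noteq> l'" "A \<in> sets borel" "B \<in> sets borel"
  shows "l2_inner lm (\<lambda>z. indicat_real A (fst z) * ortho l z) (\<lambda>z. indicat_real B (fst z) * ortho l' z) = 0"
  unfolding l2_inner_def
proof (rule integral_lm_eq_0)
  show "(\<lambda>z. indicat_real A (fst z) * ortho l z * (indicat_real B (fst z) * ortho l' z)) \<in> borel_measurable borel"
    using assms by measurable
  fix t
  obtain R where "bounded_prob (\<mu> t) R" using bounded_prob_mu' by blast
  then interpret bounded_prob "\<mu> t" R .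
  have e: "indicat_real A (fst (t, s)) * ortho l (t, s) * (indicat_real B (fst (t, s)) * ortho l' (t, s)) =
    indicat_real A t * indicat_real B t * (poly (monic_orthogonal_poly (\<mu> t) l) s * poly (monic_orthogonal_poly (\<mu> t) l') s)" for s
    by (simp add: ortho_def)
  show "integrable (\<mu> t) (\<lambda>s. indicat_real A (fst (t, s)) * ortho l (t, s) * (indicat_real B (fst (t, s)) * ortho l' (t, s)))"
    unfolding e by (intro integrable_mult_right poly_mult_integrable)
  show "(\<integral>s. indicat_real A (fst (t, s)) * ortho l (t, s) * (indicat_real B (fst (t, s)) * ortho l' (t, s)) \<partial>\<mu> t) = 0"
    unfolding e using monic_orthogonal_orth[OF assms(1)] by simp
qed

text \<open>Vectors of different degree are orthogonal in the Fock space. For equal length, a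
  density argument in each of the two arguments leaves elementary tensors, and a slot in which the
  multi-indices differ contributes the factor 0.\<close>

lemma ortho_map_orth:
  assumes ne: "ls \<noteq> ks" and f: "f \<in> L2o ls" and g: "g \<in> L2o ks"
  shows "fock_inner \<sigma> \<mu> (ortho_map ls f) (ortho_map ks g) = 0"
proof (cases "length ls = length ks")
  case False
  then show ?thesis by (intro slot_map_inner_length slots_ortho)
next
  case True
  then obtain j where j: "j < length ls" "ls ! j \<noteq> ks ! j" using ne nth_equalityI by blast
  have gF: "ortho_map ks g \<in> fock" by (rule slot_map_fock[OF slots_ortho g])
  have "ortho_map ls f \<in> {x \<in> fock. \<forall>y\<in>{ortho_map ks g}. fock_inner \<sigma> \<mu> x y = 0}"
  proof (rule ortho_map_dense[OF fock.closed_sub_orth _ f])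
    show "{ortho_map ks g} \<subseteq> fock" using gF by simp
    fix us assume us: "list_all2 (\<lambda>u l. u \<in> poly_fun l) us ls"
      "\<And>j. j < length ls \<Longrightarrow> \<exists>A\<in>sets borel. us ! j = (\<lambda>z. indicat_real A (fst z) * ortho (ls ! j) z)"
    have usL: "set us \<subseteq> L2 lm" by (rule poly_fun_list_L2[OF us(1)])
    have "ortho_map ks g \<in> {x \<in> fock. \<forall>y\<in>{tens us}. fock_inner \<sigma> \<mu> x y = 0}"
    proof (rule ortho_map_dense[OF fock.closed_sub_orth _ g])
      show "{tens us} \<subseteq> fock" using tens_fock[OF usL] by simp
      fix vs assume vs: "list_all2 (\<lambda>u l. u \<in> poly_fun l) vs ks"
        "\<And>j. j < length ks \<Longrightarrow> \<exists>A\<in>sets borel. vs ! j = (\<lambda>z. indicat_real A (fst z) * ortho (ks ! j) z)"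
      have vsL: "set vs \<subseteq> L2 lm" by (rule poly_fun_list_L2[OF vs(1)])
      have len: "length us = length ls" "length vs = length ks" using us(1) vs(1) by (auto dest: list_all2_lengthD)
      have "l2_inner lm (vs ! j) (us ! j) = 0"
        using us(2)[OF j(1)] vs(2)[of j] j True ortho_inner_0[of "ks ! j" "ls ! j"] by auto
      then have p0: "(\<Prod>j<length vs. l2_inner lm (vs ! j) (us ! j)) = 0"
        using j len True by (intro prod_zero bexI[of _ j]) auto
      have "fock_inner \<sigma> \<mu> (tens vs) (tens us) = 0"
        unfolding tens_inner[OF vsL usL] by (simp only: p0 if_cancel)
      then show "tens vs \<in> {x \<in> fock. \<forall>y\<in>{tens us}. fock_inner \<sigma> \<mu> x y = 0}"
        using tens_fock[OF vsL] by simp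
    qed
    then show "tens us \<in> {x \<in> fock. \<forall>y\<in>{ortho_map ks g}. fock_inner \<sigma> \<mu> x y = 0}"
      using tens_fock[OF usL] fock.ip_commute[of "tens us" "ortho_map ks g"] gF by simp
  qed
  then show ?thesis by simp
qed

lemma H_fock_orth:
  assumes "ls \<noteq> ks" "F \<in> H_fock \<sigma> \<mu> ls" "G \<in> H_fock \<sigma> \<mu> ks"
  shows "fock_inner \<sigma> \<mu> F G = 0"
proof -
  obtain f where f: "F \<in> fock" "f \<in> L2o ls" "fock.nrm (F - ortho_map ls f) = 0" using assms(2) H_fock_iff by blast
  obtain g where g: "G \<in> fock" "g \<in> L2o ks" "fock.nrm (G - ortho_map ks g) = 0" using assms(3) H_fock_iff by blast
  have JF: "ortho_map ls f \<in> fock" "ortho_map ks g \<in> fock" using slot_map_fock[OF slots_ortho] f g by blast+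
  have "fock_inner \<sigma> \<mu> F G = fock_inner \<sigma> \<mu> (ortho_map ls f) G" by (rule fock.ip_cong_nrm[OF f(1) JF(1) g(1) f(3)])
  also have "\<dots> = fock_inner \<sigma> \<mu> G (ortho_map ls f)" by (rule fock.ip_commute[OF JF(1) g(1)])
  also have "\<dots> = fock_inner \<sigma> \<mu> (ortho_map ks g) (ortho_map ls f)" by (rule fock.ip_cong_nrm[OF g(1) JF(2) JF(1) g(3)])
  also have "\<dots> = 0" using ortho_map_orth[OF _ g(2) f(2)] assms(1) by auto
  finally show ?thesis .
qed

section \<open>The closure of \<open>CP\<^sup>(\<^sup>n\<^sup>) \<Omega>\<close> as an orthogonal sum\<close>

text \<open>The empty multi-index is included; it accounts for the constants.\<close>
definition multi_indices_le :: "nat \<Rightarrow> nat list set" where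
  "multi_indices_le n = {ls. sum_list ls + length ls \<le> n}"

definition H_sum :: "nat \<Rightarrow> 't fock_vector set" where
  "H_sum n = {F \<in> fock. \<exists>y. (\<forall>ls\<in>multi_indices_le n. y ls \<in> H_fock \<sigma> \<mu> ls) \<and>
    fock.nrm (F - (\<Sum>ls\<in>multi_indices_le n. y ls)) = 0}"

lemma finite_multi_indices_le: "finite (multi_indices_le n)"
proof (rule finite_subset)
  show "multi_indices_le n \<subseteq> insert [] (\<Union>k\<le>n. multi_indices k)"
    by (auto simp: multi_indices_le_def multi_indices_def)
qed (simp add: finite_multi_indices)

lemma H_sum_closed: "closed_sub fock (fock_inner \<sigma> \<mu>) (H_sum n)"
  unfolding H_sum_def by (rule fock.closed_sub_orth_sum[OF finite_multi_indices_le H_fock_closed H_fock_orth])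

lemma H_sum_subspace: "subspace (H_sum n)"
  using H_sum_closed by (simp add: closed_sub_def)

lemma H_fock_H_sum:
  assumes ls: "ls \<in> multi_indices_le n" shows "H_fock \<sigma> \<mu> ls \<subseteq> H_sum n"
proof
  fix F assume F: "F \<in> H_fock \<sigma> \<mu> ls"
  define y where "y ks = (if ks = ls then F else 0)" for ks
  have "y ks \<in> H_fock \<sigma> \<mu> ks" for ks
    using F H_fock_closed[of ks] by (auto simp: y_def closed_sub_def intro: subspace_0)
  moreover have "(\<Sum>ks\<in>multi_indices_le n. y ks) = F"
    unfolding y_def using finite_multi_indices_le ls by (subst sum.delta) auto
  ultimately show "F \<in> H_sum n" using F H_fock_subset unfolding H_sum_def by force
qed

text \<open>The function on T^i is the product of the \<open>g\<close>; its square integrability is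
  read off from that of the tensor. This admits unbounded \<open>g\<close>, such as the
  Gram--Schmidt coefficients in \<open>monomial_expansion\<close>.\<close>

lemma pure_tens_H_fock:
  assumes len: "length us = length ls" and us: "set us \<subseteq> L2 lm"
    and pure: "\<And>j. j < length ls \<Longrightarrow> \<exists>g\<in>borel_measurable borel. us ! j = (\<lambda>z. g (fst z) * ortho (ls ! j) z)"
  shows "tens us \<in> H_fock \<sigma> \<mu> ls"
proof -
  have "\<forall>j. \<exists>g. j < length ls \<longrightarrow> g \<in> borel_measurable borel \<and> us ! j = (\<lambda>z. g (fst z) * ortho (ls ! j) z)"
    using pure by blast
  then obtain g where g: "\<And>j. j < length ls \<Longrightarrow> g j \<in> borel_measurable borel"
    "\<And>j. j < length ls \<Longrightarrow> us ! j = (\<lambda>z. g j (fst z) * ortho (ls ! j) z)" by metis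
  define f where "f x = (\<Prod>j<length ls. g j (x j))" for x
  have fm: "f \<in> borel_measurable (slot_power (length ls) (ortho_slots ls))"
    unfolding f_def
  proof (rule borel_measurable_prod)
    fix j assume j: "j \<in> {..<length ls}"
    have "(\<lambda>x. x j) \<in> measurable (slot_power (length ls) (ortho_slots ls)) (slot_measure (ortho (ls ! j)))"
      by (rule measurable_component_singleton[OF j])
    moreover have "g j \<in> measurable (slot_measure (ortho (ls ! j))) borel" using g(1) j by (simp cong: measurable_cong_sets)
    ultimately show "(\<lambda>x. g j (x j)) \<in> borel_measurable (slot_power (length ls) (ortho_slots ls))" by (rule measurable_compose)
  qed
  have e: "(\<lambda>y. \<Prod>j<length us. (us ! j) (y j)) = (\<lambda>y. f (fst_tuple (length ls) y) * (\<Prod>j<length ls. ortho (ls ! j) (y j)))"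
  proof
    fix y
    have "(us ! j) (y j) = g j (fst (y j)) * ortho (ls ! j) (y j)" if "j < length ls" for j
      using fun_cong[OF g(2)[OF that]] .
    then show "(\<Prod>j<length us. (us ! j) (y j)) = f (fst_tuple (length ls) y) * (\<Prod>j<length ls. ortho (ls ! j) (y j))"
      using len by (auto simp: f_def prod.distrib[symmetric] intro!: prod.cong)
  qed
  have f: "f \<in> L2o ls"
    using tens_L2[OF us] slot_map_component[OF slots_ortho fm] unfolding e unfolding len by blast
  have "tens us = ortho_map ls f" unfolding tens_def slot_map_def e unfolding len ..
  then show ?thesis using f tens_fock[OF us] unfolding H_fock_iff by (intro conjI bexI[of _ f]) auto
qed

text \<open>Up to null sets, \<open>s\<^sup>a\<close> is a combination of \<open>p\<^sup>(\<^sup>0\<^sup>), \<dots>, p\<^sup>(\<^sup>a\<^sup>)\<close>; Bessel's inequality bounds the coefficients.\<close>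
lemma monomial_expansion:
  assumes A: "A \<in> sets borel" "A \<subseteq> exh k"
  defines "v \<equiv> \<lambda>a l z. (indicat_real A (fst z) * gs_coeff (\<mu> (fst z)) a l) * ortho l z"
  shows "\<And>l. l \<le> a \<Longrightarrow> v a l \<in> L2 lm"
    and "AE z in lm. indicat_real A (fst z) * snd z ^ a = (\<Sum>l\<le>a. v a l z)"
proof -
  obtain R where R: "R > 0" "\<And>t. t \<in> closure (exh k) \<Longrightarrow> bounded_prob (\<mu> t) R" using bounded_prob_mu[OF exh(2)] by metis
  have bp: "bounded_prob (\<mu> t) R" if "t \<in> A" for t using R(2) A(2) closure_subset[of "exh k"] that by blast
  show "v a l \<in> L2 lm" if l: "l \<le> a" for l
  proof -
    have [measurable]: "(\<lambda>t. gs_coeff (\<mu> t) a l) \<in> borel_measurable borel" using gs_measurable l by blast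
    note [measurable] = A(1)
    have vm: "v a l \<in> borel_measurable borel" unfolding v_def by measurable
    have "(\<integral>\<^sup>+z. ennreal ((v a l z)\<^sup>2) \<partial>lm) = (\<integral>\<^sup>+t. \<integral>\<^sup>+s. ennreal ((v a l (t, s))\<^sup>2) \<partial>\<mu> t \<partial>\<sigma>)"
      using vm by (intro nn_integral_lm) measurable
    also have "\<dots> \<le> (\<integral>\<^sup>+t. ennreal (R ^ (2 * a)) * indicator A t \<partial>\<sigma>)"
    proof (rule nn_integral_mono)
      fix t
      show "(\<integral>\<^sup>+s. ennreal ((v a l (t, s))\<^sup>2) \<partial>\<mu> t) \<le> ennreal (R ^ (2 * a)) * indicator A t"
      proof (cases "t \<in> A")
        case True
        interpret bounded_prob "\<mu> t" R by (rule bp[OF True])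
        have "(\<integral>\<^sup>+s. ennreal ((v a l (t, s))\<^sup>2) \<partial>\<mu> t) = (\<integral>\<^sup>+s. ennreal ((gs_coeff (\<mu> t) a l)\<^sup>2 * (poly (gs l) s)\<^sup>2) \<partial>\<mu> t)"
        proof (rule nn_integral_cong_AE)
          show "AE s in \<mu> t. ennreal ((v a l (t, s))\<^sup>2) = ennreal ((gs_coeff (\<mu> t) a l)\<^sup>2 * (poly (gs l) s)\<^sup>2)"
            using monic_orthogonal_poly_AE[of l]
            by eventually_elim (simp add: v_def ortho_def power_mult_distrib True)
        qed
        also have "\<dots> = ennreal ((gs_coeff (\<mu> t) a l)\<^sup>2 * w l)"
          by (subst nn_integral_eq_integral) auto
        also have "\<dots> \<le> ennreal (R ^ (2 * a))" using gs_coeff_bound[OF l] R(1) by (intro ennreal_leI) simp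
        finally show ?thesis using True by simp
      qed (simp add: v_def)
    qed
    also have "\<dots> = ennreal (R ^ (2 * a)) * emeasure \<sigma> A" using A(1) by (intro nn_integral_cmult_indicator) simp
    also have "\<dots> < \<infinity>"
      using emeasure_in_compact[OF exh(2), of A k] A(2) closure_subset[of "exh k"] by (auto simp: ennreal_mult_less_top)
    finally show ?thesis using vm by (simp add: L2_iff_nn_integral cong: measurable_cong_sets)
  qed
  have vm: "v a l \<in> borel_measurable borel" if "l \<le> a" for l
  proof -
    have [measurable]: "(\<lambda>t. gs_coeff (\<mu> t) a l) \<in> borel_measurable borel" using gs_measurable that by blast
    note [measurable] = A(1)
    show ?thesis unfolding v_def by measurable
  qed
  have sm: "(\<lambda>z. \<Sum>l\<le>a. v a l z) \<in> borel_measurable borel" using vm by (intro borel_measurable_sum) auto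
  have im: "(\<lambda>z. indicat_real A (fst z) * snd z ^ a) \<in> borel_measurable borel" using A(1) by measurable
  have pm: "Measurable.pred borel (\<lambda>z. indicat_real A (fst z) * snd z ^ a = (\<Sum>l\<le>a. v a l z))"
    using im sm by measurable
  show "AE z in lm. indicat_real A (fst z) * snd z ^ a = (\<Sum>l\<le>a. v a l z)"
    unfolding AE_lm[OF pm]
  proof (rule AE_I2)
    fix t
    show "AE s in \<mu> t. indicat_real A (fst (t, s)) * snd (t, s) ^ a = (\<Sum>l\<le>a. v a l (t, s))"
    proof (cases "t \<in> A")
      case True
      interpret bounded_prob "\<mu> t" R by (rule bp[OF True])
      have "AE s in \<mu> t. \<forall>l\<in>{..a}. poly (monic_orthogonal_poly (\<mu> t) l) s = poly (gs l) s"
        using monic_orthogonal_poly_AE by (intro AE_finite_allI) auto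
      then show ?thesis
      proof eventually_elim
        case (elim s)
        have "s ^ a = (\<Sum>l\<le>a. gs_coeff (\<mu> t) a l * poly (gs l) s)" by (rule power_gram_schmidt)
        also have "\<dots> = (\<Sum>l\<le>a. v a l (t, s))" using elim True by (intro sum.cong) (auto simp: v_def ortho_def)
        finally show ?case using True by simp
      qed
    qed (simp add: v_def)
  qed
qed

text \<open>The factors are expanded one after the other: those in \<open>us\<close> already are
  multiples of orthogonal polynomials, those in \<open>As\<close> still are powers of s. Replacing
  s^a by p^(l) with \<open>l \<le> a\<close> never increases the weight.\<close>

lemma tens_H_sum:
  assumes "set us \<subseteq> L2 lm" "length us = length ls"
    and "\<And>j. j < length ls \<Longrightarrow> \<exists>g\<in>borel_measurable borel. us ! j = (\<lambda>z. g (fst z) * ortho (ls ! j) z)"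
    and "\<forall>(A, a)\<in>set As. A \<in> sets borel \<and> A \<subseteq> exh k"
    and "sum_list (map Suc ls) + sum_list (map (\<lambda>(A, a). Suc a) As) \<le> n"
  shows "tens (us @ map (\<lambda>(A, a) z. indicat_real A (fst z) * snd z ^ a) As) \<in> H_sum n"
  using assms
proof (induction As arbitrary: us ls)
  case Nil
  have "sum_list (map Suc ls) = sum_list ls + length ls" by (induction ls) auto
  then have "ls \<in> multi_indices_le n" using Nil by (simp add: multi_indices_le_def)
  then show ?case using pure_tens_H_fock[OF Nil(2,1,3)] H_fock_H_sum by auto
next
  case (Cons p As)
  obtain A a where p: "p = (A, a)" by (cases p)
  have A: "A \<in> sets borel" "A \<subseteq> exh k" using Cons.prems(4) p by auto
  define v where "v l = (\<lambda>z. (indicat_real A (fst z) * gs_coeff (\<mu> (fst z)) a l) * ortho l z)" for l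
  have vL: "v l \<in> L2 lm" if "l \<le> a" for l unfolding v_def using monomial_expansion(1)[OF A that] .
  have ae: "AE z in lm. indicat_real A (fst z) * snd z ^ a = (\<Sum>l\<le>a. v l z)"
    unfolding v_def by (rule monomial_expansion(2)[OF A])
  let ?u = "\<lambda>z. indicat_real A (fst z) * snd z ^ a"
  let ?ws = "map (\<lambda>(A, a) z. indicat_real A (fst z) * snd z ^ a) As"
  have mon: "(\<lambda>z. indicat_real B (fst z) * snd z ^ b) \<in> L2 lm" if "B \<in> sets borel" "B \<subseteq> exh k" for B b
  proof -
    have "indicat_real B \<in> nice" using nice_indicator[OF exh(2) that(1)] that(2) closure_subset[of "exh k"] by blast
    then show ?thesis by (rule nice_power_L2)
  qed
  have uL: "?u \<in> L2 lm" by (rule mon[OF A])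
  have wL: "set ?ws \<subseteq> L2 lm" using Cons.prems(4) mon by auto
  have sL: "(\<Sum>l\<le>a. v l) \<in> L2 lm" using vL by (intro subspace_sum[OF L2_subspace]) auto
  have each: "tens (us @ v l # ?ws) \<in> H_sum n" if l: "l \<le> a" for l
  proof -
    have "tens ((us @ [v l]) @ ?ws) \<in> H_sum n"
    proof (rule Cons.IH[where ls="ls @ [l]"])
      show "set (us @ [v l]) \<subseteq> L2 lm" using Cons.prems(1) vL[OF l] by simp
      show "\<exists>g\<in>borel_measurable borel. (us @ [v l]) ! j = (\<lambda>z. g (fst z) * ortho ((ls @ [l]) ! j) z)"
        if j: "j < length (ls @ [l])" for j
      proof (cases "j < length ls")
        case True
        then show ?thesis using Cons.prems(2,3) by (simp add: nth_append)
      next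
        case False
        then have "j = length ls" using j by simp
        moreover have "(\<lambda>t. indicat_real A t * gs_coeff (\<mu> t) a l) \<in> borel_measurable borel"
          using A(1) gs_measurable[of a] l by (intro borel_measurable_times) auto
        ultimately show ?thesis using Cons.prems(2) unfolding v_def by (auto simp: nth_append)
      qed
      show "sum_list (map Suc (ls @ [l])) + sum_list (map (\<lambda>(A, a). Suc a) As) \<le> n"
        using Cons.prems(5) l p by simp
    qed (use Cons.prems in auto)
    then show ?thesis by simp
  qed
  have "(\<Sum>l\<le>a. tens (us @ v l # ?ws)) \<in> H_sum n" using each by (intro subspace_sum[OF H_sum_subspace]) auto
  then have "tens (us @ (\<Sum>l\<le>a. v l) # ?ws) \<in> H_sum n" by (simp add: tens_slot_sum)
  moreover have "fock.nrm (tens (us @ (\<Sum>l\<le>a. v l) # ?ws) - tens (us @ ?u # ?ws)) = 0"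
    unfolding tens_slot_diff[symmetric]
  proof (rule tens_nrm_slot[OF Cons.prems(1) _ wL])
    show d: "(\<Sum>l\<le>a. v l) - ?u \<in> L2 lm" using subspace_diff[OF L2_subspace sL uL] .
    show "snorm (l2_inner lm) ((\<Sum>l\<le>a. v l) - ?u) = 0"
      unfolding l2_nrm_0_iff[OF d] using ae by eventually_elim (simp add: fun_apply sum_fun_apply)
  qed
  moreover have "tens (us @ ?u # ?ws) \<in> fock" using Cons.prems(1) uL wL by (intro tens_fock) auto
  ultimately have "tens (us @ ?u # ?ws) \<in> H_sum n" using fock.closed_sub_cong[OF H_sum_closed] by blast
  then show ?case by (simp add: p)
qed

text \<open>The kernel is not a product, but with the powers of s as slots it is the image of a
  square integrable function under \<open>slot_map\<close>. Density then leaves indicators of boxes,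
  that is tensors of the form 1_A(t) s^a.\<close>

lemma poly_kernel_H_sum:
  assumes "poly_kernel 0 d h" "d \<le> n" shows "(\<lambda>m y. h m x y) \<in> H_sum n"
  using assms
proof induction
  case zero
  show ?case using subspace_0[OF H_sum_subspace] by (simp add: zero_fun_def)
next
  case (add h h')
  have "(\<lambda>m y. (h + h') m x y) = (\<lambda>m y. h m x y) + (\<lambda>m y. h' m x y)" by (auto simp: fun_eq_iff fun_apply)
  then show ?case using add subspace_add[OF H_sum_subspace] by simp
next
  case (monom F m a)
  let ?x = "\<lambda>i. fst (x i)"
  let ?t = "\<lambda>y. F ?x (\<lambda>i. fst (y i)) * (\<Prod>j<m. snd (y j) ^ a j)"
  have tL: "?t \<in> L2 (lift_power \<sigma> \<mu> m)" by (rule term_kernel_L2[OF monom(1)])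
  have th: "(\<lambda>n y. term_kernel m F a n x y) = l2_embed m ?t"
    by (auto simp: fun_eq_iff fun_apply term_kernel_def l2_embed_def)
  define \<phi> where "\<phi> j = (\<lambda>z::'t \<times> real. snd z ^ a j)" for j
  have sl: "slots \<phi>" unfolding slots_def
  proof (intro allI conjI)
    show "\<phi> j \<in> borel_measurable borel" for j unfolding \<phi>_def by measurable
    fix j t
    obtain R where "bounded_prob (\<mu> t) R" using bounded_prob_mu' by blast
    then have "integrable (\<mu> t) (\<lambda>s. (s ^ a j)\<^sup>2)"
      by (rule bounded_prob.continuous_integrable) (intro continuous_intros)
    then show "(\<integral>\<^sup>+s. ennreal ((\<phi> j (t, s))\<^sup>2) \<partial>\<mu> t) < \<infinity>" by (simp add: \<phi>_def integrable_iff_bounded)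
  qed
  \<comment> \<open>The kernel takes full sequences; outside the index range the value that a tuple
    of length \<open>m\<close> has there is inserted, so that \<open>f\<close> depends on
    \<open>m\<close> coordinates and agrees with the term on the product space.\<close>
  define f where "f y = F ?x (\<lambda>i. if i < m then y i else fst (undefined :: 't \<times> real))" for y :: "nat \<Rightarrow> 't"
  have fm: "f \<in> borel_measurable (slot_power m \<phi>)" unfolding f_def
  proof (rule kernel_compose[OF nice_kernelD(1)[OF monom(1)]])
    fix i
    show "(\<lambda>y. if i < m then y i else fst (undefined :: 't \<times> real)) \<in> borel_measurable (slot_power m \<phi>)"
    proof (cases "i < m")
      case True
      then have "(\<lambda>y. y i) \<in> measurable (slot_power m \<phi>) (slot_measure (\<phi> i))"
        by (intro measurable_component_singleton) simp
      then show ?thesis using True by (simp cong: measurable_cong_sets)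
    qed simp
  qed simp
  have fe: "f (fst_tuple m y) * (\<Prod>j<m. \<phi> j (y j)) = ?t y" if "y \<in> space (lift_power \<sigma> \<mu> m)" for y
  proof -
    have "(\<lambda>i. if i < m then fst_tuple m y i else fst (undefined :: 't \<times> real)) = (\<lambda>i. fst (y i))"
      using that by (auto simp: fun_eq_iff space_PiM PiE_iff extensional_def)
    then show ?thesis by (simp add: f_def \<phi>_def)
  qed
  have "(\<lambda>y. f (fst_tuple m y) * (\<Prod>j<m. \<phi> j (y j))) \<in> borel_measurable (lift_power \<sigma> \<mu> m)"
    by (intro borel_measurable_times slots_prod_measurable[OF sl] measurable_compose[OF fst_tuple_slot_measurable fm])
  moreover have "(\<integral>\<^sup>+y. ennreal ((f (fst_tuple m y) * (\<Prod>j<m. \<phi> j (y j)))\<^sup>2) \<partial>lift_power \<sigma> \<mu> m) = (\<integral>\<^sup>+y. ennreal ((?t y)\<^sup>2) \<partial>lift_power \<sigma> \<mu> m)"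
    using fe by (intro nn_integral_cong) simp
  ultimately have cL: "(\<lambda>y. f (fst_tuple m y) * (\<Prod>j<m. \<phi> j (y j))) \<in> L2 (lift_power \<sigma> \<mu> m)"
    using tL by (simp add: L2_iff_nn_integral)
  then have fL: "f \<in> L2 (slot_power m \<phi>)" using slot_map_component[OF sl fm] by blast
  have JK: "slot_map m \<phi> f \<in> H_sum n"
  proof (rule slot_map_dense[OF sl H_sum_closed, where \<Omega>="\<lambda>k j. exh k"])
    show "emeasure (slot_measure (\<phi> j)) (exh k) < \<infinity>" for k j
    proof -
      have "indicat_real (exh k) \<in> nice" using nice_indicator[OF exh(2) exh_measurable closure_subset] .
      then have "(\<lambda>z. indicat_real (exh k) (fst z) * snd z ^ a j) \<in> L2 lm" by (rule nice_power_L2)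
      then have "(\<integral>\<^sup>+z. ennreal ((indicat_real (exh k) (fst z) * snd z ^ a j)\<^sup>2) \<partial>lm) < \<infinity>" by (simp add: L2_iff_nn_integral)
      moreover have "ennreal ((indicat_real (exh k) (fst z) * snd z ^ a j)\<^sup>2) = ennreal ((\<phi> j z)\<^sup>2) * indicator (exh k) (fst z)" for z
        by (auto simp: indicator_def \<phi>_def)
      moreover have "\<phi> j \<in> borel_measurable borel" using sl by (simp add: slots_def)
      ultimately show ?thesis by (simp add: emeasure_slot_measure)
    qed
    fix k A assume A: "\<And>j. j < m \<Longrightarrow> A j \<in> sets borel \<and> A j \<subseteq> exh k"
    have "sum_list (map (\<lambda>(A, a). Suc a) (map (\<lambda>j. (A j, a j)) [0..<m])) = m + (\<Sum>j<m. a j)"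
      by (induction m) auto
    then have "tens ([] @ map (\<lambda>(A, a) z. indicat_real A (fst z) * snd z ^ a) (map (\<lambda>j. (A j, a j)) [0..<m])) \<in> H_sum n"
      using A monom by (intro tens_H_sum[where ls="[]" and k=k]) auto
    then show "tens (map (\<lambda>j z. indicat_real (A j) (fst z) * \<phi> j z) [0..<m]) \<in> H_sum n"
      by (simp add: o_def \<phi>_def)
  qed (use exh fL in auto)
  have tF: "l2_embed m ?t \<in> fock" unfolding fock_l2_sum by (rule l2_embed_in[where M="\<lambda>n. lift_power \<sigma> \<mu> n", OF tL])
  have "slot_map m \<phi> f - l2_embed m ?t \<in> fock" using JK H_sum_closed tF by (auto simp: closed_sub_def)
  then have "fock.nrm (slot_map m \<phi> f - l2_embed m ?t) = 0"
    unfolding slot_map_def by (subst fock_nrm_0_iff) (auto simp: l2_embed_def fun_apply fe intro!: AE_I2)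
  then show ?case unfolding th using fock.closed_sub_cong[OF H_sum_closed JK tF] by blast
qed

lemma CP_image_H_sum: "CP_image n \<subseteq> H_sum n"
proof
  fix Q assume "Q \<in> CP_image n"
  then obtain P where P: "P \<in> CP_le \<sigma> \<mu> n" "Q = P vacuum" by (auto simp: CP_image_def)
  have "P vacuum \<in> H_sum n" using P(1)
  proof (induction rule: CP_le_induct)
    case zero
    then show ?case using subspace_0[OF H_sum_subspace] by (simp add: op_vacuum)
  next
    case (add k f P)
    obtain h where h: "poly_kernel 0 k h" "monomial \<sigma> \<mu> k f vacuum = (\<lambda>m y. h m (\<lambda>_. undefined) y)"
      using monomial_vacuum[OF add(2)] by blast
    have "monomial \<sigma> \<mu> k f vacuum \<in> H_sum n" unfolding h(2) by (rule poly_kernel_H_sum[OF h(1) add(1)])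
    then show ?case unfolding op_vacuum using add subspace_add[OF H_sum_subspace] by blast
  qed
  then show "Q \<in> H_sum n" using P by simp
qed

lemma MP_fock_H_sum: "MP_fock n \<subseteq> H_sum n"
proof
  fix x assume "x \<in> MP_fock n"
  then have x: "x \<in> fock" "\<And>e. e > 0 \<Longrightarrow> \<exists>y\<in>CP_image n. fock.nrm (y - x) < e" by (auto simp: MP_fock_def sclosure_def)
  then show "x \<in> H_sum n" using CP_image_H_sum by (intro fock.closed_sub_approx[OF H_sum_closed x(1)]) blast
qed

section \<open>The space \<open>L\<^sup>2(\<tau>)\<close>\<close>

text \<open>Says that F is a limit of the sequence of vectors x k \<Omega>, hence a version of I x.
  Being a relation that respects sums and scalars exactly, it is easier to handle than the choice
  made in \<open>tau_I\<close>.\<close>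

definition represents :: "(nat \<Rightarrow> 't fock_operator) \<Rightarrow> 't fock_vector \<Rightarrow> bool" where
  "represents x F \<longleftrightarrow> (\<forall>k. x k \<in> CP \<sigma> \<mu>) \<and> F \<in> fock \<and> (\<lambda>k. fock.nrm (x k vacuum - F)) \<longlonglongrightarrow> 0"

lemma CP_subspace: "subspace (CP \<sigma> \<mu>)"
proof (rule subspaceI)
  show "0 \<in> CP \<sigma> \<mu>" unfolding CP_def using subspace_0[OF CP_le_subspace] by blast
next
  fix P Q assume "P \<in> CP \<sigma> \<mu>" "Q \<in> CP \<sigma> \<mu>"
  then obtain n m where "P \<in> CP_le \<sigma> \<mu> n" "Q \<in> CP_le \<sigma> \<mu> m" by (auto simp: CP_def)
  then have "P \<in> CP_le \<sigma> \<mu> (max n m)" "Q \<in> CP_le \<sigma> \<mu> (max n m)"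
    using CP_le_mono[of n "max n m"] CP_le_mono[of m "max n m"] by auto
  then show "P + Q \<in> CP \<sigma> \<mu>" unfolding CP_def using subspace_add[OF CP_le_subspace] by blast
next
  fix c P assume "P \<in> CP \<sigma> \<mu>"
  then show "c *\<^sub>R P \<in> CP \<sigma> \<mu>" unfolding CP_def using subspace_scale[OF CP_le_subspace] by blast
qed

lemma CP_vacuum_fock: "P \<in> CP \<sigma> \<mu> \<Longrightarrow> P vacuum \<in> fock"
  using CP_le_vacuum_fock by (auto simp: CP_def)

lemma representsD:
  assumes "represents x F"
  shows "x k vacuum \<in> fock" "F \<in> fock" "(\<lambda>k. fock.nrm (x k vacuum - F)) \<longlonglongrightarrow> 0" "x k \<in> CP \<sigma> \<mu>"
  using assms CP_vacuum_fock by (auto simp: represents_def)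

lemma represents_const: "P \<in> CP \<sigma> \<mu> \<Longrightarrow> represents (\<lambda>_. P) (P vacuum)"
  by (simp add: represents_def CP_vacuum_fock)

lemma represents_add:
  assumes "represents x F" "represents y G" shows "represents (x + y) (F + G)"
  unfolding represents_def
proof (intro conjI allI)
  note x = representsD[OF assms(1)] and y = representsD[OF assms(2)]
  show "(x + y) k \<in> CP \<sigma> \<mu>" for k
    by (subst plus_fun_apply) (rule subspace_add[OF CP_subspace x(4) y(4)])
  show "F + G \<in> fock" using x y by blast
  have "(\<lambda>k. fock.nrm ((x k vacuum + y k vacuum) - (F + G))) \<longlonglongrightarrow> 0"
    using x y by (intro fock.tends_add) auto
  moreover have "(x + y) k vacuum = x k vacuum + y k vacuum" for k by (simp only: fun_apply)
  ultimately show "(\<lambda>k. fock.nrm ((x + y) k vacuum - (F + G))) \<longlonglongrightarrow> 0" by (simp only:)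
qed

lemma represents_scale:
  assumes "represents x F" shows "represents (c *\<^sub>R x) (c *\<^sub>R F)"
  unfolding represents_def
proof (intro conjI allI)
  note x = representsD[OF assms(1)]
  show "(c *\<^sub>R x) k \<in> CP \<sigma> \<mu>" for k
    by (subst scaleR_fun_apply) (rule subspace_scale[OF CP_subspace x(4)])
  show "c *\<^sub>R F \<in> fock" using x by blast
  have "(\<lambda>k. fock.nrm (c *\<^sub>R x k vacuum - c *\<^sub>R F)) \<longlonglongrightarrow> 0"
    using x by (intro fock.tends_scale) auto
  moreover have "(c *\<^sub>R x) k vacuum = c *\<^sub>R x k vacuum" for k by (simp only: scaleR_fun_apply)
  ultimately show "(\<lambda>k. fock.nrm ((c *\<^sub>R x) k vacuum - c *\<^sub>R F)) \<longlonglongrightarrow> 0" by (simp only:)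
qed

lemma represents_diff:
  assumes "represents x F" "represents y G" shows "represents (x - y) (F - G)"
  using represents_add[OF assms(1) represents_scale[OF assms(2), of "-1"]] by simp

lemma represents_zero: "represents 0 0"
proof -
  have "0 \<in> CP \<sigma> \<mu>" by (rule subspace_0[OF CP_subspace])
  from represents_const[OF this] show ?thesis unfolding op_vacuum zero_fun_def[where 'a=nat and 'b="'t fock_operator"] .
qed

lemma represents_sum:
  "finite A \<Longrightarrow> (\<And>i. i \<in> A \<Longrightarrow> represents (x i) (F i)) \<Longrightarrow> represents (sum x A) (sum F A)"
  by (induction A rule: finite_induct) (simp_all add: represents_zero represents_add)

text \<open>Completeness of the Fock space justifies the choice in \<open>tau_I\<close>.\<close>

lemma L2_tau_represents: "x \<in> L2_tau \<sigma> \<mu> \<Longrightarrow> represents x (tau_I \<sigma> \<mu> x)"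
proof -
  assume x: "x \<in> L2_tau \<sigma> \<mu>"
  then have CP: "x k \<in> CP \<sigma> \<mu>" for k by (simp add: L2_tau_def)
  have "\<forall>e>0. \<exists>K. \<forall>i\<ge>K. \<forall>j\<ge>K. fock.nrm (x i vacuum - x j vacuum) < e"
    using x unfolding L2_tau_def fock_norm_snorm op_vacuum by blast
  then have "\<exists>F\<in>fock. (\<lambda>k. fock.nrm (x k vacuum - F)) \<longlonglongrightarrow> 0"
    using CP_vacuum_fock[OF CP] fock.complete[of "\<lambda>k. x k vacuum"] by blast
  then have "\<exists>F. F \<in> fock \<and> (\<lambda>k. fock_norm \<sigma> \<mu> (x k vacuum - F)) \<longlonglongrightarrow> 0"
    unfolding fock_norm_snorm by blast
  from someI_ex[OF this] show ?thesis
    unfolding tau_I_def[symmetric] using CP by (simp add: represents_def fock_norm_snorm)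
qed

lemma represents_L2_tau: assumes "represents x F" shows "x \<in> L2_tau \<sigma> \<mu>"
  unfolding L2_tau_def
proof (intro CollectI conjI allI impI)
  note x = representsD[OF assms]
  show "x k \<in> CP \<sigma> \<mu>" for k by (rule x)
  fix e :: real assume "e > 0"
  then have "\<forall>\<^sub>F k in sequentially. fock.nrm (x k vacuum - F) < e / 2" using order_tendstoD(2)[OF x(3), of "e/2"] by simp
  then obtain K where K: "\<And>k. k \<ge> K \<Longrightarrow> fock.nrm (x k vacuum - F) < e / 2" by (auto simp: eventually_sequentially)
  have "fock_norm \<sigma> \<mu> ((x i - x j) vacuum) < e" if "i \<ge> K" "j \<ge> K" for i j
    unfolding op_vacuum fock_norm_snorm
    using fock.nrm_triangle3[OF x(1,2) x(1), of i j] K[OF that(1)] K[OF that(2)]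
      fock.nrm_diff_commute[OF x(2) x(1), of j] by linarith
  then show "\<exists>K. \<forall>i\<ge>K. \<forall>j\<ge>K. fock_norm \<sigma> \<mu> ((x i - x j) vacuum) < e" by blast
qed

lemma represents_unique:
  assumes "represents x F" "represents x G" shows "fock.nrm (F - G) = 0"
proof -
  note x = representsD[OF assms(1)] and y = representsD[OF assms(2)]
  have "fock.nrm (F - G) \<le> fock.nrm (x k vacuum - F) + fock.nrm (x k vacuum - G)" for k
    using fock.nrm_triangle3[OF x(2) x(1) y(2), of k] fock.nrm_diff_commute[OF x(2) x(1), of k] by linarith
  then have "fock.nrm (F - G) \<le> 0"
    using tendsto_add[OF x(3) y(3)]
    by (intro LIMSEQ_le_const[where X="\<lambda>k. fock.nrm (x k vacuum - F) + fock.nrm (x k vacuum - G)"]) auto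
  then show ?thesis using fock.nrm_nonneg[of "F - G"] x y by simp
qed

lemma tau_inner_represents:
  assumes "represents x F" "represents y G" shows "tau_inner \<sigma> \<mu> x y = fock_inner \<sigma> \<mu> F G"
  unfolding tau_inner_def
  using representsD[OF assms(1)] representsD[OF assms(2)] by (intro limI fock.ip_tendsto) auto

lemma tau_norm_represents: "represents x F \<Longrightarrow> tau_norm \<sigma> \<mu> x = fock.nrm F"
  by (simp add: tau_norm_def snorm_def tau_inner_represents)

text \<open>Surjectivity of I as far as it is used: together with \<open>H_fock_MP_fock\<close> it
  also supplies preimages for the vectors in \<open>H_fock\<close>.\<close>

lemma MP_fock_represents: assumes "F \<in> MP_fock n" obtains x where "represents x F"
proof -
  have F: "F \<in> fock" using assms MP_fock_fock by blast
  obtain X where X: "\<And>k. X k \<in> CP_image n" "(\<lambda>k::nat. fock.nrm (X k - F)) \<longlonglongrightarrow> 0"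
    using fock.sclosure_seq[OF assms[unfolded MP_fock_def] CP_image_fock] by blast
  have "\<forall>k. \<exists>P. P \<in> CP_le \<sigma> \<mu> n \<and> X k = P vacuum" using X(1) by (auto simp: CP_image_def)
  then obtain x where x: "\<And>k. x k \<in> CP_le \<sigma> \<mu> n" "\<And>k. X k = x k vacuum" by metis
  then have "represents x F" using X(2) F by (auto simp: represents_def CP_def)
  then show ?thesis by (rule that)
qed

lemma MP_iff: "x \<in> MP \<sigma> \<mu> n \<longleftrightarrow> x \<in> L2_tau \<sigma> \<mu> \<and> tau_I \<sigma> \<mu> x \<in> MP_fock n"
proof (cases "x \<in> L2_tau \<sigma> \<mu>")
  case True
  note x = L2_tau_represents[OF True]
  have F: "tau_I \<sigma> \<mu> x \<in> fock" using representsD(2)[OF x] .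
  have e: "tau_norm \<sigma> \<mu> (x - (\<lambda>_. P)) = fock.nrm (P vacuum - tau_I \<sigma> \<mu> x)" if "P \<in> CP_le \<sigma> \<mu> n" for P
  proof -
    have "P \<in> CP \<sigma> \<mu>" using that by (auto simp: CP_def)
    then have "tau_norm \<sigma> \<mu> (x - (\<lambda>_. P)) = fock.nrm (tau_I \<sigma> \<mu> x - P vacuum)"
      by (intro tau_norm_represents represents_diff[OF x] represents_const)
    then show ?thesis using fock.nrm_diff_commute[OF F CP_le_vacuum_fock[OF that]] by simp
  qed
  have "x \<in> MP \<sigma> \<mu> n \<longleftrightarrow> (\<forall>e>0. \<exists>P\<in>CP_le \<sigma> \<mu> n. fock.nrm (P vacuum - tau_I \<sigma> \<mu> x) < e)"
    unfolding MP_def using True e by simp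
  also have "\<dots> \<longleftrightarrow> tau_I \<sigma> \<mu> x \<in> MP_fock n" unfolding MP_fock_def sclosure_def CP_image_def using F by auto
  finally show ?thesis using True by simp
qed (simp add: MP_def)

lemma represents_MP:
  assumes "represents x F" "F \<in> MP_fock n" shows "x \<in> MP \<sigma> \<mu> n"
proof -
  have x: "x \<in> L2_tau \<sigma> \<mu>" by (rule represents_L2_tau[OF assms(1)])
  have "tau_I \<sigma> \<mu> x \<in> MP_fock n"
    using fock.closed_sub_cong[OF MP_fock_closed assms(2) _ represents_unique[OF assms(1) L2_tau_represents[OF x]]]
      representsD(2)[OF L2_tau_represents[OF x]] by blast
  then show ?thesis using x MP_iff by blast
qed

lemma represents_H_tau:
  assumes "represents x F" "F \<in> H_fock \<sigma> \<mu> ls" shows "x \<in> H_tau \<sigma> \<mu> ls"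
proof -
  have x: "x \<in> L2_tau \<sigma> \<mu>" by (rule represents_L2_tau[OF assms(1)])
  have "tau_I \<sigma> \<mu> x \<in> H_fock \<sigma> \<mu> ls"
    using fock.closed_sub_cong[OF H_fock_closed assms(2) _ represents_unique[OF assms(1) L2_tau_represents[OF x]]]
      representsD(2)[OF L2_tau_represents[OF x]] by blast
  then show ?thesis using x by (simp add: H_tau_def)
qed

lemma H_fock_sum_orth:
  assumes "A \<inter> B = {}" "finite A" "finite B"
    and F: "\<And>ls. ls \<in> A \<Longrightarrow> F ls \<in> H_fock \<sigma> \<mu> ls" and G: "\<And>ls. ls \<in> B \<Longrightarrow> G ls \<in> H_fock \<sigma> \<mu> ls"
  shows "fock_inner \<sigma> \<mu> (sum F A) (sum G B) = 0"
proof -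
  have FF: "F ls \<in> fock" if "ls \<in> A" for ls using F[OF that] H_fock_subset by blast
  have GF: "G ls \<in> fock" if "ls \<in> B" for ls using G[OF that] H_fock_subset by blast
  have 1: "fock_inner \<sigma> \<mu> (sum F A) (G ks) = 0" if ks: "ks \<in> B" for ks
  proof -
    have "fock_inner \<sigma> \<mu> (sum F A) (G ks) = (\<Sum>ls\<in>A. fock_inner \<sigma> \<mu> (F ls) (G ks))"
      by (rule fock.ip_sum_left[OF FF GF[OF ks]])
    also have "\<dots> = 0" using assms(1) ks by (intro sum.neutral ballI H_fock_orth[OF _ F G]) auto
    finally show ?thesis .
  qed
  have sF: "sum F A \<in> fock" "sum G B \<in> fock" using FF GF by auto
  have "fock_inner \<sigma> \<mu> (sum F A) (sum G B) = fock_inner \<sigma> \<mu> (sum G B) (sum F A)" by (rule fock.ip_commute[OF sF])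
  also have "\<dots> = (\<Sum>ks\<in>B. fock_inner \<sigma> \<mu> (G ks) (sum F A))" by (rule fock.ip_sum_left[OF GF sF(1)])
  also have "\<dots> = (\<Sum>ks\<in>B. fock_inner \<sigma> \<mu> (sum F A) (G ks))"
    by (intro sum.cong refl fock.ip_commute[OF GF sF(1)])
  also have "\<dots> = 0" using 1 by (intro sum.neutral) blast
  finally show ?thesis .
qed

text \<open>For \<open>n \<ge> 1\<close> the empty list, of weight 0, belongs to the second part, in
  agreement with its exclusion from \<open>multi_indices\<close>.\<close>

lemma multi_indices_le_split:
  assumes "n \<ge> 1"
  shows "multi_indices_le n = multi_indices n \<union> multi_indices_le (n - 1)" "multi_indices n \<inter> multi_indices_le (n - 1) = {}"
  using assms by (auto simp: multi_indices_le_def multi_indices_def)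

lemma H_tauD: "y \<in> H_tau \<sigma> \<mu> ls \<Longrightarrow> represents y (tau_I \<sigma> \<mu> y) \<and> tau_I \<sigma> \<mu> y \<in> H_fock \<sigma> \<mu> ls"
  using L2_tau_represents by (auto simp: H_tau_def)

text \<open>An element of MP^(n) is, on the Fock side, A + B with A of weight n and B of smaller
  weight. B lies in the closure of order n - 1, so orthogonality to MP^(n-1) gives 0 = (A + B, B) =
  (B, B). Conversely, sums of vectors of weight n lie in the closure of order n and are orthogonal
  to all smaller weights, hence to MP^(n-1).\<close>

lemma OP_orthogonal_sum:
  assumes n: "n \<ge> 1"
  shows "is_orthogonal_sum \<sigma> \<mu> (OP \<sigma> \<mu> n) (multi_indices n) (H_tau \<sigma> \<mu>)"
  unfolding is_orthogonal_sum_def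
proof (intro conjI ballI impI)
  show "finite (multi_indices n)" by (rule finite_multi_indices)
  show "tau_inner \<sigma> \<mu> x y = 0" if "ls \<noteq> ks" "x \<in> H_tau \<sigma> \<mu> ls" "y \<in> H_tau \<sigma> \<mu> ks" for ls ks x y
    using H_tauD[OF that(2)] H_tauD[OF that(3)] H_fock_orth[OF that(1)] tau_inner_represents by metis
  note split = multi_indices_le_split[OF n]
  have OPn: "OP \<sigma> \<mu> n = {x \<in> MP \<sigma> \<mu> n. \<forall>y\<in>MP \<sigma> \<mu> (n - 1). tau_inner \<sigma> \<mu> x y = 0}"
    using n by (simp add: OP_def)
  show "OP \<sigma> \<mu> n = {x \<in> L2_tau \<sigma> \<mu>. \<exists>y. (\<forall>i\<in>multi_indices n. y i \<in> H_tau \<sigma> \<mu> i) \<and>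
      tau_norm \<sigma> \<mu> (x - (\<Sum>i\<in>multi_indices n. y i)) = 0}"
  proof (intro equalityI subsetI)
    fix x assume "x \<in> OP \<sigma> \<mu> n"
    then have x: "x \<in> L2_tau \<sigma> \<mu>" "tau_I \<sigma> \<mu> x \<in> MP_fock n"
      and orth: "\<And>y. y \<in> MP \<sigma> \<mu> (n - 1) \<Longrightarrow> tau_inner \<sigma> \<mu> x y = 0"
      by (auto simp: OPn MP_iff)
    define F where "F = tau_I \<sigma> \<mu> x"
    have rx: "represents x F" unfolding F_def by (rule L2_tau_represents[OF x(1)])
    have FF: "F \<in> fock" by (rule representsD(2)[OF rx])
    have "F \<in> H_sum n" using x(2) MP_fock_H_sum unfolding F_def by blast
    then obtain G where G: "\<forall>ls\<in>multi_indices_le n. G ls \<in> H_fock \<sigma> \<mu> ls"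
      and FG: "fock.nrm (F - (\<Sum>ls\<in>multi_indices_le n. G ls)) = 0"
      unfolding H_sum_def by blast
    define A where "A = (\<Sum>ls\<in>multi_indices n. G ls)"
    define B where "B = (\<Sum>ls\<in>multi_indices_le (n - 1). G ls)"
    have AB: "(\<Sum>ls\<in>multi_indices_le n. G ls) = A + B"
      unfolding A_def B_def split(1) by (rule sum.union_disjoint[OF finite_multi_indices finite_multi_indices_le split(2)])
    have GV: "G ls \<in> MP_fock m" if "ls \<in> multi_indices_le n" "sum_list ls + length ls \<le> m" for ls m
      using G that H_fock_MP_fock[OF that(2)] by blast
    have B: "B \<in> MP_fock (n - 1)" unfolding B_def
      by (rule subspace_sum[OF MP_fock_subspace], rule GV) (auto simp: multi_indices_le_def)
    have BF: "B \<in> fock" using B MP_fock_fock by blast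
    have AF: "A \<in> fock" unfolding A_def using G H_fock_subset split(1) by (intro fock.H_closed) blast
    have ipAB: "fock_inner \<sigma> \<mu> A B = 0" unfolding A_def B_def
      using G split by (intro H_fock_sum_orth finite_multi_indices finite_multi_indices_le) auto
    \<comment> \<open>Orthogonality is given in the completion, so B first needs a preimage
      there.\<close>
    obtain y where y: "represents y B" using MP_fock_represents[OF B] .
    have "fock_inner \<sigma> \<mu> F B = 0"
      using orth[OF represents_MP[OF y B]] tau_inner_represents[OF rx y] by simp
    moreover have "fock_inner \<sigma> \<mu> F B = fock_inner \<sigma> \<mu> (A + B) B"
      using FG unfolding AB by (rule fock.ip_cong_nrm[OF FF fock.H_closed(2)[OF AF BF] BF])
    moreover have "fock_inner \<sigma> \<mu> (A + B) B = fock_inner \<sigma> \<mu> A B + fock_inner \<sigma> \<mu> B B"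
      by (rule fock.ip_add_left[OF AF BF BF])
    ultimately have "fock.nrm B = 0" using ipAB by (simp add: snorm_def)
    then have "fock.nrm ((A + B) - A) = 0" by simp
    then have FA: "fock.nrm (F - A) = 0"
      using FG unfolding AB by (intro fock.nrm_0_trans[OF FF fock.H_closed(2)[OF AF BF] AF])
    \<comment> \<open>The components were found in the Fock space; their preimages exist because
      each of them lies in the closure of order n.\<close>
    have "\<exists>y. represents y (G ls)" if "ls \<in> multi_indices n" for ls
      using MP_fock_represents[OF GV[of ls n]] that split(1) by (auto simp: multi_indices_def)
    then obtain y where y: "\<And>ls. ls \<in> multi_indices n \<Longrightarrow> represents (y ls) (G ls)" by metis
    have "tau_norm \<sigma> \<mu> (x - (\<Sum>i\<in>multi_indices n. y i)) = fock.nrm (F - A)"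
      unfolding A_def by (intro tau_norm_represents represents_diff[OF rx] represents_sum finite_multi_indices y)
    moreover have "y ls \<in> H_tau \<sigma> \<mu> ls" if "ls \<in> multi_indices n" for ls
      using represents_H_tau[OF y[OF that]] G that split(1) by blast
    ultimately show "x \<in> {x \<in> L2_tau \<sigma> \<mu>. \<exists>y. (\<forall>i\<in>multi_indices n. y i \<in> H_tau \<sigma> \<mu> i) \<and>
      tau_norm \<sigma> \<mu> (x - (\<Sum>i\<in>multi_indices n. y i)) = 0}"
      using x(1) FA by auto
  next
    fix x assume "x \<in> {x \<in> L2_tau \<sigma> \<mu>. \<exists>y. (\<forall>i\<in>multi_indices n. y i \<in> H_tau \<sigma> \<mu> i) \<and>
      tau_norm \<sigma> \<mu> (x - (\<Sum>i\<in>multi_indices n. y i)) = 0}"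
    then obtain y where x: "x \<in> L2_tau \<sigma> \<mu>" and y: "\<And>i. i \<in> multi_indices n \<Longrightarrow> y i \<in> H_tau \<sigma> \<mu> i"
      and xy: "tau_norm \<sigma> \<mu> (x - (\<Sum>i\<in>multi_indices n. y i)) = 0" by blast
    define F where "F = tau_I \<sigma> \<mu> x"
    have rx: "represents x F" unfolding F_def by (rule L2_tau_represents[OF x])
    have FF: "F \<in> fock" by (rule representsD(2)[OF rx])
    define G where "G i = tau_I \<sigma> \<mu> (y i)" for i
    have ry: "represents (y i) (G i)" and G: "G i \<in> H_fock \<sigma> \<mu> i" if "i \<in> multi_indices n" for i
      using H_tauD[OF y[OF that]] by (auto simp: G_def)
    define A where "A = (\<Sum>i\<in>multi_indices n. G i)"
    have "tau_norm \<sigma> \<mu> (x - (\<Sum>i\<in>multi_indices n. y i)) = fock.nrm (F - A)"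
      unfolding A_def by (intro tau_norm_represents represents_diff[OF rx] represents_sum finite_multi_indices ry)
    then have FA: "fock.nrm (F - A) = 0" using xy by simp
    have "G i \<in> MP_fock n" if "i \<in> multi_indices n" for i
      using G[OF that] H_fock_MP_fock[of i n] that by (auto simp: multi_indices_def)
    then have A: "A \<in> MP_fock n" unfolding A_def by (intro subspace_sum[OF MP_fock_subspace])
    then have AF: "A \<in> fock" using MP_fock_fock by blast
    have "fock.nrm (A - F) = 0" using FA fock.nrm_diff_commute[OF FF AF] by simp
    then have "F \<in> MP_fock n" by (rule fock.closed_sub_cong[OF MP_fock_closed A FF])
    then have "x \<in> MP \<sigma> \<mu> n" using rx by (intro represents_MP)
    moreover have "tau_inner \<sigma> \<mu> x z = 0" if z: "z \<in> MP \<sigma> \<mu> (n - 1)" for z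
    proof -
      define E where "E = tau_I \<sigma> \<mu> z"
      have rz: "represents z E" unfolding E_def using z MP_iff by (intro L2_tau_represents) blast
      have EF: "E \<in> fock" by (rule representsD(2)[OF rz])
      have "E \<in> H_sum (n - 1)" using z MP_iff MP_fock_H_sum unfolding E_def by blast
      then obtain H where H: "\<forall>ls\<in>multi_indices_le (n - 1). H ls \<in> H_fock \<sigma> \<mu> ls"
        and EH: "fock.nrm (E - (\<Sum>ls\<in>multi_indices_le (n - 1). H ls)) = 0"
        unfolding H_sum_def by blast
      define D where "D = (\<Sum>ls\<in>multi_indices_le (n - 1). H ls)"
      have DF: "D \<in> fock" unfolding D_def using H H_fock_subset by (intro fock.H_closed) blast
      have "tau_inner \<sigma> \<mu> x z = fock_inner \<sigma> \<mu> F E" by (rule tau_inner_represents[OF rx rz])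
      also have "\<dots> = fock_inner \<sigma> \<mu> A E" by (rule fock.ip_cong_nrm[OF FF AF EF FA])
      also have "\<dots> = fock_inner \<sigma> \<mu> E A" by (rule fock.ip_commute[OF AF EF])
      also have "\<dots> = fock_inner \<sigma> \<mu> D A" by (rule fock.ip_cong_nrm[OF EF DF AF EH[folded D_def]])
      also have "\<dots> = 0" unfolding A_def D_def
        using split(2) H G by (intro H_fock_sum_orth finite_multi_indices finite_multi_indices_le) auto
      finally show ?thesis .
    qed
    ultimately show "x \<in> OP \<sigma> \<mu> n" by (simp add: OPn)
  qed
qed

end

theorem theorem3p3:
  fixes \<sigma> :: "'t::{second_countable_topology,t2_space,perfect_space} measure"
    and \<mu> :: "'t \<Rightarrow> real measure"
    and n :: nat
  assumes "locally_compact_space (euclidean :: 't topology)"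
    and "radon_measure \<sigma>"
    and "non_atomic \<sigma>"
    and "\<And>U. open U \<Longrightarrow> U \<noteq> {} \<Longrightarrow> 0 < emeasure \<sigma> U"
    and "locally_bounded_kernel \<mu>"
    and "n \<ge> 1"
  shows "is_orthogonal_sum \<sigma> \<mu> (OP \<sigma> \<mu> n) (multi_indices n) (H_tau \<sigma> \<mu>)"
proof -
  interpret jacobi_setting \<sigma> \<mu> using assms by unfold_locales
  show ?thesis using assms(6) by (rule OP_orthogonal_sum)
qed

end
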